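(* Let $k$ be a commutative ring, $A$ a dg algebra over $k$, $n\ge 0$, and $A_n$ a cdg deformation of $A$ of order $n$ over $R_n=k[t]/(t^{n+1})$. Then the $n$-derived category $D^n(A_n)$ is compactly generated by the objects $\Gamma_0,\dots,\Gamma_n$: each $\Gamma_i$ is a compact object of $D^n(A_n)$, and an object $M\in D^n(A_n)$ is zero if and only if $\mathrm{Hom}_{D^n(A_n)}(\Gamma_i,M[l])=0$ for all $0\le i\le n$ and all $l\in\mathbb Z$.
   Context: Graded objects are $\mathbb Z$-graded with cohomological differentials; algebras are associative and unital. A cdg algebra over a commutative ring $R$ is a graded $R$-algebra $\mathcal A$ with a degree $1$ derivation $d$ and a curvature $c\in\mathcal A^2$ with $d(c)=0$, $d^2=[c,-]$; a dg algebra is a cdg algebra with $c=0$. A (left) cdg $\mathcal A$-module is a graded left $\mathcal A$-module $M$ with a degree $1$ derivation $d_M$ over $d$ with $d_M^2m=cm$. The cdg modules form a dg category $\mathcal A\text{-Mod}$: the degree $p$ morphisms are the degree $p$ graded $\mathcal A$-linear maps, with differential $(df)(m)=d_N(f(m))-(-1)^pf(d_Mm)$. $\mathrm{Hot}(\mathcal A)=H^0(\mathcal A\text{-Mod})$ is triangulated. A cdg deformation $A_n$ of order $n$ is a cdg algebra structure over $R_n=k[t]/(t^{n+1})$ on $A\otimes_kR_n=A[t]/(t^{n+1})$ reducing modulo $t$ to the dg algebra $A$; its curvature $c$ lies in $tA_n$. Put $A_m=A_n/t^{m+1}A_n$ for $0\le m\le n$ and $A_{-1}=0$. An $A_n$-module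 $M$ is $n$-acyclic if the dg $A$-modules $t^iM/t^{i+1}M$, $0\le i\le n$, are all acyclic. $D^n(A_n)$ is the Verdier quotient of $\mathrm{Hot}(A_n)$ by the $n$-acyclic modules; it has small coproducts. The modules $\Gamma_i$: choose $\frac ct\in A_n^2$ with $t\cdot\frac ct=c$. Let $\pi:A_i\to A_{i-1}$ be the projection and $t:A_{i-1}\to A_i$ the map induced by multiplication by $t$. For $0\le i\le n$, $\Gamma_i$ is the graded left $A_n$-module $A_i\oplus A_{i-1}[1]$ (with the usual sign convention for the shift of left modules) with predifferential $$d_{\Gamma_i}(\alpha,a)=\Big(d_{A_i}\alpha+ta,\; -d_{A_{i-1}}a+\pi\big(\alpha\tfrac ct\big)\Big),\qquad \alpha\in A_i,\ a\in A_{i-1}.$$ This is a cdg $A_n$-module, and $\Gamma_0=A$. *)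

theory Defs
  imports "HOL-Algebra.Module" "HOL-Algebra.AbelCoset" "HOL-Library.FuncSet"
begin

section \<open>Additive groups, quotients and signs\<close>

text \<open>
  Following HOL-Algebra, an abelian group is a ring record of which only the additive part
  (carrier, zero, add) is used; the multiplicative fields are dummies.
\<close>

definition add_group :: "'m set \<Rightarrow> ('m \<Rightarrow> 'm \<Rightarrow> 'm) \<Rightarrow> 'm \<Rightarrow> 'm ring" where
  "add_group C f z = \<lparr>carrier = C, mult = (\<lambda>_ _. z), one = z, zero = z, add = f\<rparr>"

definition quot_group :: "('m, 'z) ring_scheme \<Rightarrow> 'm set \<Rightarrow> 'm set ring" where
  "quot_group G N = add_group (a_rcosets\<^bsub>G\<^esub> N) (\<lambda>X Y. X <+>\<^bsub>G\<^esub> Y) N"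

text \<open>On a coset \<open>X\<close> on which \<open>f\<close> is constant modulo \<open>N\<close>, the union is the single coset \<open>N + f x\<close>.\<close>

definition coset_map :: "('n, 'z) ring_scheme \<Rightarrow> 'n set \<Rightarrow> ('m \<Rightarrow> 'n) \<Rightarrow> 'm set \<Rightarrow> 'n set" where
  "coset_map G N f X = (\<Union>x\<in>X. N +>\<^bsub>G\<^esub> f x)"

text \<open>\<open>sign_of G p x\<close> is \<open>(-1)^p x\<close>.\<close>

definition sign_of :: "('m, 'z) ring_scheme \<Rightarrow> int \<Rightarrow> 'm \<Rightarrow> 'm" where
  "sign_of G p x = (if even p then x else \<ominus>\<^bsub>G\<^esub> x)"


section \<open>cdg algebras and cdg modules\<close>

text \<open>
  A graded object is a family of components indexed by the integers; all operations act on
  homogeneous elements and carry the degrees of their arguments as parameters: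
  \<open>amult A p q\<close> maps \<open>A^p \<times> A^q\<close> to \<open>A^(p+q)\<close>, and \<open>adiff A p\<close> maps \<open>A^p\<close> to \<open>A^(p+1)\<close>.
\<close>

record ('r, 'a) cdg_alg =
  acomp :: "int \<Rightarrow> ('r, 'a) module"
  amult :: "int \<Rightarrow> int \<Rightarrow> 'a \<Rightarrow> 'a \<Rightarrow> 'a"
  aone :: "'a"
  adiff :: "int \<Rightarrow> 'a \<Rightarrow> 'a"
  acurv :: "'a"

locale cdg_algebra =
  fixes R :: "('r, 'z) ring_scheme" and A :: "('r, 'a) cdg_alg"
  assumes comp_module: "\<And>p. module R (acomp A p)"
    and mult_closed: "\<And>p q x y. \<lbrakk>x \<in> carrier (acomp A p); y \<in> carrier (acomp A q)\<rbrakk>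
      \<Longrightarrow> amult A p q x y \<in> carrier (acomp A (p + q))"
    and mult_l_distr: "\<And>p q x x' y. \<lbrakk>x \<in> carrier (acomp A p); x' \<in> carrier (acomp A p);
        y \<in> carrier (acomp A q)\<rbrakk>
      \<Longrightarrow> amult A p q (x \<oplus>\<^bsub>acomp A p\<^esub> x') y
          = amult A p q x y \<oplus>\<^bsub>acomp A (p + q)\<^esub> amult A p q x' y"
    and mult_r_distr: "\<And>p q x y y'. \<lbrakk>x \<in> carrier (acomp A p); y \<in> carrier (acomp A q);
        y' \<in> carrier (acomp A q)\<rbrakk>
      \<Longrightarrow> amult A p q x (y \<oplus>\<^bsub>acomp A q\<^esub> y')
          = amult A p q x y \<oplus>\<^bsub>acomp A (p + q)\<^esub> amult A p q x y'"
    and mult_smult_l: "\<And>p q r x y. \<lbrakk>r \<in> carrier R; x \<in> carrier (acomp A p);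
        y \<in> carrier (acomp A q)\<rbrakk>
      \<Longrightarrow> amult A p q (r \<odot>\<^bsub>acomp A p\<^esub> x) y = r \<odot>\<^bsub>acomp A (p + q)\<^esub> amult A p q x y"
    and mult_smult_r: "\<And>p q r x y. \<lbrakk>r \<in> carrier R; x \<in> carrier (acomp A p);
        y \<in> carrier (acomp A q)\<rbrakk>
      \<Longrightarrow> amult A p q x (r \<odot>\<^bsub>acomp A q\<^esub> y) = r \<odot>\<^bsub>acomp A (p + q)\<^esub> amult A p q x y"
    and mult_assoc: "\<And>p q s x y z. \<lbrakk>x \<in> carrier (acomp A p); y \<in> carrier (acomp A q);
        z \<in> carrier (acomp A s)\<rbrakk>
      \<Longrightarrow> amult A (p + q) s (amult A p q x y) z = amult A p (q + s) x (amult A q s y z)"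
    and one_closed: "aone A \<in> carrier (acomp A 0)"
    and mult_l_one: "\<And>p x. x \<in> carrier (acomp A p) \<Longrightarrow> amult A 0 p (aone A) x = x"
    and mult_r_one: "\<And>p x. x \<in> carrier (acomp A p) \<Longrightarrow> amult A p 0 x (aone A) = x"
    and diff_closed: "\<And>p x. x \<in> carrier (acomp A p) \<Longrightarrow> adiff A p x \<in> carrier (acomp A (p + 1))"
    and diff_add: "\<And>p x y. \<lbrakk>x \<in> carrier (acomp A p); y \<in> carrier (acomp A p)\<rbrakk>
      \<Longrightarrow> adiff A p (x \<oplus>\<^bsub>acomp A p\<^esub> y) = adiff A p x \<oplus>\<^bsub>acomp A (p + 1)\<^esub> adiff A p y"
    and diff_smult: "\<And>p r x. \<lbrakk>r \<in> carrier R; x \<in> carrier (acomp A p)\<rbrakk>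
      \<Longrightarrow> adiff A p (r \<odot>\<^bsub>acomp A p\<^esub> x) = r \<odot>\<^bsub>acomp A (p + 1)\<^esub> adiff A p x"
    and diff_mult: "\<And>p q x y. \<lbrakk>x \<in> carrier (acomp A p); y \<in> carrier (acomp A q)\<rbrakk>
      \<Longrightarrow> adiff A (p + q) (amult A p q x y)
          = amult A (p + 1) q (adiff A p x) y
            \<oplus>\<^bsub>acomp A (p + q + 1)\<^esub>
            sign_of (acomp A (p + q + 1)) p (amult A p (q + 1) x (adiff A q y))"
    and curv_closed: "acurv A \<in> carrier (acomp A 2)"
    and diff_curv: "adiff A 2 (acurv A) = \<zero>\<^bsub>acomp A 3\<^esub>"
    and diff_diff: "\<And>p x. x \<in> carrier (acomp A p)
      \<Longrightarrow> adiff A (p + 1) (adiff A p x)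
          = amult A 2 p (acurv A) x \<ominus>\<^bsub>acomp A (p + 2)\<^esub> amult A p 2 x (acurv A)"

definition dg_algebra :: "('r, 'z) ring_scheme \<Rightarrow> ('r, 'a) cdg_alg \<Rightarrow> bool" where
  "dg_algebra R A \<longleftrightarrow> cdg_algebra R A \<and> acurv A = \<zero>\<^bsub>acomp A 2\<^esub>"

text \<open>
  Graded left modules with a predifferential.  If \<open>A\<close> is an algebra over \<open>R\<close>, the components of
  a module need not be given as \<open>R\<close>-modules: the \<open>R\<close>-action is that of \<open>r \<cdot> 1 \<in> A^0\<close>, and a
  derivation over the \<open>R\<close>-linear differential of \<open>A\<close> is automatically \<open>R\<close>-linear.
\<close>

record ('a, 'm) cdg_mod =
  mcomp :: "int \<Rightarrow> 'm ring"
  mact :: "int \<Rightarrow> int \<Rightarrow> 'a \<Rightarrow> 'm \<Rightarrow> 'm"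
  mdiff :: "int \<Rightarrow> 'm \<Rightarrow> 'm"

locale cdg_module =
  fixes A :: "('r, 'a) cdg_alg" and M :: "('a, 'm) cdg_mod"
  assumes comp_group: "\<And>p. abelian_group (mcomp M p)"
    and act_closed: "\<And>p q a m. \<lbrakk>a \<in> carrier (acomp A p); m \<in> carrier (mcomp M q)\<rbrakk>
      \<Longrightarrow> mact M p q a m \<in> carrier (mcomp M (p + q))"
    and act_l_distr: "\<And>p q a b m. \<lbrakk>a \<in> carrier (acomp A p); b \<in> carrier (acomp A p);
        m \<in> carrier (mcomp M q)\<rbrakk>
      \<Longrightarrow> mact M p q (a \<oplus>\<^bsub>acomp A p\<^esub> b) m
          = mact M p q a m \<oplus>\<^bsub>mcomp M (p + q)\<^esub> mact M p q b m"
    and act_r_distr: "\<And>p q a m m'. \<lbrakk>a \<in> carrier (acomp A p); m \<in> carrier (mcomp M q);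
        m' \<in> carrier (mcomp M q)\<rbrakk>
      \<Longrightarrow> mact M p q a (m \<oplus>\<^bsub>mcomp M q\<^esub> m')
          = mact M p q a m \<oplus>\<^bsub>mcomp M (p + q)\<^esub> mact M p q a m'"
    and act_assoc: "\<And>p q s a b m. \<lbrakk>a \<in> carrier (acomp A p); b \<in> carrier (acomp A q);
        m \<in> carrier (mcomp M s)\<rbrakk>
      \<Longrightarrow> mact M (p + q) s (amult A p q a b) m = mact M p (q + s) a (mact M q s b m)"
    and act_one: "\<And>p m. m \<in> carrier (mcomp M p) \<Longrightarrow> mact M 0 p (aone A) m = m"
    and mdiff_closed: "\<And>p m. m \<in> carrier (mcomp M p) \<Longrightarrow> mdiff M p m \<in> carrier (mcomp M (p + 1))"
    and mdiff_add: "\<And>p m m'. \<lbrakk>m \<in> carrier (mcomp M p); m' \<in> carrier (mcomp M p)\<rbrakk>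
      \<Longrightarrow> mdiff M p (m \<oplus>\<^bsub>mcomp M p\<^esub> m') = mdiff M p m \<oplus>\<^bsub>mcomp M (p + 1)\<^esub> mdiff M p m'"
    and mdiff_act: "\<And>p q a m. \<lbrakk>a \<in> carrier (acomp A p); m \<in> carrier (mcomp M q)\<rbrakk>
      \<Longrightarrow> mdiff M (p + q) (mact M p q a m)
          = mact M (p + 1) q (adiff A p a) m
            \<oplus>\<^bsub>mcomp M (p + q + 1)\<^esub>
            sign_of (mcomp M (p + q + 1)) p (mact M p (q + 1) a (mdiff M q m))"
    and mdiff_mdiff: "\<And>p m. m \<in> carrier (mcomp M p)
      \<Longrightarrow> mdiff M (p + 1) (mdiff M p m) = mact M 2 p (acurv A) m"


section \<open>Constructions on graded modules with predifferential\<close>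

definition regular_mod :: "('r, 'a) cdg_alg \<Rightarrow> ('a, 'a) cdg_mod" where
  "regular_mod A = \<lparr>
     mcomp = (\<lambda>p. add_group (carrier (acomp A p)) (add (acomp A p)) (zero (acomp A p))),
     mact = amult A,
     mdiff = adiff A\<rparr>"

text \<open>Sub- and quotient objects with respect to a family of subgroups \<open>N p \<subseteq> M^p\<close> stable under
  the action and the predifferential.\<close>

definition sub_mod :: "('a, 'm) cdg_mod \<Rightarrow> (int \<Rightarrow> 'm set) \<Rightarrow> ('a, 'm) cdg_mod" where
  "sub_mod M N = M\<lparr>mcomp := (\<lambda>p. (mcomp M p)\<lparr>carrier := N p\<rparr>)\<rparr>"

definition quot_mod :: "('a, 'm) cdg_mod \<Rightarrow> (int \<Rightarrow> 'm set) \<Rightarrow> ('a, 'm set) cdg_mod" where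
  "quot_mod M N = \<lparr>
     mcomp = (\<lambda>p. quot_group (mcomp M p) (N p)),
     mact = (\<lambda>p q a. coset_map (mcomp M (p + q)) (N (p + q)) (mact M p q a)),
     mdiff = (\<lambda>p. coset_map (mcomp M (p + 1)) (N (p + 1)) (mdiff M p))\<rparr>"

text \<open>\<open>M[l]^p = M^(p+l)\<close>, with action twisted by \<open>(-1)^(l |a|)\<close> and differential by \<open>(-1)^l\<close>.\<close>

definition shift :: "int \<Rightarrow> ('a, 'm) cdg_mod \<Rightarrow> ('a, 'm) cdg_mod" where
  "shift l M = \<lparr>
     mcomp = (\<lambda>p. mcomp M (p + l)),
     mact = (\<lambda>p q a m. sign_of (mcomp M (p + q + l)) (l * p) (mact M p (q + l) a m)),
     mdiff = (\<lambda>p m. sign_of (mcomp M (p + 1 + l)) l (mdiff M (p + l) m))\<rparr>"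

definition sum_mod :: "('a, 'm) cdg_mod \<Rightarrow> ('a, 'n) cdg_mod \<Rightarrow> ('a, 'm \<times> 'n) cdg_mod" where
  "sum_mod M N = \<lparr>
     mcomp = (\<lambda>p. add_group (carrier (mcomp M p) \<times> carrier (mcomp N p))
       (\<lambda>(x, y) (x', y'). (x \<oplus>\<^bsub>mcomp M p\<^esub> x', y \<oplus>\<^bsub>mcomp N p\<^esub> y'))
       (\<zero>\<^bsub>mcomp M p\<^esub>, \<zero>\<^bsub>mcomp N p\<^esub>)),
     mact = (\<lambda>p q a (x, y). (mact M p q a x, mact N p q a y)),
     mdiff = (\<lambda>p (x, y). (mdiff M p x, mdiff N p y))\<rparr>"

text \<open>The mapping cone of \<open>f : M \<rightarrow> N\<close>: the module \<open>N \<oplus> M[1]\<close> with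
  \<open>d(y, x) = (d y + f x, - d x)\<close>.\<close>

definition cone :: "('a, 'm) cdg_mod \<Rightarrow> ('a, 'n) cdg_mod \<Rightarrow> (int \<Rightarrow> 'm \<Rightarrow> 'n)
    \<Rightarrow> ('a, 'n \<times> 'm) cdg_mod" where
  "cone M N f = (sum_mod N (shift 1 M))\<lparr>
     mdiff := (\<lambda>p (y, x). (mdiff N p y \<oplus>\<^bsub>mcomp N (p + 1)\<^esub> f (p + 1) x,
                           \<ominus>\<^bsub>mcomp M (p + 2)\<^esub> mdiff M (p + 1) x))\<rparr>"

text \<open>The copy of \<open>M\<close> obtained by renaming its elements along injections \<open>e p\<close>.\<close>

definition transport :: "(int \<Rightarrow> 'm \<Rightarrow> 'u) \<Rightarrow> ('a, 'm) cdg_mod \<Rightarrow> ('a, 'u) cdg_mod" where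
  "transport e M = (let e' = (\<lambda>p. inv_into (carrier (mcomp M p)) (e p)) in \<lparr>
     mcomp = (\<lambda>p. add_group (e p ` carrier (mcomp M p))
       (\<lambda>x y. e p (e' p x \<oplus>\<^bsub>mcomp M p\<^esub> e' p y)) (e p \<zero>\<^bsub>mcomp M p\<^esub>)),
     mact = (\<lambda>p q a x. e (p + q) (mact M p q a (e' q x))),
     mdiff = (\<lambda>p x. e (p + 1) (mdiff M p (e' p x)))\<rparr>)"

definition acyclic_mod :: "('a, 'm) cdg_mod \<Rightarrow> bool" where
  "acyclic_mod M \<longleftrightarrow> (\<forall>p. \<forall>x \<in> carrier (mcomp M p). mdiff M p x = \<zero>\<^bsub>mcomp M (p + 1)\<^esub>
     \<longrightarrow> (\<exists>y \<in> carrier (mcomp M (p - 1)). mdiff M (p - 1) y = x))"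


section \<open>Deformations\<close>

text \<open>
  \<open>R_n = k[t]/(t^(n+1))\<close> and \<open>V \<otimes>_k R_n = V[t]/(t^(n+1))\<close> for a \<open>k\<close>-module \<open>V\<close>, in terms of the
  coefficients of \<open>t^0, \<dots>, t^n\<close>.
\<close>

definition trunc_ring :: "('k, 'z) ring_scheme \<Rightarrow> nat \<Rightarrow> (nat \<Rightarrow> 'k) ring" where
  "trunc_ring k n = \<lparr>carrier = {..n} \<rightarrow>\<^sub>E carrier k,
     mult = (\<lambda>f g. \<lambda>j\<in>{..n}. \<Oplus>\<^bsub>k\<^esub>i\<in>{..j}. f i \<otimes>\<^bsub>k\<^esub> g (j - i)),
     one = (\<lambda>j\<in>{..n}. if j = 0 then \<one>\<^bsub>k\<^esub> else \<zero>\<^bsub>k\<^esub>),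
     zero = (\<lambda>j\<in>{..n}. \<zero>\<^bsub>k\<^esub>),
     add = (\<lambda>f g. \<lambda>j\<in>{..n}. f j \<oplus>\<^bsub>k\<^esub> g j)\<rparr>"

definition trunc_var :: "('k, 'z) ring_scheme \<Rightarrow> nat \<Rightarrow> nat \<Rightarrow> 'k" where
  "trunc_var k n = (\<lambda>j\<in>{..n}. if j = 1 then \<one>\<^bsub>k\<^esub> else \<zero>\<^bsub>k\<^esub>)"

definition trunc_module :: "nat \<Rightarrow> ('k, 'a) module \<Rightarrow> (nat \<Rightarrow> 'k, nat \<Rightarrow> 'a) module" where
  "trunc_module n V = \<lparr>carrier = {..n} \<rightarrow>\<^sub>E carrier V,
     mult = (\<lambda>_ _. \<lambda>j\<in>{..n}. \<zero>\<^bsub>V\<^esub>),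
     one = (\<lambda>j\<in>{..n}. \<zero>\<^bsub>V\<^esub>),
     zero = (\<lambda>j\<in>{..n}. \<zero>\<^bsub>V\<^esub>),
     add = (\<lambda>x y. \<lambda>j\<in>{..n}. x j \<oplus>\<^bsub>V\<^esub> y j),
     smult = (\<lambda>f x. \<lambda>j\<in>{..n}. \<Oplus>\<^bsub>V\<^esub>i\<in>{..j}. f i \<odot>\<^bsub>V\<^esub> x (j - i))\<rparr>"

text \<open>Reduction modulo \<open>t\<close> is evaluation at the coefficient of \<open>t^0\<close>.  The unit of \<open>An\<close> is only
  required to reduce to the unit of \<open>A\<close>.\<close>

definition cdg_deformation ::
    "'k ring \<Rightarrow> ('k, 'a) cdg_alg \<Rightarrow> nat \<Rightarrow> (nat \<Rightarrow> 'k, nat \<Rightarrow> 'a) cdg_alg \<Rightarrow> bool" where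
  "cdg_deformation k A n An \<longleftrightarrow>
     cdg_algebra (trunc_ring k n) An \<and>
     (\<forall>p. acomp An p = trunc_module n (acomp A p)) \<and>
     (\<forall>p q. \<forall>x \<in> carrier (acomp An p). \<forall>y \<in> carrier (acomp An q).
        amult An p q x y 0 = amult A p q (x 0) (y 0)) \<and>
     aone An 0 = aone A \<and>
     (\<forall>p. \<forall>x \<in> carrier (acomp An p). adiff An p x 0 = adiff A p (x 0)) \<and>
     acurv An 0 = acurv A"

text \<open>The element \<open>t^j \<cdot> 1\<close> of \<open>A_n^0\<close>, and the submodule \<open>t^j M\<close> of an \<open>A_n\<close>-module \<open>M\<close>.\<close>

definition t_pow :: "'k ring \<Rightarrow> nat \<Rightarrow> (nat \<Rightarrow> 'k, 'a) cdg_alg \<Rightarrow> nat \<Rightarrow> 'a" where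
  "t_pow k n An j = (trunc_var k n [^]\<^bsub>trunc_ring k n\<^esub> j) \<odot>\<^bsub>acomp An 0\<^esub> aone An"

definition t_sub :: "'k ring \<Rightarrow> nat \<Rightarrow> (nat \<Rightarrow> 'k, 'a) cdg_alg \<Rightarrow> nat \<Rightarrow> ('a, 'm) cdg_mod
    \<Rightarrow> int \<Rightarrow> 'm set" where
  "t_sub k n An j M p = mact M 0 p (t_pow k n An j) ` carrier (mcomp M p)"

text \<open>\<open>t^i M / t^(i+1) M\<close> is killed by \<open>t\<close>, hence an \<open>A\<close>-module; as \<open>c \<in> t A_n\<close> it is a dg module.\<close>

definition n_acyclic :: "'k ring \<Rightarrow> nat \<Rightarrow> (nat \<Rightarrow> 'k, 'a) cdg_alg \<Rightarrow> ('a, 'm) cdg_mod \<Rightarrow> bool" where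
  "n_acyclic k n An M \<longleftrightarrow> (\<forall>i\<le>n.
     acyclic_mod (quot_mod (sub_mod M (t_sub k n An i M)) (t_sub k n An (Suc i) M)))"

text \<open>\<open>trunc_alg k n An j = A_n / t^j A_n\<close>.  Note the index: this is \<open>A_(j-1)\<close>, so that \<open>j = 0\<close> gives
  \<open>A_(-1) = 0\<close>.\<close>

definition trunc_alg :: "'k ring \<Rightarrow> nat \<Rightarrow> (nat \<Rightarrow> 'k, 'a) cdg_alg \<Rightarrow> nat \<Rightarrow> ('a, 'a set) cdg_mod" where
  "trunc_alg k n An j = quot_mod (regular_mod An) (t_sub k n An j (regular_mod An))"

text \<open>The maps \<open>\<pi> : A_i \<rightarrow> A_(i-1)\<close>, \<open>t : A_(i-1) \<rightarrow> A_i\<close> and right multiplication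
  \<open>A_i^p \<rightarrow> A_i^(p+2)\<close> by an element of \<open>A_n^2\<close>; the first two are in degree \<open>p\<close>.\<close>

definition Gamma_proj :: "'k ring \<Rightarrow> nat \<Rightarrow> (nat \<Rightarrow> 'k, 'a) cdg_alg \<Rightarrow> nat \<Rightarrow> int \<Rightarrow> 'a set \<Rightarrow> 'a set" where
  "Gamma_proj k n An i p =
     coset_map (acomp An p) (t_sub k n An i (regular_mod An) p) (\<lambda>x. x)"

definition Gamma_t :: "'k ring \<Rightarrow> nat \<Rightarrow> (nat \<Rightarrow> 'k, 'a) cdg_alg \<Rightarrow> nat \<Rightarrow> int \<Rightarrow> 'a set \<Rightarrow> 'a set" where
  "Gamma_t k n An i p =
     coset_map (acomp An p) (t_sub k n An (Suc i) (regular_mod An) p)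
       (\<lambda>x. trunc_var k n \<odot>\<^bsub>acomp An p\<^esub> x)"

definition Gamma_rmult ::
    "'k ring \<Rightarrow> nat \<Rightarrow> (nat \<Rightarrow> 'k, 'a) cdg_alg \<Rightarrow> nat \<Rightarrow> 'a \<Rightarrow> int \<Rightarrow> 'a set \<Rightarrow> 'a set" where
  "Gamma_rmult k n An i b p =
     coset_map (acomp An (p + 2)) (t_sub k n An (Suc i) (regular_mod An) (p + 2))
       (\<lambda>x. amult An p 2 x b)"

definition Gamma ::
    "'k ring \<Rightarrow> nat \<Rightarrow> (nat \<Rightarrow> 'k, 'a) cdg_alg \<Rightarrow> 'a \<Rightarrow> nat \<Rightarrow> ('a, 'a set \<times> 'a set) cdg_mod" where
  "Gamma k n An ct i =
     (let A_i = trunc_alg k n An (Suc i); A_i1 = trunc_alg k n An i in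
      (sum_mod A_i (shift 1 A_i1))\<lparr>
        mdiff := (\<lambda>p (\<alpha>, a).
          (mdiff A_i p \<alpha> \<oplus>\<^bsub>mcomp A_i (p + 1)\<^esub> Gamma_t k n An i (p + 1) a,
           (\<ominus>\<^bsub>mcomp A_i1 (p + 2)\<^esub> mdiff A_i1 (p + 1) a) \<oplus>\<^bsub>mcomp A_i1 (p + 2)\<^esub>
             Gamma_proj k n An i (p + 2) (Gamma_rmult k n An i ct p \<alpha>)))\<rparr>)"


section \<open>Preadditive categories\<close>

text \<open>\<open>Hom C X Y\<close> is an additive group, and \<open>Comp C X Y Z g f\<close> is \<open>g \<circ> f\<close> for \<open>f : X \<rightarrow> Y\<close> and
  \<open>g : Y \<rightarrow> Z\<close>.\<close>

record ('o, 'h) precat =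
  Ob :: "'o set"
  Hom :: "'o \<Rightarrow> 'o \<Rightarrow> 'h ring"
  Comp :: "'o \<Rightarrow> 'o \<Rightarrow> 'o \<Rightarrow> 'h \<Rightarrow> 'h \<Rightarrow> 'h"
  Ident :: "'o \<Rightarrow> 'h"

definition zero_object :: "('o, 'h) precat \<Rightarrow> 'o \<Rightarrow> bool" where
  "zero_object C X \<longleftrightarrow> X \<in> Ob C \<and>
     (\<forall>Y \<in> Ob C. (\<exists>!f. f \<in> carrier (Hom C X Y)) \<and> (\<exists>!f. f \<in> carrier (Hom C Y X)))"

definition is_coproduct ::
    "('o, 'h) precat \<Rightarrow> 'i set \<Rightarrow> ('i \<Rightarrow> 'o) \<Rightarrow> 'o \<Rightarrow> ('i \<Rightarrow> 'h) \<Rightarrow> bool" where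
  "is_coproduct C I M P \<iota> \<longleftrightarrow> P \<in> Ob C \<and> (\<forall>i\<in>I. \<iota> i \<in> carrier (Hom C (M i) P)) \<and>
     (\<forall>Y \<in> Ob C. \<forall>g. (\<forall>i\<in>I. g i \<in> carrier (Hom C (M i) Y)) \<longrightarrow>
        (\<exists>!h. h \<in> carrier (Hom C P Y) \<and> (\<forall>i\<in>I. Comp C (M i) P Y h (\<iota> i) = g i)))"

text \<open>\<open>X\<close> is compact if the canonical map \<open>\<Oplus>_i Hom(X, M_i) \<rightarrow> Hom(X, \<Coprod>_i M_i)\<close> is bijective for
  all small coproducts.  The set \<open>U\<close> fixes the meaning of small: index sets are subsets of \<open>U\<close>.\<close>

definition compact_object :: "'i set \<Rightarrow> ('o, 'h) precat \<Rightarrow> 'o \<Rightarrow> bool" where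
  "compact_object U C X \<longleftrightarrow> X \<in> Ob C \<and>
     (\<forall>I M P \<iota>. I \<subseteq> U \<and> (\<forall>i\<in>I. M i \<in> Ob C) \<and> is_coproduct C I M P \<iota> \<longrightarrow>
        bij_betw
          (\<lambda>\<phi>. \<Oplus>\<^bsub>Hom C X P\<^esub>i\<in>{i\<in>I. \<phi> i \<noteq> \<zero>\<^bsub>Hom C X (M i)\<^esub>}. Comp C X (M i) P (\<iota> i) (\<phi> i))
          {\<phi> \<in> (\<Pi>\<^sub>E i\<in>I. carrier (Hom C X (M i))). finite {i\<in>I. \<phi> i \<noteq> \<zero>\<^bsub>Hom C X (M i)\<^esub>}}
          (carrier (Hom C X P)))"

text \<open>
  Localisation of \<open>C\<close> at a class \<open>S\<close> of morphisms (\<open>S X Y\<close> being the members with source \<open>X\<close> and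
  target \<open>Y\<close>) by right fractions, the standard construction of the Verdier quotient.  A morphism
  \<open>X \<rightarrow> Y\<close> is an equivalence class of roofs \<open>X \<leftarrow> W \<rightarrow> Y\<close>, written \<open>(W, s, f)\<close> with \<open>s \<in> S W X\<close>;
  two roofs are equivalent if a third one dominates both.  Sums are formed over a common
  denominator, composites over a commutative square, and the union is over all such choices, which
  yield one and the same class when \<open>S\<close> is the multiplicative system of a triangulated subcategory.
\<close>

definition roofs :: "('o, 'h) precat \<Rightarrow> ('o \<Rightarrow> 'o \<Rightarrow> 'h set) \<Rightarrow> 'o \<Rightarrow> 'o \<Rightarrow> ('o \<times> 'h \<times> 'h) set" where
  "roofs C S X Y = {(W, s, f). W \<in> Ob C \<and> s \<in> S W X \<and> s \<in> carrier (Hom C W X) \<and>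
     f \<in> carrier (Hom C W Y)}"

definition roof_rel :: "('o, 'h) precat \<Rightarrow> ('o \<Rightarrow> 'o \<Rightarrow> 'h set) \<Rightarrow> 'o \<Rightarrow> 'o
    \<Rightarrow> (('o \<times> 'h \<times> 'h) \<times> ('o \<times> 'h \<times> 'h)) set" where
  "roof_rel C S X Y = {((W, s, f), (W', s', f')).
     (W, s, f) \<in> roofs C S X Y \<and> (W', s', f') \<in> roofs C S X Y \<and>
     (\<exists>V \<in> Ob C. \<exists>u \<in> carrier (Hom C V W). \<exists>u' \<in> carrier (Hom C V W').
        Comp C V W X s u = Comp C V W' X s' u' \<and> Comp C V W X s u \<in> S V X \<and>
        Comp C V W Y f u = Comp C V W' Y f' u')}"

definition localisation :: "('o, 'h) precat \<Rightarrow> ('o \<Rightarrow> 'o \<Rightarrow> 'h set)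
    \<Rightarrow> ('o, ('o \<times> 'h \<times> 'h) set) precat" where
  "localisation C S = \<lparr>
     Ob = Ob C,
     Hom = (\<lambda>X Y. add_group (roofs C S X Y // roof_rel C S X Y)
       (\<lambda>\<Phi> \<Psi>. \<Union>{roof_rel C S X Y `` {(W, s, f \<oplus>\<^bsub>Hom C W Y\<^esub> g)} | W s f g.
                   (W, s, f) \<in> \<Phi> \<and> (W, s, g) \<in> \<Psi>})
       (roof_rel C S X Y `` {(X, Ident C X, \<zero>\<^bsub>Hom C X Y\<^esub>)})),
     Comp = (\<lambda>X Y Z \<Psi> \<Phi>.
       \<Union>{roof_rel C S X Z `` {(V, Comp C V W X s u, Comp C V W' Z g v)} | V W W' s f s' g u v.
            (W, s, f) \<in> \<Phi> \<and> (W', s', g) \<in> \<Psi> \<and> V \<in> Ob C \<and>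
            u \<in> S V W \<and> u \<in> carrier (Hom C V W) \<and> v \<in> carrier (Hom C V W') \<and>
            Comp C V W Y f u = Comp C V W' Y s' v}),
     Ident = (\<lambda>X. roof_rel C S X X `` {(X, Ident C X, Ident C X)})\<rparr>"


section \<open>The homotopy category and the \<open>n\<close>-derived category\<close>

text \<open>Degree \<open>p\<close> graded linear maps, with the Koszul sign \<open>f(a m) = (-1)^(p |a|) a f(m)\<close>.\<close>

definition hom_space :: "('r, 'a) cdg_alg \<Rightarrow> ('a, 'm) cdg_mod \<Rightarrow> ('a, 'n) cdg_mod \<Rightarrow> int
    \<Rightarrow> (int \<Rightarrow> 'm \<Rightarrow> 'n) ring" where
  "hom_space A M N p = add_group
     {f. (\<forall>q. f q \<in> carrier (mcomp M q) \<rightarrow>\<^sub>E carrier (mcomp N (q + p))) \<and>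
         (\<forall>q. \<forall>x \<in> carrier (mcomp M q). \<forall>y \<in> carrier (mcomp M q).
            f q (x \<oplus>\<^bsub>mcomp M q\<^esub> y) = f q x \<oplus>\<^bsub>mcomp N (q + p)\<^esub> f q y) \<and>
         (\<forall>r q. \<forall>a \<in> carrier (acomp A r). \<forall>x \<in> carrier (mcomp M q).
            f (r + q) (mact M r q a x)
            = sign_of (mcomp N (r + q + p)) (p * r) (mact N r (q + p) a (f q x)))}
     (\<lambda>f g q. \<lambda>x \<in> carrier (mcomp M q). f q x \<oplus>\<^bsub>mcomp N (q + p)\<^esub> g q x)
     (\<lambda>q. \<lambda>x \<in> carrier (mcomp M q). \<zero>\<^bsub>mcomp N (q + p)\<^esub>)"

definition hom_diff :: "('a, 'm) cdg_mod \<Rightarrow> ('a, 'n) cdg_mod \<Rightarrow> int \<Rightarrow> (int \<Rightarrow> 'm \<Rightarrow> 'n)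
    \<Rightarrow> (int \<Rightarrow> 'm \<Rightarrow> 'n)" where
  "hom_diff M N p f = (\<lambda>q. \<lambda>x \<in> carrier (mcomp M q).
     mdiff N (q + p) (f q x) \<ominus>\<^bsub>mcomp N (q + p + 1)\<^esub>
     sign_of (mcomp N (q + p + 1)) p (f (q + 1) (mdiff M q x)))"

definition hom_cocycles :: "('r, 'a) cdg_alg \<Rightarrow> ('a, 'm) cdg_mod \<Rightarrow> ('a, 'n) cdg_mod
    \<Rightarrow> (int \<Rightarrow> 'm \<Rightarrow> 'n) ring" where
  "hom_cocycles A M N = (hom_space A M N 0)\<lparr>carrier :=
     {f \<in> carrier (hom_space A M N 0). hom_diff M N 0 f = \<zero>\<^bsub>hom_space A M N 1\<^esub>}\<rparr>"

definition hom_boundaries :: "('r, 'a) cdg_alg \<Rightarrow> ('a, 'm) cdg_mod \<Rightarrow> ('a, 'n) cdg_mod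
    \<Rightarrow> (int \<Rightarrow> 'm \<Rightarrow> 'n) set" where
  "hom_boundaries A M N = hom_diff M N (- 1) ` carrier (hom_space A M N (- 1))"

definition Hot :: "('r, 'a) cdg_alg \<Rightarrow> (('a, 'u) cdg_mod, (int \<Rightarrow> 'u \<Rightarrow> 'u) set) precat" where
  "Hot A = \<lparr>
     Ob = {M. cdg_module A M},
     Hom = (\<lambda>M N. quot_group (hom_cocycles A M N) (hom_boundaries A M N)),
     Comp = (\<lambda>M N P \<psi> \<phi>. \<Union>g\<in>\<psi>. \<Union>f\<in>\<phi>. hom_boundaries A M P +>\<^bsub>hom_cocycles A M P\<^esub>
       (\<lambda>q. compose (carrier (mcomp M q)) (g q) (f q))),
     Ident = (\<lambda>M. hom_boundaries A M M +>\<^bsub>hom_cocycles A M M\<^esub> (\<lambda>q. \<lambda>x \<in> carrier (mcomp M q). x))\<rparr>"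

text \<open>
  The Verdier quotient of \<open>Hot(A_n)\<close> by the \<open>n\<close>-acyclic modules inverts the morphisms with
  \<open>n\<close>-acyclic cone; this does not depend on the representative \<open>f\<close>, as homotopic maps have
  isomorphic cones.

  The type \<open>'u\<close> plays the role of the universe: objects are the modules whose components are
  carried by subsets of \<open>'u\<close>.  If \<open>'u\<close> is infinite, then up to isomorphism they are closed under
  shifts, cones and direct sums indexed by subsets of \<open>'u\<close>; a module over some other type
  is brought into the universe by \<open>transport\<close>.
\<close>

definition n_quasi_isos :: "'k ring \<Rightarrow> nat \<Rightarrow> (nat \<Rightarrow> 'k, 'a) cdg_alg
    \<Rightarrow> ('a, 'u) cdg_mod \<Rightarrow> ('a, 'u) cdg_mod \<Rightarrow> (int \<Rightarrow> 'u \<Rightarrow> 'u) set set" where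
  "n_quasi_isos k n An M N =
     {\<phi> \<in> carrier (Hom (Hot An) M N). \<exists>f\<in>\<phi>. n_acyclic k n An (cone M N f)}"

type_synonym ('a, 'u) n_derived =
  "(('a, 'u) cdg_mod,
    (('a, 'u) cdg_mod \<times> (int \<Rightarrow> 'u \<Rightarrow> 'u) set \<times> (int \<Rightarrow> 'u \<Rightarrow> 'u) set) set) precat"

definition n_derived_category :: "'k ring \<Rightarrow> nat \<Rightarrow> (nat \<Rightarrow> 'k, 'a) cdg_alg \<Rightarrow> ('a, 'u) n_derived" where
  "n_derived_category k n An = localisation (Hot An) (n_quasi_isos k n An)"

end

theory Submission
  imports Defs "HOL-Library.Multiset"
begin

text \<open>
  A closed map \<open>\<Gamma>\<^sub>i \<rightarrow> M[p]\<close> is, up to sign, a pair \<open>x \<in> M^p\<close>, \<open>y \<in> M^(p-1)\<close> killed by \<open>t^(i+1)\<close> and \<open>t^i\<close> with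
  \<open>d x = (c/t) y\<close> and \<open>d y = t x\<close>, and it is null-homotopic iff \<open>(x, y)\<close> is a boundary of the same shape.
  Dividing by \<open>t\<close> repeatedly, one finds that for all \<open>i \<le> n\<close> these pairs are boundaries exactly when the
  complexes \<open>t^j M / t^(j+1) M\<close> are acyclic.  Hence \<open>\<Gamma>\<^sub>i\<close> has no nonzero maps to \<open>n\<close>-acyclic modules in
  \<open>Hot(A\<^sub>n)\<close>, so that morphisms out of \<open>\<Gamma>\<^sub>i\<close> are the same in \<open>Hot(A\<^sub>n)\<close> and in \<open>D^n(A\<^sub>n)\<close>, and the \<open>\<Gamma>\<^sub>i\<close> generate.
  As \<open>\<Gamma>\<^sub>i\<close> is generated by two elements, \<open>Hom(\<Gamma>\<^sub>i, -)\<close> commutes with direct sums in \<open>Hot(A\<^sub>n)\<close>.  An arbitrary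
  coproduct in \<open>D^n(A\<^sub>n)\<close> is compared with a direct sum through roofs representing its injections.

  A map is an \<open>n\<close>-quasi-isomorphism iff it induces bijections on the cohomology of \<open>t^j M / t^(j+1) M\<close>, and
  this is what makes the \<open>n\<close>-quasi-isomorphisms a multiplicative system.
\<close>

text \<open>The obstacle is that M is not a complex: d^2 = t b, where b is the action of c/t. On
  pairs, however, D(x, y) = (d x - b y, t x - d y) squares to zero once b and d commute on y. They
  are known to commute only on Ker t^n, since t d(c/t) = d c = 0 merely puts d(c/t) into t^n A_n.
  Hence y has to be killed by t^i with i \<le> n, which is why A_(i-1) = A_n / t^i A_n is the second
  summand of \<Gamma>_i. Acyclicity of the graded pieces speaks of quotients, maps out of \<Gamma>_i
  see kernels of powers of t. The two are compared by moving elements along the t-adic filtration,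
  with Ker t, on which d^2 = b t = 0, as the starting point. No triangulated structure is put on the
  homotopy category. Cones and cocones enter through their weak cokernel and kernel properties, and
  two out of three for quasi-isomorphisms takes the place of the equalising axiom of a calculus of
  fractions. Composites of roofs are analysed only where one factor is an honest morphism or where
  they act on morphisms out of \<Gamma>_i.\<close>

abbreviation group_plus ("_ \<oplus>[_] _" [65, 0, 66] 65) where "x \<oplus>[G] y \<equiv> x \<oplus>\<^bsub>G\<^esub> y"
abbreviation group_minus ("_ \<ominus>[_] _" [65, 0, 66] 65) where "x \<ominus>[G] y \<equiv> x \<ominus>\<^bsub>G\<^esub> y"
abbreviation group_neg ("\<ominus>[_] _" [0, 81] 80) where "\<ominus>[G] x \<equiv> \<ominus>\<^bsub>G\<^esub> x"
abbreviation group_zero ("\<zero>[_]") where "\<zero>[G] \<equiv> \<zero>\<^bsub>G\<^esub>"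

abbreviation mod_plus ("_ \<oplus>[_,_] _" [65, 0, 0, 66] 65) where "x \<oplus>[M,p] y \<equiv> x \<oplus>\<^bsub>mcomp M p\<^esub> y"
abbreviation mod_minus ("_ \<ominus>[_,_] _" [65, 0, 0, 66] 65) where "x \<ominus>[M,p] y \<equiv> x \<ominus>\<^bsub>mcomp M p\<^esub> y"
abbreviation mod_neg ("\<ominus>[_,_] _" [0, 0, 81] 80) where "\<ominus>[M,p] x \<equiv> \<ominus>\<^bsub>mcomp M p\<^esub> x"
abbreviation mod_zero ("\<zero>[_,_]") where "\<zero>[M,p] \<equiv> \<zero>\<^bsub>mcomp M p\<^esub>"

abbreviation mel where "mel M p \<equiv> carrier (mcomp M p)"
abbreviation ael where "ael A p \<equiv> carrier (acomp A p)"

section \<open>Localisation by right fractions\<close>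

lemma add_group_simps [simp]:
  "carrier (add_group C f z) = C" "zero (add_group C f z) = z" "add (add_group C f z) = f"
  by (simp_all add: add_group_def)

locale preadditive_category =
  fixes C :: "('o, 'h) precat"
  assumes hom_group: "\<lbrakk>X \<in> Ob C; Y \<in> Ob C\<rbrakk> \<Longrightarrow> abelian_group (Hom C X Y)"
    and Ident_closed: "X \<in> Ob C \<Longrightarrow> Ident C X \<in> carrier (Hom C X X)"
    and Comp_closed: "\<lbrakk>X \<in> Ob C; Y \<in> Ob C; Z \<in> Ob C; f \<in> carrier (Hom C X Y);
        g \<in> carrier (Hom C Y Z)\<rbrakk> \<Longrightarrow> Comp C X Y Z g f \<in> carrier (Hom C X Z)"
    and Comp_assoc: "\<lbrakk>W \<in> Ob C; X \<in> Ob C; Y \<in> Ob C; Z \<in> Ob C; f \<in> carrier (Hom C W X);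
        g \<in> carrier (Hom C X Y); h \<in> carrier (Hom C Y Z)\<rbrakk>
      \<Longrightarrow> Comp C W X Z (Comp C X Y Z h g) f = Comp C W Y Z h (Comp C W X Y g f)"
    and Comp_Ident_l: "\<lbrakk>X \<in> Ob C; Y \<in> Ob C; f \<in> carrier (Hom C X Y)\<rbrakk>
      \<Longrightarrow> Comp C X Y Y (Ident C Y) f = f"
    and Comp_Ident_r: "\<lbrakk>X \<in> Ob C; Y \<in> Ob C; f \<in> carrier (Hom C X Y)\<rbrakk>
      \<Longrightarrow> Comp C X X Y f (Ident C X) = f"
    and Comp_add_l: "\<lbrakk>X \<in> Ob C; Y \<in> Ob C; Z \<in> Ob C; f \<in> carrier (Hom C X Y);
        g \<in> carrier (Hom C Y Z); g' \<in> carrier (Hom C Y Z)\<rbrakk>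
      \<Longrightarrow> Comp C X Y Z (g \<oplus>[Hom C Y Z] g') f = Comp C X Y Z g f \<oplus>[Hom C X Z] Comp C X Y Z g' f"
    and Comp_add_r: "\<lbrakk>X \<in> Ob C; Y \<in> Ob C; Z \<in> Ob C; f \<in> carrier (Hom C X Y);
        f' \<in> carrier (Hom C X Y); g \<in> carrier (Hom C Y Z)\<rbrakk>
      \<Longrightarrow> Comp C X Y Z g (f \<oplus>[Hom C X Y] f') = Comp C X Y Z g f \<oplus>[Hom C X Z] Comp C X Y Z g f'"
begin

definition arr :: "'o \<Rightarrow> 'o \<Rightarrow> 'h \<Rightarrow> bool" where
  "arr X Y f \<longleftrightarrow> X \<in> Ob C \<and> Y \<in> Ob C \<and> f \<in> carrier (Hom C X Y)"

lemma arrI: "\<lbrakk>X \<in> Ob C; Y \<in> Ob C; f \<in> carrier (Hom C X Y)\<rbrakk> \<Longrightarrow> arr X Y f"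
  by (simp add: arr_def)

lemma arrD: "arr X Y f \<Longrightarrow> X \<in> Ob C" "arr X Y f \<Longrightarrow> Y \<in> Ob C"
  "arr X Y f \<Longrightarrow> f \<in> carrier (Hom C X Y)"
  by (simp_all add: arr_def)

lemma arr_Ident: "X \<in> Ob C \<Longrightarrow> arr X X (Ident C X)"
  by (simp add: arr_def Ident_closed)

lemma arr_Comp: "\<lbrakk>arr X Y f; arr Y Z g\<rbrakk> \<Longrightarrow> arr X Z (Comp C X Y Z g f)"
  by (simp add: arr_def Comp_closed)

lemma assoc: "\<lbrakk>arr W X f; arr X Y g; arr Y Z h\<rbrakk>
  \<Longrightarrow> Comp C W X Z (Comp C X Y Z h g) f = Comp C W Y Z h (Comp C W X Y g f)"
  by (simp add: arr_def Comp_assoc)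

lemma ident_l: "arr X Y f \<Longrightarrow> Comp C X Y Y (Ident C Y) f = f"
  by (simp add: arr_def Comp_Ident_l)

lemma ident_r: "arr X Y f \<Longrightarrow> Comp C X X Y f (Ident C X) = f"
  by (simp add: arr_def Comp_Ident_r)

lemma arr_add: "\<lbrakk>arr X Y f; arr X Y g\<rbrakk> \<Longrightarrow> arr X Y (f \<oplus>[Hom C X Y] g)"
  using hom_group abelian_group.axioms(1) unfolding arr_def
  by (metis abelian_monoid.a_closed)

lemma arr_zero: "\<lbrakk>X \<in> Ob C; Y \<in> Ob C\<rbrakk> \<Longrightarrow> arr X Y \<zero>[Hom C X Y]"
  using hom_group[of X Y] abelian_group.axioms(1) unfolding arr_def
  by (metis abelian_monoid.zero_closed)

lemma hom_zeroI:
  assumes "arr X Y f" "f \<oplus>[Hom C X Y] f = f"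
  shows "f = \<zero>[Hom C X Y]"
proof -
  interpret H: abelian_group "Hom C X Y" using assms hom_group by (simp add: arr_def)
  show ?thesis using assms H.add.l_cancel_one' unfolding arr_def by metis
qed

lemma Comp_zero_r:
  assumes "X \<in> Ob C" "arr Y Z g"
  shows "Comp C X Y Z g \<zero>[Hom C X Y] = \<zero>[Hom C X Z]"
proof -
  interpret H: abelian_group "Hom C X Y" using assms hom_group by (simp add: arr_def)
  show ?thesis
    using assms Comp_add_r[of X Y Z "\<zero>[Hom C X Y]" "\<zero>[Hom C X Y]" g]
    by (intro hom_zeroI) (auto simp: arr_def Comp_closed)
qed

lemma Comp_zero_l:
  assumes "Z \<in> Ob C" "arr X Y f"
  shows "Comp C X Y Z \<zero>[Hom C Y Z] f = \<zero>[Hom C X Z]"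
proof -
  interpret H: abelian_group "Hom C Y Z" using assms hom_group by (simp add: arr_def)
  show ?thesis
    using assms Comp_add_l[of X Y Z f "\<zero>[Hom C Y Z]" "\<zero>[Hom C Y Z]"]
    by (intro hom_zeroI) (auto simp: arr_def Comp_closed)
qed

lemma Comp_finsum_r:
  assumes "arr Y Z g" "X \<in> Ob C" "finite J" "\<And>i. i \<in> J \<Longrightarrow> arr X Y (f i)"
  shows "Comp C X Y Z g (\<Oplus>\<^bsub>Hom C X Y\<^esub>i\<in>J. f i) = (\<Oplus>\<^bsub>Hom C X Z\<^esub>i\<in>J. Comp C X Y Z g (f i))"
proof -
  interpret H: abelian_group "Hom C X Y" using assms hom_group by (simp add: arr_def)
  interpret K: abelian_group "Hom C X Z" using assms hom_group by (simp add: arr_def)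
  show ?thesis using assms(3,4)
  proof (induction J)
    case empty
    then show ?case using assms Comp_zero_r by simp
  next
    case (insert j J)
    then have a: "f j \<in> carrier (Hom C X Y)" "f \<in> J \<rightarrow> carrier (Hom C X Y)"
      by (auto simp: arr_def)
    then have "Comp C X Y Z g (f j) \<in> carrier (Hom C X Z)"
      "(\<lambda>i. Comp C X Y Z g (f i)) \<in> J \<rightarrow> carrier (Hom C X Z)"
      using assms by (auto simp: arr_def intro: Comp_closed)
    then show ?case using a insert assms
      by (simp add: Comp_add_r arr_def H.finsum_closed)
  qed
qed

end

text \<open>A multiplicative system with right Ore squares. \<open>S_cancel\<close> is the part of
  two out of three by which a morphism into the source of a denominator is recognised as a
  denominator; it does the work of the equalising axiom in the usual calculus of fractions.\<close>

locale fraction_category = preadditive_category C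
  for C :: "('o, 'h) precat" +
  fixes S :: "'o \<Rightarrow> 'o \<Rightarrow> 'h set"
  assumes S_Ident: "X \<in> Ob C \<Longrightarrow> Ident C X \<in> S X X"
    and S_Comp: "\<lbrakk>arr X Y s; s \<in> S X Y; arr Y Z s'; s' \<in> S Y Z\<rbrakk> \<Longrightarrow> Comp C X Y Z s' s \<in> S X Z"
    and S_cancel: "\<lbrakk>arr X Y u; arr Y Z s; s \<in> S Y Z; Comp C X Y Z s u \<in> S X Z\<rbrakk> \<Longrightarrow> u \<in> S X Y"
    and Ore: "\<lbrakk>arr X Z f; arr Y Z s; s \<in> S Y Z\<rbrakk>
      \<Longrightarrow> \<exists>W t g. arr W X t \<and> t \<in> S W X \<and> arr W Y g \<and> Comp C W X Z f t = Comp C W Y Z s g"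
begin

abbreviation "D \<equiv> localisation C S"

definition sarr :: "'o \<Rightarrow> 'o \<Rightarrow> 'h \<Rightarrow> bool" where
  "sarr X Y s \<longleftrightarrow> arr X Y s \<and> s \<in> S X Y"

lemma sarrD: "sarr X Y s \<Longrightarrow> arr X Y s" by (simp add: sarr_def)

lemma sarr_Ident: "X \<in> Ob C \<Longrightarrow> sarr X X (Ident C X)"
  by (simp add: sarr_def arr_Ident S_Ident)

lemma sarr_Comp: "\<lbrakk>sarr X Y s; sarr Y Z s'\<rbrakk> \<Longrightarrow> sarr X Z (Comp C X Y Z s' s)"
  by (simp add: sarr_def arr_Comp S_Comp)

lemma sarr_cancel: "\<lbrakk>arr X Y u; sarr Y Z s; sarr X Z (Comp C X Y Z s u)\<rbrakk> \<Longrightarrow> sarr X Y u"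
  by (auto simp add: sarr_def intro: S_cancel)

lemma ore:
  assumes "arr X Z f" "sarr Y Z s"
  obtains W t g where "sarr W X t" "arr W Y g" "Comp C W X Z f t = Comp C W Y Z s g"
  using Ore assms unfolding sarr_def by metis

definition roof :: "'o \<Rightarrow> 'o \<Rightarrow> 'o \<times> 'h \<times> 'h \<Rightarrow> bool" where
  "roof X Y r \<longleftrightarrow> (case r of (W, s, f) \<Rightarrow> sarr W X s \<and> arr W Y f)"

lemma roof_simp [simp]: "roof X Y (W, s, f) \<longleftrightarrow> sarr W X s \<and> arr W Y f"
  by (simp add: roof_def)

lemma roofs_eq: "\<lbrakk>X \<in> Ob C; Y \<in> Ob C\<rbrakk> \<Longrightarrow> roofs C S X Y = {r. roof X Y r}"
  by (auto simp: roofs_def sarr_def arr_def)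

text \<open>Membership in S is asked of the composite down to X only, as in \<open>roof_rel\<close>;
  that both legs out of V are denominators follows by cancellation.\<close>

definition dom :: "'o \<Rightarrow> 'o \<Rightarrow> 'o \<times> 'h \<times> 'h \<Rightarrow> 'o \<times> 'h \<times> 'h \<Rightarrow> bool" where
  "dom X Y r r' \<longleftrightarrow> (case (r, r') of ((W, s, f), (W', s', f')) \<Rightarrow>
     sarr W X s \<and> arr W Y f \<and> sarr W' X s' \<and> arr W' Y f' \<and>
     (\<exists>V u u'. arr V W u \<and> arr V W' u' \<and> Comp C V W X s u = Comp C V W' X s' u' \<and>
       sarr V X (Comp C V W X s u) \<and> Comp C V W Y f u = Comp C V W' Y f' u'))"

lemma roof_rel_iff: "\<lbrakk>X \<in> Ob C; Y \<in> Ob C\<rbrakk> \<Longrightarrow> (r, r') \<in> roof_rel C S X Y \<longleftrightarrow> dom X Y r r'"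
  unfolding roof_rel_def dom_def
  apply (cases r; cases r')
  apply (simp add: roofs_eq)
  apply (rule iffI)
   apply (elim conjE bexE, intro conjI, assumption+)
   subgoal for W s f W' s' f' V u u'
     using sarrD[of W X s] sarrD[of W' X s'] arr_Comp[of V W u X s]
     by (intro exI[of _ V] exI[of _ u] conjI exI[of _ u']) (simp_all add: arr_def sarr_def)
  apply (elim conjE exE, intro conjI, assumption+)
  subgoal for W s f W' s' f' V u u'
    by (intro bexI[of _ V] bexI[of _ u] bexI[of _ u'] conjI) (simp_all add: arr_def sarr_def)
  done

lemma domI:
  assumes "sarr W X s" "arr W Y f" "sarr W' X s'" "arr W' Y f'" "sarr V W u" "arr V W' u'"
    "Comp C V W X s u = Comp C V W' X s' u'" "Comp C V W Y f u = Comp C V W' Y f' u'"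
  shows "dom X Y (W, s, f) (W', s', f')"
  unfolding dom_def using assms sarr_Comp[OF assms(5,1)] sarrD[OF assms(5)]
  by (simp only: prod.case) metis

lemma domE:
  assumes "dom X Y (W, s, f) (W', s', f')"
  obtains V u u' where "sarr W X s" "arr W Y f" "sarr W' X s'" "arr W' Y f'"
    "sarr V W u" "sarr V W' u'"
    "Comp C V W X s u = Comp C V W' X s' u'" "Comp C V W Y f u = Comp C V W' Y f' u'"
  using assms unfolding dom_def by (simp, metis sarr_cancel)

lemma dom_refl: "roof X Y r \<Longrightarrow> dom X Y r r"
  by (cases r) (auto intro!: domI sarr_Ident simp: arr_Ident arrD sarr_def S_Ident)

lemma dom_sym: "dom X Y r r' \<Longrightarrow> dom X Y r' r"
  unfolding dom_def by (cases r; cases r') (simp, metis)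

lemma dom_roof: "dom X Y r r' \<Longrightarrow> roof X Y r" "dom X Y r r' \<Longrightarrow> roof X Y r'"
  by (cases r; cases r'; simp add: dom_def)+

text \<open>Both legs of a dominating roof are denominators, so two dominating roofs can be joined
  by an Ore square over the middle tip \<open>W2\<close> rather than over X. The square commutes at
  \<open>W2\<close>, and both outer comparisons follow by associativity.\<close>

lemma dom_trans:
  assumes 1: "dom X Y r1 r2" and 2: "dom X Y r2 r3"
  shows "dom X Y r1 r3"
proof -
  obtain W1 s1 f1 W2 s2 f2 W3 s3 f3 where r: "r1 = (W1, s1, f1)" "r2 = (W2, s2, f2)"
    "r3 = (W3, s3, f3)" by (cases r1; cases r2; cases r3)
  obtain V u u' where V: "sarr W1 X s1" "arr W1 Y f1" "sarr W2 X s2" "arr W2 Y f2"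
    "sarr V W1 u" "sarr V W2 u'"
    "Comp C V W1 X s1 u = Comp C V W2 X s2 u'" "Comp C V W1 Y f1 u = Comp C V W2 Y f2 u'"
    using 1 unfolding r by (rule domE)
  obtain V' v v' where V': "sarr W2 X s2" "arr W2 Y f2" "sarr W3 X s3" "arr W3 Y f3"
    "sarr V' W2 v" "sarr V' W3 v'"
    "Comp C V' W2 X s2 v = Comp C V' W3 X s3 v'" "Comp C V' W2 Y f2 v = Comp C V' W3 Y f3 v'"
    using 2 unfolding r by (rule domE)
  obtain Q a b where Q: "sarr Q V a" "arr Q V' b" "Comp C Q V W2 u' a = Comp C Q V' W2 v b"
    using ore[OF sarrD[OF V(6)] V'(5)] by metis
  note aa = sarrD[OF V(1)] sarrD[OF V(3)] sarrD[OF V(5)] sarrD[OF V(6)]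
    sarrD[OF V'(3)] sarrD[OF V'(5)] sarrD[OF V'(6)] sarrD[OF Q(1)] V(2,4) V'(4) Q(2)
  have e1: "Comp C Q W1 X s1 (Comp C Q V W1 u a) = Comp C Q W3 X s3 (Comp C Q V' W3 v' b)"
    using aa V V' Q by (metis assoc)
  have e2: "Comp C Q W1 Y f1 (Comp C Q V W1 u a) = Comp C Q W3 Y f3 (Comp C Q V' W3 v' b)"
    using aa V V' Q by (metis assoc)
  show ?thesis unfolding r
    by (rule domI[OF V(1,2) V'(3,4) sarr_Comp[OF Q(1) V(5)] arr_Comp[OF Q(2) sarrD[OF V'(6)]] e1 e2])
qed

definition cl :: "'o \<Rightarrow> 'o \<Rightarrow> 'o \<times> 'h \<times> 'h \<Rightarrow> ('o \<times> 'h \<times> 'h) set" where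
  "cl X Y r = roof_rel C S X Y `` {r}"

lemma mem_cl: "\<lbrakk>X \<in> Ob C; Y \<in> Ob C\<rbrakk> \<Longrightarrow> r' \<in> cl X Y r \<longleftrightarrow> dom X Y r r'"
  by (simp add: cl_def roof_rel_iff)

lemma cl_eq_iff:
  assumes "X \<in> Ob C" "Y \<in> Ob C" "roof X Y r'"
  shows "cl X Y r = cl X Y r' \<longleftrightarrow> dom X Y r r'"
proof
  assume "cl X Y r = cl X Y r'"
  then show "dom X Y r r'" using assms mem_cl dom_refl by blast
next
  assume "dom X Y r r'"
  then have "dom X Y r q \<longleftrightarrow> dom X Y r' q" for q using dom_sym dom_trans by metis
  then show "cl X Y r = cl X Y r'" by (simp only: set_eq_iff mem_cl[OF assms(1,2)]) blast
qed

lemma roof_Ob: "roof X Y r \<Longrightarrow> X \<in> Ob C \<and> Y \<in> Ob C"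
  by (cases r) (auto simp: sarr_def arr_def)

lemma dom_cl: "dom X Y r r' \<Longrightarrow> cl X Y r = cl X Y r'"
  using cl_eq_iff roof_Ob dom_roof(2) by blast

lemma Hom_D: "\<lbrakk>X \<in> Ob C; Y \<in> Ob C\<rbrakk> \<Longrightarrow> carrier (Hom D X Y) = {cl X Y r | r. roof X Y r}"
proof -
  assume "X \<in> Ob C" "Y \<in> Ob C"
  then have "carrier (Hom D X Y) = (\<Union>r\<in>{r. roof X Y r}. {cl X Y r})"
    by (simp add: localisation_def quotient_def cl_def roofs_eq)
  then show ?thesis by blast
qed

definition L :: "'o \<Rightarrow> 'o \<Rightarrow> 'h \<Rightarrow> ('o \<times> 'h \<times> 'h) set" where
  "L X Y f = cl X Y (X, Ident C X, f)"

lemma zero_D: "\<zero>[Hom D X Y] = L X Y \<zero>[Hom C X Y]"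
  by (simp add: localisation_def L_def cl_def)

lemma Ob_D: "Ob D = Ob C"
  by (simp add: localisation_def)

lemma roof_L: "arr X Y f \<Longrightarrow> roof X Y (X, Ident C X, f)"
  by (simp add: sarr_Ident arrD)

lemma L_closed: "arr X Y f \<Longrightarrow> L X Y f \<in> carrier (Hom D X Y)"
  using roof_L[of X Y f] Hom_D[of X Y] arrD(1,2)[of X Y f] unfolding L_def by blast

lemma L_eqD:
  assumes "L X Y f = L X Y g" "arr X Y f" "arr X Y g"
  obtains V u where "sarr V X u" "Comp C V X Y f u = Comp C V X Y g u"
proof -
  have "dom X Y (X, Ident C X, f) (X, Ident C X, g)"
    using assms cl_eq_iff[OF _ _ roof_L] by (simp add: L_def arrD)
  then show ?thesis
    by (rule domE) (metis ident_l sarrD that)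
qed

text \<open>A roof ending in an acyclic object is dominated by the zero roof, by Ore applied to \<open>0 \<rightarrow> M\<close>.\<close>

lemma zero_objectI:
  assumes M: "M \<in> Ob C" and Z: "Z \<in> Ob C" and s: "z \<in> S Z M" "arr Z M z"
    and Z0: "\<And>Y f g. \<lbrakk>arr Z Y f; arr Z Y g\<rbrakk> \<Longrightarrow> f = g"
    and Z1: "\<And>Y f g. \<lbrakk>arr Y Z f; arr Y Z g\<rbrakk> \<Longrightarrow> f = g"
  shows "zero_object D M"
proof -
  have zS: "sarr Z M z" using s by (simp add: sarr_def)
  have *: "cl M Y r = L M Y \<zero>[Hom C M Y]" if Y: "Y \<in> Ob C" and r: "roof M Y r" for Y r
  proof -
    obtain W t f where rr: "r = (W, t, f)" by (cases r)
    with r have t: "sarr W M t" and f: "arr W Y f" by auto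
    have W: "W \<in> Ob C" using f by (simp add: arr_def)
    \<comment> \<open>Z has only one morphism to M, so \<open>t\<close> after \<open>?u\<close> is
      \<open>z\<close>; cancellation then makes the zero map \<open>?u\<close> a denominator, and
      together with \<open>z\<close> it relates the roof to zero.\<close>
    let ?u = "\<zero>[Hom C Z W]"
    have u: "arr Z W ?u" using Z W by (rule arr_zero)
    have e1: "Comp C Z W M t ?u = Comp C Z M M (Ident C M) z"
      using Z0 arr_Comp[OF u sarrD[OF t]] ident_l[OF s(2)] s(2) by metis
    have uS: "sarr Z W ?u"
      by (rule sarr_cancel[OF u t]) (use e1 zS ident_l[OF s(2)] in simp)
    have e2: "Comp C Z W Y f ?u = Comp C Z M Y \<zero>[Hom C M Y] z"
      by (rule Z0) (use arr_Comp u f s(2) arr_zero M Y in blast)+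
    have "dom M Y r (M, Ident C M, \<zero>[Hom C M Y])" unfolding rr
      by (rule domI[OF t f sarr_Ident[OF M] arr_zero[OF M Y] uS s(2) e1 e2])
    then show ?thesis unfolding L_def by (rule dom_cl)
  qed
  have **: "cl Y M r = L Y M \<zero>[Hom C Y M]" if Y: "Y \<in> Ob C" and r: "roof Y M r" for Y r
  proof -
    obtain W t f where rr: "r = (W, t, f)" by (cases r)
    with r have t: "sarr W Y t" and f: "arr W M f" by auto
    obtain V v g where V: "sarr V W v" "arr V Z g" "Comp C V W M f v = Comp C V Z M z g"
      using ore[OF f zS] by metis
    have VO: "V \<in> Ob C" using V(2) by (simp add: arr_def)
    have "g = \<zero>[Hom C V Z]" using Z1[OF V(2) arr_zero] VO Z by simp
    then have fv: "Comp C V W M f v = \<zero>[Hom C V M]" using V(3) Comp_zero_r[OF VO s(2)] by simp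
    have tv: "sarr V Y (Comp C V W Y t v)" using V(1) t by (rule sarr_Comp)
    have e1: "Comp C V W Y t v = Comp C V Y Y (Ident C Y) (Comp C V W Y t v)"
      using ident_l[OF sarrD[OF tv]] by simp
    have e2: "Comp C V W M f v = Comp C V Y M \<zero>[Hom C Y M] (Comp C V W Y t v)"
      unfolding fv using Comp_zero_l[OF M sarrD[OF tv]] by simp
    have "dom Y M r (Y, Ident C Y, \<zero>[Hom C Y M])" unfolding rr
      by (rule domI[OF t f sarr_Ident[OF Y] arr_zero[OF Y M] V(1) sarrD[OF tv] e1 e2])
    then show ?thesis unfolding L_def by (rule dom_cl)
  qed
  show ?thesis
    unfolding zero_object_def Ob_D
  proof (intro conjI ballI M)
    fix Y assume Y: "Y \<in> Ob C"
    have "\<Phi> = L M Y \<zero>[Hom C M Y]" if "\<Phi> \<in> carrier (Hom D M Y)" for \<Phi>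
    proof -
      from that obtain r where "roof M Y r" "\<Phi> = cl M Y r" unfolding Hom_D[OF M Y] by blast
      then show ?thesis using *[OF Y] by (simp only:)
    qed
    then show "\<exists>!f. f \<in> carrier (Hom D M Y)"
      using L_closed[OF arr_zero[OF M Y]] by metis
    have "\<Phi> = L Y M \<zero>[Hom C Y M]" if "\<Phi> \<in> carrier (Hom D Y M)" for \<Phi>
    proof -
      from that obtain r where "roof Y M r" "\<Phi> = cl Y M r" unfolding Hom_D[OF Y M] by blast
      then show ?thesis using **[OF Y] by (simp only:)
    qed
    then show "\<exists>!f. f \<in> carrier (Hom D Y M)"
      using L_closed[OF arr_zero[OF Y M]] by metis
  qed
qed

text \<open>If the identity and the zero endomorphism of M agree in the localisation, some
  denominator V \<rightarrow> M equalises them, and this denominator is then itself zero.\<close>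

lemma zero_objectD:
  assumes "zero_object D M"
  shows "\<exists>V. V \<in> Ob C \<and> \<zero>[Hom C V M] \<in> S V M"
proof -
  have M: "M \<in> Ob C" using assms by (simp add: zero_object_def Ob_D)
  have "\<exists>!f. f \<in> carrier (Hom D M M)"
    using assms M by (simp add: zero_object_def Ob_D)
  then have "L M M (Ident C M) = L M M \<zero>[Hom C M M]"
    using L_closed[OF arr_Ident[OF M]] L_closed[OF arr_zero[OF M M]] by (elim ex1E) metis
  then obtain V u where u: "sarr V M u" "Comp C V M M (Ident C M) u = Comp C V M M \<zero>[Hom C M M] u"
    by (rule L_eqD[OF _ arr_Ident[OF M] arr_zero[OF M M]])
  then have "u = \<zero>[Hom C V M]" using ident_l[OF sarrD[OF u(1)]] Comp_zero_l[OF M sarrD[OF u(1)]] by simp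
  then show ?thesis using u by (auto simp: sarr_def arr_def)
qed

lemma Comp_D_mem:
  "c \<in> Comp D X Y Z \<Psi> \<Phi> \<longleftrightarrow> (\<exists>V W W' s f s' g u v. (W, s, f) \<in> \<Phi> \<and> (W', s', g) \<in> \<Psi> \<and>
      V \<in> Ob C \<and> u \<in> S V W \<and> u \<in> carrier (Hom C V W) \<and> v \<in> carrier (Hom C V W') \<and>
      Comp C V W Y f u = Comp C V W' Y s' v \<and>
      c \<in> cl X Z (V, Comp C V W X s u, Comp C V W' Z g v))"
  by (simp add: localisation_def cl_def) blast

text \<open>One admissible choice of a square over Y, kept as a relation because different squares
  need not a priori give equivalent roofs.\<close>

definition comp_roof :: "'o \<Rightarrow> 'o \<Rightarrow> 'o \<Rightarrow> 'o \<times> 'h \<times> 'h \<Rightarrow> 'o \<times> 'h \<times> 'h \<Rightarrow> 'o \<times> 'h \<times> 'h \<Rightarrow> bool" where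
  "comp_roof X Y Z r' r c \<longleftrightarrow> (\<exists>V W W' s f s' g u v. r = (W, s, f) \<and> r' = (W', s', g) \<and>
     sarr V W u \<and> arr V W' v \<and> Comp C V W Y f u = Comp C V W' Y s' v \<and>
     c = (V, Comp C V W X s u, Comp C V W' Z g v))"

lemma Comp_D_eq:
  assumes "roof X Y r" "roof Y Z r'"
  shows "Comp D X Y Z (cl Y Z r') (cl X Y r)
    = \<Union>{cl X Z c | c. \<exists>r1 r1'. dom X Y r r1 \<and> dom Y Z r' r1' \<and> comp_roof X Y Z r1' r1 c}"
proof -
  have O: "X \<in> Ob C" "Y \<in> Ob C" "Z \<in> Ob C" using roof_Ob assms by blast+
  show ?thesis
  proof (intro Set.set_eqI iffI)
    fix c assume "c \<in> Comp D X Y Z (cl Y Z r') (cl X Y r)"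
    then obtain V W W' s f s' g u v where c: "dom X Y r (W, s, f)" "dom Y Z r' (W', s', g)"
      "V \<in> Ob C" "u \<in> S V W" "u \<in> carrier (Hom C V W)" "v \<in> carrier (Hom C V W')"
      "Comp C V W Y f u = Comp C V W' Y s' v" "c \<in> cl X Z (V, Comp C V W X s u, Comp C V W' Z g v)"
      unfolding Comp_D_mem mem_cl[OF O(1,2)] mem_cl[OF O(2,3)] by metis
    have "sarr V W u" "arr V W' v"
      using c dom_roof(2)[OF c(1)] dom_roof(2)[OF c(2)] by (auto simp: sarr_def arr_def)
    then have "comp_roof X Y Z (W', s', g) (W, s, f) (V, Comp C V W X s u, Comp C V W' Z g v)"
      unfolding comp_roof_def using c(7) by blast
    then show "c \<in> \<Union>{cl X Z c | c. \<exists>r1 r1'. dom X Y r r1 \<and> dom Y Z r' r1' \<and> comp_roof X Y Z r1' r1 c}"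
      using c(1,2,8) by blast
  next
    fix c assume "c \<in> \<Union>{cl X Z c | c. \<exists>r1 r1'. dom X Y r r1 \<and> dom Y Z r' r1' \<and> comp_roof X Y Z r1' r1 c}"
    then obtain c' r1 r1' where c: "dom X Y r r1" "dom Y Z r' r1'" "comp_roof X Y Z r1' r1 c'" "c \<in> cl X Z c'"
      by blast
    then show "c \<in> Comp D X Y Z (cl Y Z r') (cl X Y r)"
      unfolding Comp_D_mem mem_cl[OF O(1,2)] mem_cl[OF O(2,3)] comp_roof_def sarr_def arr_def
      by blast
  qed
qed

lemma comp_roof_ex:
  assumes "roof X Y r" "roof Y Z r'"
  shows "\<exists>c. comp_roof X Y Z r' r c"
proof -
  obtain W s f W' s' g where r: "r = (W, s, f)" "r' = (W', s', g)" by (cases r; cases r')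
  then obtain V u v where "sarr V W u" "arr V W' v" "Comp C V W Y f u = Comp C V W' Y s' v"
  proof -
    have "arr W Y f" "sarr W' Y s'" using assms r by simp_all
    then show ?thesis using that by (rule ore)
  qed
  then have "comp_roof X Y Z r' r (V, Comp C V W X s u, Comp C V W' Z g v)"
    unfolding comp_roof_def r by blast
  then show ?thesis ..
qed

lemma comp_roof_roof:
  "\<lbrakk>roof X Y r; roof Y Z r'; comp_roof X Y Z r' r c\<rbrakk> \<Longrightarrow> roof X Z c"
  unfolding comp_roof_def by (elim exE conjE) (simp add: sarr_Comp arr_Comp)

lemma Comp_D_memI:
  assumes "roof X Y r" "roof Y Z r'" "comp_roof X Y Z r' r c"
  shows "c \<in> Comp D X Y Z (cl Y Z r') (cl X Y r)"
proof -
  have "c \<in> cl X Z c"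
    using mem_cl[of X Z] roof_Ob dom_refl comp_roof_roof[OF assms] by (simp only:)
  then show ?thesis unfolding Comp_D_eq[OF assms(1,2)]
    using assms(3) dom_refl[OF assms(1)] dom_refl[OF assms(2)] by blast
qed

text \<open>Composition in \<open>localisation\<close> is a union over all representatives and
  squares. It is a single class as soon as every choice is equivalent to one fixed roof, and this is
  checked separately in each situation that occurs.\<close>

lemma Comp_D_eqI:
  assumes "roof X Y r" "roof Y Z r'" "roof X Z c0"
    and "\<And>r1 r1' c. \<lbrakk>dom X Y r r1; dom Y Z r' r1'; comp_roof X Y Z r1' r1 c\<rbrakk> \<Longrightarrow> dom X Z c c0"
  shows "Comp D X Y Z (cl Y Z r') (cl X Y r) = cl X Z c0"
proof -
  have O: "X \<in> Ob C" "Z \<in> Ob C" using roof_Ob assms by blast+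
  have "\<And>c. \<exists>r1 r1'. dom X Y r r1 \<and> dom Y Z r' r1' \<and> comp_roof X Y Z r1' r1 c \<Longrightarrow> cl X Z c = cl X Z c0"
    by (elim exE conjE) (rule dom_cl[OF assms(4)])
  moreover have "\<exists>c. \<exists>r1 r1'. dom X Y r r1 \<and> dom Y Z r' r1' \<and> comp_roof X Y Z r1' r1 c"
    using comp_roof_ex[OF assms(1,2)] dom_refl[OF assms(1)] dom_refl[OF assms(2)] by blast
  ultimately show ?thesis unfolding Comp_D_eq[OF assms(1,2)] by blast
qed

text \<open>A roof equivalent to (Y, id, q) admits a denominator \<open>z\<close> into its tip along
  which the left leg becomes \<open>a\<close> and the right leg becomes q after \<open>a\<close>.
  Comparing an arbitrary square with \<open>z\<close> by Ore reduces the composite to q after the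
  right leg of the given roof.\<close>

lemma Comp_L:
  assumes r: "roof X Y (W, s, f)" and q: "arr Y Z q"
  shows "Comp D X Y Z (L Y Z q) (cl X Y (W, s, f)) = cl X Z (W, s, Comp C W Y Z q f)"
  unfolding L_def
proof (rule Comp_D_eqI[OF r roof_L[OF q]])
  show r0: "roof X Z (W, s, Comp C W Y Z q f)" using r q arr_Comp by auto
  fix r1 r1' c
  assume d1: "dom X Y (W, s, f) r1" and d2: "dom Y Z (Y, Ident C Y, q) r1'"
    and c: "comp_roof X Y Z r1' r1 c"
  obtain V W1 W' s1 f1 s' g u v where c: "r1 = (W1, s1, f1)" "r1' = (W', s', g)" "sarr V W1 u"
     "arr V W' v" "Comp C V W1 Y f1 u = Comp C V W' Y s' v"
     "c = (V, Comp C V W1 X s1 u, Comp C V W' Z g v)"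
    using c unfolding comp_roof_def by blast
  obtain T a z where T: "sarr W' Y s'" "arr W' Z g" "sarr T Y a" "sarr T W' z"
    "Comp C T Y Y (Ident C Y) a = Comp C T W' Y s' z" "Comp C T Y Z q a = Comp C T W' Z g z"
    using d2 unfolding c by (rule domE) blast
  have a: "a = Comp C T W' Y s' z" using T(5) ident_l[OF sarrD[OF T(3)]] by simp
  \<comment> \<open>\<open>z\<close> is a denominator, so the arbitrary square and the comparison
    with \<open>q\<close> can be put over one object.\<close>
  obtain V' t w where V': "sarr V' V t" "arr V' T w" "Comp C V' V W' v t = Comp C V' T W' z w"
    using ore[OF c(4) T(4)] by metis
  have r1: "sarr W1 X s1" "arr W1 Y f1" using dom_roof(2)[OF d1] c(1) by auto
  have qf: "roof X Z (W1, s1, Comp C W1 Y Z q f1)" using r1 q arr_Comp by auto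
  note aa = sarrD[OF T(1)] T(2) sarrD[OF T(3)] sarrD[OF T(4)] sarrD[OF V'(1)] V'(2) c(4)
     sarrD[OF c(3)] r1(2) sarrD[OF r1(1)] q
  have "dom X Z (V, Comp C V W1 X s1 u, Comp C V W' Z g v) (W1, s1, Comp C W1 Y Z q f1)"
  proof (rule domI)
    show "sarr V' V t" by (rule V')
    show "arr V' W1 (Comp C V' V W1 u t)" using aa arr_Comp by blast
    show "sarr V X (Comp C V W1 X s1 u)" using c r1 sarr_Comp by blast
    show "arr V Z (Comp C V W' Z g v)" using aa arr_Comp by blast
    show "sarr W1 X s1" by (rule r1)
    show "arr W1 Z (Comp C W1 Y Z q f1)" using aa arr_Comp by blast
    show "Comp C V' V X (Comp C V W1 X s1 u) t = Comp C V' W1 X s1 (Comp C V' V W1 u t)"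
      using aa assoc by metis
    have "Comp C V' V Z (Comp C V W' Z g v) t = Comp C V' W' Z g (Comp C V' V W' v t)"
      using aa assoc by metis
    also have "\<dots> = Comp C V' T Z (Comp C T W' Z g z) w" unfolding V'(3) using aa assoc by metis
    also have "\<dots> = Comp C V' Y Z q (Comp C V' T Y a w)"
      unfolding T(6)[symmetric] using aa assoc by metis
    also have "Comp C V' T Y a w = Comp C V' W' Y s' (Comp C V' V W' v t)"
      unfolding a V'(3) using aa assoc by metis
    also have "\<dots> = Comp C V' V Y (Comp C V W1 Y f1 u) t"
      unfolding c(5) using aa assoc by metis
    also have "\<dots> = Comp C V' W1 Y f1 (Comp C V' V W1 u t)" using aa assoc by metis
    also have "Comp C V' Y Z q \<dots> = Comp C V' W1 Z (Comp C W1 Y Z q f1) (Comp C V' V W1 u t)"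
      using assoc[OF arr_Comp[OF sarrD[OF V'(1)] sarrD[OF c(3)]] r1(2) q] by simp
    finally show "Comp C V' V Z (Comp C V W' Z g v) t
       = Comp C V' W1 Z (Comp C W1 Y Z q f1) (Comp C V' V W1 u t)" .
  qed
  moreover have "dom X Z (W1, s1, Comp C W1 Y Z q f1) (W, s, Comp C W Y Z q f)"
  proof -
    obtain B b b' where B: "sarr W X s" "arr W Y f" "sarr W1 X s1" "arr W1 Y f1" "sarr B W b" "sarr B W1 b'"
      "Comp C B W X s b = Comp C B W1 X s1 b'" "Comp C B W Y f b = Comp C B W1 Y f1 b'"
      using d1 unfolding c(1) by (rule domE)
    have "Comp C B W Z (Comp C W Y Z q f) b = Comp C B W1 Z (Comp C W1 Y Z q f1) b'"
      using assoc[OF sarrD[OF B(5)] B(2) q] assoc[OF sarrD[OF B(6)] B(4) q] B(8) by simp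
    then show ?thesis
      using domI[OF B(1) _ B(3) _ B(5) sarrD[OF B(6)] B(7)] arr_Comp[OF _ q] B(2,4)
      by (intro dom_sym[where r="(W, s, Comp C W Y Z q f)"]) blast
  qed
  ultimately show "dom X Z c (W, s, Comp C W Y Z q f)" unfolding c(6) by (rule dom_trans)
qed

end

section \<open>Objects that are projective for the denominators\<close>

text \<open>\<open>lift\<close> says that Hom(G, -) turns denominators into bijections: G plays the
  part of a homotopically projective object, and morphisms out of G in the localisation are governed
  by this property.\<close>

locale fraction_projective = fraction_category C S
  for C :: "('o, 'h) precat" and S +
  fixes G :: 'o
  assumes G_Ob: "G \<in> Ob C"
    and lift: "\<lbrakk>sarr X Y s; arr G Y \<phi>\<rbrakk> \<Longrightarrow> \<exists>!\<psi>. arr G X \<psi> \<and> Comp C G X Y s \<psi> = \<phi>"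
begin

text \<open>Since Hom(G, -) inverts S, it extends to the localisation; \<open>ind\<close> is this
  extension, the action of a roof on morphisms out of G. The description operator picks the lift,
  which is unique by \<open>lift\<close>.\<close>

definition ind :: "'o \<Rightarrow> 'o \<Rightarrow> 'o \<times> 'h \<times> 'h \<Rightarrow> 'h \<Rightarrow> 'h" where
  "ind X Y r \<phi> = (case r of (W, s, f) \<Rightarrow>
     Comp C G W Y f (THE \<psi>. arr G W \<psi> \<and> Comp C G W X s \<psi> = \<phi>))"

lemma liftE:
  assumes "sarr X Y s" "arr G Y \<phi>"
  obtains \<psi> where "arr G X \<psi>" "\<phi> = Comp C G X Y s \<psi>"
  using ex1_implies_ex[OF lift[OF assms]] that by blast

lemma ind_eq:
  assumes "sarr W X s" "arr G W \<psi>" "\<phi> = Comp C G W X s \<psi>"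
  shows "ind X Y (W, s, f) \<phi> = Comp C G W Y f \<psi>"
proof -
  have "arr G X \<phi>" unfolding assms(3) using assms(2) sarrD[OF assms(1)] by (rule arr_Comp)
  then have "(THE \<psi>. arr G W \<psi> \<and> Comp C G W X s \<psi> = \<phi>) = \<psi>"
    using lift[OF assms(1)] assms(2,3) by (intro the1_equality) simp_all
  then show ?thesis by (simp add: ind_def)
qed

lemma ind_arr:
  assumes "roof X Y r" "arr G X \<phi>"
  shows "arr G Y (ind X Y r \<phi>)"
proof -
  obtain W s f where r: "r = (W, s, f)" by (cases r)
  then have s: "sarr W X s" "arr W Y f" using assms by auto
  obtain \<psi> where p: "arr G W \<psi>" "\<phi> = Comp C G W X s \<psi>" using s(1) assms(2) by (rule liftE)
  show ?thesis unfolding r ind_eq[OF s(1) p] using p(1) s(2) by (rule arr_Comp)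
qed

lemma ind_L: "\<lbrakk>arr X Y f; arr G X \<phi>\<rbrakk> \<Longrightarrow> ind X Y (X, Ident C X, f) \<phi> = Comp C G X Y f \<phi>"
  by (rule ind_eq) (simp_all add: sarr_Ident arrD ident_l)

text \<open>Lift \<phi> to the tip of the dominating roof; the images of this lift in W and W' are
  the lifts used on either side.\<close>

lemma ind_dom:
  assumes "dom X Y r r'" "arr G X \<phi>"
  shows "ind X Y r \<phi> = ind X Y r' \<phi>"
proof -
  obtain W s f W' s' f' where r: "r = (W, s, f)" "r' = (W', s', f')" by (cases r; cases r')
  obtain V u u' where V: "sarr W X s" "arr W Y f" "sarr W' X s'" "arr W' Y f'"
    "sarr V W u" "sarr V W' u'"
    "Comp C V W X s u = Comp C V W' X s' u'" "Comp C V W Y f u = Comp C V W' Y f' u'"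
    using assms(1) unfolding r by (rule domE)
  obtain v where v: "arr G V v" "\<phi> = Comp C G V X (Comp C V W X s u) v"
    using sarr_Comp[OF V(5,1)] assms(2) by (rule liftE)
  have 1: "\<phi> = Comp C G W X s (Comp C G V W u v)"
    using v assoc[OF v(1) sarrD[OF V(5)] sarrD[OF V(1)]] by simp
  have 2: "\<phi> = Comp C G W' X s' (Comp C G V W' u' v)"
    using v assoc[OF v(1) sarrD[OF V(6)] sarrD[OF V(3)]] V(7) by simp
  have "Comp C G W Y f (Comp C G V W u v) = Comp C G W' Y f' (Comp C G V W' u' v)"
    using assoc[OF v(1) sarrD[OF V(5)] V(2)] assoc[OF v(1) sarrD[OF V(6)] V(4)] V(8) by simp
  then show ?thesis unfolding r
    using ind_eq[OF V(1) arr_Comp[OF v(1) sarrD[OF V(5)]] 1]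
      ind_eq[OF V(3) arr_Comp[OF v(1) sarrD[OF V(6)]] 2] by simp
qed

lemma ind_comp:
  assumes "roof X Y r" "roof Y Z r'" "comp_roof X Y Z r' r c" "arr G X \<phi>"
  shows "ind X Z c \<phi> = ind Y Z r' (ind X Y r \<phi>)"
proof -
  obtain V W W' s f s' g u v where c: "r = (W, s, f)" "r' = (W', s', g)" "sarr V W u"
     "arr V W' v" "Comp C V W Y f u = Comp C V W' Y s' v"
     "c = (V, Comp C V W X s u, Comp C V W' Z g v)"
    using assms(3) unfolding comp_roof_def by (elim exE conjE)
  have r: "sarr W X s" "arr W Y f" "sarr W' Y s'" "arr W' Z g" using assms(1,2) c(1,2) by auto
  obtain w where w: "arr G V w" "\<phi> = Comp C G V X (Comp C V W X s u) w"
    using sarr_Comp[OF c(3) r(1)] assms(4) by (rule liftE)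
  have 1: "\<phi> = Comp C G W X s (Comp C G V W u w)"
    using w assoc[OF w(1) sarrD[OF c(3)] sarrD[OF r(1)]] by simp
  have 2: "ind X Y r \<phi> = Comp C G W' Y s' (Comp C G V W' v w)"
    unfolding c(1) ind_eq[OF r(1) arr_Comp[OF w(1) sarrD[OF c(3)]] 1]
    using assoc[OF w(1) sarrD[OF c(3)] r(2)] assoc[OF w(1) c(4) sarrD[OF r(3)]] c(5) by simp
  have 3: "ind Y Z r' (ind X Y r \<phi>) = Comp C G W' Z g (Comp C G V W' v w)"
    unfolding c(2) by (rule ind_eq[OF r(3) arr_Comp[OF w(1) c(4)] 2])
  show ?thesis unfolding 3 c(6) ind_eq[OF sarr_Comp[OF c(3) r(1)] w]
    by (rule assoc[OF w(1) c(4) r(4)])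
qed

lemma ind_add:
  assumes "roof X Y r" "arr G X \<phi>" "arr G X \<phi>'"
  shows "ind X Y r (\<phi> \<oplus>[Hom C G X] \<phi>') = ind X Y r \<phi> \<oplus>[Hom C G Y] ind X Y r \<phi>'"
proof -
  obtain W s f where r: "r = (W, s, f)" by (cases r)
  then have s: "sarr W X s" "arr W Y f" using assms by auto
  obtain \<psi> where p: "arr G W \<psi>" "\<phi> = Comp C G W X s \<psi>" using s(1) assms(2) by (rule liftE)
  obtain \<psi>' where p': "arr G W \<psi>'" "\<phi>' = Comp C G W X s \<psi>'" using s(1) assms(3) by (rule liftE)
  have "\<phi> \<oplus>[Hom C G X] \<phi>' = Comp C G W X s (\<psi> \<oplus>[Hom C G W] \<psi>')"
    using Comp_add_r[of G W X \<psi> \<psi>' s] p p' arrD sarrD[OF s(1)] by simp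
  then have "ind X Y r (\<phi> \<oplus>[Hom C G X] \<phi>') = Comp C G W Y f (\<psi> \<oplus>[Hom C G W] \<psi>')"
    unfolding r using ind_eq[OF s(1) arr_add[OF p(1) p'(1)]] by simp
  then show ?thesis
    unfolding r ind_eq[OF s(1) p] ind_eq[OF s(1) p']
    using Comp_add_r[of G W Y \<psi> \<psi>' f] p p' arrD s(2) by simp
qed

lemma ind_zero:
  assumes "roof X Y r"
  shows "ind X Y r \<zero>[Hom C G X] = \<zero>[Hom C G Y]"
proof -
  have X: "X \<in> Ob C" using roof_Ob[OF assms] by simp
  interpret H: abelian_group "Hom C G X" by (rule hom_group[OF G_Ob X])
  have z: "arr G X \<zero>[Hom C G X]" by (rule arr_zero[OF G_Ob X])
  show ?thesis
    using ind_add[OF assms z z] by (intro hom_zeroI ind_arr[OF assms z]) simp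
qed

lemma ind_finsum:
  assumes "roof X Y r" "finite J" "\<And>i. i \<in> J \<Longrightarrow> arr G X (f i)"
  shows "ind X Y r (\<Oplus>\<^bsub>Hom C G X\<^esub>i\<in>J. f i) = (\<Oplus>\<^bsub>Hom C G Y\<^esub>i\<in>J. ind X Y r (f i))"
proof -
  have O: "X \<in> Ob C" "Y \<in> Ob C" using roof_Ob[OF assms(1)] by simp_all
  interpret H: abelian_group "Hom C G X" by (rule hom_group[OF G_Ob O(1)])
  interpret K: abelian_group "Hom C G Y" by (rule hom_group[OF G_Ob O(2)])
  show ?thesis using assms(2,3)
  proof (induction J)
    case empty
    then show ?case using ind_zero[OF assms(1)] by simp
  next
    case (insert j J)
    then have a: "arr G X (f j)" "f \<in> J \<rightarrow> carrier (Hom C G X)" by (auto simp: arr_def)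
    have b: "arr G Y (ind X Y r (f j))" by (rule ind_arr[OF assms(1) a(1)])
    have c: "(\<lambda>i. ind X Y r (f i)) \<in> J \<rightarrow> carrier (Hom C G Y)"
      using ind_arr[OF assms(1)] insert.prems arrD(3) by (intro Pi_I) simp
    have d: "arr G X (\<Oplus>\<^bsub>Hom C G X\<^esub>i\<in>J. f i)"
      using G_Ob O(1) H.finsum_closed[OF a(2)] by (simp add: arr_def)
    show ?case using insert a(2) arrD(3)[OF a(1)] arrD(3)[OF b] c ind_add[OF assms(1) a(1) d] by simp
  qed
qed

text \<open>The identity of G lifts to a section of the denominator, and the section is a
  denominator by cancellation; composing with it turns the roof into an honest morphism.\<close>

lemma cl_eq_L:
  assumes "roof G Y r"
  shows "cl G Y r = L G Y (ind G Y r (Ident C G))"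
proof -
  obtain W s f where r: "r = (W, s, f)" by (cases r)
  then have s: "sarr W G s" "arr W Y f" using assms by auto
  obtain \<psi> where p: "arr G W \<psi>" "Ident C G = Comp C G W G s \<psi>"
    using s(1) arr_Ident[OF G_Ob] by (rule liftE)
  have "sarr G W \<psi>" using sarr_cancel[OF p(1) s(1)] p(2) sarr_Ident[OF G_Ob] by simp
  moreover note fp = arr_Comp[OF p(1) s(2)]
  moreover have "Comp C G W G s \<psi> = Comp C G G G (Ident C G) (Ident C G)"
    using ident_l[OF arr_Ident[OF G_Ob]] p(2) by simp
  moreover have "Comp C G W Y f \<psi> = Comp C G G Y (Comp C G W Y f \<psi>) (Ident C G)"
    using ident_r[OF fp] by simp
  ultimately have "dom G Y r (G, Ident C G, Comp C G W Y f \<psi>)" unfolding r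
    using domI[OF s sarr_Ident[OF G_Ob]] arr_Ident[OF G_Ob] by blast
  then show ?thesis unfolding L_def r ind_eq[OF s(1) p] by (rule dom_cl)
qed

text \<open>A denominator into G that equalises f and g has a right inverse, because the identity of
  G lifts along it.\<close>

lemma L_inj:
  assumes "L G Y f = L G Y g" "arr G Y f" "arr G Y g"
  shows "f = g"
proof -
  obtain V u where u: "sarr V G u" "Comp C V G Y f u = Comp C V G Y g u"
    using assms by (rule L_eqD)
  obtain v where v: "arr G V v" "Ident C G = Comp C G V G u v"
    using u(1) arr_Ident[OF G_Ob] by (rule liftE)
  have "f = Comp C G V Y (Comp C V G Y f u) v"
    unfolding assoc[OF v(1) sarrD[OF u(1)] assms(2)] v(2)[symmetric] ident_r[OF assms(2)] ..
  also have "\<dots> = g"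
    unfolding u(2) assoc[OF v(1) sarrD[OF u(1)] assms(3)] v(2)[symmetric] ident_r[OF assms(3)] ..
  finally show ?thesis .
qed

lemma Hom_D_G:
  assumes "Y \<in> Ob C"
  shows "carrier (Hom D G Y) = L G Y ` carrier (Hom C G Y)"
proof
  show "carrier (Hom D G Y) \<subseteq> L G Y ` carrier (Hom C G Y)"
  proof
    fix \<Phi> assume "\<Phi> \<in> carrier (Hom D G Y)"
    then obtain r where r: "roof G Y r" "\<Phi> = cl G Y r" unfolding Hom_D[OF G_Ob assms] by blast
    then show "\<Phi> \<in> L G Y ` carrier (Hom C G Y)"
      using cl_eq_L[OF r(1)] arrD(3)[OF ind_arr[OF r(1) arr_Ident[OF G_Ob]]] by simp
  qed
  show "L G Y ` carrier (Hom C G Y) \<subseteq> carrier (Hom D G Y)"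
    using L_closed arrI[OF G_Ob assms] by (intro image_subsetI) simp
qed

lemma trivial_Hom_D_iff:
  assumes "Y \<in> Ob C"
  shows "carrier (Hom D G Y) = {\<zero>[Hom D G Y]} \<longleftrightarrow> carrier (Hom C G Y) = {\<zero>[Hom C G Y]}"
proof -
  have z: "arr G Y \<zero>[Hom C G Y]" using G_Ob assms by (rule arr_zero)
  show ?thesis
    unfolding Hom_D_G[OF assms] zero_D
  proof
    assume *: "L G Y ` carrier (Hom C G Y) = {L G Y \<zero>[Hom C G Y]}"
    have "f = \<zero>[Hom C G Y]" if "f \<in> carrier (Hom C G Y)" for f
      using L_inj[OF _ arrI[OF G_Ob assms that] z] * that by blast
    then show "carrier (Hom C G Y) = {\<zero>[Hom C G Y]}" using arrD(3)[OF z] by blast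
  qed simp
qed

text \<open>Every composite roof acts on morphisms out of G by the composite of the two actions, and
  a roof out of G is determined by where it sends the identity of G. Thus all choices in the
  composition give one class.\<close>

lemma Comp_G:
  assumes "roof X Y r" "arr G X \<phi>"
  shows "Comp D G X Y (cl X Y r) (L G X \<phi>) = L G Y (ind X Y r \<phi>)"
proof -
  have c: "arr G Y (ind X Y r \<phi>)" by (rule ind_arr[OF assms])
  show ?thesis
    unfolding L_def
  proof (rule Comp_D_eqI[OF roof_L[OF assms(2)] assms(1) roof_L[OF c]])
    fix r1 r1' c'
    assume d1: "dom G X (G, Ident C G, \<phi>) r1" and d2: "dom X Y r r1'" and cr: "comp_roof G X Y r1' r1 c'"
    note rf = dom_roof(2)[OF d1] dom_roof(2)[OF d2]
    have rc: "roof G Y c'" by (rule comp_roof_roof[OF rf cr])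
    have "ind G Y c' (Ident C G) = ind X Y r1' (ind G X r1 (Ident C G))"
      by (rule ind_comp[OF rf cr arr_Ident[OF G_Ob]])
    also have "ind G X r1 (Ident C G) = \<phi>"
      using ind_dom[OF d1 arr_Ident[OF G_Ob]] ind_L[OF assms(2) arr_Ident[OF G_Ob]] ident_r[OF assms(2)]
      by simp
    also have "ind X Y r1' \<phi> = ind X Y r \<phi>" using ind_dom[OF d2 assms(2)] by simp
    finally have "cl G Y c' = cl G Y (G, Ident C G, ind X Y r \<phi>)"
      using cl_eq_L[OF rc] by (simp add: L_def)
    then show "dom G Y c' (G, Ident C G, ind X Y r \<phi>)"
      using cl_eq_iff[OF G_Ob arrD(2)[OF c] roof_L[OF c]] by simp
  qed
qed

lemma add_D:
  "add (Hom D X Y) \<Phi> \<Psi> = \<Union>{cl X Y (W, s, f \<oplus>[Hom C W Y] g) | W s f g. (W, s, f) \<in> \<Phi> \<and> (W, s, g) \<in> \<Psi>}"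
  by (simp add: localisation_def cl_def)

text \<open>Sums in the localisation are formed over a common denominator W \<rightarrow> G. A
  section of it pulls the two numerators back to f and g simultaneously, whichever representatives
  were chosen.\<close>

lemma L_add:
  assumes "arr G Y f" "arr G Y g"
  shows "L G Y f \<oplus>[Hom D G Y] L G Y g = L G Y (f \<oplus>[Hom C G Y] g)"
proof -
  have Y: "Y \<in> Ob C" using assms by (simp add: arr_def)
  have *: "cl G Y (W, s, f' \<oplus>[Hom C W Y] g') = L G Y (f \<oplus>[Hom C G Y] g)"
    if "(W, s, f') \<in> L G Y f" "(W, s, g') \<in> L G Y g" for W s f' g'
  proof -
    have d: "dom G Y (G, Ident C G, f) (W, s, f')" "dom G Y (G, Ident C G, g) (W, s, g')"
      using that unfolding L_def mem_cl[OF G_Ob Y] by simp_all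
    have s: "sarr W G s" "arr W Y f'" "arr W Y g'" using dom_roof(2)[OF d(1)] dom_roof(2)[OF d(2)] by auto
    have i: "arr G G (Ident C G)" by (rule arr_Ident[OF G_Ob])
    obtain \<psi> where p: "arr G W \<psi>" "Ident C G = Comp C G W G s \<psi>"
      using s(1) i by (rule liftE)
    have "f = Comp C G W Y f' \<psi>"
      using ind_dom[OF d(1) i] ind_L[OF assms(1) i] ident_r[OF assms(1)] ind_eq[OF s(1) p] by simp
    moreover have "g = Comp C G W Y g' \<psi>"
      using ind_dom[OF d(2) i] ind_L[OF assms(2) i] ident_r[OF assms(2)] ind_eq[OF s(1) p] by simp
    ultimately have "Comp C G W Y (f' \<oplus>[Hom C W Y] g') \<psi> = f \<oplus>[Hom C G Y] g"
      using Comp_add_l[of G W Y \<psi> f' g'] p(1) s arrD by simp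
    then show ?thesis
      using cl_eq_L[of Y "(W, s, f' \<oplus>[Hom C W Y] g')"] s arr_add[OF s(2,3)] ind_eq[OF s(1) p] by simp
  qed
  have "(G, Ident C G, f) \<in> L G Y f" "(G, Ident C G, g) \<in> L G Y g"
    using dom_refl[OF roof_L[OF assms(1)]] dom_refl[OF roof_L[OF assms(2)]]
    unfolding L_def mem_cl[OF G_Ob Y] by simp_all
  then have "\<exists>W s f' g'. (W, s, f') \<in> L G Y f \<and> (W, s, g') \<in> L G Y g" by (intro exI conjI)
  then show ?thesis unfolding add_D using * by blast
qed

lemma group_D:
  assumes Y: "Y \<in> Ob C"
  shows "abelian_group (Hom D G Y)"
proof -
  interpret H: abelian_group "Hom C G Y" by (rule hom_group[OF G_Ob Y])
  note a = arrI[OF G_Ob Y]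
  show ?thesis
    by (rule abelian_groupI; unfold Hom_D_G[OF Y] zero_D; (elim imageE)?)
      (auto simp: L_add a H.a_ac H.r_neg intro!: bexI[where x="\<ominus>[Hom C G Y] _"] arg_cong[where f="L G Y"])
qed

lemma finsum_L:
  assumes Y: "Y \<in> Ob C" and "finite J" "\<And>i. i \<in> J \<Longrightarrow> arr G Y (f i)"
  shows "(\<Oplus>\<^bsub>Hom D G Y\<^esub>i\<in>J. L G Y (f i)) = L G Y (\<Oplus>\<^bsub>Hom C G Y\<^esub>i\<in>J. f i)"
proof -
  interpret H: abelian_group "Hom C G Y" by (rule hom_group[OF G_Ob Y])
  interpret K: abelian_group "Hom D G Y" by (rule group_D[OF Y])
  show ?thesis using assms(2,3)
  proof (induction J)
    case empty
    then show ?case by (simp add: zero_D)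
  next
    case (insert j J)
    then have a: "arr G Y (f j)" "f \<in> J \<rightarrow> carrier (Hom C G Y)" by (auto simp: arr_def)
    have c: "(\<lambda>i. L G Y (f i)) \<in> J \<rightarrow> carrier (Hom D G Y)"
      using L_closed insert.prems by (intro Pi_I) simp
    have d: "arr G Y (\<Oplus>\<^bsub>Hom C G Y\<^esub>i\<in>J. f i)"
      using G_Ob Y H.finsum_closed[OF a(2)] by (simp add: arr_def)
    show ?case using insert a(2) arrD(3)[OF a(1)] L_closed[OF a(1)] c L_add[OF a(1) d] by simp
  qed
qed

text \<open>One member of the composite class suffices, because the action of a roof depends only on
  its class.\<close>

lemma Comp_D_ind:
  assumes "roof X Y r" "roof Y Z r'" "roof X Z r''" "arr G X \<phi>"
    and "Comp D X Y Z (cl Y Z r') (cl X Y r) = cl X Z r''"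
  shows "ind Y Z r' (ind X Y r \<phi>) = ind X Z r'' \<phi>"
proof -
  obtain c where c: "comp_roof X Y Z r' r c" using comp_roof_ex[OF assms(1,2)] ..
  then have "c \<in> cl X Z r''" using Comp_D_memI[OF assms(1,2) c] assms(5) by simp
  then have "dom X Z r'' c" using mem_cl roof_Ob[OF assms(3)] by simp
  then show ?thesis using ind_dom[OF _ assms(4)] ind_comp[OF assms(1,2) c assms(4)] by metis
qed

text \<open>
  For a coproduct \<open>P\<close> of the \<open>M i\<close> with injections represented by roofs \<open>M i \<leftarrow> W i \<rightarrow> P\<close>, uniqueness
  of maps out of \<open>P\<close> shows that the weak cokernel of \<open>\<Oplus> W i \<rightarrow> P\<close> vanishes, so that every morphism
  \<open>G \<rightarrow> P\<close> lifts to \<open>\<Oplus> W i\<close>; the maps \<open>P \<rightarrow> M j\<close> with components \<open>\<delta>\<close> give injectivity.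
\<close>

theorem compact_objectI:
  fixes U :: "'i set"
  assumes cone: "\<And>X Y f. arr X Y f \<Longrightarrow> \<exists>Z q. arr Y Z q \<and> Comp C X Y Z q f = \<zero>[Hom C X Z] \<and>
      (\<forall>\<phi>. arr G Y \<phi> \<and> Comp C G Y Z q \<phi> = \<zero>[Hom C G Z] \<longrightarrow> (\<exists>\<psi>. arr G X \<psi> \<and> Comp C G X Y f \<psi> = \<phi>))"
    and dsum: "\<And>(I :: 'i set) W. \<lbrakk>I \<subseteq> U; \<And>i. i \<in> I \<Longrightarrow> W i \<in> Ob C\<rbrakk> \<Longrightarrow> \<exists>Q \<kappa>. Q \<in> Ob C \<and> (\<forall>i\<in>I. arr (W i) Q (\<kappa> i)) \<and>
      (\<forall>Y f. Y \<in> Ob C \<and> (\<forall>i\<in>I. arr (W i) Y (f i)) \<longrightarrow>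
        (\<exists>g. arr Q Y g \<and> (\<forall>i\<in>I. Comp C (W i) Q Y g (\<kappa> i) = f i))) \<and>
      (\<forall>\<phi>. arr G Q \<phi> \<longrightarrow> (\<exists>J \<psi>. finite J \<and> J \<subseteq> I \<and> (\<forall>i\<in>J. arr G (W i) (\<psi> i)) \<and>
        \<phi> = (\<Oplus>\<^bsub>Hom C G Q\<^esub>i\<in>J. Comp C G (W i) Q (\<kappa> i) (\<psi> i))))"
  shows "compact_object U D G"
  unfolding compact_object_def Ob_D
proof (intro conjI allI impI G_Ob; elim conjE)
  fix I :: "'i set" and M P \<iota>
  assume I: "I \<subseteq> U" and M: "\<forall>i\<in>I. M i \<in> Ob C" and co: "is_coproduct D I M P \<iota>"
  have P: "P \<in> Ob C" and io: "\<And>i. i \<in> I \<Longrightarrow> \<iota> i \<in> carrier (Hom D (M i) P)"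
    and univ: "\<And>Y g. \<lbrakk>Y \<in> Ob C; \<And>i. i \<in> I \<Longrightarrow> g i \<in> carrier (Hom D (M i) Y)\<rbrakk>
        \<Longrightarrow> \<exists>!h. h \<in> carrier (Hom D P Y) \<and> (\<forall>i\<in>I. Comp D (M i) P Y h (\<iota> i) = g i)"
    using co unfolding is_coproduct_def Ob_D by blast+
  have "\<forall>i\<in>I. \<exists>r. roof (M i) P r \<and> \<iota> i = cl (M i) P r"
    using io M P Hom_D by blast
  then obtain r where r: "\<And>i. i \<in> I \<Longrightarrow> roof (M i) P (r i)" "\<And>i. i \<in> I \<Longrightarrow> \<iota> i = cl (M i) P (r i)"
    using bchoice[of I "\<lambda>i r. roof (M i) P r \<and> \<iota> i = cl (M i) P r"] by blast
  let ?z = "\<lambda>i. \<zero>[Hom D G (M i)]"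
  let ?A = "{\<phi> \<in> (\<Pi>\<^sub>E i\<in>I. carrier (Hom D G (M i))). finite {i\<in>I. \<phi> i \<noteq> ?z i}}"
  let ?\<Theta> = "\<lambda>\<phi>. \<Oplus>\<^bsub>Hom D G P\<^esub>i\<in>{i\<in>I. \<phi> i \<noteq> ?z i}. Comp D G (M i) P (\<iota> i) (\<phi> i)"
  interpret DP: abelian_group "Hom D G P" by (rule group_D[OF P])
  interpret CP: abelian_group "Hom C G P" by (rule hom_group[OF G_Ob P])
  \<comment> \<open>The canonical map is computed in C on representatives \<open>x i\<close>. The
    finite set J may exceed the support, so that two families can be compared over one index
    set.\<close>
  have \<Theta>: "?\<Theta> \<phi> = L G P (\<Oplus>\<^bsub>Hom C G P\<^esub>i\<in>J. ind (M i) P (r i) (x i))"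
    if x: "\<And>i. i \<in> I \<Longrightarrow> arr G (M i) (x i)" "\<And>i. i \<in> I \<Longrightarrow> \<phi> i = L G (M i) (x i)"
      and J: "finite J" "J \<subseteq> I" "\<And>i. i \<in> I - J \<Longrightarrow> x i = \<zero>[Hom C G (M i)]" for \<phi> x J
  proof -
    have a: "arr G P (ind (M i) P (r i) (x i))" if "i \<in> I" for i
      by (rule ind_arr[OF r(1)[OF that] x(1)[OF that]])
    have s: "{i\<in>I. \<phi> i \<noteq> ?z i} \<subseteq> J" using x(2) J(3) by (auto simp: zero_D)
    have z: "ind (M i) P (r i) (x i) = \<zero>[Hom C G P]" if "i \<in> J - {i\<in>I. \<phi> i \<noteq> ?z i}" for i
    proof -
      have i: "i \<in> I" "L G (M i) (x i) = L G (M i) \<zero>[Hom C G (M i)]"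
        using that J(2) x(2) by (auto simp: zero_D)
      have "M i \<in> Ob C" using M i(1) by blast
      then have "x i = \<zero>[Hom C G (M i)]" by (intro L_inj[OF i(2) x(1)[OF i(1)]] arr_zero[OF G_Ob])
      then show ?thesis using ind_zero[OF r(1)[OF i(1)]] by simp
    qed
    have "?\<Theta> \<phi> = (\<Oplus>\<^bsub>Hom D G P\<^esub>i\<in>{i\<in>I. \<phi> i \<noteq> ?z i}. L G P (ind (M i) P (r i) (x i)))"
      using L_closed[OF a] x(2) r Comp_G[OF r(1) x(1)]
      by (intro DP.finsum_cong') auto
    also have "\<dots> = L G P (\<Oplus>\<^bsub>Hom C G P\<^esub>i\<in>{i\<in>I. \<phi> i \<noteq> ?z i}. ind (M i) P (r i) (x i))"
      using finite_subset[OF s J(1)] a by (intro finsum_L[OF P]) auto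
    also have "(\<Oplus>\<^bsub>Hom C G P\<^esub>i\<in>{i\<in>I. \<phi> i \<noteq> ?z i}. ind (M i) P (r i) (x i))
       = (\<Oplus>\<^bsub>Hom C G P\<^esub>i\<in>J. ind (M i) P (r i) (x i))"
      using arrD(3)[OF a] J(2) by (intro CP.add.finprod_mono_neutral_cong_left[OF J(1) s z]) auto
    finally show ?thesis .
  qed
  have choose: "\<exists>x. (\<forall>i\<in>I. arr G (M i) (x i)) \<and> (\<forall>i\<in>I. \<phi> i = L G (M i) (x i))" if "\<phi> \<in> ?A" for \<phi>
  proof -
    have "\<forall>i\<in>I. \<exists>x. arr G (M i) x \<and> \<phi> i = L G (M i) x"
    proof
      fix i assume i: "i \<in> I"
      then have "\<phi> i \<in> carrier (Hom D G (M i))" "M i \<in> Ob C" using that M by auto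
      then show "\<exists>x. arr G (M i) x \<and> \<phi> i = L G (M i) x" using Hom_D_G arrI[OF G_Ob] by blast
    qed
    from bchoice[OF this] show ?thesis by blast
  qed
  have support: "x i = \<zero>[Hom C G (M i)]" 
    if "\<forall>i\<in>I. arr G (M i) (x i)" "\<forall>i\<in>I. \<phi> i = L G (M i) (x i)" "i \<in> I - {i\<in>I. \<phi> i \<noteq> ?z i}" for x \<phi> i
  proof -
    have i: "i \<in> I" "M i \<in> Ob C" "L G (M i) (x i) = L G (M i) \<zero>[Hom C G (M i)]"
      using that M by (auto simp: zero_D)
    show ?thesis by (rule L_inj[OF i(3)]) (use that i arr_zero[OF G_Ob] in auto)
  qed
  show "bij_betw ?\<Theta> ?A (carrier (Hom D G P))"
    unfolding bij_betw_def
  proof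
    show "inj_on ?\<Theta> ?A"
    proof (rule inj_onI)
      fix \<phi> \<phi>' assume A: "\<phi> \<in> ?A" "\<phi>' \<in> ?A" and eq: "?\<Theta> \<phi> = ?\<Theta> \<phi>'"
      obtain x where x: "\<forall>i\<in>I. arr G (M i) (x i)" "\<forall>i\<in>I. \<phi> i = L G (M i) (x i)"
        using choose[OF A(1)] by blast
      obtain x' where x': "\<forall>i\<in>I. arr G (M i) (x' i)" "\<forall>i\<in>I. \<phi>' i = L G (M i) (x' i)"
        using choose[OF A(2)] by blast
      define J where "J = {i\<in>I. \<phi> i \<noteq> ?z i} \<union> {i\<in>I. \<phi>' i \<noteq> ?z i}"
      have J: "finite J" "J \<subseteq> I" using A by (auto simp: J_def)
      have xJ: "x i = \<zero>[Hom C G (M i)]" "x' i = \<zero>[Hom C G (M i)]" if "i \<in> I - J" for i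
        using support[OF x, of i] support[OF x', of i] that by (auto simp: J_def)
      let ?s = "\<lambda>x. \<Oplus>\<^bsub>Hom C G P\<^esub>i\<in>J. ind (M i) P (r i) (x i)"
      have ai: "arr G P (ind (M i) P (r i) (x i))" "arr G P (ind (M i) P (r i) (x' i))" if "i \<in> J" for i
        using ind_arr[OF r(1)] that J(2) x(1) x'(1) by blast+
      have as: "arr G P (?s x)" "arr G P (?s x')"
        using ai by (auto intro!: arrI G_Ob P CP.finsum_closed simp: arr_def)
      have "L G P (?s x) = L G P (?s x')"
        using \<Theta>[of x \<phi> J] \<Theta>[of x' \<phi>' J] x x' J xJ eq by simp
      then have ss: "?s x = ?s x'" using L_inj as by blast
      have "x j = x' j" if j: "j \<in> J" for j
      proof -
        have jI: "j \<in> I" and Mj: "M j \<in> Ob C" using j J(2) M by auto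
        define \<delta> where "\<delta> i = (if i = j then Ident C (M j) else \<zero>[Hom C (M i) (M j)])" for i
        have d: "arr (M i) (M j) (\<delta> i)" if "i \<in> I" for i
          using that M Mj by (auto simp: \<delta>_def arr_Ident arr_zero)
        obtain p where "p \<in> carrier (Hom D P (M j))" and
          pi: "\<And>i. i \<in> I \<Longrightarrow> Comp D (M i) P (M j) p (\<iota> i) = L (M i) (M j) (\<delta> i)"
          using univ[OF Mj, of "\<lambda>i. L (M i) (M j) (\<delta> i)"] L_closed[OF d] by blast
        then obtain q where q: "roof P (M j) q" "p = cl P (M j) q"
          unfolding Hom_D[OF P Mj] by blast
        interpret Cj: abelian_group "Hom C G (M j)" by (rule hom_group[OF G_Ob Mj])
        \<comment> \<open>The roof \<open>q\<close> represents the projection to the factor j; on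
          morphisms out of G it undoes the injection of index j and kills all others.\<close>
        have q': "ind P (M j) q (ind (M i) P (r i) y) = Comp C G (M i) (M j) (\<delta> i) y"
          if i: "i \<in> I" and y: "arr G (M i) y" for i y
        proof -
          have "ind P (M j) q (ind (M i) P (r i) y) = ind (M i) (M j) (M i, Ident C (M i), \<delta> i) y"
            using pi[OF i] r(2)[OF i] q(2)
            by (intro Comp_D_ind[OF r(1)[OF i] q(1) roof_L[OF d[OF i]] y]) (simp add: L_def)
          then show ?thesis using ind_L[OF d[OF i] y] by simp
        qed
        have qs: "ind P (M j) q (?s y) = y j" if y: "\<And>i. i \<in> J \<Longrightarrow> arr G (M i) (y i)" for y
        proof -
          have aa: "arr G P (ind (M i) P (r i) (y i))" if "i \<in> J" for i
            using ind_arr[OF r(1)] that J(2) y by blast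
          have yj: "y j \<in> carrier (Hom C G (M j))" using y[OF j] by (simp add: arr_def)
          have "ind P (M j) q (?s y) = (\<Oplus>\<^bsub>Hom C G (M j)\<^esub>i\<in>J. ind P (M j) q (ind (M i) P (r i) (y i)))"
            by (rule ind_finsum[OF q(1) J(1) aa])
          also have "\<dots> = (\<Oplus>\<^bsub>Hom C G (M j)\<^esub>i\<in>J. if j = i then y j else \<zero>[Hom C G (M j)])"
          proof (rule Cj.finsum_cong')
            fix i assume i: "i \<in> J"
            then have iI: "i \<in> I" using J by auto
            show "ind P (M j) q (ind (M i) P (r i) (y i)) = (if j = i then y j else \<zero>[Hom C G (M j)])"
              using q'[OF iI y[OF i]] ident_l[OF y[OF i]] Comp_zero_l[OF Mj y[OF i]] by (auto simp: \<delta>_def)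
          qed (use yj in auto)
          also have "\<dots> = y j"
            using Cj.add.finprod_singleton[OF j J(1), of "\<lambda>i. y j"] yj by simp
          finally show ?thesis .
        qed
        have "\<And>i. i \<in> J \<Longrightarrow> arr G (M i) (x i)" "\<And>i. i \<in> J \<Longrightarrow> arr G (M i) (x' i)" using x x' J(2) by auto
        then show ?thesis using qs[of x] qs[of x'] ss by simp
      qed
      then have "x i = x' i" if "i \<in> I" for i using xJ that by (cases "i \<in> J") auto
      then have "\<phi> i = \<phi>' i" if "i \<in> I" for i using x x' that by simp
      moreover have "\<phi> \<in> (\<Pi>\<^sub>E i\<in>I. carrier (Hom D G (M i)))" "\<phi>' \<in> (\<Pi>\<^sub>E i\<in>I. carrier (Hom D G (M i)))"
        using A by auto
      ultimately show "\<phi> = \<phi>'" by (metis PiE_ext)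
    qed
    show "?\<Theta> ` ?A = carrier (Hom D G P)"
    proof (intro equalityI subsetI)
      fix y assume "y \<in> ?\<Theta> ` ?A"
      then obtain \<phi> where A: "\<phi> \<in> ?A" and y: "y = ?\<Theta> \<phi>" by blast
      obtain x where x: "\<forall>i\<in>I. arr G (M i) (x i)" "\<forall>i\<in>I. \<phi> i = L G (M i) (x i)"
        using choose[OF A(1)] by blast
      have "y = L G P (\<Oplus>\<^bsub>Hom C G P\<^esub>i\<in>{i\<in>I. \<phi> i \<noteq> ?z i}. ind (M i) P (r i) (x i))"
        unfolding y using x A by (intro \<Theta> support[OF x]) auto
      moreover have "arr G P (\<Oplus>\<^bsub>Hom C G P\<^esub>i\<in>{i\<in>I. \<phi> i \<noteq> ?z i}. ind (M i) P (r i) (x i))"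
      proof (intro arrI G_Ob P CP.finsum_closed Pi_I)
        fix i assume "i \<in> {i\<in>I. \<phi> i \<noteq> ?z i}"
        then have i: "i \<in> I" "arr G (M i) (x i)" using x by auto
        show "ind (M i) P (r i) (x i) \<in> carrier (Hom C G P)" by (rule arrD(3)[OF ind_arr[OF r(1)[OF i(1)] i(2)]])
      qed
      ultimately show "y \<in> carrier (Hom D G P)" using L_closed by simp
    next
      fix \<Psi> assume "\<Psi> \<in> carrier (Hom D G P)"
      then obtain y where y: "arr G P y" "\<Psi> = L G P y" using Hom_D_G[OF P] arrI[OF G_Ob P] by blast
      define W s f where "W i = fst (r i)" and "s i = fst (snd (r i))" and "f i = snd (snd (r i))" for i
      have rW: "r i = (W i, s i, f i)" for i by (simp add: W_def s_def f_def)
      have s: "sarr (W i) (M i) (s i)" and f: "arr (W i) P (f i)" if "i \<in> I" for i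
        using r(1)[OF that] unfolding rW by auto
      have W: "W i \<in> Ob C" if "i \<in> I" for i using f[OF that] by (simp add: arr_def)
      obtain Q \<kappa> where Q: "Q \<in> Ob C" and \<kappa>': "\<forall>i\<in>I. arr (W i) Q (\<kappa> i)"
        and ext: "\<forall>Y f. Y \<in> Ob C \<and> (\<forall>i\<in>I. arr (W i) Y (f i)) \<longrightarrow>
           (\<exists>g. arr Q Y g \<and> (\<forall>i\<in>I. Comp C (W i) Q Y g (\<kappa> i) = f i))"
        and fin: "\<forall>\<phi>. arr G Q \<phi> \<longrightarrow> (\<exists>J \<psi>. finite J \<and> J \<subseteq> I \<and> (\<forall>i\<in>J. arr G (W i) (\<psi> i)) \<and>
          \<phi> = (\<Oplus>\<^bsub>Hom C G Q\<^esub>i\<in>J. Comp C G (W i) Q (\<kappa> i) (\<psi> i)))"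
        by (rule exE[OF dsum[OF I W]], assumption, elim exE conjE) (rule that)
      have \<kappa>: "arr (W i) Q (\<kappa> i)" if "i \<in> I" for i using \<kappa>' that by (rule bspec)
      have "\<exists>g. arr Q P g \<and> (\<forall>i\<in>I. Comp C (W i) Q P g (\<kappa> i) = f i)"
        using ext f P by simp
      then obtain g where g: "arr Q P g" "\<And>i. i \<in> I \<Longrightarrow> Comp C (W i) Q P g (\<kappa> i) = f i"
        by (elim exE conjE) simp
      obtain Z q where q: "arr P Z q" "Comp C Q P Z q g = \<zero>[Hom C Q Z]"
        and ker: "\<forall>\<phi>. arr G P \<phi> \<and> Comp C G P Z q \<phi> = \<zero>[Hom C G Z] \<longrightarrow> (\<exists>\<psi>. arr G Q \<psi> \<and> Comp C G Q P g \<psi> = \<phi>)"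
        using cone[OF g(1)] by (elim exE conjE)
      have Z: "Z \<in> Ob C" using q by (simp add: arr_def)
      have zP: "arr P Z \<zero>[Hom C P Z]" by (rule arr_zero[OF P Z])
      have *: "Comp D (M i) P Z (L P Z q) (\<iota> i) = Comp D (M i) P Z (L P Z \<zero>[Hom C P Z]) (\<iota> i)"
        if i: "i \<in> I" for i
      proof -
        have ri: "roof (M i) P (W i, s i, f i)" using r(1)[OF i] rW by simp
        have "Comp C (W i) P Z q (f i) = Comp C (W i) Q Z (Comp C Q P Z q g) (\<kappa> i)"
          using assoc[OF \<kappa>[OF i] g(1) q(1)] g(2)[OF i] by simp
        also have "\<dots> = Comp C (W i) P Z \<zero>[Hom C P Z] (f i)"
          unfolding q(2) using Comp_zero_l[OF Z \<kappa>[OF i]] Comp_zero_l[OF Z f[OF i]] by simp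
        finally show ?thesis unfolding r(2)[OF i] rW Comp_L[OF ri q(1)] Comp_L[OF ri zP] by simp
      qed
      have cl: "Comp D (M i) P Z (L P Z \<zero>[Hom C P Z]) (\<iota> i) \<in> carrier (Hom D (M i) Z)" if i: "i \<in> I" for i
      proof -
        have ri: "roof (M i) P (W i, s i, f i)" using r(1)[OF i] rW by simp
        have "roof (M i) Z (W i, s i, Comp C (W i) P Z \<zero>[Hom C P Z] (f i))"
          using s[OF i] arr_Comp[OF f[OF i] zP] by simp
        then show ?thesis
          unfolding r(2)[OF i] rW Comp_L[OF ri zP] using M i Hom_D[OF _ Z] by blast
      qed
      \<comment> \<open>Since q after g is zero, both sides agree after every injection, and
        uniqueness in the universal property of P identifies them. Equality in the localisation then
        means that q vanishes in C after some denominator into P.\<close>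
      have "L P Z q = L P Z \<zero>[Hom C P Z]"
        using univ[OF Z cl] L_closed[OF q(1)] L_closed[OF zP] * by blast
      then obtain V u where u: "sarr V P u" "Comp C V P Z q u = Comp C V P Z \<zero>[Hom C P Z] u"
        using q(1) zP by (rule L_eqD)
      \<comment> \<open>\<open>y\<close> factors through the denominator on which \<open>q\<close>
        vanishes; hence q after y is zero in C itself, and y comes from the direct sum Q.\<close>
      obtain v where v: "arr G V v" "y = Comp C G V P u v" using u(1) y(1) by (rule liftE)
      have "Comp C G P Z q y = \<zero>[Hom C G Z]"
        using assoc[OF v(1) sarrD[OF u(1)] q(1)] assoc[OF v(1) sarrD[OF u(1)] zP] u(2) v(2)
          Comp_zero_l[OF Z y(1)] by simp
      then obtain \<psi> where \<psi>: "arr G Q \<psi>" "Comp C G Q P g \<psi> = y" using ker y(1) by blast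
      obtain J z where J: "finite J" "J \<subseteq> I" and z': "\<forall>i\<in>J. arr G (W i) (z i)"
        and \<psi>z: "\<psi> = (\<Oplus>\<^bsub>Hom C G Q\<^esub>i\<in>J. Comp C G (W i) Q (\<kappa> i) (z i))"
        using fin[rule_format, OF \<psi>(1)] by (elim exE conjE)
      have z: "arr G (W i) (z i)" if "i \<in> J" for i using z' that by (rule bspec)
      \<comment> \<open>The components of y live on the tips \<open>W i\<close>. Pushing them along
        the denominators gives morphisms into \<open>M i\<close> on which the roof
        \<open>r i\<close> acts as \<open>f i\<close> after \<open>z i\<close>.\<close>
      define x where "x i = (if i \<in> J then Comp C G (W i) (M i) (s i) (z i) else \<zero>[Hom C G (M i)])" for i
      define \<phi> where "\<phi> = (\<lambda>i\<in>I. L G (M i) (x i))"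
      have x: "arr G (M i) (x i)" if "i \<in> I" for i
        using that M z sarrD[OF s[OF that]] arr_Comp arr_zero[OF G_Ob] by (auto simp: x_def)
      have ix: "ind (M i) P (r i) (x i) = Comp C G (W i) P (f i) (z i)" if i: "i \<in> J" for i
      proof -
        have iI: "i \<in> I" using i J by blast
        show ?thesis unfolding rW by (rule ind_eq[OF s[OF iI] z[OF i]]) (simp add: x_def i)
      qed
      have "y = (\<Oplus>\<^bsub>Hom C G P\<^esub>i\<in>J. Comp C G Q P g (Comp C G (W i) Q (\<kappa> i) (z i)))"
        unfolding \<psi>(2)[symmetric] \<psi>z
        by (rule Comp_finsum_r[OF g(1) G_Ob J(1)]) (use arr_Comp[OF z \<kappa>] J(2) in blast)
      also have "\<dots> = (\<Oplus>\<^bsub>Hom C G P\<^esub>i\<in>J. ind (M i) P (r i) (x i))"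
      proof (rule CP.finsum_cong')
        fix i assume i: "i \<in> J"
        then have iI: "i \<in> I" using J by blast
        show "Comp C G Q P g (Comp C G (W i) Q (\<kappa> i) (z i)) = ind (M i) P (r i) (x i)"
          unfolding ix[OF i] g(2)[OF iI, symmetric] by (rule assoc[OF z[OF i] \<kappa>[OF iI] g(1), symmetric])
      next
        show "(\<lambda>i. ind (M i) P (r i) (x i)) \<in> J \<rightarrow> carrier (Hom C G P)"
          using ind_arr[OF r(1) x] J(2) arrD(3) by (intro Pi_I) blast
      qed simp
      also have "L G P \<dots> = ?\<Theta> \<phi>"
        by (rule \<Theta>[symmetric, OF x _ J]) (auto simp: \<phi>_def x_def)
      finally have "\<Psi> = ?\<Theta> \<phi>" using y(2) by simp
      moreover have "{i\<in>I. \<phi> i \<noteq> ?z i} \<subseteq> J" by (auto simp: \<phi>_def x_def zero_D)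
      then have "\<phi> \<in> ?A"
        using L_closed[OF x] finite_subset[OF _ J(1)] by (auto simp: \<phi>_def)
      ultimately show "\<Psi> \<in> ?\<Theta> ` ?A" by blast
    qed
  qed
qed

end

section \<open>Additive groups, cdg algebras and cdg modules\<close>

context abelian_group begin

definition lsum :: "'a list \<Rightarrow> 'a" where
  "lsum xs = foldr (\<oplus>) xs \<zero>"

text \<open>A normal form: x is the sum of \<open>ps\<close> minus the sum of \<open>ns\<close>,
  stated additively so that two normal forms combine by appending lists.\<close>

definition rep :: "'a \<Rightarrow> 'a list \<Rightarrow> 'a list \<Rightarrow> bool" where
  "rep x ps ns \<longleftrightarrow> x \<in> carrier G \<and> set ps \<subseteq> carrier G \<and> set ns \<subseteq> carrier G \<and> x \<oplus> lsum ns = lsum ps"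

lemma lsum_simps: "lsum [] = \<zero>" "lsum (x # xs) = x \<oplus> lsum xs"
  by (simp_all add: lsum_def)

lemma lsum_closed: "set xs \<subseteq> carrier G \<Longrightarrow> lsum xs \<in> carrier G"
  by (induction xs) (auto simp: lsum_simps)

lemma lsum_append:
  "\<lbrakk>set xs \<subseteq> carrier G; set ys \<subseteq> carrier G\<rbrakk> \<Longrightarrow> lsum (xs @ ys) = lsum xs \<oplus> lsum ys"
  by (induction xs) (auto simp: lsum_simps lsum_closed a_assoc)

lemma lsum_remove1:
  "\<lbrakk>x \<in> set ys; set ys \<subseteq> carrier G\<rbrakk> \<Longrightarrow> lsum ys = x \<oplus> lsum (remove1 x ys)"
proof (induction ys)
  case (Cons y ys)
  have "set (remove1 x ys) \<subseteq> carrier G" using Cons.prems set_remove1_subset[of x ys] by auto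
  then show ?case using Cons by (auto simp: lsum_simps a_lcomm lsum_closed)
qed simp

lemma lsum_mset: "\<lbrakk>mset xs = mset ys; set xs \<subseteq> carrier G\<rbrakk> \<Longrightarrow> lsum xs = lsum ys"
proof (induction xs arbitrary: ys)
  case (Cons x xs)
  have x: "x \<in> set ys" using Cons.prems(1) by (metis list.set_intros(1) mset_eq_setD)
  have ys: "set ys \<subseteq> carrier G" using Cons.prems by (metis mset_eq_setD)
  have "mset xs = mset (remove1 x ys)" using Cons.prems(1) x by (metis mset_remove1 mset.simps(2) add_mset_remove_trivial)
  then have "lsum xs = lsum (remove1 x ys)" using Cons by simp
  then show ?case using lsum_remove1[OF x ys] by (simp add: lsum_simps)
qed simp

lemma rep_add: "\<lbrakk>rep x ps ns; rep y ps' ns'\<rbrakk> \<Longrightarrow> rep (x \<oplus> y) (ps @ ps') (ns @ ns')"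
proof -
  assume "rep x ps ns" "rep y ps' ns'"
  then have a: "x \<in> carrier G" "set ps \<subseteq> carrier G" "set ns \<subseteq> carrier G" "x \<oplus> lsum ns = lsum ps"
    "y \<in> carrier G" "set ps' \<subseteq> carrier G" "set ns' \<subseteq> carrier G" "y \<oplus> lsum ns' = lsum ps'"
    by (auto simp: rep_def)
  have "(x \<oplus> y) \<oplus> (lsum ns \<oplus> lsum ns') = (x \<oplus> lsum ns) \<oplus> (y \<oplus> lsum ns')"
    using a(1,5) lsum_closed[OF a(3)] lsum_closed[OF a(7)] by (simp add: a_ac)
  then show ?thesis using a by (simp add: rep_def lsum_append)
qed

lemma rep_neg: 
  assumes "rep x ps ns" shows "rep (\<ominus> x) ns ps"
proof -
  have "x \<in> carrier G" "set ps \<subseteq> carrier G" "set ns \<subseteq> carrier G" "x \<oplus> lsum ns = lsum ps"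
    using assms by (auto simp: rep_def)
  moreover from this have "\<ominus> x \<oplus> lsum ps = lsum ns" using lsum_closed r_neg1 by metis
  ultimately show ?thesis by (simp add: rep_def)
qed

lemma rep_minus: "\<lbrakk>rep x ps ns; rep y ps' ns'\<rbrakk> \<Longrightarrow> rep (x \<ominus> y) (ps @ ns') (ns @ ps')"
  unfolding a_minus_def by (intro rep_add rep_neg)

lemma rep_zero: "rep \<zero> [] []"
  by (simp add: rep_def lsum_simps)

lemma rep_atom: "x \<in> carrier G \<Longrightarrow> rep x [x] []"
  by (simp add: rep_def lsum_simps)

text \<open>Moving all negative summands to the other side turns an equation into an equality of
  multisets. With \<open>rep_rules\<close> computing the normal forms, this settles identities with
  cancelling terms, on which rewriting by associativity and commutativity gets stuck.\<close>

lemma group_eqI: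
  assumes "rep x ps ns" "rep y ps' ns'" "mset (ps @ ns') = mset (ps' @ ns)"
  shows "x = y"
proof -
  have a: "x \<in> carrier G" "set ps \<subseteq> carrier G" "set ns \<subseteq> carrier G" "x \<oplus> lsum ns = lsum ps"
    "y \<in> carrier G" "set ps' \<subseteq> carrier G" "set ns' \<subseteq> carrier G" "y \<oplus> lsum ns' = lsum ps'"
    using assms by (auto simp: rep_def)
  have "lsum (ps @ ns') = lsum (ps' @ ns)" using a by (intro lsum_mset assms(3)) simp
  then have "(x \<oplus> lsum ns) \<oplus> lsum ns' = (y \<oplus> lsum ns') \<oplus> lsum ns" using a by (simp add: lsum_append)
  then have "x \<oplus> (lsum ns \<oplus> lsum ns') = y \<oplus> (lsum ns \<oplus> lsum ns')"
    using a_assoc[OF a(1) lsum_closed[OF a(3)] lsum_closed[OF a(7)]]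
      a_assoc[OF a(5) lsum_closed[OF a(7)] lsum_closed[OF a(3)]]
      a_comm[OF lsum_closed[OF a(3)] lsum_closed[OF a(7)]] by simp
  then show ?thesis using a lsum_closed by (simp add: add.m_closed add.right_cancel)
qed

lemmas rep_rules = rep_add rep_minus rep_neg rep_zero rep_atom

end

lemma (in abelian_group) minus_eq_zero_iff:
  "\<lbrakk>x \<in> carrier G; y \<in> carrier G\<rbrakk> \<Longrightarrow> x \<ominus> y = \<zero> \<longleftrightarrow> x = y"
  using minus_equality[of x "\<ominus> y"] by (auto simp: a_minus_def r_neg)

lemma (in abelian_group) sign_of_closed [simp]: "x \<in> carrier G \<Longrightarrow> sign_of G p x \<in> carrier G"
  by (simp add: sign_of_def)

lemma (in abelian_group) sign_of_add:
  "\<lbrakk>x \<in> carrier G; y \<in> carrier G\<rbrakk> \<Longrightarrow> sign_of G p (x \<oplus> y) = sign_of G p x \<oplus> sign_of G p y"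
  by (simp add: sign_of_def minus_add)

lemma (in abelian_group) sign_of_zero [simp]: "sign_of G p \<zero> = \<zero>"
  by (simp add: sign_of_def)

lemma (in abelian_group) sign_of_sign_of [simp]:
  "x \<in> carrier G \<Longrightarrow> sign_of G p (sign_of G q x) = sign_of G (p + q) x"
  by (simp add: sign_of_def)

lemma sign_of_even: "even p \<Longrightarrow> sign_of G p x = x"
  by (simp add: sign_of_def)

lemma sign_of_odd: "odd p \<Longrightarrow> sign_of G p x = \<ominus>[G] x"
  by (simp add: sign_of_def)

locale additive_map = G: abelian_group G + H: abelian_group H
  for G :: "('x, 'u) ring_scheme" and H :: "('y, 'v) ring_scheme" and f +
  assumes closed [simp]: "x \<in> carrier G \<Longrightarrow> f x \<in> carrier H"
    and add: "\<lbrakk>x \<in> carrier G; y \<in> carrier G\<rbrakk> \<Longrightarrow> f (x \<oplus>[G] y) = f x \<oplus>[H] f y"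
begin

lemma zero [simp]: "f \<zero>[G] = \<zero>[H]"
proof -
  have "f \<zero>[G] \<oplus>[H] f \<zero>[G] = f \<zero>[G]" using add[of "\<zero>[G]" "\<zero>[G]"] by simp
  then show ?thesis using H.add.l_cancel_one'[of "f \<zero>[G]" "f \<zero>[G]"] by simp
qed

lemma neg:
  assumes "x \<in> carrier G"
  shows "f (\<ominus>[G] x) = \<ominus>[H] f x"
proof (rule H.minus_equality[symmetric])
  show "f (\<ominus>[G] x) \<oplus>[H] f x = \<zero>[H]" using add[of "\<ominus>[G] x" x] assms by (simp add: G.l_neg)
qed (use assms in simp_all)

lemma minus: "\<lbrakk>x \<in> carrier G; y \<in> carrier G\<rbrakk> \<Longrightarrow> f (x \<ominus>[G] y) = f x \<ominus>[H] f y"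
  by (simp add: a_minus_def add neg)

lemma sign: "x \<in> carrier G \<Longrightarrow> f (sign_of G p x) = sign_of H p (f x)"
  by (simp add: sign_of_def neg)

lemmas push = add neg minus sign

end

context abelian_subgroup
begin

lemma coset_eq_iff:
  assumes "x \<in> carrier G" "y \<in> carrier G"
  shows "H +> x = H +> y \<longleftrightarrow> x \<ominus> y \<in> H"
proof -
  have "H +> x = H +> y \<longleftrightarrow> x \<in> H +> y"
    using assms a_repr_independence'[of x y] a_rcos_self[of x] by auto
  then show ?thesis using assms a_rcos_module[of y x] by (simp add: a_minus_def)
qed

lemma carrier_quot_group: "carrier (quot_group G H) = (\<lambda>x. H +> x) ` carrier G"
  by (auto simp: quot_group_def A_RCOSETS_defs a_r_coset_def)

lemma quot_group_add:
  "\<lbrakk>x \<in> carrier G; y \<in> carrier G\<rbrakk> \<Longrightarrow> (H +> x) \<oplus>[quot_group G H] (H +> y) = H +> (x \<oplus> y)"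
  by (simp add: quot_group_def a_rcos_sum)

lemma quot_group_zero: "\<zero>[quot_group G H] = H"
  by (simp add: quot_group_def)

lemma coset_zero: "H +> \<zero> = H"
  by (simp add: a_subset)

lemma coset_eq_subgroup_iff: "x \<in> carrier G \<Longrightarrow> H +> x = H \<longleftrightarrow> x \<in> H"
  using coset_eq_iff[of x \<zero>] coset_zero minus_equality[of \<zero> \<zero>] by (simp add: a_minus_def)

lemma quot_group_abelian: "abelian_group (quot_group G H)"
proof (rule abelian_groupI; unfold carrier_quot_group quot_group_zero; (elim imageE)?)
  show "H \<in> (+>) H ` carrier G" using coset_zero by blast
next
  fix X x assume "X = H +> x" "x \<in> carrier G"
  then show "H \<oplus>[quot_group G H] X = X"
    using quot_group_add[of \<zero> x] coset_zero by simp
  show "\<exists>Y\<in>(+>) H ` carrier G. Y \<oplus>[quot_group G H] X = H"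
    using quot_group_add[of "\<ominus> x" x] coset_zero \<open>X = H +> x\<close> \<open>x \<in> carrier G\<close>
    by (intro bexI[of _ "H +> (\<ominus> x)"]) (simp_all add: l_neg)
qed (auto simp: quot_group_add a_ac)

lemma quot_group_neg:
  assumes "x \<in> carrier G"
  shows "\<ominus>[quot_group G H] (H +> x) = H +> (\<ominus> x)"
proof -
  interpret Q: abelian_group "quot_group G H" by (rule quot_group_abelian)
  show ?thesis
    using assms quot_group_add[of "\<ominus> x" x] coset_zero
    by (intro Q.minus_equality) (simp_all add: l_neg quot_group_zero carrier_quot_group)
qed

text \<open>Elements of one coset differ by an element of H, which f sends into N, so the union in
  \<open>coset_map\<close> runs over one and the same coset.\<close>

lemma coset_map_coset:
  assumes f: "additive_map G K f" and K: "abelian_subgroup N K" and fH: "f ` H \<subseteq> N" and x: "x \<in> carrier G"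
  shows "coset_map K N f (H +> x) = N +>\<^bsub>K\<^esub> f x"
proof -
  interpret f: additive_map G K f by (rule f)
  interpret K: abelian_subgroup N K by (rule K)
  have "N +>\<^bsub>K\<^esub> f y = N +>\<^bsub>K\<^esub> f x" if "y \<in> H +> x" for y
  proof -
    have y: "y \<in> carrier G" using that x a_elemrcos_carrier by blast
    then have "y \<ominus> x \<in> H" using that x a_rcos_module[of x y] by (simp add: a_minus_def)
    then have "f (y \<ominus> x) \<in> N" using fH by blast
    then have "f y \<ominus>[K] f x \<in> N" unfolding f.minus[OF y x] .
    then show ?thesis unfolding K.coset_eq_iff[OF f.closed[OF y] f.closed[OF x]] .
  qed
  moreover have "x \<in> H +> x" using x by (rule a_rcos_self)
  ultimately show ?thesis unfolding coset_map_def by blast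
qed

end

lemma additive_subgroupI':
  assumes "abelian_group G" "H \<subseteq> carrier G" "\<zero>[G] \<in> H"
    "\<And>x y. \<lbrakk>x \<in> H; y \<in> H\<rbrakk> \<Longrightarrow> x \<oplus>[G] y \<in> H" "\<And>x. x \<in> H \<Longrightarrow> \<ominus>[G] x \<in> H"
  shows "abelian_subgroup H G"
proof -
  interpret abelian_group G by fact
  have "additive_subgroup H G"
    using assms by (intro additive_subgroup.intro subgroup.intro) (auto simp: a_inv_def)
  then show ?thesis using abelian_group_axioms by (rule abelian_subgroupI3)
qed

lemma (in additive_map) image_subgroup: "abelian_subgroup (f ` carrier G) H"
proof (rule additive_subgroupI')
  show "abelian_group H" by (rule H.abelian_group_axioms)
  show "\<zero>[H] \<in> f ` carrier G" using zero by (metis G.zero_closed imageI)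
  show "x \<oplus>[H] y \<in> f ` carrier G" if "x \<in> f ` carrier G" "y \<in> f ` carrier G" for x y
    using that by (auto simp: add[symmetric])
  show "\<ominus>[H] x \<in> f ` carrier G" if "x \<in> f ` carrier G" for x
    using that by (auto simp: neg[symmetric])
qed auto

section \<open>Operations of algebras and modules as additive maps\<close>

context cdg_algebra
begin

sublocale AM: module R "acomp A p" for p by (rule comp_module)

lemma alg_group: "abelian_group (acomp A p)"
  by (rule AM.M.abelian_group_axioms)

text \<open>The degree of the result is a variable tied by an equation: p + (q + 1) and p + q + 1
  are different terms for one integer, and this form leaves their identification to arithmetic. The
  primed rules below are made for the same purpose.\<close>

lemma mult_closed' [simp]:
  "\<lbrakk>x \<in> ael A p; y \<in> ael A q; s = p + q\<rbrakk> \<Longrightarrow> amult A p q x y \<in> ael A s"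
  by (simp add: mult_closed)

lemma diff_closed' [simp]:
  "\<lbrakk>x \<in> ael A p; s = p + 1\<rbrakk> \<Longrightarrow> adiff A p x \<in> ael A s"
  by (simp add: diff_closed)

lemma diff_map: "s = p + 1 \<Longrightarrow> additive_map (acomp A p) (acomp A s) (adiff A p)"
  by (auto intro!: additive_map.intro additive_map_axioms.intro alg_group simp: diff_add)

lemma lmult_map: "\<lbrakk>x \<in> ael A p; s = p + q\<rbrakk> \<Longrightarrow> additive_map (acomp A q) (acomp A s) (amult A p q x)"
  by (auto intro!: additive_map.intro additive_map_axioms.intro alg_group simp: mult_r_distr)

lemma rmult_map:
  "\<lbrakk>y \<in> ael A q; s = p + q\<rbrakk> \<Longrightarrow> additive_map (acomp A p) (acomp A s) (\<lambda>x. amult A p q x y)"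
  by (auto intro!: additive_map.intro additive_map_axioms.intro alg_group simp: mult_l_distr)

lemma smult_map: "r \<in> carrier R \<Longrightarrow> additive_map (acomp A p) (acomp A p) (\<lambda>x. r \<odot>\<^bsub>acomp A p\<^esub> x)"
  by (auto intro!: additive_map.intro additive_map_axioms.intro alg_group simp: AM.smult_r_distr)

declare one_closed [simp] curv_closed [simp] mult_l_one [simp] mult_r_one [simp]

text \<open>The Leibniz rule for the product of 1 with itself gives d(1) = d(1) + d(1).\<close>

lemma diff_one: "adiff A 0 (aone A) = \<zero>[acomp A 1]"
proof -
  have "adiff A 0 (aone A) = adiff A 0 (aone A) \<oplus>[acomp A 1] adiff A 0 (aone A)"
    using diff_mult[OF one_closed one_closed] by (simp add: sign_of_def)
  moreover have "adiff A 0 (aone A) \<in> ael A 1" by simp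
  ultimately show ?thesis using AM.M.add.l_cancel_one' by blast
qed

end

context cdg_module
begin

sublocale G: abelian_group "mcomp M p" for p by (rule comp_group)

lemma act_closed' [simp]:
  "\<lbrakk>a \<in> ael A p; m \<in> mel M q; s = p + q\<rbrakk> \<Longrightarrow> mact M p q a m \<in> mel M s"
  by (simp add: act_closed)

lemma mdiff_closed' [simp]:
  "\<lbrakk>m \<in> mel M p; s = p + 1\<rbrakk> \<Longrightarrow> mdiff M p m \<in> mel M s"
  by (simp add: mdiff_closed)

lemma mdiff_map: "s = p + 1 \<Longrightarrow> additive_map (mcomp M p) (mcomp M s) (mdiff M p)"
  by (auto intro!: additive_map.intro additive_map_axioms.intro comp_group simp: mdiff_add)

lemma act_map: "\<lbrakk>a \<in> ael A p; s = p + q\<rbrakk> \<Longrightarrow> additive_map (mcomp M q) (mcomp M s) (mact M p q a)"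
  by (auto intro!: additive_map.intro additive_map_axioms.intro comp_group simp: act_r_distr)

lemma mdiff_zero [simp]: "mdiff M p \<zero>[M,p] = \<zero>[M,p + 1]"
  using additive_map.zero[OF mdiff_map] by blast

lemma mdiff_neg: "\<lbrakk>m \<in> mel M p; s = p + 1\<rbrakk> \<Longrightarrow> mdiff M p (\<ominus>[M,p] m) = \<ominus>[M,s] mdiff M p m"
  using additive_map.neg[OF mdiff_map] by blast

lemma mdiff_minus: "\<lbrakk>m \<in> mel M p; m' \<in> mel M p; s = p + 1\<rbrakk>
  \<Longrightarrow> mdiff M p (m \<ominus>[M,p] m') = mdiff M p m \<ominus>[M,s] mdiff M p m'"
  using additive_map.minus[OF mdiff_map] by blast

lemma act_zero: "\<lbrakk>a \<in> ael A p; s = p + q\<rbrakk> \<Longrightarrow> mact M p q a \<zero>[M,q] = \<zero>[M,s]"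
  using additive_map.zero[OF act_map] by blast

lemma act_neg: "\<lbrakk>a \<in> ael A p; m \<in> mel M q; s = p + q\<rbrakk>
  \<Longrightarrow> mact M p q a (\<ominus>[M,q] m) = \<ominus>[M,s] mact M p q a m"
  using additive_map.neg[OF act_map] by blast

end

section \<open>Closed maps and homotopies\<close>

definition chain_map :: "('r, 'a) cdg_alg \<Rightarrow> ('a, 'm) cdg_mod \<Rightarrow> ('a, 'n) cdg_mod \<Rightarrow> (int \<Rightarrow> 'm \<Rightarrow> 'n) \<Rightarrow> bool" where
  "chain_map A M N f \<longleftrightarrow>
    (\<forall>q. f q \<in> mel M q \<rightarrow>\<^sub>E mel N q) \<and>
    (\<forall>q. \<forall>x\<in>mel M q. \<forall>y\<in>mel M q.
      f q (x \<oplus>[M,q] y) = f q x \<oplus>[N,q] f q y) \<and>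
    (\<forall>r q. \<forall>a\<in>ael A r. \<forall>x\<in>mel M q. f (r + q) (mact M r q a x) = mact N r q a (f q x)) \<and>
    (\<forall>q. \<forall>x\<in>mel M q. f (q + 1) (mdiff M q x) = mdiff N q (f q x))"

text \<open>The degree -1 elements of \<open>hom_space\<close>; the Koszul sign (-1)^(-r) is written
  as (-1)^r.\<close>

definition homotopy :: "('r, 'a) cdg_alg \<Rightarrow> ('a, 'm) cdg_mod \<Rightarrow> ('a, 'n) cdg_mod \<Rightarrow> (int \<Rightarrow> 'm \<Rightarrow> 'n) \<Rightarrow> bool" where
  "homotopy A M N h \<longleftrightarrow>
    (\<forall>q. h q \<in> mel M q \<rightarrow>\<^sub>E mel N (q - 1)) \<and>
    (\<forall>q. \<forall>x\<in>mel M q. \<forall>y\<in>mel M q.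
      h q (x \<oplus>[M,q] y) = h q x \<oplus>[N,q - 1] h q y) \<and>
    (\<forall>r q. \<forall>a\<in>ael A r. \<forall>x\<in>mel M q.
      h (r + q) (mact M r q a x) = sign_of (mcomp N (r + q - 1)) r (mact N r (q - 1) a (h q x)))"

text \<open>This is \<open>hom_diff\<close> in degree -1, where the odd degree turns the graded
  commutator of d and h into a sum.\<close>

definition boundary :: "('a, 'm) cdg_mod \<Rightarrow> ('a, 'n) cdg_mod \<Rightarrow> (int \<Rightarrow> 'm \<Rightarrow> 'n) \<Rightarrow> int \<Rightarrow> 'm \<Rightarrow> 'n" where
  "boundary M N h = (\<lambda>q. \<lambda>x\<in>mel M q.
     mdiff N (q - 1) (h q x) \<oplus>[N,q] h (q + 1) (mdiff M q x))"

definition null_homotopic :: "('r, 'a) cdg_alg \<Rightarrow> ('a, 'm) cdg_mod \<Rightarrow> ('a, 'n) cdg_mod \<Rightarrow> (int \<Rightarrow> 'm \<Rightarrow> 'n) \<Rightarrow> bool" where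
  "null_homotopic A M N f \<longleftrightarrow> (\<exists>h. homotopy A M N h \<and> f = boundary M N h)"

definition add_map :: "('a, 'm) cdg_mod \<Rightarrow> ('a, 'n) cdg_mod \<Rightarrow> (int \<Rightarrow> 'm \<Rightarrow> 'n) \<Rightarrow> (int \<Rightarrow> 'm \<Rightarrow> 'n) \<Rightarrow> int \<Rightarrow> 'm \<Rightarrow> 'n" where
  "add_map M N f g = (\<lambda>q. \<lambda>x\<in>mel M q. f q x \<oplus>[N,q] g q x)"

definition neg_map :: "('a, 'm) cdg_mod \<Rightarrow> ('a, 'n) cdg_mod \<Rightarrow> (int \<Rightarrow> 'm \<Rightarrow> 'n) \<Rightarrow> int \<Rightarrow> 'm \<Rightarrow> 'n" where
  "neg_map M N f = (\<lambda>q. \<lambda>x\<in>mel M q. \<ominus>[N,q] f q x)"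

definition zero_map :: "('a, 'm) cdg_mod \<Rightarrow> ('a, 'n) cdg_mod \<Rightarrow> int \<Rightarrow> 'm \<Rightarrow> 'n" where
  "zero_map M N = (\<lambda>q. \<lambda>x\<in>mel M q. \<zero>[N,q])"

definition comp_map :: "('a, 'm) cdg_mod \<Rightarrow> (int \<Rightarrow> 'n \<Rightarrow> 'p) \<Rightarrow> (int \<Rightarrow> 'm \<Rightarrow> 'n) \<Rightarrow> int \<Rightarrow> 'm \<Rightarrow> 'p" where
  "comp_map M g f = (\<lambda>q. compose (mel M q) (g q) (f q))"

definition id_map :: "('a, 'm) cdg_mod \<Rightarrow> int \<Rightarrow> 'm \<Rightarrow> 'm" where
  "id_map M = (\<lambda>q. \<lambda>x\<in>mel M q. x)"

lemma map_simps [simp]: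
  "x \<in> mel M q \<Longrightarrow> boundary M N h q x = mdiff N (q - 1) (h q x) \<oplus>[N,q] h (q + 1) (mdiff M q x)"
  "x \<in> mel M q \<Longrightarrow> add_map M N f g q x = f q x \<oplus>[N,q] g q x"
  "x \<in> mel M q \<Longrightarrow> neg_map M N f q x = \<ominus>[N,q] f q x"
  "x \<in> mel M q \<Longrightarrow> zero_map M N q x = \<zero>[N,q]"
  "x \<in> mel M q \<Longrightarrow> comp_map M k f q x = k q (f q x)"
  "x \<in> mel M q \<Longrightarrow> id_map M q x = x"
  by (simp_all add: boundary_def add_map_def neg_map_def zero_map_def comp_map_def compose_def id_map_def)

lemma map_extensional [simp]:
  "boundary M N h q \<in> extensional (mel M q)"
  "add_map M N f g q \<in> extensional (mel M q)"
  "neg_map M N f q \<in> extensional (mel M q)"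
  "zero_map M N q \<in> extensional (mel M q)"
  "comp_map M k f q \<in> extensional (mel M q)"
  "id_map M q \<in> extensional (mel M q)"
  by (simp_all add: boundary_def add_map_def neg_map_def zero_map_def comp_map_def id_map_def)

lemma graded_map_eqI:
  assumes "\<And>q. f q \<in> extensional (mel M q)" "\<And>q. g q \<in> extensional (mel M q)"
    "\<And>q x. x \<in> mel M q \<Longrightarrow> f q x = g q x"
  shows "f = g"
  using assms extensionalityI by (metis ext)

lemma chain_mapI:
  assumes "\<And>q. f q \<in> extensional (mel M q)"
    and "\<And>q x. x \<in> mel M q \<Longrightarrow> f q x \<in> mel N q"
    and "\<And>q x y. \<lbrakk>x \<in> mel M q; y \<in> mel M q\<rbrakk>
      \<Longrightarrow> f q (x \<oplus>[M,q] y) = f q x \<oplus>[N,q] f q y"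
    and "\<And>r q a x. \<lbrakk>a \<in> ael A r; x \<in> mel M q\<rbrakk>
      \<Longrightarrow> f (r + q) (mact M r q a x) = mact N r q a (f q x)"
    and "\<And>q x. x \<in> mel M q \<Longrightarrow> f (q + 1) (mdiff M q x) = mdiff N q (f q x)"
  shows "chain_map A M N f"
  using assms by (simp add: chain_map_def PiE_def)

lemma homotopyI:
  assumes "\<And>q. h q \<in> extensional (mel M q)"
    and "\<And>q x. x \<in> mel M q \<Longrightarrow> h q x \<in> mel N (q - 1)"
    and "\<And>q x y. \<lbrakk>x \<in> mel M q; y \<in> mel M q\<rbrakk>
      \<Longrightarrow> h q (x \<oplus>[M,q] y) = h q x \<oplus>[N,q - 1] h q y"
    and "\<And>r q a x. \<lbrakk>a \<in> ael A r; x \<in> mel M q\<rbrakk>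
      \<Longrightarrow> h (r + q) (mact M r q a x) = sign_of (mcomp N (r + q - 1)) r (mact N r (q - 1) a (h q x))"
  shows "homotopy A M N h"
  using assms by (simp add: homotopy_def PiE_def)

locale cdg_map = M: cdg_module A M + N: cdg_module A N
  for A :: "('r, 'a) cdg_alg" and M :: "('a, 'm) cdg_mod" and N :: "('a, 'n) cdg_mod" +
  fixes f
  assumes chain_map: "chain_map A M N f"
begin

lemma extensional: "f q \<in> extensional (mel M q)"
  using chain_map by (simp add: chain_map_def PiE_def)

lemma closed [simp]: "x \<in> mel M q \<Longrightarrow> f q x \<in> mel N q"
  using chain_map unfolding chain_map_def by blast

lemma add: "\<lbrakk>x \<in> mel M q; y \<in> mel M q\<rbrakk>
  \<Longrightarrow> f q (x \<oplus>[M,q] y) = f q x \<oplus>[N,q] f q y"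
  using chain_map unfolding chain_map_def by blast

lemma act: "\<lbrakk>a \<in> ael A r; x \<in> mel M q; s = r + q\<rbrakk>
  \<Longrightarrow> f s (mact M r q a x) = mact N r q a (f q x)"
  using chain_map unfolding chain_map_def by blast

lemma diff: "\<lbrakk>x \<in> mel M q; s = q + 1\<rbrakk> \<Longrightarrow> f s (mdiff M q x) = mdiff N q (f q x)"
  using chain_map unfolding chain_map_def by blast

sublocale additive_map "mcomp M q" "mcomp N q" "f q" for q
  by (intro additive_map.intro additive_map_axioms.intro M.comp_group N.comp_group closed add)

end

locale cdg_homotopy = M: cdg_module A M + N: cdg_module A N
  for A :: "('r, 'a) cdg_alg" and M :: "('a, 'm) cdg_mod" and N :: "('a, 'n) cdg_mod" +
  fixes h
  assumes homotopy: "homotopy A M N h"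
begin

lemma closed [simp]: "\<lbrakk>x \<in> mel M q; s = q - 1\<rbrakk> \<Longrightarrow> h q x \<in> mel N s"
  using homotopy unfolding homotopy_def by blast

lemma add: "\<lbrakk>x \<in> mel M q; y \<in> mel M q; s = q - 1\<rbrakk>
  \<Longrightarrow> h q (x \<oplus>[M,q] y) = h q x \<oplus>[N,s] h q y"
  using homotopy unfolding homotopy_def by blast

lemma act: "\<lbrakk>a \<in> ael A r; x \<in> mel M q; s = r + q; u = s - 1; v = q - 1\<rbrakk>
  \<Longrightarrow> h s (mact M r q a x) = sign_of (mcomp N u) r (mact N r v a (h q x))"
  using homotopy unfolding homotopy_def by blast

lemma map: "s = q - 1 \<Longrightarrow> additive_map (mcomp M q) (mcomp N s) (h q)"
  by (intro additive_map.intro additive_map_axioms.intro M.comp_group N.comp_group) (simp_all add: add)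

end

lemma cdg_mapI: "\<lbrakk>cdg_module A M; cdg_module A N; chain_map A M N f\<rbrakk> \<Longrightarrow> cdg_map A M N f"
  by (simp add: cdg_map.intro cdg_map_axioms.intro)

lemma cdg_homotopyI: "\<lbrakk>cdg_module A M; cdg_module A N; homotopy A M N f\<rbrakk> \<Longrightarrow> cdg_homotopy A M N f"
  by (simp add: cdg_homotopy.intro cdg_homotopy_axioms.intro)

locale cdg_module_pair = cdg_algebra R A + M: cdg_module A M + N: cdg_module A N
  for R :: "('r, 'z) ring_scheme" and A :: "('r, 'a) cdg_alg"
    and M :: "('a, 'm) cdg_mod" and N :: "('a, 'n) cdg_mod"
begin

lemma M: "cdg_module A M" and N: "cdg_module A N"
  by unfold_locales

lemma chain_map_zero: "chain_map A M N (zero_map M N)"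
  by (rule chain_mapI) (simp_all add: N.act_zero)

lemma chain_map_add:
  assumes "chain_map A M N f" "chain_map A M N g"
  shows "chain_map A M N (add_map M N f g)"
proof -
  interpret f: cdg_map A M N f using M N assms by (intro cdg_mapI)
  interpret g: cdg_map A M N g using M N assms by (intro cdg_mapI)
  show ?thesis
    by (rule chain_mapI)
      (simp_all add: f.add g.add f.act g.act f.diff g.diff N.act_r_distr N.mdiff_add N.G.a_ac)
qed

lemma chain_map_neg:
  assumes "chain_map A M N f"
  shows "chain_map A M N (neg_map M N f)"
proof -
  interpret f: cdg_map A M N f using M N assms by (intro cdg_mapI)
  show ?thesis
    by (rule chain_mapI)
      (simp_all add: f.add f.act f.diff N.act_neg N.mdiff_neg N.G.minus_add)
qed

lemma map_add_assoc:
  assumes "chain_map A M N f" "chain_map A M N g" "chain_map A M N k"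
  shows "add_map M N (add_map M N f g) k = add_map M N f (add_map M N g k)"
proof -
  interpret f: cdg_map A M N f using M N assms by (intro cdg_mapI)
  interpret g: cdg_map A M N g using M N assms by (intro cdg_mapI)
  interpret k: cdg_map A M N k using M N assms by (intro cdg_mapI)
  show ?thesis by (rule graded_map_eqI[where M=M]) (simp_all add: N.G.a_assoc)
qed

lemma map_add_comm:
  assumes "chain_map A M N f" "chain_map A M N g"
  shows "add_map M N f g = add_map M N g f"
proof -
  interpret f: cdg_map A M N f using M N assms by (intro cdg_mapI)
  interpret g: cdg_map A M N g using M N assms by (intro cdg_mapI)
  show ?thesis by (rule graded_map_eqI[where M=M]) (simp_all add: N.G.a_comm)
qed

lemma map_add_zero:
  assumes "chain_map A M N f"
  shows "add_map M N (zero_map M N) f = f"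
proof -
  interpret f: cdg_map A M N f using M N assms by (intro cdg_mapI)
  show ?thesis by (rule graded_map_eqI[where M=M]) (simp_all add: f.extensional)
qed

lemma map_add_neg:
  assumes "chain_map A M N f"
  shows "add_map M N (neg_map M N f) f = zero_map M N"
proof -
  interpret f: cdg_map A M N f using M N assms by (intro cdg_mapI)
  show ?thesis by (rule graded_map_eqI[where M=M]) (simp_all add: N.G.l_neg)
qed

lemma homotopy_zero: "homotopy A M N (\<lambda>q. \<lambda>x\<in>mel M q. \<zero>[N,q - 1])"
  by (rule homotopyI) (simp_all add: N.act_zero add_diff_eq)

lemma homotopy_add:
  assumes "homotopy A M N h" "homotopy A M N k"
  shows "homotopy A M N (\<lambda>q. \<lambda>x\<in>mel M q. h q x \<oplus>[N,q - 1] k q x)"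
proof -
  interpret h: cdg_homotopy A M N h using M N assms by (intro cdg_homotopyI)
  interpret k: cdg_homotopy A M N k using M N assms by (intro cdg_homotopyI)
  have d: "mact N r (q - 1) a (x \<oplus>[N,q - 1] y) = mact N r (q - 1) a x \<oplus>[N,r + q - 1] mact N r (q - 1) a y"
    if "a \<in> ael A r" "x \<in> mel N (q - 1)" "y \<in> mel N (q - 1)" for r q a x y
    using N.act_r_distr[OF that] by (simp add: add_diff_eq)
  show ?thesis
    by (rule homotopyI)
      (simp_all add: h.add k.add h.act k.act d N.G.a_ac N.G.sign_of_add)
qed

lemma homotopy_neg:
  assumes "homotopy A M N h"
  shows "homotopy A M N (\<lambda>q. \<lambda>x\<in>mel M q. \<ominus>[N,q - 1] h q x)"
proof -
  interpret h: cdg_homotopy A M N h using M N assms by (intro cdg_homotopyI)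
  show ?thesis
    by (rule homotopyI)
      (simp_all add: h.add h.act N.act_neg[where s="_ + _ - 1"] N.G.minus_add sign_of_def)
qed

text \<open>Commuting with d is where the curvature enters: d^2 is the action of c on both modules,
  and h passes c without a sign because c has even degree, so the terms d^2 h and h d^2
  agree.\<close>

lemma chain_map_boundary:
  assumes "homotopy A M N h"
  shows "chain_map A M N (boundary M N h)"
proof -
  interpret h: cdg_homotopy A M N h using M N assms by (intro cdg_homotopyI)
  show ?thesis
  proof (rule chain_mapI)
    show "boundary M N h q (x \<oplus>[M,q] y) = boundary M N h q x \<oplus>[N,q] boundary M N h q y"
      if x: "x \<in> mel M q" "y \<in> mel M q" for q x y
    proof -
      have "mdiff N (q - 1) (h q (x \<oplus>[M,q] y)) = mdiff N (q - 1) (h q x) \<oplus>[N,q] mdiff N (q - 1) (h q y)"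
        using N.mdiff_add[of "h q x" "q - 1" "h q y"] x by (simp add: h.add)
      moreover have "h (q + 1) (mdiff M q (x \<oplus>[M,q] y)) = h (q + 1) (mdiff M q x) \<oplus>[N,q] h (q + 1) (mdiff M q y)"
        using x by (simp add: M.mdiff_add h.add)
      ultimately show ?thesis using x by (simp add: N.G.a_ac)
    qed
  next
    fix r q a x assume a: "a \<in> ael A r" and x: "x \<in> mel M q"
    interpret R: additive_map "mcomp M (r + q + 1)" "mcomp N (r + q)" "h (r + q + 1)" by (rule h.map) simp
    interpret R': additive_map "mcomp N (r + q - 1)" "mcomp N (r + q)" "mdiff N (r + q - 1)" by (rule N.mdiff_map) simp
    show "boundary M N h (r + q) (mact M r q a x) = mact N r q a (boundary M N h q x)"
    proof -
      have 1: "mdiff N (r + q - 1) (mact N r (q - 1) a (h q x)) = mact N (r + 1) (q - 1) (adiff A r a) (h q x)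
          \<oplus>[N,r + q] sign_of (mcomp N (r + q)) r (mact N r q a (mdiff N (q - 1) (h q x)))"
        using N.mdiff_act[of a r "h q x" "q - 1"] a x by (simp add: add_diff_eq)
      \<comment> \<open>The sign (-1)^(r+1) here against the (-1)^r from moving h past a makes the
        two terms containing d a cancel.\<close>
      have 2: "h (r + q + 1) (mact M (r + 1) q (adiff A r a) x) = sign_of (mcomp N (r + q)) (r + 1) (mact N (r + 1) (q - 1) (adiff A r a) (h q x))"
        using a x by (simp add: h.act)
      have 3: "h (r + q + 1) (mact M r (q + 1) a (mdiff M q x)) = sign_of (mcomp N (r + q)) r (mact N r q a (h (q + 1) (mdiff M q x)))"
        using a x by (simp add: h.act)
      show ?thesis
        using a x
        apply (simp add: h.act M.mdiff_act R.push R'.push 1 2 3 N.act_r_distr N.G.sign_of_add)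
        apply (cases "even r"; simp add: sign_of_even sign_of_odd)
         apply (rule N.G.group_eqI, (rule N.G.rep_rules | simp)+)+
        done
    qed
  next
    fix q x assume x: "x \<in> mel M q"
    have 1: "mdiff N q (mdiff N (q - 1) (h q x)) = mact N 2 (q - 1) (acurv A) (h q x)"
      using N.mdiff_mdiff[of "h q x" "q - 1"] x by simp
    have 2: "h (q + 2) (mdiff M (q + 1) (mdiff M q x)) = mact N 2 (q - 1) (acurv A) (h q x)"
      using x by (simp add: M.mdiff_mdiff h.act sign_of_even)
    show "boundary M N h (q + 1) (mdiff M q x) = mdiff N q (boundary M N h q x)"
      using x 2 by (simp add: N.mdiff_add 1 add.commute[of 2] N.G.a_comm)
  qed simp_all
qed

lemma boundary_zero: "boundary M N (\<lambda>q. \<lambda>x\<in>mel M q. \<zero>[N,q - 1]) = zero_map M N"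
  using N.mdiff_zero[of "_ - 1"] by (intro graded_map_eqI[where M=M]) simp_all

lemma boundary_add:
  assumes "homotopy A M N h" "homotopy A M N k"
  shows "boundary M N (\<lambda>q. \<lambda>x\<in>mel M q. h q x \<oplus>[N,q - 1] k q x)
    = add_map M N (boundary M N h) (boundary M N k)"
proof -
  interpret h: cdg_homotopy A M N h using M N assms by (intro cdg_homotopyI)
  interpret k: cdg_homotopy A M N k using M N assms by (intro cdg_homotopyI)
  have d: "mdiff N (q - 1) (x \<oplus>[N,q - 1] y) = mdiff N (q - 1) x \<oplus>[N,q] mdiff N (q - 1) y"
    if "x \<in> mel N (q - 1)" "y \<in> mel N (q - 1)" for q x y
    using N.mdiff_add[OF that] by simp
  show ?thesis
    by (rule graded_map_eqI[where M=M]) (simp_all add: d N.G.a_ac)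
qed

lemma boundary_neg:
  assumes "homotopy A M N h"
  shows "boundary M N (\<lambda>q. \<lambda>x\<in>mel M q. \<ominus>[N,q - 1] h q x)
    = neg_map M N (boundary M N h)"
proof -
  interpret h: cdg_homotopy A M N h using M N assms by (intro cdg_homotopyI)
  show ?thesis
    by (rule graded_map_eqI[where M=M]) (simp_all add: N.mdiff_neg[where s="_"] N.G.minus_add)
qed

lemma hom_cocycles_carrier: "carrier (hom_cocycles A M N) = {f. chain_map A M N f}"
proof (intro Set.set_eqI iffI; unfold mem_Collect_eq)
  fix f assume f: "f \<in> carrier (hom_cocycles A M N)"
  then have c: "\<And>q. f q \<in> extensional (mel M q)"
    "\<And>q x. x \<in> mel M q \<Longrightarrow> f q x \<in> mel N q"
    by (auto simp: hom_cocycles_def hom_space_def PiE_def)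
  have d: "mdiff N q (f q x) \<ominus>[N,q + 1] f (q + 1) (mdiff M q x) = \<zero>[N,q + 1]"
    if "x \<in> mel M q" for q x
  proof -
    have "hom_diff M N 0 f q x = \<zero>[hom_space A M N 1] q x" using f by (simp add: hom_cocycles_def)
    then show ?thesis using that by (simp add: hom_diff_def hom_space_def sign_of_even)
  qed
  have "f (q + 1) (mdiff M q x) = mdiff N q (f q x)" if "x \<in> mel M q" for q x
    using d[OF that] c(2) that by (simp add: N.G.minus_eq_zero_iff)
  then show "chain_map A M N f"
    using f c by (intro chain_mapI) (auto simp: hom_cocycles_def hom_space_def sign_of_even)
next
  fix f assume f: "chain_map A M N f"
  interpret f: cdg_map A M N f using M N f by (intro cdg_mapI)
  have "hom_diff M N 0 f = \<zero>[hom_space A M N 1]"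
    by (rule graded_map_eqI[where M=M]) (simp_all add: hom_diff_def hom_space_def sign_of_even f.diff N.G.minus_eq_zero_iff)
  then show "f \<in> carrier (hom_cocycles A M N)"
    using f by (simp add: hom_cocycles_def hom_space_def chain_map_def sign_of_even)
qed

lemma hom_cocycles_simps:
  "f \<oplus>[hom_cocycles A M N] g = add_map M N f g" "\<zero>[hom_cocycles A M N] = zero_map M N"
  by (simp_all add: hom_cocycles_def hom_space_def add_map_def zero_map_def)

lemma homotopies: "carrier (hom_space A M N (- 1)) = {h. homotopy A M N h}"
  by (simp add: hom_space_def homotopy_def sign_of_def)

lemma hom_boundaries_eq: "hom_boundaries A M N = {f. null_homotopic A M N f}"
proof -
  have "hom_diff M N (- 1) h = boundary M N h" if "homotopy A M N h" for h
  proof -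
    interpret h: cdg_homotopy A M N h using M N that by (intro cdg_homotopyI)
    show ?thesis
      by (rule graded_map_eqI[where M=M]) (simp_all add: hom_diff_def sign_of_odd a_minus_def)
  qed
  then show ?thesis unfolding hom_boundaries_def homotopies null_homotopic_def by auto
qed

lemma hom_cocycles_group: "abelian_group (hom_cocycles A M N)"
  by (rule abelian_groupI; unfold hom_cocycles_carrier hom_cocycles_simps mem_Collect_eq)
    (auto simp: chain_map_add chain_map_zero map_add_assoc map_add_zero intro: map_add_comm map_add_neg chain_map_neg)

sublocale Z: abelian_group "hom_cocycles A M N"
  by (rule hom_cocycles_group)

lemma hom_cocycles_neg: "chain_map A M N f \<Longrightarrow> \<ominus>[hom_cocycles A M N] f = neg_map M N f"
  by (rule Z.minus_equality) (simp_all add: hom_cocycles_carrier hom_cocycles_simps map_add_neg chain_map_neg)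

lemma null_homotopic_chain_map: "null_homotopic A M N f \<Longrightarrow> chain_map A M N f"
  by (auto simp: null_homotopic_def chain_map_boundary)

lemma hom_boundaries_subgroup: "abelian_subgroup (hom_boundaries A M N) (hom_cocycles A M N)"
proof (rule additive_subgroupI'[OF hom_cocycles_group])
  show "\<ominus>[hom_cocycles A M N] f \<in> hom_boundaries A M N" if "f \<in> hom_boundaries A M N" for f
    using that homotopy_neg boundary_neg null_homotopic_chain_map
    by (fastforce simp: hom_boundaries_eq hom_cocycles_neg null_homotopic_def)
  show "f \<oplus>[hom_cocycles A M N] g \<in> hom_boundaries A M N"
    if "f \<in> hom_boundaries A M N" "g \<in> hom_boundaries A M N" for f g
    using that homotopy_add boundary_add
    by (fastforce simp: hom_boundaries_eq hom_cocycles_simps null_homotopic_def)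
  show "\<zero>[hom_cocycles A M N] \<in> hom_boundaries A M N"
    using homotopy_zero boundary_zero by (auto simp: hom_boundaries_eq hom_cocycles_simps null_homotopic_def)
qed (auto simp: hom_boundaries_eq hom_cocycles_carrier null_homotopic_chain_map)

sublocale B: abelian_subgroup "hom_boundaries A M N" "hom_cocycles A M N"
  by (rule hom_boundaries_subgroup)

end

section \<open>The homotopy category\<close>

definition homotopic :: "('r, 'a) cdg_alg \<Rightarrow> ('a, 'm) cdg_mod \<Rightarrow> ('a, 'n) cdg_mod \<Rightarrow> (int \<Rightarrow> 'm \<Rightarrow> 'n) \<Rightarrow> (int \<Rightarrow> 'm \<Rightarrow> 'n) \<Rightarrow> bool" where
  "homotopic A M N f g \<longleftrightarrow> (\<exists>h. homotopy A M N h \<and> (\<forall>q. \<forall>x\<in>mel M q.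
     f q x = g q x \<oplus>[N,q] (mdiff N (q - 1) (h q x) \<oplus>[N,q] h (q + 1) (mdiff M q x))))"

definition hot_class :: "('r, 'a) cdg_alg \<Rightarrow> ('a, 'm) cdg_mod \<Rightarrow> ('a, 'n) cdg_mod \<Rightarrow> (int \<Rightarrow> 'm \<Rightarrow> 'n) \<Rightarrow> (int \<Rightarrow> 'm \<Rightarrow> 'n) set" where
  "hot_class A M N f = hom_boundaries A M N +>\<^bsub>hom_cocycles A M N\<^esub> f"

lemma Ob_Hot: "Ob (Hot A) = {M. cdg_module A M}"
  by (simp add: Hot_def)

context cdg_module_pair
begin

lemma homotopic_iff:
  assumes "chain_map A M N f" "chain_map A M N g"
  shows "homotopic A M N f g \<longleftrightarrow> f \<ominus>[hom_cocycles A M N] g \<in> hom_boundaries A M N"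
proof -
  interpret f: cdg_map A M N f using M N assms by (intro cdg_mapI)
  interpret g: cdg_map A M N g using M N assms by (intro cdg_mapI)
  have *: "f \<ominus>[hom_cocycles A M N] g = add_map M N f (neg_map M N g)"
    using assms by (simp add: a_minus_def hom_cocycles_simps hom_cocycles_neg)
  have "f \<ominus>[hom_cocycles A M N] g = boundary M N h \<longleftrightarrow> (\<forall>q. \<forall>x\<in>mel M q.
     f q x = g q x \<oplus>[N,q] (mdiff N (q - 1) (h q x) \<oplus>[N,q] h (q + 1) (mdiff M q x)))"
    (is "?l \<longleftrightarrow> ?r") if "homotopy A M N h" for h
  proof -
    interpret h: cdg_homotopy A M N h using M N that by (intro cdg_homotopyI)
    have e: "x \<oplus>[N,q] \<ominus>[N,q] y = z \<longleftrightarrow> x = y \<oplus>[N,q] z"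
      if "x \<in> mel N q" "y \<in> mel N q" "z \<in> mel N q" for x y z q
    proof
      assume "x \<oplus>[N,q] \<ominus>[N,q] y = z"
      moreover have "y \<oplus>[N,q] (x \<oplus>[N,q] \<ominus>[N,q] y) = x"
        by (rule N.G.group_eqI, (rule N.G.rep_rules | simp add: that)+)
      ultimately show "x = y \<oplus>[N,q] z" by simp
    next
      have "y \<oplus>[N,q] z \<oplus>[N,q] \<ominus>[N,q] y = z"
        by (rule N.G.group_eqI, (rule N.G.rep_rules | simp add: that)+)
      moreover assume "x = y \<oplus>[N,q] z"
      ultimately show "x \<oplus>[N,q] \<ominus>[N,q] y = z" by simp
    qed
    show ?thesis
    proof
      assume l: ?l
      show ?r
      proof (intro allI ballI)
        fix q x assume x: "x \<in> mel M q"
        have "add_map M N f (neg_map M N g) q x = boundary M N h q x" using l * by simp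
        then show "f q x = g q x \<oplus>[N,q] (mdiff N (q - 1) (h q x) \<oplus>[N,q] h (q + 1) (mdiff M q x))"
          using x by (simp add: e)
      qed
    next
      assume r: ?r
      show ?l unfolding * by (rule graded_map_eqI[where M=M]) (simp_all add: r e)
    qed
  qed
  then show ?thesis unfolding homotopic_def hom_boundaries_eq null_homotopic_def mem_Collect_eq by auto
qed

lemma hot_class_eq_iff:
  "\<lbrakk>chain_map A M N f; chain_map A M N g\<rbrakk> \<Longrightarrow> hot_class A M N f = hot_class A M N g \<longleftrightarrow> homotopic A M N f g"
  by (simp add: hot_class_def homotopic_iff B.coset_eq_iff hom_cocycles_carrier)

lemma mem_hot_class:
  assumes "chain_map A M N f"
  shows "g \<in> hot_class A M N f \<longleftrightarrow> chain_map A M N g \<and> homotopic A M N g f"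
proof -
  have "g \<in> hot_class A M N f \<Longrightarrow> chain_map A M N g"
    using B.a_elemrcos_carrier[of f g] assms by (simp add: hot_class_def hom_cocycles_carrier)
  moreover have "chain_map A M N g \<Longrightarrow> g \<in> hot_class A M N f \<longleftrightarrow> homotopic A M N g f"
    using assms B.a_rcos_module[of f g]
    by (simp add: hot_class_def hom_cocycles_carrier homotopic_iff a_minus_def)
  ultimately show ?thesis by blast
qed

end

locale hot_pair = cdg_module_pair R A M N
  for R :: "('r, 'z) ring_scheme" and A :: "('r, 'a) cdg_alg" and M N :: "('a, 'u) cdg_mod"
begin

lemma Hom_Hot: "Hom (Hot A) M N = quot_group (hom_cocycles A M N) (hom_boundaries A M N)"
  by (simp add: Hot_def)

lemma Hom_Hot_carrier: "carrier (Hom (Hot A) M N) = hot_class A M N ` {f. chain_map A M N f}"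
  by (simp add: Hom_Hot B.carrier_quot_group hom_cocycles_carrier hot_class_def)

lemma Hom_Hot_group: "abelian_group (Hom (Hot A) M N)"
  unfolding Hom_Hot by (rule B.quot_group_abelian)

lemma hot_class_add:
  "\<lbrakk>chain_map A M N f; chain_map A M N g\<rbrakk>
    \<Longrightarrow> hot_class A M N f \<oplus>[Hom (Hot A) M N] hot_class A M N g = hot_class A M N (add_map M N f g)"
  by (simp add: Hom_Hot hot_class_def B.quot_group_add hom_cocycles_carrier hom_cocycles_simps)

lemma hot_class_zero: "\<zero>[Hom (Hot A) M N] = hot_class A M N (zero_map M N)"
  using B.coset_zero by (simp add: Hom_Hot hot_class_def B.quot_group_zero hom_cocycles_simps)

lemma hot_class_eq_zero_iff:
  "chain_map A M N f \<Longrightarrow> hot_class A M N f = \<zero>[Hom (Hot A) M N] \<longleftrightarrow> null_homotopic A M N f"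
  unfolding Hom_Hot B.quot_group_zero hot_class_def
  using B.coset_eq_subgroup_iff[of f] by (simp add: hom_cocycles_carrier hom_boundaries_eq)

end

lemma homotopic_refl:
  assumes "cdg_algebra R A" "cdg_module A M" "cdg_module A N" "chain_map A M N f"
  shows "homotopic A M N f f"
proof -
  interpret cdg_module_pair R A M N using assms by (simp add: cdg_module_pair.intro)
  show ?thesis using hot_class_eq_iff[OF assms(4,4)] by simp
qed

lemma chain_map_comp:
  assumes "cdg_module A M" "cdg_module A N" "cdg_module A P" "chain_map A M N f" "chain_map A N P g"
  shows "chain_map A M P (comp_map M g f)"
proof -
  interpret f: cdg_map A M N f using assms by (intro cdg_mapI)
  interpret g: cdg_map A N P g using assms by (intro cdg_mapI)
  show ?thesis by (rule chain_mapI) (simp_all add: f.add f.act f.diff g.add g.act g.diff)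
qed

lemma chain_map_id: "cdg_module A M \<Longrightarrow> chain_map A M M (id_map M)"
proof -
  assume "cdg_module A M"
  then interpret cdg_module A M .
  show ?thesis by (rule chain_mapI) simp_all
qed

text \<open>The homotopy is g' h + k f, from the decomposition g f - g' f' = (g - g') f + g' (f -
  f').\<close>

lemma homotopic_comp:
  assumes MNP: "cdg_module A M" "cdg_module A N" "cdg_module A P"
    and f: "chain_map A M N f" "chain_map A M N f'" "homotopic A M N f f'"
    and g: "chain_map A N P g" "chain_map A N P g'" "homotopic A N P g g'"
  shows "homotopic A M P (comp_map M g f) (comp_map M g' f')"
proof -
  interpret f: cdg_map A M N f using assms by (intro cdg_mapI)
  interpret g: cdg_map A N P g using assms by (intro cdg_mapI)
  interpret f': cdg_map A M N f' using assms by (intro cdg_mapI)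
  interpret g': cdg_map A N P g' using assms by (intro cdg_mapI)
  obtain h where h: "homotopy A M N h" "\<And>q x. x \<in> mel M q \<Longrightarrow>
     f q x = f' q x \<oplus>[N,q] (mdiff N (q - 1) (h q x) \<oplus>[N,q] h (q + 1) (mdiff M q x))"
    using f(3) unfolding homotopic_def by blast
  obtain k where k: "homotopy A N P k" "\<And>q x. x \<in> mel N q \<Longrightarrow>
     g q x = g' q x \<oplus>[P,q] (mdiff P (q - 1) (k q x) \<oplus>[P,q] k (q + 1) (mdiff N q x))"
    using g(3) unfolding homotopic_def by blast
  interpret h: cdg_homotopy A M N h using assms h by (intro cdg_homotopyI)
  interpret k: cdg_homotopy A N P k using assms k by (intro cdg_homotopyI)
  define l where "l q = (\<lambda>x\<in>mel M q. g' (q - 1) (h q x) \<oplus>[P,q - 1] k q (f q x))" for q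
  have l: "l q x = g' (q - 1) (h q x) \<oplus>[P,q - 1] k q (f q x)" if "x \<in> mel M q" for q x
    using that by (simp add: l_def)
  have a: "mact P r (q - 1) a (x \<oplus>[P,q - 1] y) = mact P r (q - 1) a x \<oplus>[P,r + q - 1] mact P r (q - 1) a y"
    if "a \<in> ael A r" "x \<in> mel P (q - 1)" "y \<in> mel P (q - 1)" for r q a x y
    using g.N.act_r_distr[OF that] by (simp add: add_diff_eq)
  have "homotopy A M P l"
  proof (rule homotopyI)
    show "l q \<in> extensional (mel M q)" for q by (simp add: l_def)
    show "l q x \<in> mel P (q - 1)" if "x \<in> mel M q" for q x
      using that by (simp add: l)
    show "l q (x \<oplus>[M,q] y) = l q x \<oplus>[P,q - 1] l q y"
      if "x \<in> mel M q" "y \<in> mel M q" for q x y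
      using that by (simp add: l h.add k.add f.add g'.add g.N.G.a_ac)
    show "l (r + q) (mact M r q a x) = sign_of (mcomp P (r + q - 1)) r (mact P r (q - 1) a (l q x))"
      if "a \<in> ael A r" "x \<in> mel M q" for r q a x
      using that by (simp add: l h.act k.act f.act g'.sign g'.act a g.N.G.sign_of_add)
  qed
  moreover have "comp_map M g f q x = comp_map M g' f' q x \<oplus>[P,q]
      (mdiff P (q - 1) (l q x) \<oplus>[P,q] l (q + 1) (mdiff M q x))" if x: "x \<in> mel M q" for q x
  proof -
    have d: "mdiff P (q - 1) (y \<oplus>[P,q - 1] z) = mdiff P (q - 1) y \<oplus>[P,q] mdiff P (q - 1) z"
      if "y \<in> mel P (q - 1)" "z \<in> mel P (q - 1)" for y z
      using g.N.mdiff_add[OF that] by simp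
    have e: "g' q (mdiff N (q - 1) (h q x)) = mdiff P (q - 1) (g' (q - 1) (h q x))"
      using x by (simp add: g'.diff)
    have "comp_map M g f q x = g' q (f q x) \<oplus>[P,q] (mdiff P (q - 1) (k q (f q x)) \<oplus>[P,q] k (q + 1) (f (q + 1) (mdiff M q x)))"
      using x by (simp add: k(2) f.diff)
    also have "g' q (f q x) = g' q (f' q x) \<oplus>[P,q] (mdiff P (q - 1) (g' (q - 1) (h q x)) \<oplus>[P,q] g' q (h (q + 1) (mdiff M q x)))"
      unfolding h(2)[OF x] using x by (simp add: g'.add e)
    finally show ?thesis using x by (simp add: l d g.N.G.a_ac)
  qed
  ultimately show ?thesis unfolding homotopic_def by blast
qed

text \<open>\<open>Hot\<close> composes classes as a union over all representatives;
  \<open>homotopic_comp\<close> makes all members of this union equal, and reflexivity makes the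
  union nonempty.\<close>

lemma Comp_Hot:
  assumes A: "cdg_algebra R A" and MNP: "cdg_module A M" "cdg_module A N" "cdg_module A P"
    and f: "chain_map A M N f" and g: "chain_map A N P g"
  shows "Comp (Hot A) M N P (hot_class A N P g) (hot_class A M N f) = hot_class A M P (comp_map M g f)"
proof -
  interpret MN: hot_pair R A M N using assms by (simp add: hot_pair.intro cdg_module_pair.intro)
  interpret NP: hot_pair R A N P using assms by (simp add: hot_pair.intro cdg_module_pair.intro)
  interpret MP: hot_pair R A M P using assms by (simp add: hot_pair.intro cdg_module_pair.intro)
  have "Comp (Hot A) M N P (hot_class A N P g) (hot_class A M N f) =
     (\<Union>g'\<in>hot_class A N P g. \<Union>f'\<in>hot_class A M N f. hot_class A M P (comp_map M g' f'))"
    by (simp add: Hot_def hot_class_def comp_map_def)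
  also have "\<dots> = (\<Union>g'\<in>hot_class A N P g. \<Union>f'\<in>hot_class A M N f. hot_class A M P (comp_map M g f))"
  proof (intro SUP_cong refl)
    fix g' f' assume "g' \<in> hot_class A N P g" "f' \<in> hot_class A M N f"
    then show "hot_class A M P (comp_map M g' f') = hot_class A M P (comp_map M g f)"
      using f g MNP unfolding MN.mem_hot_class[OF f] NP.mem_hot_class[OF g]
      by (subst MP.hot_class_eq_iff) (auto intro: chain_map_comp homotopic_comp)
  qed
  also have "\<dots> = hot_class A M P (comp_map M g f)"
    using MN.mem_hot_class[OF f, of f] NP.mem_hot_class[OF g, of g] f g homotopic_refl[OF A] MNP by auto
  finally show ?thesis .
qed

lemma Ident_Hot: "Ident (Hot A) M = hot_class A M M (id_map M)"
  by (simp add: Hot_def hot_class_def id_map_def)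

lemma Hot_preadditive:
  fixes A :: "('r, 'a) cdg_alg"
  assumes A: "cdg_algebra R A"
  shows "preadditive_category (Hot A :: (('a, 'u) cdg_mod, _) precat)"
proof -
  have pair: "hot_pair R A M N" if "cdg_module A M" "cdg_module A N" for M N :: "('a, 'u) cdg_mod"
    using that A by (simp add: hot_pair.intro cdg_module_pair.intro)
  note hc = hot_pair.Hom_Hot_carrier[OF pair]
  note cm = chain_map_comp chain_map_id cdg_module_pair.chain_map_add[OF hot_pair.axioms(1)[OF pair]]
  note ch = Comp_Hot[OF A] 
  show ?thesis
  proof (rule preadditive_category.intro; unfold Ob_Hot mem_Collect_eq)
    fix X Y :: "('a, 'u) cdg_mod" assume XY: "cdg_module A X" "cdg_module A Y"
    show "abelian_group (Hom (Hot A) X Y)" by (rule hot_pair.Hom_Hot_group[OF pair[OF XY]])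
    fix \<phi> assume "\<phi> \<in> carrier (Hom (Hot A) X Y)"
    then obtain f where f: "chain_map A X Y f" "\<phi> = hot_class A X Y f" unfolding hc[OF XY] by blast
    interpret f: cdg_map A X Y f using XY f by (intro cdg_mapI)
    have "comp_map X (id_map Y) f = f" "comp_map X f (id_map X) = f"
      by (rule graded_map_eqI[where M=X]; simp add: f.extensional)+
    then show "Comp (Hot A) X Y Y (Ident (Hot A) Y) \<phi> = \<phi>" "Comp (Hot A) X X Y \<phi> (Ident (Hot A) X) = \<phi>"
      unfolding f(2) Ident_Hot
      using ch[OF XY(1) XY(2) XY(2) f(1) chain_map_id[OF XY(2)]]
        ch[OF XY(1) XY(1) XY(2) chain_map_id[OF XY(1)] f(1)] by simp_all
  next
    fix X :: "('a, 'u) cdg_mod" assume X: "cdg_module A X"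
    show "Ident (Hot A) X \<in> carrier (Hom (Hot A) X X)"
      unfolding hc[OF X X] Ident_Hot using chain_map_id[OF X] by blast
  next
    fix X Y Z :: "('a, 'u) cdg_mod" and \<phi> \<psi> assume XYZ: "cdg_module A X" "cdg_module A Y" "cdg_module A Z"
      and "\<phi> \<in> carrier (Hom (Hot A) X Y)" "\<psi> \<in> carrier (Hom (Hot A) Y Z)"
    then obtain f g where f: "chain_map A X Y f" "\<phi> = hot_class A X Y f"
      and g: "chain_map A Y Z g" "\<psi> = hot_class A Y Z g" unfolding hc[OF XYZ(1,2)] hc[OF XYZ(2,3)] by blast
    show "Comp (Hot A) X Y Z \<psi> \<phi> \<in> carrier (Hom (Hot A) X Z)"
      unfolding f g ch[OF XYZ f(1) g(1)] hc[OF XYZ(1,3)] using cm(1)[OF XYZ f(1) g(1)] by blast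
    interpret f: cdg_map A X Y f using XYZ f by (intro cdg_mapI)
    interpret g: cdg_map A Y Z g using XYZ g by (intro cdg_mapI)
    {
      fix \<psi>' assume "\<psi>' \<in> carrier (Hom (Hot A) Y Z)"
      then obtain g' where g': "chain_map A Y Z g'" "\<psi>' = hot_class A Y Z g'" unfolding hc[OF XYZ(2,3)] by blast
      have "comp_map X (add_map Y Z g g') f = add_map X Z (comp_map X g f) (comp_map X g' f)"
        by (rule graded_map_eqI[where M=X]) simp_all
      then show "Comp (Hot A) X Y Z (\<psi> \<oplus>[Hom (Hot A) Y Z] \<psi>') \<phi>
          = Comp (Hot A) X Y Z \<psi> \<phi> \<oplus>[Hom (Hot A) X Z] Comp (Hot A) X Y Z \<psi>' \<phi>"
        unfolding f g g' using XYZ f(1) g(1) g'(1)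
        by (simp add: ch cm hot_pair.hot_class_add[OF pair])
    }
    {
      fix \<phi>' assume "\<phi>' \<in> carrier (Hom (Hot A) X Y)"
      then obtain f' where f': "chain_map A X Y f'" "\<phi>' = hot_class A X Y f'" unfolding hc[OF XYZ(1,2)] by blast
      interpret f': cdg_map A X Y f' using XYZ f' by (intro cdg_mapI)
      have "comp_map X g (add_map X Y f f') = add_map X Z (comp_map X g f) (comp_map X g f')"
        by (rule graded_map_eqI[where M=X]) (simp_all add: g.add)
      then show "Comp (Hot A) X Y Z \<psi> (\<phi> \<oplus>[Hom (Hot A) X Y] \<phi>')
          = Comp (Hot A) X Y Z \<psi> \<phi> \<oplus>[Hom (Hot A) X Z] Comp (Hot A) X Y Z \<psi> \<phi>'"
        unfolding f g f' using XYZ f(1) g(1) f'(1)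
        by (simp add: ch cm hot_pair.hot_class_add[OF pair])
    }
    {
      fix W :: "('a, 'u) cdg_mod" and \<chi> assume W: "cdg_module A W" and "\<chi> \<in> carrier (Hom (Hot A) W X)"
      then obtain k where k: "chain_map A W X k" "\<chi> = hot_class A W X k" unfolding hc[OF W XYZ(1)] by blast
      interpret k: cdg_map A W X k using XYZ W k by (intro cdg_mapI)
      have "comp_map W (comp_map X g f) k = comp_map W g (comp_map W f k)"
        by (rule graded_map_eqI[where M=W]) simp_all
      then show "Comp (Hot A) W X Z (Comp (Hot A) X Y Z \<psi> \<phi>) \<chi> = Comp (Hot A) W Y Z \<psi> (Comp (Hot A) W X Y \<phi> \<chi>)"
        unfolding f g k using XYZ W f(1) g(1) k(1) by (simp add: ch cm)
    }
  qed
qed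

section \<open>Acyclicity of the graded pieces as an exactness condition\<close>

text \<open>Numerals are moved to the right so that terms of the same degree match syntactically;
  the rules are in force for this section only.\<close>

lemma degree_simps: "1 + p = p + 1" "2 + p = p + 2" "3 + p = p + 3" for p :: int
  by simp_all

declare degree_simps [simp]

text \<open>\<open>T j\<close> is multiplication by \<open>t^j\<close>, and \<open>b\<close> that by \<open>c/t\<close>; in general \<open>b\<close> commutes with \<open>d\<close> only on \<open>Ker t^n\<close>.\<close>

locale curved_complex =
  fixes G :: "int \<Rightarrow> ('m, 'z) ring_scheme" and d :: "int \<Rightarrow> 'm \<Rightarrow> 'm" and T :: "nat \<Rightarrow> int \<Rightarrow> 'm \<Rightarrow> 'm"
    and b :: "int \<Rightarrow> 'm \<Rightarrow> 'm" and n :: nat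
  assumes d_map: "additive_map (G p) (G (p + 1)) (d p)"
    and T_map: "additive_map (G p) (G p) (T j p)"
    and b_map: "additive_map (G p) (G (p + 2)) (b p)"
    and T_0: "x \<in> carrier (G p) \<Longrightarrow> T 0 p x = x"
    and T_T: "x \<in> carrier (G p) \<Longrightarrow> T i p (T j p x) = T (i + j) p x"
    and d_T: "x \<in> carrier (G p) \<Longrightarrow> d p (T j p x) = T j (p + 1) (d p x)"
    and b_T: "x \<in> carrier (G p) \<Longrightarrow> b p (T j p x) = T j (p + 2) (b p x)"
    and d_d: "\<lbrakk>x \<in> carrier (G p); q = p + 1\<rbrakk> \<Longrightarrow> d q (d p x) = T (Suc 0) (p + 2) (b p x)"
    and T_n: "x \<in> carrier (G p) \<Longrightarrow> T (Suc n) p x = \<zero>[G p]"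
    and d_b: "\<lbrakk>x \<in> carrier (G p); T n p x = \<zero>[G p]; q = p + 2; r = p + 1\<rbrakk> \<Longrightarrow> d q (b p x) = b r (d p x)"
begin

sublocale G: abelian_group "G p" for p
  using additive_map.axioms(1)[OF T_map] .

sublocale d: additive_map "G p" "G (p + 1)" "d p" for p by (rule d_map)
sublocale T: additive_map "G p" "G p" "T j p" for j p by (rule T_map)
sublocale b: additive_map "G p" "G (p + 2)" "b p" for p by (rule b_map)

lemma closed [simp]:
  "\<lbrakk>x \<in> carrier (G p); q = p + 1\<rbrakk> \<Longrightarrow> d p x \<in> carrier (G q)"
  "\<lbrakk>x \<in> carrier (G p); q = p + 2\<rbrakk> \<Longrightarrow> b p x \<in> carrier (G q)"
  by simp_all

lemma neg_zero [simp]: "\<ominus>[G p] \<zero>[G p] = \<zero>[G p]"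
  by (rule G.minus_equality) simp_all

lemmas push = d.add d.neg d.minus T.add T.neg T.minus b.add b.neg b.minus T_0 T_T d_T b_T d_d

text \<open>Acyclicity of t^j G / t^(j+1) G on representatives, with explicit quotients by t^j and
  t^(j+1) in place of cosets.\<close>

definition gr_acyclic :: "nat \<Rightarrow> bool" where
  "gr_acyclic j \<longleftrightarrow> (\<forall>p. \<forall>u\<in>carrier (G p). \<forall>m\<in>carrier (G (p + 1)). d p (T j p u) = T (Suc j) (p + 1) m \<longrightarrow>
     (\<exists>v\<in>carrier (G (p - 1)). \<exists>w\<in>carrier (G p). T j p u = d (p - 1) (T j (p - 1) v) \<oplus>[G p] T (Suc j) p w))"

text \<open>These are the cycles of D(x, y) = (d x - b y, t x - d y) on Ker t^(i+1) and Ker t^i, and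
  \<open>cone_boundary\<close> is the image of D. Up to shift it is the cone of multiplication by t
  from Ker t^(i+1) to Ker t^i, corrected by b because d^2 = t b.\<close>

definition cone_cocycle :: "nat \<Rightarrow> int \<Rightarrow> 'm \<Rightarrow> 'm \<Rightarrow> bool" where
  "cone_cocycle i p x y \<longleftrightarrow> x \<in> carrier (G p) \<and> y \<in> carrier (G (p - 1)) \<and>
     T (Suc i) p x = \<zero>[G p] \<and> T i (p - 1) y = \<zero>[G (p - 1)] \<and>
     d p x = b (p - 1) y \<and> d (p - 1) y = T (Suc 0) p x"

definition cone_boundary :: "nat \<Rightarrow> int \<Rightarrow> 'm \<Rightarrow> 'm \<Rightarrow> bool" where
  "cone_boundary i p x y \<longleftrightarrow> (\<exists>x'\<in>carrier (G (p - 1)). \<exists>y'\<in>carrier (G (p - 2)).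
     T (Suc i) (p - 1) x' = \<zero>[G (p - 1)] \<and> T i (p - 2) y' = \<zero>[G (p - 2)] \<and>
     x = d (p - 1) x' \<ominus>[G p] b (p - 2) y' \<and> y = T (Suc 0) (p - 1) x' \<ominus>[G (p - 1)] d (p - 2) y')"

lemma gr_acyclicD:
  assumes "gr_acyclic j" "u \<in> carrier (G p)" "m \<in> carrier (G (p + 1))" "d p (T j p u) = T (Suc j) (p + 1) m"
  obtains v w where "v \<in> carrier (G (p - 1))" "w \<in> carrier (G p)"
    "T j p u = d (p - 1) (T j (p - 1) v) \<oplus>[G p] T (Suc j) p w"
  using assms unfolding gr_acyclic_def by blast

lemma T_zero_mono:
  assumes "T i p y = \<zero>[G p]" "i \<le> j" "y \<in> carrier (G p)"
  shows "T j p y = \<zero>[G p]"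
proof -
  have "T j p y = T (j - i) p (T i p y)" using T_T[OF assms(3), of "j - i" i] assms(2) by simp
  then show ?thesis unfolding assms(1) by simp
qed

section \<open>Acyclic graded pieces make the pair complexes exact\<close>

context
  assumes acyclic: "\<And>j. j \<le> n \<Longrightarrow> gr_acyclic j"
begin

text \<open>Acyclicity of the piece j alone gives t^j u = d(t^j v) + t^(j+1) w, where t^j v need not
  lie in Ker t. Multiplying by t shows that t^(j+1) v is a cycle of the next piece, and acyclicity
  there supplies the correction of v.\<close>

lemma kernel_step:
  assumes j: "j \<le> n" and u: "u \<in> carrier (G p)" and T1: "T (Suc 0) p (T j p u) = \<zero>[G p]"
    and d0: "d p (T j p u) = \<zero>[G (p + 1)]"
  shows "\<exists>z\<in>carrier (G (p - 1)). \<exists>w\<in>carrier (G p). T (Suc 0) (p - 1) z = \<zero>[G (p - 1)] \<and>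
    T j p u = d (p - 1) z \<oplus>[G p] T (Suc j) p w"
proof -
  have "d p (T j p u) = T (Suc j) (p + 1) \<zero>[G (p + 1)]" using d0 by simp
  then obtain v w where v: "v \<in> carrier (G (p - 1))" "w \<in> carrier (G p)"
    and x: "T j p u = d (p - 1) (T j (p - 1) v) \<oplus>[G p] T (Suc j) p w"
    using gr_acyclicD[OF acyclic[OF j] u G.zero_closed] by blast
  show ?thesis
  proof (cases "j = n")
    \<comment> \<open>At the top level t^n v is already killed by t.\<close>
    case True
    then show ?thesis using v x T_n
      by (intro bexI[of _ "T n (p - 1) v"] bexI[of _ w]) (simp_all add: T_T)
  next
    case False
    have "T (Suc 0) p (T j p u) = T (Suc j) p (d (p - 1) v) \<oplus>[G p] T (Suc (Suc j)) p w"
      unfolding x using v by (simp add: push)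
    then have "T (Suc j) p (d (p - 1) v) = \<ominus>[G p] T (Suc (Suc j)) p w"
      using T1 v by (intro G.minus_equality[symmetric]) simp_all
    then have "d (p - 1) (T (Suc j) (p - 1) v) = T (Suc (Suc j)) (p - 1 + 1) (\<ominus>[G p] w)"
      using v by (simp add: push)
    moreover have "gr_acyclic (Suc j)" using j False by (intro acyclic) simp
    ultimately obtain v' w' where v': "v' \<in> carrier (G (p - 1 - 1))" "w' \<in> carrier (G (p - 1))"
      and y: "T (Suc j) (p - 1) v = d (p - 1 - 1) (T (Suc j) (p - 1 - 1) v') \<oplus>[G (p - 1)] T (Suc (Suc j)) (p - 1) w'"
      using gr_acyclicD[of "Suc j" v "p - 1" "\<ominus>[G p] w"] v by auto
    \<comment> \<open>Subtracting the contributions of v' and w' puts z into Ker t. The element w2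
      collects what d z then misses; its term b v' comes from d(d v') = t b v'.\<close>
    define z where "z = T j (p - 1) v \<ominus>[G (p - 1)] d (p - 2) (T j (p - 2) v') \<ominus>[G (p - 1)] T (Suc j) (p - 1) w'"
    define w2 where "w2 = b (p - 2) v' \<oplus>[G p] d (p - 1) w' \<oplus>[G p] w"
    have z: "z \<in> carrier (G (p - 1))" using v v' by (simp add: z_def)
    have w2: "w2 \<in> carrier (G p)" using v v' by (simp add: w2_def)
    have "T (Suc 0) (p - 1) z = T (Suc j) (p - 1) v \<ominus>[G (p - 1)] T (Suc j) (p - 1) (d (p - 2) v') \<ominus>[G (p - 1)] T (Suc (Suc j)) (p - 1) w'"
      using v v' by (simp add: z_def push)
    also have "T (Suc j) (p - 1) v = T (Suc j) (p - 1) (d (p - 2) v') \<oplus>[G (p - 1)] T (Suc (Suc j)) (p - 1) w'"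
      unfolding y using v' by (simp add: push)
    finally have Tz: "T (Suc 0) (p - 1) z = T (Suc j) (p - 1) (d (p - 2) v') \<oplus>[G (p - 1)] T (Suc (Suc j)) (p - 1) w'
        \<ominus>[G (p - 1)] T (Suc j) (p - 1) (d (p - 2) v') \<ominus>[G (p - 1)] T (Suc (Suc j)) (p - 1) w'" .
    have v2: "v' \<in> carrier (G (p - 2))" using v' by simp
    have "T (Suc j) (p - 1) (d (p - 2) v') \<oplus>[G (p - 1)] T (Suc (Suc j)) (p - 1) w'
        \<ominus>[G (p - 1)] T (Suc j) (p - 1) (d (p - 2) v') \<ominus>[G (p - 1)] T (Suc (Suc j)) (p - 1) w' = \<zero>[G (p - 1)]"
      by (rule G.group_eqI[where p="p - 1"], (rule G.rep_rules | simp add: v v2 v'(2))+)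
    then have "T (Suc 0) (p - 1) z = \<zero>[G (p - 1)]" using Tz by simp
    moreover have "T j p u = d (p - 1) z \<oplus>[G p] T (Suc j) p w2"
    proof -
      have v2: "v' \<in> carrier (G (p - 2))" using v' by simp
      have "d (p - 1) z = T j p (d (p - 1) v) \<ominus>[G p] T (Suc j) p (b (p - 2) v') \<ominus>[G p] T (Suc j) p (d (p - 1) w')"
        using v v' v2 by (simp add: z_def push)
      moreover have "T (Suc j) p w2 = T (Suc j) p (b (p - 2) v') \<oplus>[G p] T (Suc j) p (d (p - 1) w') \<oplus>[G p] T (Suc j) p w"
        using v v' v2 by (simp add: w2_def push)
      moreover have "T j p u = T j p (d (p - 1) v) \<oplus>[G p] T (Suc j) p w" unfolding x using v by (simp add: push)
      ultimately show ?thesis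
        using v v' v2
        by (simp only:) (rule G.group_eqI, (rule G.rep_rules | simp)+)
    qed
    ultimately show ?thesis using z w2 by blast
  qed
qed

text \<open>On Ker t one has d^2 = b t = 0. Consider x divisible by t^j, with j descending from n +
  1, where x vanishes: \<open>kernel_step\<close> trades divisibility by t^j for divisibility by
  t^(j+1) at the cost of a boundary from Ker t.\<close>

lemma kernel_acyclic:
  assumes "x \<in> carrier (G p)" "T (Suc 0) p x = \<zero>[G p]" "d p x = \<zero>[G (p + 1)]"
  shows "\<exists>z\<in>carrier (G (p - 1)). T (Suc 0) (p - 1) z = \<zero>[G (p - 1)] \<and> x = d (p - 1) z"
proof -
  have "\<forall>u\<in>carrier (G p). T (Suc 0) p (T j p u) = \<zero>[G p] \<and> d p (T j p u) = \<zero>[G (p + 1)] \<longrightarrow>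
    (\<exists>z\<in>carrier (G (p - 1)). T (Suc 0) (p - 1) z = \<zero>[G (p - 1)] \<and> T j p u = d (p - 1) z)" if "j \<le> Suc n" for j
    using that
  proof (induction j rule: inc_induct)
    case base
    show ?case using T_n d.zero[of "p - 1"] by (auto intro!: bexI[where x="\<zero>[G (p - 1)]"])
  next
    case (step j)
    show ?case
    proof (intro ballI impI; elim conjE)
      fix u assume u: "u \<in> carrier (G p)" "T (Suc 0) p (T j p u) = \<zero>[G p]" "d p (T j p u) = \<zero>[G (p + 1)]"
      from kernel_step[OF _ u] step obtain z w where z: "z \<in> carrier (G (p - 1))" "w \<in> carrier (G p)"
        "T (Suc 0) (p - 1) z = \<zero>[G (p - 1)]" "T j p u = d (p - 1) z \<oplus>[G p] T (Suc j) p w"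
        by auto
      have w: "T (Suc j) p w = T j p u \<ominus>[G p] d (p - 1) z"
        unfolding z(4) by (rule G.group_eqI[where p=p], (rule G.rep_rules | simp add: z)+)
      have T1: "T (Suc 0) p (T (Suc j) p w) = \<zero>[G p]"
      proof -
        have "T (Suc 0) p (d (p - 1) z) = d (p - 1) (T (Suc 0) (p - 1) z)" using z(1) by (simp add: d_T)
        also have "\<dots> = \<zero>[G p]" using z(3) d.zero[of "p - 1"] by simp
        finally show ?thesis unfolding w using u z T.minus[of "T j p u" p "d (p - 1) z" "Suc 0"]
          by (simp add: a_minus_def G.r_neg)
      qed
      have d1: "d p (T (Suc j) p w) = \<zero>[G (p + 1)]"
      proof -
        have "d p (d (p - 1) z) = b (p - 1) (T (Suc 0) (p - 1) z)" using z(1) by (simp add: d_d b_T)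
        also have "\<dots> = \<zero>[G (p + 1)]" using z(3) b.zero[of "p - 1"] by simp
        finally show ?thesis unfolding w using u z d.minus[of "T j p u" p "d (p - 1) z"]
          by (simp add: a_minus_def G.r_neg)
      qed
      obtain z' where z': "z' \<in> carrier (G (p - 1))" "T (Suc 0) (p - 1) z' = \<zero>[G (p - 1)]"
        "T (Suc j) p w = d (p - 1) z'" using step.IH z(2) T1 d1 by blast
      have "T j p u = d (p - 1) (z \<oplus>[G (p - 1)] z')" using z z' d.add[of z "p - 1" z'] by simp
      then show "\<exists>z\<in>carrier (G (p - 1)). T (Suc 0) (p - 1) z = \<zero>[G (p - 1)] \<and> T j p u = d (p - 1) z"
        using z z' by (intro bexI[of _ "z \<oplus>[G (p - 1)] z'"]) (simp_all add: T.add)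
    qed
  qed
  from this[of 0] assms show ?thesis by (simp add: T_0)
qed

text \<open>Since d y is divisible by t, y is a boundary d y1 modulo t; since t^i y = 0, acyclicity
  of the piece i corrects y1 to an element y2 of Ker t^i. Subtracting the boundary of the pair (x0,
  - y2) leaves (x1, 0) with x1 a cycle in Ker t, to which \<open>kernel_acyclic\<close>
  applies.\<close>

lemma cone_acyclic:
  assumes i: "i \<le> n" and c: "cone_cocycle i p x y"
  shows "cone_boundary i p x y"
proof -
  have x: "x \<in> carrier (G p)" "T (Suc i) p x = \<zero>[G p]" "d p x = b (p - 1) y"
    and y: "y \<in> carrier (G (p - 1))" "T i (p - 1) y = \<zero>[G (p - 1)]" "d (p - 1) y = T (Suc 0) p x"
    using c by (auto simp: cone_cocycle_def)
  have "d (p - 1) (T 0 (p - 1) y) = T (Suc 0) (p - 1 + 1) x" using x y by (simp add: T_0)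
  then obtain y1 m where y1: "y1 \<in> carrier (G (p - 1 - 1))" "m \<in> carrier (G (p - 1))"
    "T 0 (p - 1) y = d (p - 1 - 1) (T 0 (p - 1 - 1) y1) \<oplus>[G (p - 1)] T (Suc 0) (p - 1) m"
    using gr_acyclicD[OF acyclic[of 0] y(1)] x(1) by auto
  then have y1c: "y1 \<in> carrier (G (p - 2))" and ye: "y = d (p - 2) y1 \<oplus>[G (p - 1)] T (Suc 0) (p - 1) m"
    using y(1) by (simp_all add: T_0)
  have "T i (p - 1) y = T i (p - 1) (d (p - 2) y1) \<oplus>[G (p - 1)] T (Suc i) (p - 1) m"
    unfolding ye using y1c y1(2) by (simp add: push)
  then have "T i (p - 1) (d (p - 2) y1) = \<ominus>[G (p - 1)] T (Suc i) (p - 1) m"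
    using y(2) y1(2) y1c by (intro G.minus_equality[symmetric]) simp_all
  then have "d (p - 2) (T i (p - 2) y1) = T (Suc i) (p - 2 + 1) (\<ominus>[G (p - 1)] m)"
    using y1 y1c by (simp add: push)
  then obtain w m' where w: "w \<in> carrier (G (p - 2 - 1))" "m' \<in> carrier (G (p - 2))"
    "T i (p - 2) y1 = d (p - 2 - 1) (T i (p - 2 - 1) w) \<oplus>[G (p - 2)] T (Suc i) (p - 2) m'"
    using gr_acyclicD[OF acyclic[OF i] y1c, of "\<ominus>[G (p - 1)] m"] y1(2) by auto
  then have wc: "w \<in> carrier (G (p - 3))"
    and we: "T i (p - 2) y1 = T i (p - 2) (d (p - 3) w) \<oplus>[G (p - 2)] T (Suc i) (p - 2) m'"
    by (simp_all add: d_T)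
  define y2 where "y2 = y1 \<ominus>[G (p - 2)] d (p - 3) w \<ominus>[G (p - 2)] T (Suc 0) (p - 2) m'"
  \<comment> \<open>A quotient of y - d y2 by t, read off from y = d y1 + t m; the term b w comes
    from d(d w) = t b w.\<close>
  define x0 where "x0 = b (p - 3) w \<oplus>[G (p - 1)] d (p - 2) m' \<oplus>[G (p - 1)] m"
  note cc = y1(2) y1c wc w(2) x(1) y(1)
  have y2c: "y2 \<in> carrier (G (p - 2))" and x0c: "x0 \<in> carrier (G (p - 1))"
    using cc by (simp_all add: y2_def x0_def)
  have Ty2: "T i (p - 2) y2 = \<zero>[G (p - 2)]"
  proof -
    have "T i (p - 2) y2 = T i (p - 2) y1 \<ominus>[G (p - 2)] T i (p - 2) (d (p - 3) w) \<ominus>[G (p - 2)] T (Suc i) (p - 2) m'"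
      using cc by (simp add: y2_def push)
    also have "\<dots> = \<zero>[G (p - 2)]" unfolding we
      by (rule G.group_eqI, (rule G.rep_rules | simp add: cc)+)
    finally show ?thesis .
  qed
  have Tx0: "T (Suc 0) (p - 1) x0 = y \<ominus>[G (p - 1)] d (p - 2) y2"
  proof -
    have 1: "T (Suc 0) (p - 1) x0 = T (Suc 0) (p - 1) (b (p - 3) w) \<oplus>[G (p - 1)] T (Suc 0) (p - 1) (d (p - 2) m') \<oplus>[G (p - 1)] T (Suc 0) (p - 1) m"
      using cc by (simp add: x0_def push)
    have 2: "d (p - 2) y2 = d (p - 2) y1 \<ominus>[G (p - 1)] T (Suc 0) (p - 1) (b (p - 3) w) \<ominus>[G (p - 1)] T (Suc 0) (p - 1) (d (p - 2) m')"
      using cc by (simp add: y2_def push)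
    show ?thesis unfolding 1 2 ye
      by (rule G.group_eqI, (rule G.rep_rules | simp add: cc)+)
  qed
  have Tix0: "T (Suc i) (p - 1) x0 = \<zero>[G (p - 1)]"
  proof -
    have "T (Suc i) (p - 1) x0 = T i (p - 1) (T (Suc 0) (p - 1) x0)" using x0c by (simp add: T_T)
    also have "\<dots> = T i (p - 1) y \<ominus>[G (p - 1)] d (p - 2) (T i (p - 2) y2)"
      unfolding Tx0 using cc y2c by (simp add: push)
    also have "\<dots> = \<zero>[G (p - 1)]" using y(2) Ty2 d.zero[of "p - 2"] by (simp add: a_minus_def G.r_neg)
    finally show ?thesis .
  qed
  define x1 where "x1 = x \<ominus>[G p] d (p - 1) x0 \<ominus>[G p] b (p - 2) y2"
  have x1c: "x1 \<in> carrier (G p)" using cc x0c y2c by (simp add: x1_def)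
  have Tx1: "T (Suc 0) p x1 = \<zero>[G p]"
  proof -
    have "T (Suc 0) p x1 = d (p - 1) y \<ominus>[G p] d (p - 1) (T (Suc 0) (p - 1) x0) \<ominus>[G p] d (p - 1) (d (p - 2) y2)"
      using cc x0c y2c by (simp add: x1_def T.minus d_T d_d y(3))
    also have "d (p - 1) (T (Suc 0) (p - 1) x0) = d (p - 1) y \<ominus>[G p] d (p - 1) (d (p - 2) y2)"
      unfolding Tx0 using cc y2c d.minus[of y "p - 1" "d (p - 2) y2"] by simp
    also have "d (p - 1) y \<ominus>[G p] (d (p - 1) y \<ominus>[G p] d (p - 1) (d (p - 2) y2)) \<ominus>[G p] d (p - 1) (d (p - 2) y2) = \<zero>[G p]"
      by (rule G.group_eqI, (rule G.rep_rules | simp add: cc y2c)+)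
    finally show ?thesis .
  qed
  have dx1: "d p x1 = \<zero>[G (p + 1)]"
  proof -
    \<comment> \<open>The bound i \<le> n enters here: t^i y2 = 0 gives t^n y2 = 0, and on Ker t^n
      the maps b and d commute.\<close>
    have 1: "d p (b (p - 2) y2) = b (p - 1) (d (p - 2) y2)"
      using d_b[OF y2c T_zero_mono[OF Ty2 i y2c]] by simp
    have 2: "d p (d (p - 1) x0) = b (p - 1) y \<ominus>[G (p + 1)] b (p - 1) (d (p - 2) y2)"
    proof -
      have "d p (d (p - 1) x0) = b (p - 1) (T (Suc 0) (p - 1) x0)" using x0c by (simp add: d_d b_T)
      then show ?thesis unfolding Tx0 using cc y2c b.minus[of y "p - 1" "d (p - 2) y2"] by simp
    qed
    have "d p x1 = b (p - 1) y \<ominus>[G (p + 1)] d p (d (p - 1) x0) \<ominus>[G (p + 1)] d p (b (p - 2) y2)"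
      using cc x0c y2c x(3) by (simp add: x1_def d.minus)
    also have "\<dots> = \<zero>[G (p + 1)]" unfolding 1 2
      by (rule G.group_eqI, (rule G.rep_rules | simp add: cc y2c)+)
    finally show ?thesis .
  qed
  obtain z where z: "z \<in> carrier (G (p - 1))" "T (Suc 0) (p - 1) z = \<zero>[G (p - 1)]" "x1 = d (p - 1) z"
    using kernel_acyclic[OF x1c Tx1 dx1] by blast
  have "T (Suc i) (p - 1) z = \<zero>[G (p - 1)]" using T_zero_mono[OF z(2) _ z(1)] by simp
  moreover have "x = d (p - 1) (x0 \<oplus>[G (p - 1)] z) \<ominus>[G p] b (p - 2) (\<ominus>[G (p - 2)] y2)"
  proof -
    have 1: "d (p - 1) (x0 \<oplus>[G (p - 1)] z) = d (p - 1) x0 \<oplus>[G p] x1" using x0c z d.add[of x0 "p - 1" z] by simp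
    have 2: "b (p - 2) (\<ominus>[G (p - 2)] y2) = \<ominus>[G p] b (p - 2) y2" using y2c b.neg[of y2 "p - 2"] by simp
    show ?thesis unfolding 1 2 unfolding x1_def
      by (rule G.group_eqI[where p=p], (rule G.rep_rules | simp add: cc y2c x0c)+)
  qed
  moreover have "y = T (Suc 0) (p - 1) (x0 \<oplus>[G (p - 1)] z) \<ominus>[G (p - 1)] d (p - 2) (\<ominus>[G (p - 2)] y2)"
  proof -
    have 1: "T (Suc 0) (p - 1) (x0 \<oplus>[G (p - 1)] z) = y \<ominus>[G (p - 1)] d (p - 2) y2"
      using x0c z cc y2c by (simp add: T.add Tx0)
    have 2: "d (p - 2) (\<ominus>[G (p - 2)] y2) = \<ominus>[G (p - 1)] d (p - 2) y2" using y2c d.neg[of y2 "p - 2"] by simp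
    show ?thesis unfolding 1 2
      by (rule G.group_eqI[where p="p - 1"], (rule G.rep_rules | simp add: cc y2c x0c)+)
  qed
  ultimately show ?thesis
    unfolding cone_boundary_def using x0c z y2c Tix0 Ty2
    by (intro bexI[of _ "x0 \<oplus>[G (p - 1)] z"] bexI[of _ "\<ominus>[G (p - 2)] y2"] conjI) (simp_all add: T.add T.neg)
qed

end

section \<open>Exact pair complexes make the graded pieces acyclic\<close>

context
  assumes exact: "\<And>i p x y. \<lbrakk>i \<le> n; cone_cocycle i p x y\<rbrakk> \<Longrightarrow> cone_boundary i p x y"
begin

text \<open>The case i = 0, in which the second component of every pair is zero and the pair complex
  is Ker t.\<close>

lemma kernel_exact:
  assumes x: "x \<in> carrier (G p)" "T (Suc 0) p x = \<zero>[G p]" "d p x = \<zero>[G (p + 1)]"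
  shows "\<exists>z\<in>carrier (G (p - 1)). T (Suc 0) (p - 1) z = \<zero>[G (p - 1)] \<and> x = d (p - 1) z"
proof -
  have "cone_cocycle 0 p x \<zero>[G (p - 1)]"
    using x d.zero[of "p - 1"] b.zero[of "p - 1"] by (simp add: cone_cocycle_def)
  then have "cone_boundary 0 p x \<zero>[G (p - 1)]" using exact[of 0] by simp
  then obtain x' y' where "x' \<in> carrier (G (p - 1))" "y' \<in> carrier (G (p - 2))" "T (Suc 0) (p - 1) x' = \<zero>[G (p - 1)]"
    "T 0 (p - 2) y' = \<zero>[G (p - 2)]" "x = d (p - 1) x' \<ominus>[G p] b (p - 2) y'" unfolding cone_boundary_def by blast
  then show ?thesis using b.zero[of "p - 2"] by (intro bexI[of _ x']) (simp_all add: T_0 a_minus_def)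
qed

text \<open>The pair (x, y) can only fail the condition d x = b y. The defect x1 = d x - b y lies in
  Ker t and is closed, so it is d z with z in Ker t; replacing x by x - z leaves t x unchanged and
  makes the pair a cocycle. A bounding pair then provides y' and m.\<close>

lemma divide_kernel:
  assumes i: "i \<le> n" and y: "y \<in> carrier (G q)" "T i q y = \<zero>[G q]"
    and x: "x \<in> carrier (G (q + 1))" "d q y = T (Suc 0) (q + 1) x"
  shows "\<exists>y'\<in>carrier (G (q - 1)). \<exists>m\<in>carrier (G q). T i (q - 1) y' = \<zero>[G (q - 1)] \<and>
    y = d (q - 1) y' \<oplus>[G q] T (Suc 0) q m"
proof -
  have Tx: "T (Suc i) (q + 1) x = \<zero>[G (q + 1)]"
  proof -
    have "T (Suc i) (q + 1) x = T i (q + 1) (d q y)" unfolding x(2) using x(1) by (simp add: T_T)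
    also have "\<dots> = d q (T i q y)" using y(1) by (simp add: d_T)
    finally show ?thesis unfolding y(2) by simp
  qed
  define x1 where "x1 = d (q + 1) x \<ominus>[G (q + 2)] b q y"
  have x1c: "x1 \<in> carrier (G (q + 2))" using x y by (simp add: x1_def)
  have "T (Suc 0) (q + 2) x1 = \<zero>[G (q + 2)]"
  proof -
    have "T (Suc 0) (q + 2) x1 = d (q + 1) (T (Suc 0) (q + 1) x) \<ominus>[G (q + 2)] d (q + 1) (d q y)"
      using x(1) y(1) by (simp add: x1_def T.minus d_T d_d)
    then show ?thesis unfolding x(2) using x(1) by (simp add: a_minus_def G.r_neg)
  qed
  moreover have "d (q + 2) x1 = \<zero>[G (q + 2 + 1)]"
  proof -
    have 1: "d (q + 2) (b q y) = b (q + 1) (T (Suc 0) (q + 1) x)"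
      using d_b[OF y(1) T_zero_mono[OF y(2) i y(1)]] x(2) by simp
    have "d (q + 2) x1 = d (q + 2) (d (q + 1) x) \<ominus>[G (q + 3)] d (q + 2) (b q y)"
      using x(1) y(1) d.minus[of "d (q + 1) x" "q + 2" "b q y"] by (simp add: x1_def)
    then show ?thesis unfolding 1 using x(1) by (simp add: a_minus_def G.r_neg d_d b_T)
  qed
  ultimately have "\<exists>z\<in>carrier (G (q + 1)). T (Suc 0) (q + 1) z = \<zero>[G (q + 1)] \<and> x1 = d (q + 1) z"
    using kernel_exact[OF x1c] by simp
  then obtain z where z: "z \<in> carrier (G (q + 1))" "T (Suc 0) (q + 1) z = \<zero>[G (q + 1)]" "x1 = d (q + 1) z" by blast
  have Tz: "T (Suc i) (q + 1) z = \<zero>[G (q + 1)]" using T_zero_mono[OF z(2) _ z(1)] by simp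
  have "d (q + 1) (x \<ominus>[G (q + 1)] z) = d (q + 1) x \<ominus>[G (q + 2)] x1"
    using d.minus[of x "q + 1" z] x z by simp
  also have "\<dots> = b q y" unfolding x1_def
    by (rule G.group_eqI, (rule G.rep_rules | simp add: x y)+)
  finally have dxz: "d (q + 1) (x \<ominus>[G (q + 1)] z) = b q y" .
  have Txz: "T (Suc i) (q + 1) (x \<ominus>[G (q + 1)] z) = \<zero>[G (q + 1)]" "T (Suc 0) (q + 1) (x \<ominus>[G (q + 1)] z) = T (Suc 0) (q + 1) x"
    using T.minus[of x "q + 1" z] x(1) z Tz Tx
    by (simp_all add: a_minus_def)
  have "cone_cocycle i (q + 1) (x \<ominus>[G (q + 1)] z) y"
    unfolding cone_cocycle_def using x y z dxz Txz by simp
  from exact[OF i this] obtain x' y' where *: "x' \<in> carrier (G q)" "y' \<in> carrier (G (q - 1))"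
    "T i (q - 1) y' = \<zero>[G (q - 1)]" "y = T (Suc 0) q x' \<ominus>[G q] d (q - 1) y'"
    unfolding cone_boundary_def by auto
  have "y = d (q - 1) (\<ominus>[G (q - 1)] y') \<oplus>[G q] T (Suc 0) q x'"
    using * d.neg[of y' "q - 1"] by (simp add: a_minus_def G.a_comm)
  then show ?thesis using * by (intro bexI[of _ "\<ominus>[G (q - 1)] y'"] bexI[of _ x']) (simp_all add: T.neg)
qed

text \<open>A primitive of t^n u in Ker t that is divisible by t^j is replaced by one divisible by
  t^(j+1). Dividing d w - t^(n-j) u by \<open>divide_kernel\<close> allows w to be altered so that d
  w becomes divisible by t; dividing the altered w itself then extracts the further factor t, up to
  a boundary from Ker t^(j+1) that changes neither condition.\<close>

lemma push_kernel:
  assumes j: "j < n" and w: "w \<in> carrier (G q)" and u: "u \<in> carrier (G (q + 1))"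
    and z: "T (Suc 0) q (T j q w) = \<zero>[G q]" "d q (T j q w) = T n (q + 1) u"
  shows "\<exists>w'\<in>carrier (G q). T (Suc 0) q (T (Suc j) q w') = \<zero>[G q] \<and> d q (T (Suc j) q w') = T n (q + 1) u"
proof -
  define y where "y = d q w \<ominus>[G (q + 1)] T (n - j) (q + 1) u"
  have yc: "y \<in> carrier (G (q + 1))" using w u by (simp add: y_def)
  have nj: "n - j = Suc (n - Suc j)" using j by simp
  have Ty: "T j (q + 1) y = \<zero>[G (q + 1)]"
  proof -
    have "T j (q + 1) y = d q (T j q w) \<ominus>[G (q + 1)] T n (q + 1) u"
      using w u j by (simp add: y_def T.minus d_T T_T)
    then show ?thesis unfolding z(2) using u by (simp add: a_minus_def G.r_neg)
  qed
  have dy: "d (q + 1) y = T (Suc 0) (q + 1 + 1) (b q w \<ominus>[G (q + 2)] T (n - Suc j) (q + 2) (d (q + 1) u))"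
    unfolding y_def nj using w u d.minus[of "d q w" "q + 1" "T (Suc (n - Suc j)) (q + 1) u"]
    by (simp add: d_T d_d T.minus T_T)
  obtain y' m where y': "y' \<in> carrier (G q)" "m \<in> carrier (G (q + 1))" "T j q y' = \<zero>[G q]"
    "y = d q y' \<oplus>[G (q + 1)] T (Suc 0) (q + 1) m"
    using divide_kernel[OF _ yc Ty _ dy] j w u by auto
  \<comment> \<open>Since t^j y' = 0, this leaves t^j w unchanged; w1 is killed by t^(j+1) and d w1
    is divisible by t, so \<open>divide_kernel\<close> applies once more.\<close>
  define w1 where "w1 = w \<ominus>[G q] y'"
  have w1c: "w1 \<in> carrier (G q)" using w y' by (simp add: w1_def)
  have Tw1: "T (Suc j) q w1 = \<zero>[G q]"
  proof -
    have 1: "T (Suc j) q w = \<zero>[G q]" using z(1) w by (simp add: T_T)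
    have 2: "T (Suc j) q y' = \<zero>[G q]" using T_zero_mono[OF y'(3) _ y'(1)] by simp
    show ?thesis using w y' 1 2 by (simp add: w1_def a_minus_def T.add T.neg)
  qed
  have dw1: "d q w1 = T (Suc 0) (q + 1) (m \<oplus>[G (q + 1)] T (n - Suc j) (q + 1) u)"
  proof -
    have "d q w1 = d q w \<ominus>[G (q + 1)] d q y'" using w y' by (simp add: w1_def d.minus)
    also have "d q w = y \<oplus>[G (q + 1)] T (n - j) (q + 1) u" unfolding y_def
      by (rule G.group_eqI[where p="q + 1"], (rule G.rep_rules | simp add: w u)+)
    also have "y \<oplus>[G (q + 1)] T (n - j) (q + 1) u \<ominus>[G (q + 1)] d q y' = T (Suc 0) (q + 1) m \<oplus>[G (q + 1)] T (n - j) (q + 1) u"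
      unfolding y'(4) by (rule G.group_eqI, (rule G.rep_rules | simp add: y' u)+)
    finally show ?thesis unfolding nj using y' u by (simp add: T.add T_T)
  qed
  have "Suc j \<le> n" using j by simp
  from divide_kernel[OF this w1c Tw1 _ dw1] obtain y2 m' where y2: "y2 \<in> carrier (G (q - 1))" "m' \<in> carrier (G q)"
    "T (Suc j) (q - 1) y2 = \<zero>[G (q - 1)]" "w1 = d (q - 1) y2 \<oplus>[G q] T (Suc 0) q m'"
    using y' u by auto
  define z' where "z' = T j q w \<ominus>[G q] d (q - 1) (T j (q - 1) y2)"
  have z': "T (Suc j) q m' = z'"
  proof -
    have "T j q w = T j q w1"
    proof -
      have "T j q w1 = T j q w \<ominus>[G q] T j q y'" using w y' by (simp add: w1_def T.minus del: y'(3))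
      then show ?thesis unfolding y'(3) using w by (simp add: a_minus_def)
    qed
    also have "\<dots> = d (q - 1) (T j (q - 1) y2) \<oplus>[G q] T (Suc j) q m'"
      unfolding y2(4) using y2(1,2) by (simp add: T.add d_T T_T)
    finally have e: "T j q w = d (q - 1) (T j (q - 1) y2) \<oplus>[G q] T (Suc j) q m'" .
    show ?thesis unfolding z'_def e
      by (rule G.group_eqI[where p=q], (rule G.rep_rules | simp add: y2(1,2))+)
  qed
  have "T (Suc 0) q z' = T (Suc 0) q (T j q w) \<ominus>[G q] d (q - 1) (T (Suc j) (q - 1) y2)"
    unfolding z'_def using w y2(1) T.minus[of "T j q w" q "d (q - 1) (T j (q - 1) y2)" "Suc 0"] by (simp add: d_T T_T)
  then have Tz': "T (Suc 0) q z' = \<zero>[G q]" unfolding z(1) y2(3) using d.zero[of "q - 1"] by (simp add: a_minus_def G.r_neg)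
  have dd: "d q (d (q - 1) (T j (q - 1) y2)) = b (q - 1) (T (Suc j) (q - 1) y2)"
    using y2(1) by (simp add: d_d b_T d_T T_T)
  have "d q z' = T n (q + 1) u"
    unfolding z'_def using w u y2(1) d.minus[of "T j q w" q "d (q - 1) (T j (q - 1) y2)"] z(2) dd b.zero[of "q - 1"]
    unfolding y2(3) by (simp add: a_minus_def)
  then show ?thesis using y2(2) Tz' unfolding z'[symmetric] by blast
qed

text \<open>t^n u lies in Ker t and is closed there because t^(n+1) = 0, so it has a primitive in
  Ker t. \<open>push_kernel\<close> raises the divisibility of the primitive step by step until it
  is a multiple of t^n.\<close>

lemma top_gr_acyclic: "gr_acyclic n"
  unfolding gr_acyclic_def
proof (intro allI ballI impI)
  fix p u m assume u: "u \<in> carrier (G p)" and m: "m \<in> carrier (G (p + 1))" and du: "d p (T n p u) = T (Suc n) (p + 1) m"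
  have "T (Suc 0) p (T n p u) = \<zero>[G p]" using T_T[OF u, of "Suc 0" n] T_n[OF u] by simp
  moreover have "d p (T n p u) = \<zero>[G (p + 1)]" using du T_n[OF m] by simp
  ultimately obtain z where z: "z \<in> carrier (G (p - 1))" "T (Suc 0) (p - 1) z = \<zero>[G (p - 1)]" "T n p u = d (p - 1) z"
    using kernel_exact[of "T n p u" p] u by auto
  have "\<exists>w\<in>carrier (G (p - 1)). T (Suc 0) (p - 1) (T j (p - 1) w) = \<zero>[G (p - 1)] \<and> d (p - 1) (T j (p - 1) w) = T n (p - 1 + 1) u"
    if "j \<le> n" for j
    using that
  proof (induction j)
    case 0
    then show ?case using z by (intro bexI[of _ z]) (simp_all add: T_0)
  next
    case (Suc j)
    then obtain w where "w \<in> carrier (G (p - 1))" "T (Suc 0) (p - 1) (T j (p - 1) w) = \<zero>[G (p - 1)]"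
       "d (p - 1) (T j (p - 1) w) = T n (p - 1 + 1) u" by auto
    then show ?case using Suc.prems u by (intro push_kernel) simp_all
  qed
  then obtain w where w: "w \<in> carrier (G (p - 1))" "d (p - 1) (T n (p - 1) w) = T n p u" by auto
  then show "\<exists>v\<in>carrier (G (p - 1)). \<exists>w\<in>carrier (G p). T n p u = d (p - 1) (T n (p - 1) v) \<oplus>[G p] T (Suc n) p w"
    using u by (intro bexI[of _ w] bexI[of _ "\<zero>[G p]"]) simp_all
qed

text \<open>First u is altered by an element of Ker t^i, which does not affect t^i u, so that d u
  becomes divisible by t. The top piece, already known to be acyclic, then makes t^n u a boundary
  d(t^n v), and u - d v falls under \<open>divide_kernel\<close> for the exponent n.\<close>

lemma exact_gr_acyclic:
  assumes i: "i \<le> n"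
  shows "gr_acyclic i"
proof (cases "i = n")
  case True
  then show ?thesis using top_gr_acyclic by simp
next
  case False
  show ?thesis
    unfolding gr_acyclic_def
  proof (intro allI ballI impI)
    fix p u m assume u: "u \<in> carrier (G p)" and m: "m \<in> carrier (G (p + 1))" and du: "d p (T i p u) = T (Suc i) (p + 1) m"
    define y where "y = d p u \<ominus>[G (p + 1)] T (Suc 0) (p + 1) m"
    have yc: "y \<in> carrier (G (p + 1))" using u m by (simp add: y_def)
    have Ty: "T i (p + 1) y = \<zero>[G (p + 1)]"
    proof -
      have "T i (p + 1) y = d p (T i p u) \<ominus>[G (p + 1)] T (Suc i) (p + 1) m"
        using u m by (simp add: y_def T.minus d_T T_T)
      then show ?thesis unfolding du using m by (simp add: a_minus_def G.r_neg)
    qed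
    have dy: "d (p + 1) y = T (Suc 0) (p + 1 + 1) (b p u \<ominus>[G (p + 2)] d (p + 1) m)"
      unfolding y_def using u m d.minus[of "d p u" "p + 1" "T (Suc 0) (p + 1) m"]
      by (simp add: d_T d_d T.minus)
    obtain y' m' where y': "y' \<in> carrier (G p)" "m' \<in> carrier (G (p + 1))" "T i p y' = \<zero>[G p]"
      "y = d p y' \<oplus>[G (p + 1)] T (Suc 0) (p + 1) m'"
      using divide_kernel[OF i yc Ty _ dy] u m by auto
    define u1 where "u1 = u \<ominus>[G p] y'"
    have u1c: "u1 \<in> carrier (G p)" using u y' by (simp add: u1_def)
    have Tu1: "T i p u1 = T i p u"
    proof -
      have "T i p u1 = T i p u \<ominus>[G p] T i p y'" using u y' by (simp add: u1_def T.minus del: y'(3))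
      then show ?thesis unfolding y'(3) using u by (simp add: a_minus_def)
    qed
    have du1: "d p u1 = T (Suc 0) (p + 1) (m' \<oplus>[G (p + 1)] m)"
    proof -
      have "d p u1 = d p u \<ominus>[G (p + 1)] d p y'" using u y' by (simp add: u1_def d.minus)
      also have "d p u = y \<oplus>[G (p + 1)] T (Suc 0) (p + 1) m" unfolding y_def
        by (rule G.group_eqI[where p="p + 1"], (rule G.rep_rules | simp add: u m)+)
      also have "y \<oplus>[G (p + 1)] T (Suc 0) (p + 1) m \<ominus>[G (p + 1)] d p y' = T (Suc 0) (p + 1) m' \<oplus>[G (p + 1)] T (Suc 0) (p + 1) m"
        unfolding y'(4) by (rule G.group_eqI, (rule G.rep_rules | simp add: y' m)+)
      finally show ?thesis using y' m by (simp add: T.add)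
    qed
    have "d p (T n p u1) = T (Suc n) (p + 1) (m' \<oplus>[G (p + 1)] m)"
      using u1c y' m by (simp add: d_T du1 T_T)
    then obtain v w where v: "v \<in> carrier (G (p - 1))" "w \<in> carrier (G p)" "T n p u1 = d (p - 1) (T n (p - 1) v) \<oplus>[G p] T (Suc n) p w"
      using gr_acyclicD[OF top_gr_acyclic u1c, of "m' \<oplus>[G (p + 1)] m"] y' m by auto
    have v': "T n p u1 = T n p (d (p - 1) v)" using v T_n[OF v(2)] by (simp add: d_T)
    \<comment> \<open>t^n u2 = 0 by the choice of v, and d u2 is still divisible by t because d(d v)
      = t b v.\<close>
    define u2 where "u2 = u1 \<ominus>[G p] d (p - 1) v"
    have u2c: "u2 \<in> carrier (G p)" using u1c v by (simp add: u2_def)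
    have Tu2: "T n p u2 = \<zero>[G p]"
      using u1c v(1) by (simp add: u2_def a_minus_def T.add T.neg v' G.r_neg)
    have du2: "d p u2 = T (Suc 0) (p + 1) (m' \<oplus>[G (p + 1)] m \<ominus>[G (p + 1)] b (p - 1) v)"
      using u1c v(1) y' m by (simp add: u2_def d.minus du1 d_d T.minus)
    obtain y2 m2 where y2: "y2 \<in> carrier (G (p - 1))" "m2 \<in> carrier (G p)" "u2 = d (p - 1) y2 \<oplus>[G p] T (Suc 0) p m2"
      using divide_kernel[OF order_refl u2c Tu2 _ du2] y' m v(1) by auto
    have "u1 = d (p - 1) y2 \<oplus>[G p] T (Suc 0) p m2 \<oplus>[G p] d (p - 1) v"
    proof -
      have "u1 = u2 \<oplus>[G p] d (p - 1) v" unfolding u2_def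
        by (rule G.group_eqI[where p=p], (rule G.rep_rules | simp add: u1c v(1))+)
      then show ?thesis unfolding y2(3) .
    qed
    then have "T i p u = T i p (d (p - 1) y2) \<oplus>[G p] T (Suc i) p m2 \<oplus>[G p] T i p (d (p - 1) v)"
      unfolding Tu1[symmetric] using y2(1,2) v(1) by (simp add: T.add T_T)
    also have "\<dots> = d (p - 1) (T i (p - 1) (y2 \<oplus>[G (p - 1)] v)) \<oplus>[G p] T (Suc i) p m2"
      using y2(1,2) v(1) d.add[of "T i (p - 1) y2" "p - 1" "T i (p - 1) v"] by (simp add: T.add d_T G.a_ac)
    finally show "\<exists>v\<in>carrier (G (p - 1)). \<exists>w\<in>carrier (G p). T i p u = d (p - 1) (T i (p - 1) v) \<oplus>[G p] T (Suc i) p w"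
      using y2(1,2) v(1) by blast
  qed
qed

end

end

declare degree_simps [simp del]

section \<open>Transport, shifts and cones\<close>

lemma (in abelian_group) neg_zero [simp]: "\<ominus> \<zero> = \<zero>"
  by (rule minus_equality) simp_all

context cdg_module
begin

lemma act_sign: "\<lbrakk>a \<in> ael A p; m \<in> mel M q; s = p + q\<rbrakk>
  \<Longrightarrow> mact M p q a (sign_of (mcomp M q) r m) = sign_of (mcomp M s) r (mact M p q a m)"
  by (simp add: sign_of_def act_neg)

lemma mdiff_sign: "\<lbrakk>m \<in> mel M p; s = p + 1\<rbrakk>
  \<Longrightarrow> mdiff M p (sign_of (mcomp M p) r m) = sign_of (mcomp M s) r (mdiff M p m)"
  by (simp add: sign_of_def mdiff_neg)

lemma mdiff_mdiff': "\<lbrakk>m \<in> mel M p; q = p + 1\<rbrakk> \<Longrightarrow> mdiff M q (mdiff M p m) = mact M 2 p (acurv A) m"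
  by (simp add: mdiff_mdiff)

lemma mdiff_act': "\<lbrakk>a \<in> ael A p; m \<in> mel M q; s = p + q; u = s + 1; v = q + 1\<rbrakk>
  \<Longrightarrow> mdiff M s (mact M p q a m)
      = mact M (p + 1) q (adiff A p a) m \<oplus>[M,u] sign_of (mcomp M u) p (mact M p v a (mdiff M q m))"
  by (simp add: mdiff_act)

end

text \<open>All module axioms except the one on d^2, because the free module covering \<Gamma>_i
  satisfies that one only after passing to the quotient.\<close>

locale pre_cdg_module =
  fixes A :: "('r, 'a) cdg_alg" and F :: "('a, 'm) cdg_mod"
  assumes group: "\<And>p. abelian_group (mcomp F p)"
    and act_closed: "\<And>p q a m. \<lbrakk>a \<in> ael A p; m \<in> mel F q\<rbrakk>
      \<Longrightarrow> mact F p q a m \<in> mel F (p + q)"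
    and act_l_distr: "\<And>p q a b m. \<lbrakk>a \<in> ael A p; b \<in> ael A p; m \<in> mel F q\<rbrakk>
      \<Longrightarrow> mact F p q (a \<oplus>[acomp A p] b) m = mact F p q a m \<oplus>[F,p + q] mact F p q b m"
    and act_r_distr: "\<And>p q a m m'. \<lbrakk>a \<in> ael A p; m \<in> mel F q; m' \<in> mel F q\<rbrakk>
      \<Longrightarrow> mact F p q a (m \<oplus>[F,q] m') = mact F p q a m \<oplus>[F,p + q] mact F p q a m'"
    and act_assoc: "\<And>p q s a b m. \<lbrakk>a \<in> ael A p; b \<in> ael A q; m \<in> mel F s\<rbrakk>
      \<Longrightarrow> mact F (p + q) s (amult A p q a b) m = mact F p (q + s) a (mact F q s b m)"
    and act_one: "\<And>p m. m \<in> mel F p \<Longrightarrow> mact F 0 p (aone A) m = m"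
    and mdiff_closed: "\<And>p m. m \<in> mel F p \<Longrightarrow> mdiff F p m \<in> mel F (p + 1)"
    and mdiff_add: "\<And>p m m'. \<lbrakk>m \<in> mel F p; m' \<in> mel F p\<rbrakk>
      \<Longrightarrow> mdiff F p (m \<oplus>[F,p] m') = mdiff F p m \<oplus>[F,p + 1] mdiff F p m'"
    and mdiff_act: "\<And>p q a m. \<lbrakk>a \<in> ael A p; m \<in> mel F q\<rbrakk>
      \<Longrightarrow> mdiff F (p + q) (mact F p q a m) = mact F (p + 1) q (adiff A p a) m
            \<oplus>[F,p + q + 1] sign_of (mcomp F (p + q + 1)) p (mact F p (q + 1) a (mdiff F q m))"

lemma (in cdg_module) pre_cdg_module: "pre_cdg_module A M"
  by (rule pre_cdg_module.intro)
    (simp_all add: comp_group act_l_distr act_r_distr act_assoc act_one mdiff_add mdiff_act)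

lemma abelian_group_image:
  assumes "abelian_group G" and car: "carrier H = f ` carrier G" and zero: "zero H = f (zero G)"
    and add: "\<And>x y. \<lbrakk>x \<in> carrier G; y \<in> carrier G\<rbrakk> \<Longrightarrow> f x \<oplus>[H] f y = f (x \<oplus>[G] y)"
  shows "abelian_group H"
proof -
  interpret abelian_group G by fact
  show ?thesis
  proof (rule abelian_groupI; unfold car zero; (elim imageE)?)
    fix y x assume x: "y = f x" "x \<in> carrier G"
    then show "\<exists>z\<in>f ` carrier G. z \<oplus>[H] y = f \<zero>[G]"
      by (intro bexI[of _ "f (\<ominus>[G] x)"]) (simp_all add: add l_neg)
  qed (auto simp: add a_ac)
qed

text \<open>The axioms pass along a surjection \<pi> compatible with all operations, while the
  condition on d^2 is demanded only after applying \<pi>. Renaming along an injection and the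
  quotient map onto \<Gamma>_i are both instances.\<close>

lemma cdg_module_image:
  fixes F :: "('a, 'm) cdg_mod" and M :: "('a, 'n) cdg_mod"
  assumes A: "cdg_algebra R A" and F: "pre_cdg_module A F"
    and car: "\<And>p. mel M p = \<pi> p ` mel F p"
    and zero: "\<And>p. \<zero>[M,p] = \<pi> p \<zero>[F,p]"
    and add: "\<And>p x y. \<lbrakk>x \<in> mel F p; y \<in> mel F p\<rbrakk>
      \<Longrightarrow> \<pi> p x \<oplus>[M,p] \<pi> p y = \<pi> p (x \<oplus>[F,p] y)"
    and act: "\<And>p q a x. \<lbrakk>a \<in> ael A p; x \<in> mel F q\<rbrakk>
      \<Longrightarrow> mact M p q a (\<pi> q x) = \<pi> (p + q) (mact F p q a x)"
    and diff: "\<And>p x. x \<in> mel F p \<Longrightarrow> mdiff M p (\<pi> p x) = \<pi> (p + 1) (mdiff F p x)"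
    and dd: "\<And>p x. x \<in> mel F p
      \<Longrightarrow> \<pi> (p + 2) (mdiff F (p + 1) (mdiff F p x)) = \<pi> (p + 2) (mact F 2 p (acurv A) x)"
  shows "cdg_module A M"
proof -
  interpret A: cdg_algebra R A by (rule A)
  interpret F: pre_cdg_module A F by (rule F)
  interpret FG: abelian_group "mcomp F p" for p by (rule F.group)
  have g: "abelian_group (mcomp M p)" for p
    by (rule abelian_group_image[OF F.group car zero add])
  interpret MG: abelian_group "mcomp M p" for p by (rule g)
  have cl: "x \<in> mel F p \<Longrightarrow> \<pi> p x \<in> mel M p" for x p by (simp add: car)
  have map: "additive_map (mcomp F p) (mcomp M p) (\<pi> p)" for p
    by (intro additive_map.intro additive_map_axioms.intro F.group g) (simp_all add: cl add)
  interpret \<pi>: additive_map "mcomp F p" "mcomp M p" "\<pi> p" for p by (rule map)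
  have ex: "\<exists>x\<in>mel F q. m = \<pi> q x" if "m \<in> mel M q" for q m
    using that unfolding car by blast
  show ?thesis
  proof (rule cdg_module.intro)
    show "abelian_group (mcomp M p)" for p by (rule g)
  next
    fix p q a m assume a: "a \<in> ael A p" and "m \<in> mel M q"
    then obtain x where x: "m = \<pi> q x" "x \<in> mel F q" using ex by blast
    then show "mact M p q a m \<in> mel M (p + q)" using a by (simp add: act F.act_closed cl)
    have c: "mact F p q a x \<in> mel F (p + q)" "mdiff F q x \<in> mel F (q + 1)"
      using a x F.act_closed F.mdiff_closed by simp_all
    have 3: "p + 1 + q = p + q + 1" "p + (q + 1) = p + q + 1" by simp_all
    have c': "mact F (p + 1) q (adiff A p a) x \<in> mel F (p + q + 1)"
      "mact F p (q + 1) a (mdiff F q x) \<in> mel F (p + q + 1)"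
      using F.act_closed[OF A.diff_closed[OF a] x(2)] F.act_closed[OF a c(2)] unfolding 3 by simp_all
    have 1: "mact M (p + 1) q (adiff A p a) (\<pi> q x) = \<pi> (p + q + 1) (mact F (p + 1) q (adiff A p a) x)"
      using act[OF A.diff_closed[OF a] x(2)] unfolding 3 .
    have 2: "mact M p (q + 1) a (\<pi> (q + 1) (mdiff F q x)) = \<pi> (p + q + 1) (mact F p (q + 1) a (mdiff F q x))"
      using act[OF a c(2)] unfolding 3 .
    show "mdiff M (p + q) (mact M p q a m) = mact M (p + 1) q (adiff A p a) m \<oplus>[M,p + q + 1]
       sign_of (mcomp M (p + q + 1)) p (mact M p (q + 1) a (mdiff M q m))"
      unfolding x(1) act[OF a x(2)] diff[OF c(1)] diff[OF x(2)] F.mdiff_act[OF a x(2)] 1 2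
      using c' by (simp add: \<pi>.add \<pi>.sign)
  next
    fix p q a b m assume a: "a \<in> ael A p" "b \<in> ael A p" and "m \<in> mel M q"
    then obtain x where x: "m = \<pi> q x" "x \<in> mel F q" using ex by blast
    then show "mact M p q (a \<oplus>[acomp A p] b) m = mact M p q a m \<oplus>[M,p + q] mact M p q b m"
      using a by (simp add: act F.act_l_distr F.act_closed add)
  next
    fix p q a m m' assume a: "a \<in> ael A p" and "m \<in> mel M q" "m' \<in> mel M q"
    then obtain x x' where x: "m = \<pi> q x" "x \<in> mel F q" "m' = \<pi> q x'" "x' \<in> mel F q" using ex by metis
    then show "mact M p q a (m \<oplus>[M,q] m') = mact M p q a m \<oplus>[M,p + q] mact M p q a m'"
      using a by (simp add: act F.act_r_distr F.act_closed add)
  next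
    fix p q s a b m assume a: "a \<in> ael A p" "b \<in> ael A q" and "m \<in> mel M s"
    then obtain x where x: "m = \<pi> s x" "x \<in> mel F s" using ex by blast
    then show "mact M (p + q) s (amult A p q a b) m = mact M p (q + s) a (mact M q s b m)"
      using a by (simp add: act F.act_assoc F.act_closed add.assoc)
  next
    fix p m assume "m \<in> mel M p"
    then obtain x where x: "m = \<pi> p x" "x \<in> mel F p" using ex by blast
    then show "mact M 0 p (aone A) m = m" by (simp add: act F.act_one)
    show "mdiff M p m \<in> mel M (p + 1)" using x by (simp add: diff F.mdiff_closed cl)
    have "mdiff M (p + 1) (\<pi> (p + 1) (mdiff F p x)) = \<pi> (p + 2) (mdiff F (p + 1) (mdiff F p x))"
      using diff[OF F.mdiff_closed[OF x(2)]] by (simp add: add.assoc)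
    then have "mdiff M (p + 1) (mdiff M p m) = \<pi> (2 + p) (mact F 2 p (acurv A) x)"
      unfolding x(1) diff[OF x(2)] dd[OF x(2)] by (simp add: add.commute)
    then show "mdiff M (p + 1) (mdiff M p m) = mact M 2 p (acurv A) m"
      unfolding x(1) act[OF A.curv_closed x(2)] .
  next
    fix p m m' assume "m \<in> mel M p" "m' \<in> mel M p"
    then obtain x x' where "m = \<pi> p x" "x \<in> mel F p" "m' = \<pi> p x'" "x' \<in> mel F p" using ex by metis
    then show "mdiff M p (m \<oplus>[M,p] m') = mdiff M p m \<oplus>[M,p + 1] mdiff M p m'"
      by (simp add: diff add F.mdiff_add F.mdiff_closed)
  qed
qed

definition transport_map :: "(int \<Rightarrow> 'm \<Rightarrow> 'u) \<Rightarrow> ('a, 'm) cdg_mod \<Rightarrow> int \<Rightarrow> 'm \<Rightarrow> 'u" where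
  "transport_map e M = (\<lambda>q. restrict (e q) (mel M q))"

definition transport_inv :: "(int \<Rightarrow> 'm \<Rightarrow> 'u) \<Rightarrow> ('a, 'm) cdg_mod \<Rightarrow> int \<Rightarrow> 'u \<Rightarrow> 'm" where
  "transport_inv e M = (\<lambda>q. \<lambda>x\<in>e q ` mel M q. inv_into (mel M q) (e q) x)"

locale transported = cdg_algebra R A + cdg_module A M
  for R :: "('r, 'z) ring_scheme" and A :: "('r, 'a) cdg_alg" and M :: "('a, 'm) cdg_mod" +
  fixes e :: "int \<Rightarrow> 'm \<Rightarrow> 'u"
  assumes inj: "\<And>p. inj_on (e p) (mel M p)"
begin

lemma transport_simps:
  "mel (transport e M) p = e p ` mel M p"
  "\<zero>[transport e M,p] = e p \<zero>[M,p]"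
  "\<lbrakk>x \<in> mel M p; y \<in> mel M p\<rbrakk> \<Longrightarrow> e p x \<oplus>[transport e M,p] e p y = e p (x \<oplus>[M,p] y)"
  "x \<in> mel M q \<Longrightarrow> mact (transport e M) p q a (e q x) = e (p + q) (mact M p q a x)"
  "x \<in> mel M q \<Longrightarrow> mdiff (transport e M) q (e q x) = e (q + 1) (mdiff M q x)"
  using inj by (simp_all add: transport_def Let_def)

lemma inv_into_e [simp]: "x \<in> mel M p \<Longrightarrow> inv_into (mel M p) (e p) (e p x) = x"
  by (simp add: inj)

lemma transport_inv_e [simp]: "x \<in> mel M p \<Longrightarrow> transport_inv e M p (e p x) = x"
  by (simp add: transport_inv_def)

lemma transport_cdg_module: "cdg_module A (transport e M)"
  by (rule cdg_module_image[OF cdg_algebra_axioms pre_cdg_module, where \<pi>=e])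
    (simp_all add: transport_simps mdiff_mdiff)

lemma transport_map: "chain_map A M (transport e M) (transport_map e M)"
  by (rule chain_mapI) (simp_all add: transport_map_def transport_simps)

lemma transport_inv: "chain_map A (transport e M) M (transport_inv e M)"
proof (rule chain_mapI)
  show "transport_inv e M q \<in> extensional (mel (transport e M) q)" for q
    by (simp add: transport_inv_def transport_simps)
qed (auto simp: transport_simps)

lemma transport_inv_map: "comp_map M (transport_inv e M) (transport_map e M) = id_map M"
  by (rule graded_map_eqI[where M=M]) (simp_all add: transport_map_def transport_inv_def inj)

lemma transport_map_inv: "comp_map (transport e M) (transport_map e M) (transport_inv e M) = id_map (transport e M)"
proof (rule graded_map_eqI[where M="transport e M"])
  fix q x assume "x \<in> mel (transport e M) q"
  then obtain y where "x = e q y" "y \<in> mel M q" by (auto simp: transport_simps)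
  then show "comp_map (transport e M) (transport_map e M) (transport_inv e M) q x = id_map (transport e M) q x"
    by (simp add: transport_simps transport_map_def)
qed simp_all

end

section \<open>Shifts\<close>

lemma shift_simps [simp]:
  "mcomp (shift l M) p = mcomp M (p + l)"
  "mact (shift l M) p q a m = sign_of (mcomp M (p + q + l)) (l * p) (mact M p (q + l) a m)"
  "mdiff (shift l M) p m = sign_of (mcomp M (p + 1 + l)) l (mdiff M (p + l) m)"
  by (simp_all add: shift_def)

text \<open>Passing from a to d a changes the factor (-1)^(l p) by (-1)^l, which is also the sign of
  the shifted differential, so the Leibniz rule survives. On d^2 and on the action of c, both of
  even degree, the signs disappear.\<close>

lemma shift_cdg_module:
  assumes A: "cdg_algebra R A" and M: "cdg_module A M"
  shows "cdg_module A (shift l M)"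
proof -
  interpret A: cdg_algebra R A by (rule A)
  interpret M: cdg_module A M by (rule M)
  have c: "mact M p (q + l) a m \<in> mel M (p + q + l)"
    if "a \<in> ael A p" "m \<in> mel M (q + l)" for p q a m
    using that by simp
  show ?thesis
  proof (rule cdg_module.intro; unfold shift_simps)
    fix p q a m assume a: "a \<in> ael A p" and m: "m \<in> mel M (q + l)"
    have 1: "mdiff M (p + q + l) (sign_of (mcomp M (p + q + l)) (l * p) (mact M p (q + l) a m))
      = sign_of (mcomp M (p + q + 1 + l)) (l * p) (mact M (p + 1) (q + l) (adiff A p a) m \<oplus>[M,p + q + 1 + l]
        sign_of (mcomp M (p + q + 1 + l)) p (mact M p (q + 1 + l) a (mdiff M (q + l) m)))"
      using a m by (simp add: M.mdiff_sign[where s="p + q + 1 + l"] M.mdiff_act'[where u="p + q + 1 + l" and v="q + 1 + l"])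
    have 2: "mact M p (q + 1 + l) a (sign_of (mcomp M (q + 1 + l)) l (mdiff M (q + l) m))
      = sign_of (mcomp M (p + q + 1 + l)) l (mact M p (q + 1 + l) a (mdiff M (q + l) m))"
      using a m by (simp add: M.act_sign[where s="p + q + 1 + l"])
    have cc: "mact M (p + 1) (q + l) (adiff A p a) m \<in> mel M (p + q + 1 + l)"
       "mact M p (q + 1 + l) a (mdiff M (q + l) m) \<in> mel M (p + q + 1 + l)"
      using a m by simp_all
    have 3: "p + 1 + q + l = p + q + 1 + l" "p + (q + 1) + l = p + q + 1 + l" by simp_all
    show "sign_of (mcomp M (p + q + 1 + l)) l (mdiff M (p + q + l) (sign_of (mcomp M (p + q + l)) (l * p) (mact M p (q + l) a m)))
     = sign_of (mcomp M (p + 1 + q + l)) (l * (p + 1)) (mact M (p + 1) (q + l) (adiff A p a) m) \<oplus>[M,p + q + 1 + l]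
       sign_of (mcomp M (p + q + 1 + l)) p (sign_of (mcomp M (p + (q + 1) + l)) (l * p)
         (mact M p (q + 1 + l) a (sign_of (mcomp M (q + 1 + l)) l (mdiff M (q + l) m))))"
      unfolding 1 2 3 using cc
      by (simp only: M.G.sign_of_add M.G.sign_of_sign_of M.G.sign_of_closed)
        (cases "even l"; cases "even p"; simp add: sign_of_even sign_of_odd)
  next
    fix p q s a b m
    assume a: "a \<in> ael A p" "b \<in> ael A q" and m: "m \<in> mel M (s + l)"
    have "mact M p (q + s + l) a (sign_of (mcomp M (q + s + l)) (l * q) (mact M q (s + l) b m))
      = sign_of (mcomp M (p + q + s + l)) (l * q) (mact M (p + q) (s + l) (amult A p q a b) m)"
      using a m M.act_assoc[of a p b q m "s + l"] by (simp add: M.act_sign[where s="p + q + s + l"] add.assoc)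
    then show "sign_of (mcomp M (p + q + s + l)) (l * (p + q)) (mact M (p + q) (s + l) (amult A p q a b) m)
      = sign_of (mcomp M (p + (q + s) + l)) (l * p) (mact M p (q + s + l) a (sign_of (mcomp M (q + s + l)) (l * q) (mact M q (s + l) b m)))"
      using a m by (simp add: distrib_left add.assoc[symmetric])
  next
    fix p m assume m: "m \<in> mel M (p + l)"
    show "sign_of (mcomp M (0 + p + l)) (l * 0) (mact M 0 (p + l) (aone A) m) = m"
      using m by (simp add: sign_of_even M.act_one)
    show "sign_of (mcomp M (p + 1 + 1 + l)) l (mdiff M (p + 1 + l) (sign_of (mcomp M (p + 1 + l)) l (mdiff M (p + l) m)))
       = sign_of (mcomp M (2 + p + l)) (l * 2) (mact M 2 (p + l) (acurv A) m)"
    proof -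
      have 3: "p + 1 + 1 + l = p + 2 + l" "2 + p + l = p + 2 + l" by simp_all
      have 1: "mdiff M (p + l) m \<in> mel M (p + 1 + l)" using m by simp
      have 2: "mact M 2 (p + l) (acurv A) m \<in> mel M (p + 2 + l)" using m by simp
      have 4: "mdiff M (p + 1 + l) (mdiff M (p + l) m) = mact M 2 (p + l) (acurv A) m"
        by (rule M.mdiff_mdiff'[OF m]) simp
      have 5: "mdiff M (p + 1 + l) (sign_of (mcomp M (p + 1 + l)) l (mdiff M (p + l) m))
        = sign_of (mcomp M (p + 2 + l)) l (mact M 2 (p + l) (acurv A) m)"
        unfolding 4[symmetric] by (rule M.mdiff_sign[OF 1]) simp
      show ?thesis
        unfolding 3 5 M.G.sign_of_sign_of[OF 2] by (simp add: sign_of_even)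
    qed
  next
    fix p m m' assume m: "m \<in> mel M (p + l)" "m' \<in> mel M (p + l)"
    have "mdiff M (p + l) (m \<oplus>[M,p + l] m') = mdiff M (p + l) m \<oplus>[M,p + 1 + l] mdiff M (p + l) m'"
      using M.mdiff_add[OF m] by (simp add: algebra_simps)
    then show "sign_of (mcomp M (p + 1 + l)) l (mdiff M (p + l) (m \<oplus>[M,p + l] m'))
      = sign_of (mcomp M (p + 1 + l)) l (mdiff M (p + l) m) \<oplus>[M,p + 1 + l] sign_of (mcomp M (p + 1 + l)) l (mdiff M (p + l) m')"
      using m by (simp add: M.G.sign_of_add)
  next
    fix p q a b m
    assume a: "a \<in> ael A p" "b \<in> ael A p" and m: "m \<in> mel M (q + l)"
    then show "sign_of (mcomp M (p + q + l)) (l * p) (mact M p (q + l) (a \<oplus>[acomp A p] b) m)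
      = sign_of (mcomp M (p + q + l)) (l * p) (mact M p (q + l) a m) \<oplus>[M,p + q + l]
        sign_of (mcomp M (p + q + l)) (l * p) (mact M p (q + l) b m)"
      using M.act_l_distr[OF a m] by (simp add: M.G.sign_of_add add.assoc[symmetric])
  next
    fix p q a m m'
    assume a: "a \<in> ael A p" and m: "m \<in> mel M (q + l)" "m' \<in> mel M (q + l)"
    then show "sign_of (mcomp M (p + q + l)) (l * p) (mact M p (q + l) a (m \<oplus>[M,q + l] m'))
      = sign_of (mcomp M (p + q + l)) (l * p) (mact M p (q + l) a m) \<oplus>[M,p + q + l]
        sign_of (mcomp M (p + q + l)) (l * p) (mact M p (q + l) a m')"
      using M.act_r_distr[OF a m] by (simp add: M.G.sign_of_add add.assoc[symmetric])
  qed (simp_all add: M.comp_group c)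
qed

section \<open>Mapping cones and cocones\<close>

lemma cone_simps [simp]:
  "mel (cone M N f) p = mel N p \<times> mel M (p + 1)"
  "\<zero>[cone M N f,p] = (\<zero>[N,p], \<zero>[M,p + 1])"
  "(y, x) \<oplus>[cone M N f,p] (y', x') = (y \<oplus>[N,p] y', x \<oplus>[M,p + 1] x')"
  "mact (cone M N f) p q a (y, x) = (mact N p q a y, sign_of (mcomp M (p + q + 1)) p (mact M p (q + 1) a x))"
  "mdiff (cone M N f) p (y, x) = (mdiff N p y \<oplus>[N,p + 1] f (p + 1) x, \<ominus>[M,p + 2] mdiff M (p + 1) x)"
  by (simp_all add: cone_def sum_mod_def)

lemma abelian_group_pairs:
  assumes "abelian_group G" "abelian_group H" "carrier K = carrier G \<times> carrier H" "zero K = (zero G, zero H)"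
    "\<And>x y x' y'. (x, y) \<oplus>[K] (x', y') = (x \<oplus>[G] x', y \<oplus>[H] y')"
  shows "abelian_group K"
proof -
  interpret G: abelian_group G by fact
  interpret H: abelian_group H by fact
  show ?thesis
  proof (rule abelian_groupI)
    fix z assume "z \<in> carrier K"
    then obtain x y where "z = (x, y)" "x \<in> carrier G" "y \<in> carrier H" by (auto simp: assms)
    then show "\<exists>w\<in>carrier K. w \<oplus>[K] z = \<zero>[K]"
      by (intro bexI[of _ "(\<ominus>[G] x, \<ominus>[H] y)"]) (simp_all add: assms G.l_neg H.l_neg)
  qed (auto simp: assms G.a_ac H.a_ac)
qed

lemma pair_neg:
  assumes "abelian_group G" "abelian_group H" "carrier K = carrier G \<times> carrier H" "zero K = (zero G, zero H)"
    "\<And>x y x' y'. (x, y) \<oplus>[K] (x', y') = (x \<oplus>[G] x', y \<oplus>[H] y')"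
    "x \<in> carrier G" "y \<in> carrier H"
  shows "\<ominus>[K] (x, y) = (\<ominus>[G] x, \<ominus>[H] y)"
proof -
  interpret G: abelian_group G by fact
  interpret H: abelian_group H by fact
  interpret K: abelian_group K by (rule abelian_group_pairs[OF assms(1-5)])
  show ?thesis
    by (rule K.minus_equality) (simp_all add: assms G.l_neg H.l_neg)
qed

context cdg_map
begin

lemma cone_group: "abelian_group (mcomp (cone M N f) p)"
  by (rule abelian_group_pairs[OF N.comp_group M.comp_group]) simp_all

lemma cone_neg: "\<lbrakk>y \<in> mel N p; x \<in> mel M (p + 1)\<rbrakk>
  \<Longrightarrow> \<ominus>[cone M N f,p] (y, x) = (\<ominus>[N,p] y, \<ominus>[M,p + 1] x)"
  by (rule pair_neg[OF N.comp_group M.comp_group]) simp_all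

lemma cone_sign: "\<lbrakk>y \<in> mel N p; x \<in> mel M (p + 1)\<rbrakk>
  \<Longrightarrow> sign_of (mcomp (cone M N f) p) r (y, x) = (sign_of (mcomp N p) r y, sign_of (mcomp M (p + 1)) r x)"
  by (simp add: sign_of_def cone_neg)

text \<open>In the square of the differential the cross terms d f x and - f d x cancel because f is
  closed, and c acts on the shifted summand without a sign since its degree is even.\<close>

lemma cone_cdg_module:
  assumes A: "cdg_algebra R A"
  shows "cdg_module A (cone M N f)"
proof -
  interpret A: cdg_algebra R A by (rule A)
  note shiftM = shift_cdg_module[OF A M.cdg_module_axioms, of 1]
  interpret S: cdg_module A "shift 1 M" by (rule shiftM)
  show ?thesis
  proof (rule cdg_module.intro)
    show "abelian_group (mcomp (cone M N f) p)" for p by (rule cone_group)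
  next
    fix p q a m assume a: "a \<in> ael A p" and m: "m \<in> mel (cone M N f) q"
    then obtain y x where m: "m = (y, x)" "y \<in> mel N q" "x \<in> mel M (q + 1)" by auto
    then show "mact (cone M N f) p q a m \<in> mel (cone M N f) (p + q)" using a by simp
    have E: "p + 1 + q + 1 = p + q + 2" "p + (q + 1) + 1 = p + q + 2" "q + 1 + 1 = q + 2" "p + q + 1 + 1 = p + q + 2"
      "p + 1 + q = p + q + 1" "p + (q + 1) = p + q + 1"
      by simp_all
    have dy: "mdiff N q y \<in> mel N (q + 1)" "f (q + 1) x \<in> mel N (q + 1)"
      "mdiff M (q + 1) x \<in> mel M (q + 2)" using m by simp_all
    have c: "mact N p q a y \<in> mel N (p + q)" "mact M p (q + 1) a x \<in> mel M (p + q + 1)"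
      "mact N (p + 1) q (adiff A p a) y \<in> mel N (p + q + 1)"
      "mact M (p + 1) (q + 1) (adiff A p a) x \<in> mel M (p + q + 2)"
      "mact N p (q + 1) a (mdiff N q y) \<in> mel N (p + q + 1)"
      "mact N p (q + 1) a (f (q + 1) x) \<in> mel N (p + q + 1)"
      "mact M p (q + 2) a (mdiff M (q + 1) x) \<in> mel M (p + q + 2)"
      using a m dy by (simp_all add: E)
    have e1: "mdiff N (p + q) (mact N p q a y) \<oplus>[N,p + q + 1] f (p + q + 1) (sign_of (mcomp M (p + q + 1)) p (mact M p (q + 1) a x))
      = mact N (p + 1) q (adiff A p a) y \<oplus>[N,p + q + 1]
        sign_of (mcomp N (p + q + 1)) p (mact N p (q + 1) a (mdiff N q y \<oplus>[N,q + 1] f (q + 1) x))"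
    proof -
      have 1: "f (p + q + 1) (sign_of (mcomp M (p + q + 1)) p (mact M p (q + 1) a x)) = sign_of (mcomp N (p + q + 1)) p (mact N p (q + 1) a (f (q + 1) x))"
        using act[OF a m(3), of "p + q + 1"] c(2) by (simp add: sign E)
      have 2: "mact N p (q + 1) a (mdiff N q y \<oplus>[N,q + 1] f (q + 1) x) = mact N p (q + 1) a (mdiff N q y) \<oplus>[N,p + q + 1] mact N p (q + 1) a (f (q + 1) x)"
        using N.act_r_distr[OF a dy(1,2)] by (simp only: E)
      show ?thesis unfolding 1 2 N.mdiff_act[OF a m(2)]
        using c by (simp add: N.G.sign_of_add N.G.a_assoc)
    qed
    have e2: "\<ominus>[M,p + q + 2] mdiff M (p + q + 1) (sign_of (mcomp M (p + q + 1)) p (mact M p (q + 1) a x))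
      = sign_of (mcomp M (p + q + 2)) (p + 1) (mact M (p + 1) (q + 1) (adiff A p a) x) \<oplus>[M,p + q + 2]
        sign_of (mcomp M (p + q + 2)) p (sign_of (mcomp M (p + q + 2)) p (mact M p (q + 2) a (\<ominus>[M,q + 2] mdiff M (q + 1) x)))"
    proof -
      have 1: "mdiff M (p + q + 1) (sign_of (mcomp M (p + q + 1)) p (mact M p (q + 1) a x)) = sign_of (mcomp M (p + q + 2)) p
         (mact M (p + 1) (q + 1) (adiff A p a) x \<oplus>[M,p + q + 2] sign_of (mcomp M (p + q + 2)) p (mact M p (q + 2) a (mdiff M (q + 1) x)))"
        using M.mdiff_sign[OF c(2), of "p + q + 2"] M.mdiff_act'[OF a m(3), of "p + q + 1" "p + q + 2" "q + 2"] by simp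
      have 2: "mact M p (q + 2) a (\<ominus>[M,q + 2] mdiff M (q + 1) x) = \<ominus>[M,p + q + 2] mact M p (q + 2) a (mdiff M (q + 1) x)"
        by (rule M.act_neg[OF a dy(3)]) simp
      show ?thesis unfolding 1 2
        using c by (cases "even p"; simp add: sign_of_even sign_of_odd M.G.minus_add)
    qed
    have s1: "sign_of (mcomp N (p + q + 1)) p z \<in> mel N (p + q + 1)" if "z \<in> mel N (p + q + 1)" for z using that by simp
    have s2: "mact N p (q + 1) a (mdiff N q y \<oplus>[N,q + 1] f (q + 1) x) \<in> mel N (p + q + 1)"
      "sign_of (mcomp M (p + q + 2)) p (mact M p (q + 2) a (\<ominus>[M,q + 2] mdiff M (q + 1) x)) \<in> mel M (p + q + 1 + 1)"
      using a dy by (simp_all add: E M.G.sign_of_closed)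
    show "mdiff (cone M N f) (p + q) (mact (cone M N f) p q a m) = mact (cone M N f) (p + 1) q (adiff A p a) m
      \<oplus>[cone M N f,p + q + 1] sign_of (mcomp (cone M N f) (p + q + 1)) p (mact (cone M N f) p (q + 1) a (mdiff (cone M N f) q m))"
      using e1 e2 cone_sign[OF s2, of p] unfolding m(1) by (simp only: cone_simps E)
  next
    fix p q a b m
    assume a: "a \<in> ael A p" "b \<in> ael A p" and m: "m \<in> mel (cone M N f) q"
    then show "mact (cone M N f) p q (a \<oplus>[acomp A p] b) m = mact (cone M N f) p q a m \<oplus>[cone M N f,p + q] mact (cone M N f) p q b m"
      using M.act_l_distr[OF a, of _ "q + 1"] N.act_l_distr[OF a, of _ q] by (auto simp: M.G.sign_of_add add.assoc)
  next
    fix p q a m m'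
    assume a: "a \<in> ael A p" and m: "m \<in> mel (cone M N f) q" "m' \<in> mel (cone M N f) q"
    then show "mact (cone M N f) p q a (m \<oplus>[cone M N f,q] m') = mact (cone M N f) p q a m \<oplus>[cone M N f,p + q] mact (cone M N f) p q a m'"
      using M.act_r_distr[OF a, of _ "q + 1"] N.act_r_distr[OF a, of _ q] by (auto simp: M.G.sign_of_add add.assoc)
  next
    fix p q s a b m
    assume a: "a \<in> ael A p" "b \<in> ael A q" and m: "m \<in> mel (cone M N f) s"
    then obtain y x where m: "m = (y, x)" "y \<in> mel N s" "x \<in> mel M (s + 1)" by auto
    have E: "p + (q + s) + 1 = p + q + s + 1" "p + (q + s) = p + q + s" "p + (q + s + 1) = p + q + s + 1" by simp_all
    have c: "mact M q (s + 1) b x \<in> mel M (q + s + 1)" using a m by simp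
    have c': "mact M p (q + s + 1) a (mact M q (s + 1) b x) \<in> mel M (p + q + s + 1)" using a(1) c by simp
    have 1: "mact M p (q + s + 1) a (sign_of (mcomp M (q + s + 1)) q (mact M q (s + 1) b x))
      = sign_of (mcomp M (p + q + s + 1)) q (mact M p (q + s + 1) a (mact M q (s + 1) b x))"
      by (rule M.act_sign[OF a(1) c]) simp
    have 2: "mact M (p + q) (s + 1) (amult A p q a b) x = mact M p (q + s + 1) a (mact M q (s + 1) b x)"
      using M.act_assoc[OF a m(3)] by (simp add: add.assoc)
    show "mact (cone M N f) (p + q) s (amult A p q a b) m = mact (cone M N f) p (q + s) a (mact (cone M N f) q s b m)"
      unfolding m(1) cone_simps E 1 2 M.G.sign_of_sign_of[OF c'] using N.act_assoc[OF a m(2)] by simp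
  next
    fix p m assume m: "m \<in> mel (cone M N f) p"
    then obtain y x where m: "m = (y, x)" "y \<in> mel N p" "x \<in> mel M (p + 1)" by auto
    show "mact (cone M N f) 0 p (aone A) m = m"
      using m by (simp add: N.act_one M.act_one sign_of_even)
    show "mdiff (cone M N f) p m \<in> mel (cone M N f) (p + 1)"
      using m by (simp add: add.assoc)
    have E: "p + 1 + 1 = p + 2" "p + 1 + 2 = p + 3" "2 + p = p + 2" "p + 2 + 1 = p + 3" by simp_all
    have c: "mdiff N p y \<in> mel N (p + 1)" "f (p + 1) x \<in> mel N (p + 1)"
      "mdiff M (p + 1) x \<in> mel M (p + 2)" using m by simp_all
    have 1: "mdiff N (p + 1) (mdiff N p y \<oplus>[N,p + 1] f (p + 1) x) \<oplus>[N,p + 2] f (p + 2) (\<ominus>[M,p + 2] mdiff M (p + 1) x)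
      = mact N 2 p (acurv A) y"
    proof -
      have "mdiff N (p + 1) (mdiff N p y \<oplus>[N,p + 1] f (p + 1) x) = mdiff N (p + 1) (mdiff N p y) \<oplus>[N,p + 2] mdiff N (p + 1) (f (p + 1) x)"
        using N.mdiff_add[OF c(1,2)] by (simp only: E)
      moreover have "f (p + 2) (\<ominus>[M,p + 2] mdiff M (p + 1) x) = \<ominus>[N,p + 2] mdiff N (p + 1) (f (p + 1) x)"
        using c(3) diff[OF m(3), of "p + 2"] by (simp add: neg)
      moreover have "mdiff N (p + 1) (mdiff N p y) = mact N 2 p (acurv A) y" using N.mdiff_mdiff[OF m(2)] .
      moreover have "mact N 2 p (acurv A) y \<oplus>[N,p + 2] mdiff N (p + 1) (f (p + 1) x) \<oplus>[N,p + 2] \<ominus>[N,p + 2] mdiff N (p + 1) (f (p + 1) x) = mact N 2 p (acurv A) y"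
        by (rule N.G.group_eqI[where p="p + 2"], (rule N.G.rep_rules | simp add: m c)+)
      ultimately show ?thesis by simp
    qed
    have 2: "\<ominus>[M,p + 3] mdiff M (p + 2) (\<ominus>[M,p + 2] mdiff M (p + 1) x) = sign_of (mcomp M (p + 3)) 2 (mact M 2 (p + 1) (acurv A) x)"
    proof -
      have "mdiff M (p + 2) (\<ominus>[M,p + 2] mdiff M (p + 1) x) = \<ominus>[M,p + 3] mdiff M (p + 2) (mdiff M (p + 1) x)"
        by (rule M.mdiff_neg[OF c(3)]) simp
      moreover have "mdiff M (p + 2) (mdiff M (p + 1) x) = mact M 2 (p + 1) (acurv A) x"
        by (rule M.mdiff_mdiff'[OF m(3)]) simp
      ultimately show ?thesis using m by (simp add: sign_of_even)
    qed
    show "mdiff (cone M N f) (p + 1) (mdiff (cone M N f) p m) = mact (cone M N f) 2 p (acurv A) m"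
      using 1 2 unfolding m(1) by (simp only: cone_simps E)
  next
    fix p m m' assume m: "m \<in> mel (cone M N f) p" "m' \<in> mel (cone M N f) p"
    then obtain y x y' x' where m: "m = (y, x)" "y \<in> mel N p" "x \<in> mel M (p + 1)"
       "m' = (y', x')" "y' \<in> mel N p" "x' \<in> mel M (p + 1)" by auto
    have E: "p + 1 + 1 = p + 2" by simp
    have "mdiff M (p + 1) (x \<oplus>[M,p + 1] x') = mdiff M (p + 1) x \<oplus>[M,p + 2] mdiff M (p + 1) x'"
      using M.mdiff_add[OF m(3,6)] by (simp only: E)
    then show "mdiff (cone M N f) p (m \<oplus>[cone M N f,p] m') = mdiff (cone M N f) p m \<oplus>[cone M N f,p + 1] mdiff (cone M N f) p m'"
      unfolding m(1,4) cone_simps E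
      using m by (simp add: N.mdiff_add add M.G.minus_add N.G.a_ac)
  qed
qed

definition cone_in :: "int \<Rightarrow> 'n \<Rightarrow> 'n \<times> 'm" where
  "cone_in = (\<lambda>q. \<lambda>y\<in>mel N q. (y, \<zero>[M,q + 1]))"

lemma cone_in_chain_map: "chain_map A N (cone M N f) cone_in"
proof (rule chain_mapI)
  fix r q a y assume a: "a \<in> ael A r" and y: "y \<in> mel N q"
  have "mact M r (q + 1) a \<zero>[M,q + 1] = \<zero>[M,r + q + 1]" by (rule M.act_zero[OF a]) simp
  then show "cone_in (r + q) (mact N r q a y) = mact (cone M N f) r q a (cone_in q y)"
    using a y by (simp add: cone_in_def)
next
  fix q y assume y: "y \<in> mel N q"
  have "mdiff M (q + 1) \<zero>[M,q + 1] = \<zero>[M,q + 2]" using M.mdiff_zero[of "q + 1"] by (simp add: add.assoc)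
  then show "cone_in (q + 1) (mdiff N q y) = mdiff (cone M N f) q (cone_in q y)"
    using y by (simp add: cone_in_def add.assoc)
qed (simp_all add: cone_in_def)

text \<open>The homotopy is x \<mapsto> (0, x), whose boundary at x is (f x, - d x + d x).\<close>

lemma cone_in_null: "null_homotopic A M (cone M N f) (comp_map M cone_in f)"
  unfolding null_homotopic_def
proof (intro exI conjI)
  let ?h = "\<lambda>q. \<lambda>x\<in>mel M q. (\<zero>[N,q - 1], x)"
  show "homotopy A M (cone M N f) ?h"
  proof (rule homotopyI)
    fix r q a x assume a: "a \<in> ael A r" and x: "x \<in> mel M q"
    have c: "mact M r q a x \<in> mel M (r + q)" using a x by simp
    have E: "r + (q - 1) + 1 = r + q" "q - 1 + 1 = q" "r + q - 1 + 1 = r + q" by simp_all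
    have z: "mact N r (q - 1) a \<zero>[N,q - 1] = \<zero>[N,r + q - 1]" by (rule N.act_zero[OF a]) simp
    have "sign_of (mcomp (cone M N f) (r + q - 1)) r (\<zero>[N,r + q - 1], sign_of (mcomp M (r + q)) r (mact M r q a x))
      = (\<zero>[N,r + q - 1], mact M r q a x)"
      using cone_sign[of "\<zero>[N,r + q - 1]" "r + q - 1" "sign_of (mcomp M (r + q)) r (mact M r q a x)" r] c
      by (simp add: E) (simp add: sign_of_even)
    then show "?h (r + q) (mact M r q a x) = sign_of (mcomp (cone M N f) (r + q - 1)) r (mact (cone M N f) r (q - 1) a (?h q x))"
      using x c z by (simp add: E)
  qed simp_all
  show "comp_map M cone_in f = boundary M (cone M N f) ?h"
  proof (rule graded_map_eqI[where M=M])
    fix q x assume x: "x \<in> mel M q"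
    have E: "q - 1 + 1 = q" "q - 1 + 2 = q + 1" "q + 1 - 1 = q" by simp_all
    have "mdiff N (q - 1) \<zero>[N,q - 1] = \<zero>[N,q]" using N.mdiff_zero[of "q - 1"] by simp
    then show "comp_map M cone_in f q x = boundary M (cone M N f) ?h q x"
      using x by (simp add: cone_in_def E M.G.l_neg)
  qed simp_all
qed

text \<open>Split a null-homotopy into components h1 and h2. Its second equation says that h2 is a
  closed map V \<rightarrow> M, the first that h1 is a homotopy between k and f h2. This is
  exactness of maps out of V at N, obtained without the triangulated structure.\<close>

lemma cone_lift:
  assumes V: "cdg_module A V" and k: "chain_map A V N k" and nul: "null_homotopic A V (cone M N f) (comp_map V cone_in k)"
  shows "\<exists>k'. chain_map A V M k' \<and> homotopic A V N k (comp_map V f k')"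
proof -
  interpret V: cdg_module A V by (rule V)
  interpret k: cdg_map A V N k by (rule cdg_mapI[OF V N.cdg_module_axioms k])
  obtain h where h: "homotopy A V (cone M N f) h" "comp_map V cone_in k = boundary V (cone M N f) h"
    using nul unfolding null_homotopic_def by blast
  define h1 h2 where "h1 q = (\<lambda>x\<in>mel V q. fst (h q x))" and "h2 q = (\<lambda>x\<in>mel V q. snd (h q x))" for q
  have hc: "h q x \<in> mel N (q - 1) \<times> mel M q" if "x \<in> mel V q" for q x
  proof -
    have "h q x \<in> mel (cone M N f) (q - 1)" using h(1) that unfolding homotopy_def by blast
    then show ?thesis by simp
  qed
  have hh: "h q x = (h1 q x, h2 q x)" "h1 q x \<in> mel N (q - 1)" "h2 q x \<in> mel M q" if "x \<in> mel V q" for q x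
    using hc[OF that] that by (auto simp: h1_def h2_def mem_Times_iff)
  have add': "h1 q (x \<oplus>[V,q] y) = h1 q x \<oplus>[N,q - 1] h1 q y \<and> h2 q (x \<oplus>[V,q] y) = h2 q x \<oplus>[M,q] h2 q y"
    if x: "x \<in> mel V q" "y \<in> mel V q" for q x y
  proof -
    have "h q (x \<oplus>[V,q] y) = h q x \<oplus>[cone M N f,q - 1] h q y" using h(1) x unfolding homotopy_def by blast
    then show ?thesis using x by (simp add: hh)
  qed
  have act': "h1 (r + q) (mact V r q a x) = sign_of (mcomp N (r + q - 1)) r (mact N r (q - 1) a (h1 q x)) \<and>
     h2 (r + q) (mact V r q a x) = mact M r q a (h2 q x)"
    if a: "a \<in> ael A r" and x: "x \<in> mel V q" for r q a x
  proof -
    have "h (r + q) (mact V r q a x) = sign_of (mcomp (cone M N f) (r + q - 1)) r (mact (cone M N f) r (q - 1) a (h q x))"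
      using h(1) a x unfolding homotopy_def by blast
    moreover have "mact (cone M N f) r (q - 1) a (h q x) = (mact N r (q - 1) a (h1 q x), sign_of (mcomp M (r + q)) r (mact M r q a (h2 q x)))"
      using x by (simp add: hh)
    moreover have "mact N r (q - 1) a (h1 q x) \<in> mel N (r + q - 1)" "mact M r q a (h2 q x) \<in> mel M (r + q)"
      using a x by (simp_all add: hh)
    ultimately show ?thesis using a x by (simp add: hh cone_sign sign_of_even)
  qed
  have bd: "k q x = mdiff N (q - 1) (h1 q x) \<oplus>[N,q] f q (h2 q x) \<oplus>[N,q] h1 (q + 1) (mdiff V q x) \<and>
     \<ominus>[M,q + 1] mdiff M q (h2 q x) \<oplus>[M,q + 1] h2 (q + 1) (mdiff V q x) = \<zero>[M,q + 1]"
    if x: "x \<in> mel V q" for q x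
  proof -
    have E: "q - 1 + 1 = q" "q - 1 + 2 = q + 1" "q + 1 - 1 = q" by simp_all
    have "comp_map V cone_in k q x = boundary V (cone M N f) h q x" using h(2) by simp
    then show ?thesis using x by (simp add: hh cone_in_def E)
  qed
  have "chain_map A V M h2"
  proof (rule chain_mapI)
    show "h2 q \<in> extensional (mel V q)" for q by (simp add: h2_def)
    fix q x assume x: "x \<in> mel V q"
    then have c: "mdiff M q (h2 q x) \<in> mel M (q + 1)" "h2 (q + 1) (mdiff V q x) \<in> mel M (q + 1)"
      using hh(3)[of "mdiff V q x" "q + 1"] by (simp_all add: hh)
    have "\<ominus>[M,q + 1] (\<ominus>[M,q + 1] mdiff M q (h2 q x)) = h2 (q + 1) (mdiff V q x)"
      using bd[OF x] c by (intro M.G.minus_equality) (simp_all add: M.G.a_comm)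
    then show "h2 (q + 1) (mdiff V q x) = mdiff M q (h2 q x)" using c by simp
  qed (simp_all add: add' act' hh)
  moreover have "homotopy A V N h1"
  proof (rule homotopyI)
    show "h1 q \<in> extensional (mel V q)" for q by (simp add: h1_def)
  qed (simp_all add: add' act' hh)
  then have "homotopic A V N k (comp_map V f h2)"
    unfolding homotopic_def
  proof (intro exI[of _ h1] conjI allI ballI)
    fix q x assume x: "x \<in> mel V q"
    have "h1 (q + 1) (mdiff V q x) \<in> mel N q" using hh(2)[of "mdiff V q x" "q + 1"] x by simp
    then show "k q x = comp_map V f h2 q x \<oplus>[N,q] (mdiff N (q - 1) (h1 q x) \<oplus>[N,q] h1 (q + 1) (mdiff V q x))"
      using bd[OF x] x by (simp add: hh N.G.a_ac)
  qed
  ultimately show ?thesis by blast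
qed

text \<open>The homotopy fibre of f, taken as a shifted cone so that the module axioms and
  n-acyclicity are inherited from cones and shifts.\<close>

abbreviation cocone :: "('a, 'n \<times> 'm) cdg_mod" where
  "cocone \<equiv> shift (- 1) (cone M N f)"

definition cocone_out :: "int \<Rightarrow> 'n \<times> 'm \<Rightarrow> 'm" where
  "cocone_out = (\<lambda>q. \<lambda>z\<in>mel cocone q. snd z)"

text \<open>The sign of the shift by -1 and that of the shift inside the cone cancel on the summand
  M, which makes \<open>cocone_out\<close> linear in degree 0; only the former remains on N.\<close>

lemma cocone_simps:
  "mel cocone q = mel N (q - 1) \<times> mel M q"
  "(y, x) \<oplus>[cocone,q] (y', x') = (y \<oplus>[N,q - 1] y', x \<oplus>[M,q] x')"
  "\<lbrakk>a \<in> ael A r; y \<in> mel N (q - 1); x \<in> mel M q\<rbrakk>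
    \<Longrightarrow> mact cocone r q a (y, x) = (sign_of (mcomp N (r + q - 1)) r (mact N r (q - 1) a y), mact M r q a x)"
  "\<lbrakk>y \<in> mel N (q - 1); x \<in> mel M q\<rbrakk>
    \<Longrightarrow> mdiff cocone q (y, x) = (\<ominus>[N,q] (mdiff N (q - 1) y \<oplus>[N,q] f q x), mdiff M q x)"
proof -
  show "mel cocone q = mel N (q - 1) \<times> mel M q" by simp
  show "(y, x) \<oplus>[cocone,q] (y', x') = (y \<oplus>[N,q - 1] y', x \<oplus>[M,q] x')" by simp
  show "mact cocone r q a (y, x) = (sign_of (mcomp N (r + q - 1)) r (mact N r (q - 1) a y), mact M r q a x)"
    if "a \<in> ael A r" "y \<in> mel N (q - 1)" "x \<in> mel M q"
  proof -
    have c: "mact N r (q - 1) a y \<in> mel N (r + q - 1)" "mact M r q a x \<in> mel M (r + q)"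
      using that by simp_all
    then show ?thesis
      using cone_sign[of "mact N r (q - 1) a y" "r + q - 1" "sign_of (mcomp M (r + q)) r (mact M r q a x)" "- r"]
      by (simp add: sign_of_even) (simp add: sign_of_def)
  qed
  show "mdiff cocone q (y, x) = (\<ominus>[N,q] (mdiff N (q - 1) y \<oplus>[N,q] f q x), mdiff M q x)"
    if "y \<in> mel N (q - 1)" "x \<in> mel M q"
  proof -
    have E: "q - 1 + 1 = q" "q - 1 + 2 = q + 1" "q + 1 - 1 = q" "q + - 1 = q - 1" by simp_all
    have c: "mdiff N (q - 1) y \<oplus>[N,q] f q x \<in> mel N q" "\<ominus>[M,q + 1] mdiff M q x \<in> mel M (q + 1)"
      using that by simp_all
    show ?thesis using cone_neg[OF c] that by (simp add: E sign_of_odd)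
  qed
qed

lemma cocone_cdg_module: "cdg_algebra R A \<Longrightarrow> cdg_module A cocone"
  by (intro shift_cdg_module cone_cdg_module)

lemma cocone_out_chain_map: "chain_map A cocone M cocone_out"
proof (rule chain_mapI)
  show "cocone_out q \<in> extensional (mel cocone q)" for q by (simp add: cocone_out_def del: shift_simps)
  show "cocone_out q x \<in> mel M q" if "x \<in> mel cocone q" for q x
    using that unfolding cocone_out_def by (simp add: mem_Times_iff)
  have snd: "cocone_out q (y, x) = x" if "y \<in> mel N (q - 1)" "x \<in> mel M q" for q y x
    using that by (simp add: cocone_out_def)
  show "cocone_out q (z \<oplus>[cocone,q] w) = cocone_out q z \<oplus>[M,q] cocone_out q w"
    if "z \<in> mel cocone q" "w \<in> mel cocone q" for q z w
    using that unfolding cocone_simps(1) by (elim SigmaE) (simp only: cocone_simps snd N.G.a_closed M.G.a_closed)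
  show "cocone_out (r + q) (mact cocone r q a z) = mact M r q a (cocone_out q z)"
    if a: "a \<in> ael A r" and zc: "z \<in> mel cocone q" for r q a z
  proof -
    obtain y x where z: "z = (y, x)" "y \<in> mel N (q - 1)" "x \<in> mel M q" using zc unfolding cocone_simps(1) by blast
    have "sign_of (mcomp N (r + q - 1)) r (mact N r (q - 1) a y) \<in> mel N (r + q - 1)" "mact M r q a x \<in> mel M (r + q)"
      using a z by simp_all
    then show ?thesis unfolding z(1) cocone_simps(3)[OF a z(2,3)] snd[OF z(2,3)] by (rule snd)
  qed
  show "cocone_out (q + 1) (mdiff cocone q z) = mdiff M q (cocone_out q z)" if zc: "z \<in> mel cocone q" for q z
  proof -
    obtain y x where z: "z = (y, x)" "y \<in> mel N (q - 1)" "x \<in> mel M q" using zc unfolding cocone_simps(1) by blast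
    show ?thesis unfolding z(1) cocone_simps(4)[OF z(2,3)] snd[OF z(2,3)]
      by (rule snd) (use z in simp_all)
  qed
qed

text \<open>The homotopy is (y, x) \<mapsto> - y: its boundary at (y, x) is - d y + (d y + f
  x).\<close>

lemma cocone_out_null: "null_homotopic A cocone N (comp_map cocone f cocone_out)"
  unfolding null_homotopic_def
proof (intro exI conjI)
  let ?h = "\<lambda>q. \<lambda>z\<in>mel cocone q. \<ominus>[N,q - 1] fst z"
  have h: "?h q (y, x) = \<ominus>[N,s] y" if "y \<in> mel N s" "x \<in> mel M q" "s = q - 1" for q y x s
    using that by simp
  have ex: "\<exists>y\<in>mel N (q - 1). \<exists>x\<in>mel M q. z = (y, x)" if "z \<in> mel cocone q" for q z
    using that unfolding cocone_simps(1) by blast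
  show "homotopy A cocone N ?h"
  proof (rule homotopyI)
    fix q z assume "z \<in> mel cocone q"
    then show "?h q z \<in> mel N (q - 1)" by auto
  next
    fix q z w assume "z \<in> mel cocone q" "w \<in> mel cocone q"
    then obtain y x y' x' where z: "z = (y, x)" "y \<in> mel N (q - 1)" "x \<in> mel M q"
      "w = (y', x')" "y' \<in> mel N (q - 1)" "x' \<in> mel M q" using ex by metis
    then show "?h q (z \<oplus>[cocone,q] w) = ?h q z \<oplus>[N,q - 1] ?h q w"
      by (simp add: N.G.minus_add)
  next
    fix r q a z assume a: "a \<in> ael A r" and "z \<in> mel cocone q"
    then obtain y x where z: "z = (y, x)" "y \<in> mel N (q - 1)" "x \<in> mel M q" using ex by metis
    have c: "mact N r (q - 1) a y \<in> mel N (r + q - 1)" "mact M r q a x \<in> mel M (r + q)"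
      using a z by simp_all
    have "mact N r (q - 1) a (\<ominus>[N,q - 1] y) = \<ominus>[N,r + q - 1] mact N r (q - 1) a y"
      by (rule N.act_neg[OF a z(2)]) simp
    then show "?h (r + q) (mact cocone r q a z) = sign_of (mcomp N (r + q - 1)) r (mact N r (q - 1) a (?h q z))"
      unfolding z(1) cocone_simps(3)[OF a z(2,3)] h[OF z(2,3) refl]
      using c by (subst h) (simp_all, simp add: sign_of_def)
  qed simp_all
  show "comp_map cocone f cocone_out = boundary cocone N ?h"
  proof (rule graded_map_eqI[where M=cocone])
    fix q z assume zc: "z \<in> mel cocone q"
    then obtain y x where z: "z = (y, x)" "y \<in> mel N (q - 1)" "x \<in> mel M q" using ex by metis
    have dd: "mdiff N (q - 1) (\<ominus>[N,q - 1] y) = \<ominus>[N,q] mdiff N (q - 1) y"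
      by (rule N.mdiff_neg[OF z(2)]) simp
    have c: "mdiff N (q - 1) y \<in> mel N q" "f q x \<in> mel N q" using z by simp_all
    have hd: "?h (q + 1) (mdiff cocone q z) = mdiff N (q - 1) y \<oplus>[N,q] f q x"
      unfolding z(1) cocone_simps(4)[OF z(2,3)] using z c by (subst h[where s=q]) simp_all
    have "f q x = \<ominus>[N,q] mdiff N (q - 1) y \<oplus>[N,q] (mdiff N (q - 1) y \<oplus>[N,q] f q x)"
      by (rule N.G.group_eqI[where p=q], (rule N.G.rep_rules | simp add: c)+)
    moreover have "cocone_out q z = x" using z by (simp add: cocone_out_def)
    moreover have "?h q z = \<ominus>[N,q - 1] y" unfolding z(1) by (rule h[OF z(2,3) refl])
    ultimately show "comp_map cocone f cocone_out q z = boundary cocone N ?h q z"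
      unfolding map_simps(5)[OF zc] map_simps(1)[OF zc] hd using dd by simp
  qed (simp_all del: shift_simps)
qed

text \<open>A null-homotopy h of f k is exactly what is missing for k to factor: the lift is x
  \<mapsto> (- h x, k x). The factorisation holds on the nose and not merely up to homotopy.\<close>

lemma cocone_lift:
  assumes V: "cdg_module A V" and k: "chain_map A V M k" and nul: "null_homotopic A V N (comp_map V f k)"
  shows "\<exists>k'. chain_map A V cocone k' \<and> comp_map V cocone_out k' = k"
proof -
  interpret V: cdg_module A V by (rule V)
  interpret k: cdg_map A V M k by (rule cdg_mapI[OF V M.cdg_module_axioms k])
  obtain h where h: "homotopy A V N h" "comp_map V f k = boundary V N h"
    using nul unfolding null_homotopic_def by blast
  interpret h: cdg_homotopy A V N h by (rule cdg_homotopyI[OF V N.cdg_module_axioms h(1)])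
  define k' where "k' q = (\<lambda>x\<in>mel V q. (\<ominus>[N,q - 1] h q x, k q x))" for q
  have k': "k' q x = (\<ominus>[N,s] h q x, k q x)" if "x \<in> mel V q" "s = q - 1" for q x s
    using that by (simp add: k'_def)
  have hc: "\<ominus>[N,q - 1] h q x \<in> mel N (q - 1)" "k q x \<in> mel M q" if "x \<in> mel V q" for q x
    using that by simp_all
  have "chain_map A V cocone k'"
  proof (rule chain_mapI)
    show "k' q \<in> extensional (mel V q)" for q by (simp add: k'_def)
    show "k' q x \<in> mel cocone q" if "x \<in> mel V q" for q x
      using that by (simp add: k')
    show "k' q (x \<oplus>[V,q] y) = k' q x \<oplus>[cocone,q] k' q y"
      if "x \<in> mel V q" "y \<in> mel V q" for q x y
      using that by (simp add: k' h.add k.add N.G.minus_add)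
    show "k' (r + q) (mact V r q a x) = mact cocone r q a (k' q x)"
      if a: "a \<in> ael A r" and x: "x \<in> mel V q" for r q a x
    proof -
      have "mact N r (q - 1) a (\<ominus>[N,q - 1] h q x) = \<ominus>[N,r + q - 1] mact N r (q - 1) a (h q x)"
        by (rule N.act_neg[OF a]) (use x in simp_all)
      moreover have "h (r + q) (mact V r q a x) = sign_of (mcomp N (r + q - 1)) r (mact N r (q - 1) a (h q x))"
        using h.act[OF a x] by simp
      moreover have "mact V r q a x \<in> mel V (r + q)" using a x by simp
      moreover have "mact N r (q - 1) a (h q x) \<in> mel N (r + q - 1)" using a x by simp
      ultimately show ?thesis
        unfolding k'[OF x refl] cocone_simps(3)[OF a hc[OF x]] using k.act[OF a x] by (simp add: k' sign_of_def)
    qed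
    show "k' (q + 1) (mdiff V q x) = mdiff cocone q (k' q x)" if x: "x \<in> mel V q" for q x
    proof -
      have dx: "mdiff V q x \<in> mel V (q + 1)" using x by simp
      have "comp_map V f k q x = boundary V N h q x" using h(2) by simp
      then have fk: "f q (k q x) = mdiff N (q - 1) (h q x) \<oplus>[N,q] h (q + 1) (mdiff V q x)" using x by simp
      have c: "mdiff N (q - 1) (h q x) \<in> mel N q" "h (q + 1) (mdiff V q x) \<in> mel N q" using x by simp_all
      have 1: "mdiff N (q - 1) (\<ominus>[N,q - 1] h q x) = \<ominus>[N,q] mdiff N (q - 1) (h q x)"
        by (rule N.mdiff_neg) (use x in simp_all)
      have "\<ominus>[N,q] mdiff N (q - 1) (h q x) \<oplus>[N,q] (mdiff N (q - 1) (h q x) \<oplus>[N,q] h (q + 1) (mdiff V q x)) = h (q + 1) (mdiff V q x)"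
        by (rule N.G.group_eqI[where p=q], (rule N.G.rep_rules | simp add: c)+)
      then show ?thesis
        unfolding k'[OF x refl] cocone_simps(4)[OF hc[OF x]] k'[OF dx refl] 1 fk using k.diff[OF x] by simp
    qed
  qed
  moreover have "comp_map V cocone_out k' = k"
    by (rule graded_map_eqI[where M=V]) (simp_all add: k.extensional cocone_out_def k')
  ultimately show ?thesis by blast
qed

end

section \<open>Direct sums\<close>

lemma (in additive_map) map_finsum:
  assumes "finite J" "\<And>i. i \<in> J \<Longrightarrow> g i \<in> carrier G"
  shows "f (\<Oplus>\<^bsub>G\<^esub>i\<in>J. g i) = (\<Oplus>\<^bsub>H\<^esub>i\<in>J. f (g i))"
  using assms
proof (induction J)
  case (insert j J)
  then have "g \<in> J \<rightarrow> carrier G" "g j \<in> carrier G" "(\<lambda>i. f (g i)) \<in> J \<rightarrow> carrier H" by auto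
  then show ?case using insert by (simp add: add)
qed simp

definition dsum_mod :: "'i set \<Rightarrow> ('i \<Rightarrow> ('a, 'm) cdg_mod) \<Rightarrow> ('a, 'i \<Rightarrow> 'm) cdg_mod" where
  "dsum_mod I M = \<lparr>
     mcomp = (\<lambda>p. add_group {x \<in> \<Pi>\<^sub>E i\<in>I. mel (M i) p. finite {i\<in>I. x i \<noteq> \<zero>[M i,p]}}
       (\<lambda>x y. \<lambda>i\<in>I. x i \<oplus>[M i,p] y i) (\<lambda>i\<in>I. \<zero>[M i,p])),
     mact = (\<lambda>p q a x. \<lambda>i\<in>I. mact (M i) p q a (x i)),
     mdiff = (\<lambda>p x. \<lambda>i\<in>I. mdiff (M i) p (x i))\<rparr>"

locale dsum = cdg_algebra R A for R :: "('r, 'z) ring_scheme" and A :: "('r, 'a) cdg_alg" +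
  fixes I :: "'i set" and M :: "'i \<Rightarrow> ('a, 'm) cdg_mod"
  assumes mod: "\<And>i. i \<in> I \<Longrightarrow> cdg_module A (M i)"
begin

abbreviation "DS \<equiv> dsum_mod I M"

definition inclusion :: "'i \<Rightarrow> int \<Rightarrow> 'm \<Rightarrow> 'i \<Rightarrow> 'm" where
  "inclusion i = (\<lambda>q. \<lambda>x\<in>mel (M i) q. \<lambda>j\<in>I. if j = i then x else \<zero>[M j,q])"

definition projection :: "'i \<Rightarrow> int \<Rightarrow> ('i \<Rightarrow> 'm) \<Rightarrow> 'm" where
  "projection i = (\<lambda>q. \<lambda>x\<in>mel DS q. x i)"

lemma dsum_simps:
  "\<zero>[DS,p] = (\<lambda>i\<in>I. \<zero>[M i,p])"
  "x \<oplus>[DS,p] y = (\<lambda>i\<in>I. x i \<oplus>[M i,p] y i)"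
  "mact DS p q a x = (\<lambda>i\<in>I. mact (M i) p q a (x i))"
  "mdiff DS p x = (\<lambda>i\<in>I. mdiff (M i) p (x i))"
  by (simp_all add: dsum_mod_def)

lemma mem_dsum: "x \<in> mel DS p \<longleftrightarrow> x \<in> extensional I \<and> (\<forall>i\<in>I. x i \<in> mel (M i) p) \<and>
   finite {i\<in>I. x i \<noteq> \<zero>[M i,p]}"
  by (auto simp: dsum_mod_def PiE_iff)

lemma comp_closed: "\<lbrakk>x \<in> mel DS p; i \<in> I\<rbrakk> \<Longrightarrow> x i \<in> mel (M i) p"
  by (simp add: mem_dsum)

lemma grp: "i \<in> I \<Longrightarrow> abelian_group (mcomp (M i) p)"
  using mod cdg_module.comp_group by blast

lemma mem_dsumI:
  assumes "finite J" "\<And>i. i \<in> I \<Longrightarrow> y i \<in> mel (M i) p" "\<And>i. \<lbrakk>i \<in> I; i \<notin> J\<rbrakk> \<Longrightarrow> y i = \<zero>[M i,p]"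
  shows "(\<lambda>i\<in>I. y i) \<in> mel DS p"
proof -
  have "{i\<in>I. y i \<noteq> \<zero>[M i,p]} \<subseteq> J" using assms(3) by auto
  moreover have "{i \<in> I. (\<lambda>i\<in>I. y i) i \<noteq> \<zero>[M i,p]} = {i\<in>I. y i \<noteq> \<zero>[M i,p]}" by auto
  ultimately show ?thesis using assms(1,2) finite_subset unfolding mem_dsum by auto
qed

definition supp :: "int \<Rightarrow> ('i \<Rightarrow> 'm) \<Rightarrow> 'i set" where
  "supp p x = {i\<in>I. x i \<noteq> \<zero>[M i,p]}"

lemma finite_supp: "x \<in> mel DS p \<Longrightarrow> finite (supp p x)"
  by (simp add: mem_dsum supp_def)

lemma not_supp: "\<lbrakk>i \<in> I; i \<notin> supp p x\<rbrakk> \<Longrightarrow> x i = \<zero>[M i,p]"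
  by (simp add: supp_def)

lemma dsum_ext: "\<lbrakk>x \<in> mel DS p; y \<in> extensional I; \<And>i. i \<in> I \<Longrightarrow> x i = y i\<rbrakk> \<Longrightarrow> x = y"
  by (rule extensionalityI[of _ I]) (simp_all add: mem_dsum)

lemma dsum_group: "abelian_group (mcomp DS p)"
proof (rule abelian_groupI)
  note g = abelian_group.axioms(1)[OF grp, THEN abelian_monoid.zero_closed] abelian_group.axioms(1)[OF grp, THEN abelian_monoid.a_closed]
  show z: "\<zero>[DS,p] \<in> mel DS p"
    unfolding dsum_simps by (rule mem_dsumI[of "{}"]) (simp_all add: g)
  fix x y assume x: "x \<in> mel DS p" and y: "y \<in> mel DS p"
  show xy: "x \<oplus>[DS,p] y \<in> mel DS p"
    unfolding dsum_simps
  proof (rule mem_dsumI)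
    show "finite (supp p x \<union> supp p y)" using finite_supp x y by blast
    fix i assume i: "i \<in> I"
    interpret Mi: abelian_group "mcomp (M i) p" by (rule grp[OF i])
    show "x i \<oplus>[M i,p] y i \<in> mel (M i) p" using comp_closed[OF x i] comp_closed[OF y i] by simp
    show "i \<notin> supp p x \<union> supp p y \<Longrightarrow> x i \<oplus>[M i,p] y i = \<zero>[M i,p]"
      using not_supp[OF i, of p x] not_supp[OF i, of p y] by simp
  qed
  show "x \<oplus>[DS,p] y = y \<oplus>[DS,p] x"
  proof (rule dsum_ext[OF xy])
    fix i assume i: "i \<in> I"
    interpret Mi: abelian_group "mcomp (M i) p" by (rule grp[OF i])
    show "(x \<oplus>[DS,p] y) i = (y \<oplus>[DS,p] x) i"
      using i comp_closed[OF x i] comp_closed[OF y i] by (simp add: dsum_simps Mi.a_comm)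
  qed (simp add: dsum_simps)
  have "\<zero>[DS,p] \<oplus>[DS,p] x = (\<lambda>i\<in>I. x i)"
  proof -
    have "\<zero>[M i,p] \<oplus>[M i,p] x i = x i" if i: "i \<in> I" for i
    proof -
      interpret Mi: abelian_group "mcomp (M i) p" by (rule grp[OF i])
      show ?thesis using comp_closed[OF x i] by simp
    qed
    then show ?thesis by (auto simp: dsum_simps)
  qed
  then show "\<zero>[DS,p] \<oplus>[DS,p] x = x" using dsum_ext[OF x, of "\<lambda>i\<in>I. x i"] by simp
  show "\<exists>y\<in>mel DS p. y \<oplus>[DS,p] x = \<zero>[DS,p]"
  proof
    show "(\<lambda>i\<in>I. \<ominus>[M i,p] x i) \<in> mel DS p"
    proof (rule mem_dsumI[OF finite_supp[OF x]])
      fix i assume i: "i \<in> I"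
      interpret Mi: abelian_group "mcomp (M i) p" by (rule grp[OF i])
      show "\<ominus>[M i,p] x i \<in> mel (M i) p" using comp_closed[OF x i] by simp
      show "i \<notin> supp p x \<Longrightarrow> \<ominus>[M i,p] x i = \<zero>[M i,p]" using not_supp[OF i, of p x] by simp
    qed
    have "\<ominus>[M i,p] x i \<oplus>[M i,p] x i = \<zero>[M i,p]" if i: "i \<in> I" for i
    proof -
      interpret Mi: abelian_group "mcomp (M i) p" by (rule grp[OF i])
      show ?thesis using comp_closed[OF x i] by (simp add: Mi.l_neg)
    qed
    then show "(\<lambda>i\<in>I. \<ominus>[M i,p] x i) \<oplus>[DS,p] x = \<zero>[DS,p]"
      by (auto simp: dsum_simps)
  qed
  fix w assume w: "w \<in> mel DS p"
  have "x i \<oplus>[M i,p] y i \<oplus>[M i,p] w i = x i \<oplus>[M i,p] (y i \<oplus>[M i,p] w i)" if i: "i \<in> I" for i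
  proof -
    interpret Mi: abelian_group "mcomp (M i) p" by (rule grp[OF i])
    show ?thesis using comp_closed[OF x i] comp_closed[OF y i] comp_closed[OF w i] by (simp add: Mi.a_assoc)
  qed
  then show "x \<oplus>[DS,p] y \<oplus>[DS,p] w = x \<oplus>[DS,p] (y \<oplus>[DS,p] w)"
    by (auto simp: dsum_simps)
qed

sublocale D: abelian_group "mcomp DS p" for p by (rule dsum_group)

lemma projection_map: "i \<in> I \<Longrightarrow> additive_map (mcomp DS q) (mcomp (M i) q) (\<lambda>x. x i)"
  by (intro additive_map.intro additive_map_axioms.intro dsum_group grp) (auto simp: comp_closed dsum_simps)

lemma dsum_sign: "\<lbrakk>x \<in> mel DS q; i \<in> I\<rbrakk> \<Longrightarrow> sign_of (mcomp DS q) r x i = sign_of (mcomp (M i) q) r (x i)"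
  using additive_map.sign[OF projection_map] .

lemma act_mem:
  assumes "a \<in> ael A p" "x \<in> mel DS q"
  shows "mact DS p q a x \<in> mel DS (p + q)"
  unfolding dsum_simps
proof (rule mem_dsumI[OF finite_supp[OF assms(2)]])
  fix i assume i: "i \<in> I"
  interpret Mi: cdg_module A "M i" by (rule mod[OF i])
  show "mact (M i) p q a (x i) \<in> mel (M i) (p + q)" using assms comp_closed[OF _ i] by simp
  show "i \<notin> supp q x \<Longrightarrow> mact (M i) p q a (x i) = \<zero>[M i,p + q]"
    using not_supp[OF i, of q x] assms by (simp add: Mi.act_zero)
qed

lemma diff_mem:
  assumes "x \<in> mel DS q"
  shows "mdiff DS q x \<in> mel DS (q + 1)"
  unfolding dsum_simps
proof (rule mem_dsumI[OF finite_supp[OF assms]])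
  fix i assume i: "i \<in> I"
  interpret Mi: cdg_module A "M i" by (rule mod[OF i])
  show "mdiff (M i) q (x i) \<in> mel (M i) (q + 1)" using assms comp_closed[OF _ i] by simp
  show "i \<notin> supp q x \<Longrightarrow> mdiff (M i) q (x i) = \<zero>[M i,q + 1]"
    using not_supp[OF i, of q x] assms by simp
qed

lemma dsum_cdg_module: "cdg_module A DS"
proof (rule cdg_module.intro)
  show "abelian_group (mcomp DS p)" for p by (rule dsum_group)
next
  fix p q a m assume a: "a \<in> ael A p" and m: "m \<in> mel DS q"
  show "mact DS p q a m \<in> mel DS (p + q)" using a m by (rule act_mem)
  have c: "mact DS p (q + 1) a (mdiff DS q m) \<in> mel DS (p + q + 1)"
    using act_mem[OF a diff_mem[OF m]] by (simp only: add.assoc)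
  show "mdiff DS (p + q) (mact DS p q a m) = mact DS (p + 1) q (adiff A p a) m \<oplus>[DS,p + q + 1]
      sign_of (mcomp DS (p + q + 1)) p (mact DS p (q + 1) a (mdiff DS q m))"
  proof (rule dsum_ext[OF diff_mem[OF act_mem[OF a m]]])
    fix i assume i: "i \<in> I"
    interpret Mi: cdg_module A "M i" by (rule mod[OF i])
    show "mdiff DS (p + q) (mact DS p q a m) i = (mact DS (p + 1) q (adiff A p a) m \<oplus>[DS,p + q + 1]
      sign_of (mcomp DS (p + q + 1)) p (mact DS p (q + 1) a (mdiff DS q m))) i"
      using i a comp_closed[OF m i] dsum_sign[OF c i, of p] by (simp add: dsum_simps Mi.mdiff_act)
  qed (simp add: dsum_simps)
next
  fix p q a b m assume a: "a \<in> ael A p" "b \<in> ael A p" and m: "m \<in> mel DS q"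
  show "mact DS p q (a \<oplus>[acomp A p] b) m = mact DS p q a m \<oplus>[DS,p + q] mact DS p q b m"
    using a comp_closed[OF m] cdg_module.act_l_distr[OF mod] by (auto simp: dsum_simps)
next
  fix p q a m m' assume a: "a \<in> ael A p" and m: "m \<in> mel DS q" "m' \<in> mel DS q"
  show "mact DS p q a (m \<oplus>[DS,q] m') = mact DS p q a m \<oplus>[DS,p + q] mact DS p q a m'"
    using a comp_closed[OF m(1)] comp_closed[OF m(2)] cdg_module.act_r_distr[OF mod] by (auto simp: dsum_simps)
next
  fix p q s a b m assume a: "a \<in> ael A p" "b \<in> ael A q" and m: "m \<in> mel DS s"
  show "mact DS (p + q) s (amult A p q a b) m = mact DS p (q + s) a (mact DS q s b m)"
    using a comp_closed[OF m] cdg_module.act_assoc[OF mod] by (auto simp: dsum_simps)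
next
  fix p m assume m: "m \<in> mel DS p"
  show "mdiff DS p m \<in> mel DS (p + 1)" using m by (rule diff_mem)
  show "mact DS 0 p (aone A) m = m"
    using comp_closed[OF m] cdg_module.act_one[OF mod] by (intro dsum_ext[OF m, symmetric]) (auto simp: dsum_simps)
  show "mdiff DS (p + 1) (mdiff DS p m) = mact DS 2 p (acurv A) m"
    using comp_closed[OF m] cdg_module.mdiff_mdiff[OF mod] by (auto simp: dsum_simps)
next
  fix p m m' assume m: "m \<in> mel DS p" "m' \<in> mel DS p"
  show "mdiff DS p (m \<oplus>[DS,p] m') = mdiff DS p m \<oplus>[DS,p + 1] mdiff DS p m'"
    using comp_closed[OF m(1)] comp_closed[OF m(2)] cdg_module.mdiff_add[OF mod] by (auto simp: dsum_simps)
qed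

lemma inclusion_chain_map:
  assumes i: "i \<in> I"
  shows "chain_map A (M i) DS (inclusion i)"
proof -
  interpret Mi: cdg_module A "M i" by (rule mod[OF i])
  note z = cdg_module.act_zero[OF mod] cdg_module.mdiff_zero[OF mod]
  note g = abelian_group.axioms(1)[OF grp, THEN abelian_monoid.zero_closed] abelian_group.axioms(1)[OF grp, THEN abelian_monoid.l_zero]
  have e: "inclusion i q x = (\<lambda>j\<in>I. if j = i then x else \<zero>[M j,q])" if "x \<in> mel (M i) q" for q x
    using that by (simp add: inclusion_def)
  show ?thesis
  proof (rule chain_mapI)
    show "inclusion i q \<in> extensional (mel (M i) q)" for q by (simp add: inclusion_def)
    show "inclusion i q x \<in> mel DS q" if "x \<in> mel (M i) q" for q x
      unfolding e[OF that] using that by (intro mem_dsumI[of "{i}"]) (auto simp: g)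
    show "inclusion i q (x \<oplus>[M i,q] y) = inclusion i q x \<oplus>[DS,q] inclusion i q y"
      if "x \<in> mel (M i) q" "y \<in> mel (M i) q" for q x y
      using that by (auto simp: e dsum_simps g)
    show "inclusion i (r + q) (mact (M i) r q a x) = mact DS r q a (inclusion i q x)"
      if "a \<in> ael A r" "x \<in> mel (M i) q" for r q a x
      using that by (auto simp: e dsum_simps z)
    show "inclusion i (q + 1) (mdiff (M i) q x) = mdiff DS q (inclusion i q x)"
      if "x \<in> mel (M i) q" for q x
      using that by (auto simp: e dsum_simps z)
  qed
qed

lemma projection_chain_map:
  assumes i: "i \<in> I"
  shows "chain_map A DS (M i) (projection i)"
proof -
  interpret DS: cdg_module A DS by (rule dsum_cdg_module)
  have c: "mact DS r q a x \<in> mel DS (r + q)" "mdiff DS q x \<in> mel DS (q + 1)"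
    if "a \<in> ael A r" "x \<in> mel DS q" for r q a x
    using that by simp_all
  show ?thesis
    by (rule chain_mapI; simp add: projection_def comp_closed i D.a_closed)
      (simp_all add: dsum_simps i)
qed

text \<open>The factorisation is obtained on the level of closed maps, by summing the values of the
  \<open>g i\<close> over the support.\<close>

lemma dsum_lift:
  assumes Y: "cdg_module A Y" and g: "\<And>i. i \<in> I \<Longrightarrow> chain_map A (M i) Y (g i)"
  shows "\<exists>k. chain_map A DS Y k \<and> (\<forall>i\<in>I. comp_map (M i) k (inclusion i) = g i)"
proof -
  interpret Y: cdg_module A Y by (rule Y)
  interpret DS: cdg_module A DS by (rule dsum_cdg_module)
  have cm: "cdg_map A (M i) Y (g i)" if "i \<in> I" for i
    using that by (intro cdg_mapI mod Y g)
  have gm: "additive_map (mcomp (M i) q) (mcomp Y q) (g i q)" if "i \<in> I" for i q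
    using cdg_map.closed[OF cm] cdg_map.add[OF cm] that by (intro additive_map.intro additive_map_axioms.intro grp Y.comp_group) auto
  define k where "k q = (\<lambda>x\<in>mel DS q. \<Oplus>\<^bsub>mcomp Y q\<^esub>i\<in>supp q x. g i q (x i))" for q
  have gc: "g i q (x i) \<in> mel Y q" if "i \<in> I" "x \<in> mel DS q" for i q x
    using cdg_map.closed[OF cm] comp_closed that by blast
  \<comment> \<open>The support may be enlarged to any finite J inside I. Supports can shrink under
    d and the action, and two summands may have different ones, so the sums are compared over a
    common index set.\<close>
  have k: "k q x = (\<Oplus>\<^bsub>mcomp Y q\<^esub>i\<in>J. g i q (x i))" if x: "x \<in> mel DS q" and J: "finite J" "supp q x \<subseteq> J" "J \<subseteq> I" for q x J
  proof -
    have "(\<Oplus>\<^bsub>mcomp Y q\<^esub>i\<in>supp q x. g i q (x i)) = (\<Oplus>\<^bsub>mcomp Y q\<^esub>i\<in>J. g i q (x i))"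
    proof (rule Y.G.add.finprod_mono_neutral_cong_left[OF J(1,2)])
      fix i assume "i \<in> J - supp q x"
      then have i: "i \<in> I" "i \<notin> supp q x" using J by auto
      show "g i q (x i) = \<zero>[Y,q]" unfolding not_supp[OF i] by (rule additive_map.zero[OF gm[OF i(1)]])
    qed (use gc[OF _ x] J in auto)
    then show ?thesis using x by (simp add: k_def)
  qed
  have "chain_map A DS Y k"
  proof (rule chain_mapI)
    show "k q \<in> extensional (mel DS q)" for q by (simp add: k_def)
    fix q x assume x: "x \<in> mel DS q"
    have sx: "finite (supp q x)" "supp q x \<subseteq> I" using finite_supp[OF x] by (auto simp: supp_def)
    show "k q x \<in> mel Y q" using gc[OF _ x] sx by (auto simp: k[OF x sx(1) order_refl sx(2)] intro!: Y.G.finsum_closed)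
    show "k (q + 1) (mdiff DS q x) = mdiff Y q (k q x)"
    proof -
      have s: "supp (q + 1) (mdiff DS q x) \<subseteq> supp q x"
      proof
        fix i assume i: "i \<in> supp (q + 1) (mdiff DS q x)"
        then have iI: "i \<in> I" by (simp add: supp_def)
        interpret Mi: cdg_module A "M i" by (rule mod[OF iI])
        show "i \<in> supp q x" using i iI by (auto simp: supp_def dsum_simps)
      qed
      have "k (q + 1) (mdiff DS q x) = (\<Oplus>\<^bsub>mcomp Y (q + 1)\<^esub>i\<in>supp q x. g i (q + 1) (mdiff DS q x i))"
        by (rule k[OF _ sx(1) s sx(2)]) (simp add: x)
      also have "\<dots> = (\<Oplus>\<^bsub>mcomp Y (q + 1)\<^esub>i\<in>supp q x. mdiff Y q (g i q (x i)))"
      proof (rule Y.G.finsum_cong')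
        fix i assume "i \<in> supp q x"
        then have i: "i \<in> I" using sx by blast
        show "g i (q + 1) (mdiff DS q x i) = mdiff Y q (g i q (x i))"
          using i cdg_map.diff[OF cm[OF i] comp_closed[OF x i]] by (simp add: dsum_simps)
      qed (use gc[OF _ x] sx in auto)
      also have "\<dots> = mdiff Y q (k q x)"
        unfolding k[OF x sx(1) order_refl sx(2)]
        using sx gc[OF _ x] by (intro additive_map.map_finsum[OF Y.mdiff_map, symmetric]) auto
      finally show ?thesis .
    qed
    show "k q (x \<oplus>[DS,q] y) = k q x \<oplus>[Y,q] k q y" if y: "y \<in> mel DS q" for y
    proof -
      let ?J = "supp q x \<union> supp q y"
      have J: "finite ?J" "?J \<subseteq> I" using sx finite_supp[OF y] by (auto simp: supp_def)
      have s: "supp q (x \<oplus>[DS,q] y) \<subseteq> ?J"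
      proof
        fix i assume i: "i \<in> supp q (x \<oplus>[DS,q] y)"
        then have iI: "i \<in> I" by (simp add: supp_def)
        interpret Mi: cdg_module A "M i" by (rule mod[OF iI])
        show "i \<in> ?J" using i iI by (auto simp: supp_def dsum_simps)
      qed
      have "k q (x \<oplus>[DS,q] y) = (\<Oplus>\<^bsub>mcomp Y q\<^esub>i\<in>?J. g i q ((x \<oplus>[DS,q] y) i))"
        by (rule k[OF _ J(1) s J(2)]) (simp add: x y)
      also have "\<dots> = (\<Oplus>\<^bsub>mcomp Y q\<^esub>i\<in>?J. g i q (x i) \<oplus>[Y,q] g i q (y i))"
      proof (rule Y.G.finsum_cong')
        fix i assume "i \<in> ?J"
        then have i: "i \<in> I" using J by blast
        show "g i q ((x \<oplus>[DS,q] y) i) = g i q (x i) \<oplus>[Y,q] g i q (y i)"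
          using i cdg_map.add[OF cm[OF i] comp_closed[OF x i] comp_closed[OF y i]] by (simp add: dsum_simps)
      qed (use gc[OF _ x] gc[OF _ y] J in auto)
      also have "\<dots> = (\<Oplus>\<^bsub>mcomp Y q\<^esub>i\<in>?J. g i q (x i)) \<oplus>[Y,q] (\<Oplus>\<^bsub>mcomp Y q\<^esub>i\<in>?J. g i q (y i))"
        using gc[OF _ x] gc[OF _ y] J by (intro Y.G.finsum_addf) auto
      also have "\<dots> = k q x \<oplus>[Y,q] k q y" using k[OF x J(1) _ J(2)] k[OF y J(1) _ J(2)] by simp
      finally show ?thesis .
    qed
    show "k (r + q) (mact DS r q a x) = mact Y r q a (k q x)" if a: "a \<in> ael A r" for r a
    proof -
      have s: "supp (r + q) (mact DS r q a x) \<subseteq> supp q x"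
      proof
        fix i assume i: "i \<in> supp (r + q) (mact DS r q a x)"
        then have iI: "i \<in> I" by (simp add: supp_def)
        interpret Mi: cdg_module A "M i" by (rule mod[OF iI])
        show "i \<in> supp q x" using i iI a Mi.act_zero[OF a, of "r + q" q] by (auto simp: supp_def dsum_simps)
      qed
      have "k (r + q) (mact DS r q a x) = (\<Oplus>\<^bsub>mcomp Y (r + q)\<^esub>i\<in>supp q x. g i (r + q) (mact DS r q a x i))"
        by (rule k[OF _ sx(1) s sx(2)]) (simp add: x a)
      also have "\<dots> = (\<Oplus>\<^bsub>mcomp Y (r + q)\<^esub>i\<in>supp q x. mact Y r q a (g i q (x i)))"
      proof (rule Y.G.finsum_cong')
        fix i assume "i \<in> supp q x"
        then have i: "i \<in> I" using sx by blast
        show "g i (r + q) (mact DS r q a x i) = mact Y r q a (g i q (x i))"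
          using i cdg_map.act[OF cm[OF i] a comp_closed[OF x i]] by (simp add: dsum_simps)
      qed (use gc[OF _ x] sx a in auto)
      also have "\<dots> = mact Y r q a (k q x)"
        unfolding k[OF x sx(1) order_refl sx(2)]
        using sx gc[OF _ x] by (intro additive_map.map_finsum[OF Y.act_map[OF a], symmetric]) auto
      finally show ?thesis .
    qed
  qed
  moreover have "comp_map (M i) k (inclusion i) = g i" if i: "i \<in> I" for i
  proof (rule graded_map_eqI[where M="M i"])
    interpret Mi: cdg_module A "M i" by (rule mod[OF i])
    show "g i q \<in> extensional (mel (M i) q)" for q using cdg_map.extensional[OF cm[OF i]] .
    fix q x assume x: "x \<in> mel (M i) q"
    have c: "inclusion i q x \<in> mel DS q" using inclusion_chain_map[OF i] x unfolding chain_map_def by blast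
    have s: "supp q (inclusion i q x) \<subseteq> {i}" using x by (auto simp: supp_def inclusion_def)
    have "k q (inclusion i q x) = (\<Oplus>\<^bsub>mcomp Y q\<^esub>j\<in>{i}. g j q (inclusion i q x j))"
      by (rule k[OF c _ s]) (simp_all add: i)
    also have "\<dots> = g i q x" using x i cdg_map.closed[OF cm[OF i] x] by (simp add: inclusion_def)
    finally show "comp_map (M i) k (inclusion i) q x = g i q x" using x by simp
  qed simp
  ultimately show ?thesis by blast
qed

text \<open>Evaluation at an element and projection to a factor are additive, so the sum in the
  group of closed maps can be compared with \<phi> one coordinate at a time; each coordinate
  receives a single summand. The finite J stands for the finiteness that a finitely generated source
  provides.\<close>

lemma dsum_decompose:
  assumes V: "cdg_module A V" and \<phi>: "chain_map A V DS \<phi>" and J: "finite J" "J \<subseteq> I"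
    and s: "\<And>q x i. \<lbrakk>x \<in> mel V q; i \<in> I - J\<rbrakk> \<Longrightarrow> \<phi> q x i = \<zero>[M i,q]"
  shows "\<phi> = (\<Oplus>\<^bsub>hom_cocycles A V DS\<^esub>i\<in>J. comp_map V (inclusion i) (comp_map V (projection i) \<phi>))"
proof -
  interpret V: cdg_module A V by (rule V)
  interpret P: cdg_module_pair R A V DS
    by (intro cdg_module_pair.intro cdg_algebra_axioms V dsum_cdg_module)
  interpret \<phi>: cdg_map A V DS \<phi> by (rule cdg_mapI[OF V dsum_cdg_module \<phi>])
  let ?F = "\<lambda>i. comp_map V (inclusion i) (comp_map V (projection i) \<phi>)"
  have F: "chain_map A V DS (?F i)" if "i \<in> J" for i
  proof -
    have i: "i \<in> I" using that J(2) by blast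
    show ?thesis
      by (rule chain_map_comp[OF V mod[OF i] dsum_cdg_module chain_map_comp[OF V dsum_cdg_module mod[OF i] \<phi> projection_chain_map[OF i]] inclusion_chain_map[OF i]])
  qed
  have Fc: "?F i \<in> carrier (hom_cocycles A V DS)" if "i \<in> J" for i
    using F[OF that] by (simp add: P.hom_cocycles_carrier)
  have sum: "chain_map A V DS (\<Oplus>\<^bsub>hom_cocycles A V DS\<^esub>i\<in>J. ?F i)"
  proof -
    have "(\<Oplus>\<^bsub>hom_cocycles A V DS\<^esub>i\<in>J. ?F i) \<in> carrier (hom_cocycles A V DS)"
      using Fc by (intro P.Z.finsum_closed) auto
    then show ?thesis by (simp add: P.hom_cocycles_carrier)
  qed
  interpret S: cdg_map A V DS "\<Oplus>\<^bsub>hom_cocycles A V DS\<^esub>i\<in>J. ?F i" by (rule cdg_mapI[OF V dsum_cdg_module sum])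
  show ?thesis
  proof (rule graded_map_eqI[where M=V])
    fix q x assume x: "x \<in> mel V q"
    have ev: "additive_map (hom_cocycles A V DS) (mcomp DS q) (\<lambda>f. f q x)"
      using x cdg_map.closed[OF cdg_mapI[OF V dsum_cdg_module]]
      by (intro additive_map.intro additive_map_axioms.intro P.hom_cocycles_group dsum_group)
        (simp_all add: P.hom_cocycles_carrier P.hom_cocycles_simps)
    have e1: "(\<Oplus>\<^bsub>hom_cocycles A V DS\<^esub>i\<in>J. ?F i) q x = (\<Oplus>\<^bsub>mcomp DS q\<^esub>i\<in>J. ?F i q x)"
      by (rule additive_map.map_finsum[OF ev J(1) Fc])
    have Fx: "?F i q x \<in> mel DS q" if "i \<in> J" for i
      using cdg_map.closed[OF cdg_mapI[OF V dsum_cdg_module F[OF that]] x] .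
    show "\<phi> q x = (\<Oplus>\<^bsub>hom_cocycles A V DS\<^esub>i\<in>J. ?F i) q x"
    proof (rule dsum_ext[OF \<phi>.closed[OF x]])
      show "(\<Oplus>\<^bsub>hom_cocycles A V DS\<^esub>i\<in>J. ?F i) q x \<in> extensional I" using S.closed[OF x] by (simp only: mem_dsum)
      fix j assume j: "j \<in> I"
      interpret Mj: cdg_module A "M j" by (rule mod[OF j])
      have pc: "\<phi> q x i \<in> mel (M i) q" if "i \<in> I" for i using comp_closed[OF \<phi>.closed[OF x] that] .
      have "(\<Oplus>\<^bsub>hom_cocycles A V DS\<^esub>i\<in>J. ?F i) q x j = (\<Oplus>\<^bsub>mcomp (M j) q\<^esub>i\<in>J. ?F i q x j)"
        unfolding e1 by (rule additive_map.map_finsum[OF projection_map[OF j] J(1) Fx])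
      also have "\<dots> = (\<Oplus>\<^bsub>mcomp (M j) q\<^esub>i\<in>J. if j = i then \<phi> q x j else \<zero>[M j,q])"
      proof (rule Mj.G.finsum_cong')
        fix i assume "i \<in> J"
        then have i: "i \<in> I" using J by blast
        show "?F i q x j = (if j = i then \<phi> q x j else \<zero>[M j,q])"
          using x i j pc[OF i] by (simp add: inclusion_def projection_def)
      qed (use pc[OF j] in auto)
      also have "\<dots> = \<phi> q x j"
      proof (cases "j \<in> J")
        case True
        then show ?thesis using Mj.G.add.finprod_singleton[OF True J(1), of "\<lambda>i. \<phi> q x j"] pc[OF j] by simp
      next
        case False
        then have "(\<Oplus>\<^bsub>mcomp (M j) q\<^esub>i\<in>J. if j = i then \<phi> q x j else \<zero>[M j,q]) = (\<Oplus>\<^bsub>mcomp (M j) q\<^esub>i\<in>J. \<zero>[M j,q])"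
          by (intro Mj.G.finsum_cong') auto
        then show ?thesis using s[OF x, of j] False j by simp
      qed
      finally show "\<phi> q x j = (\<Oplus>\<^bsub>hom_cocycles A V DS\<^esub>i\<in>J. ?F i) q x j" by simp
    qed
  qed (simp_all add: \<phi>.extensional S.extensional)
qed

end

section \<open>Pairs and finitely supported families fit into an infinite universe\<close>

lemma inj_prod_universe:
  assumes "infinite (UNIV :: 'u set)"
  shows "\<exists>e :: 'u \<times> 'u \<Rightarrow> 'u. inj e"
proof -
  have "(card_of (UNIV \<times> UNIV :: ('u \<times> 'u) set), card_of (UNIV :: 'u set)) \<in> ordLeq"
    using card_of_Times_same_infinite[OF assms] ordIso_imp_ordLeq by blast
  then show ?thesis unfolding card_of_ordLeq[symmetric] by (elim exE conjE) (auto intro: exI)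
qed

text \<open>Lists of a fixed length are handled by induction through an injection of pairs; all
  lists form a countable union of such sets, which an infinite type absorbs.\<close>

lemma inj_list_universe:
  assumes inf: "infinite (UNIV :: 'u set)"
  shows "\<exists>e :: 'u list \<Rightarrow> 'u. inj e"
proof -
  have L: "(card_of {xs :: 'u list. length xs = n}, card_of (UNIV :: 'u set)) \<in> ordLeq" for n
  proof (induction n)
    case 0
    have "\<exists>f :: 'u list \<Rightarrow> 'u. inj_on f {xs. length xs = 0} \<and> f ` {xs. length xs = 0} \<subseteq> UNIV"
      by (intro exI[of _ "\<lambda>_. undefined"]) simp
    then show ?case unfolding card_of_ordLeq[symmetric] .
  next
    case (Suc n)
    then have "\<exists>f :: 'u list \<Rightarrow> 'u. inj_on f {xs. length xs = n} \<and> f ` {xs. length xs = n} \<subseteq> UNIV"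
      unfolding card_of_ordLeq .
    then obtain f :: "'u list \<Rightarrow> 'u" where f: "inj_on f {xs. length xs = n}" by (elim exE conjE)
    obtain e :: "'u \<times> 'u \<Rightarrow> 'u" where e: "inj e" using inj_prod_universe[OF inf] by blast
    have "inj_on (\<lambda>xs. e (hd xs, f (tl xs))) {xs. length xs = Suc n}"
    proof (rule inj_onI)
      fix xs ys :: "'u list" assume l: "xs \<in> {xs. length xs = Suc n}" "ys \<in> {xs. length xs = Suc n}"
        and eq: "e (hd xs, f (tl xs)) = e (hd ys, f (tl ys))"
      have p: "(hd xs, f (tl xs)) = (hd ys, f (tl ys))" by (rule injD[OF e eq])
      have "hd xs = hd ys" "f (tl xs) = f (tl ys)"
        using arg_cong[OF p, of fst] arg_cong[OF p, of snd] by (simp_all only: fst_conv snd_conv)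
      moreover have "tl xs \<in> {xs. length xs = n}" "tl ys \<in> {xs. length xs = n}" using l by simp_all
      ultimately have "hd xs = hd ys" "tl xs = tl ys" using inj_onD[OF f] by blast+
      moreover have "xs \<noteq> []" "ys \<noteq> []" using l by force+
      ultimately show "xs = ys" by (metis list.expand)
    qed
    then have "\<exists>f :: 'u list \<Rightarrow> 'u. inj_on f {xs. length xs = Suc n} \<and> f ` {xs. length xs = Suc n} \<subseteq> UNIV"
      by (intro exI conjI subset_UNIV)
    then show ?case unfolding card_of_ordLeq .
  qed
  have "(card_of (UNIV :: nat set), card_of (UNIV :: 'u set)) \<in> ordLeq" using inf infinite_iff_card_of_nat by blast
  then have "(card_of (\<Union>n\<in>(UNIV :: nat set). {xs :: 'u list. length xs = n}), card_of (UNIV :: 'u set)) \<in> ordLeq"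
    using L by (intro card_of_UNION_ordLeq_infinite[OF inf]) simp_all
  moreover have "(\<Union>n\<in>(UNIV :: nat set). {xs :: 'u list. length xs = n}) = UNIV" by auto
  ultimately have "(card_of (UNIV :: 'u list set), card_of (UNIV :: 'u set)) \<in> ordLeq" by (simp only:)
  then show ?thesis unfolding card_of_ordLeq[symmetric] by (elim exE conjE) (rule exI)
qed

text \<open>A family is determined by the finite graph of its values differing from z. Coding pairs
  by \<open>e2\<close> makes this graph a finite subset of the universe, and an enumeration of it,
  chosen by \<open>l\<close>, is coded as a single element.\<close>

lemma inj_finite_support:
  fixes z :: "'u \<Rightarrow> 'u"
  assumes inf: "infinite (UNIV :: 'u set)"
  shows "\<exists>e :: ('u \<Rightarrow> 'u) \<Rightarrow> 'u. inj_on e {x \<in> \<Pi>\<^sub>E i\<in>I. C i. finite {i\<in>I. x i \<noteq> z i}}"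
proof -
  obtain e2 :: "'u \<times> 'u \<Rightarrow> 'u" where e2: "inj e2" using inj_prod_universe[OF inf] by blast
  obtain eL :: "'u list \<Rightarrow> 'u" where eL: "inj eL" using inj_list_universe[OF inf] by blast
  define l where "l S = (SOME xs. set xs = S)" for S :: "'u set"
  have l: "set (l S) = S" if "finite S" for S unfolding l_def using finite_list[OF that] by (rule someI_ex)
  define S where "S x = e2 ` {(i, x i) | i. i \<in> I \<and> x i \<noteq> z i}" for x
  have "inj_on (\<lambda>x. eL (l (S x))) {x \<in> \<Pi>\<^sub>E i\<in>I. C i. finite {i\<in>I. x i \<noteq> z i}}"
  proof (rule inj_onI)
    fix x y assume x: "x \<in> {x \<in> \<Pi>\<^sub>E i\<in>I. C i. finite {i\<in>I. x i \<noteq> z i}}" and y: "y \<in> {x \<in> \<Pi>\<^sub>E i\<in>I. C i. finite {i\<in>I. x i \<noteq> z i}}"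
      and eq: "eL (l (S x)) = eL (l (S y))"
    have fin: "finite (S x)" if "finite {i\<in>I. x i \<noteq> z i}" for x
    proof -
      have "{(i, x i) | i. i \<in> I \<and> x i \<noteq> z i} = (\<lambda>i. (i, x i)) ` {i\<in>I. x i \<noteq> z i}" by auto
      then show ?thesis using that by (simp add: S_def)
    qed
    have ll: "l (S x) = l (S y)" by (rule injD[OF eL eq])
    have fx: "finite {i\<in>I. x i \<noteq> z i}" and fy: "finite {i\<in>I. y i \<noteq> z i}" using x y by simp_all
    have "S x = set (l (S x))" by (rule l[OF fin[OF fx], symmetric])
    also have "\<dots> = S y" unfolding ll by (rule l[OF fin[OF fy]])
    finally have *: "{(i, x i) | i. i \<in> I \<and> x i \<noteq> z i} = {(i, y i) | i. i \<in> I \<and> y i \<noteq> z i}"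
      unfolding S_def inj_image_eq_iff[OF e2] .
    have "x i = y i" if "i \<in> I" for i
    proof (cases "x i = z i")
      case False
      then have "(i, x i) \<in> {(i, y i) | i. i \<in> I \<and> y i \<noteq> z i}" unfolding *[symmetric] using that by blast
      then show ?thesis by blast
    next
      case True
      show ?thesis
      proof (rule ccontr)
        assume "x i \<noteq> y i"
        then have "y i \<noteq> z i" using True by simp
        then have "(i, y i) \<in> {(i, x i) | i. i \<in> I \<and> x i \<noteq> z i}" unfolding * using that by blast
        then show False using \<open>x i \<noteq> y i\<close> by force
      qed
    qed
    moreover have "x \<in> (\<Pi>\<^sub>E i\<in>I. C i)" "y \<in> (\<Pi>\<^sub>E i\<in>I. C i)" using x y by simp_all
    ultimately show "x = y" by (intro PiE_ext[of x I C y])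
  qed
  then show ?thesis by blast
qed

section \<open>Modules over a deformation\<close>

lemma (in cdg_algebra) act_zero_l:
  assumes "cdg_module A M" "m \<in> mel M q" "s = p + q"
  shows "mact M p q \<zero>[acomp A p] m = \<zero>[M,s]"
proof -
  interpret M: cdg_module A M by fact
  have "additive_map (acomp A p) (mcomp M s) (\<lambda>a. mact M p q a m)"
    using assms by (intro additive_map.intro additive_map_axioms.intro alg_group M.comp_group) (simp_all add: M.act_l_distr)
  then show ?thesis by (rule additive_map.zero)
qed

locale deformation =
  fixes k :: "'k ring" and A :: "('k, 'a) cdg_alg" and n :: nat
    and An :: "(nat \<Rightarrow> 'k, nat \<Rightarrow> 'a) cdg_alg" and ct :: "nat \<Rightarrow> 'a"
  assumes base_ring: "cring k" and base_algebra: "dg_algebra k A" and deformation: "cdg_deformation k A n An"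
    and ct_closed [simp]: "ct \<in> ael An 2"
    and t_ct: "trunc_var k n \<odot>\<^bsub>acomp An 2\<^esub> ct = acurv An"
begin

sublocale cdg_algebra "trunc_ring k n" An
  using deformation unfolding cdg_deformation_def by (rule conjunct1)

lemma acomp_An: "acomp An p = trunc_module n (acomp A p)"
  using deformation unfolding cdg_deformation_def by blast

lemma base_module: "module k (acomp A p)"
  using base_algebra by (simp add: dg_algebra_def cdg_algebra.comp_module)

lemma trunc_cring: "cring (trunc_ring k n)"
  using comp_module module.axioms(1) by blast

abbreviation t :: "nat \<Rightarrow> 'k" where "t \<equiv> trunc_var k n"
abbreviation tpow :: "nat \<Rightarrow> nat \<Rightarrow> 'k" where "tpow j \<equiv> trunc_var k n [^]\<^bsub>trunc_ring k n\<^esub> j"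
abbreviation \<tau> :: "nat \<Rightarrow> nat \<Rightarrow> 'a" where "\<tau> \<equiv> t_pow k n An"

lemma t_closed [simp]: "t \<in> carrier (trunc_ring k n)"
proof -
  interpret cring k by (rule base_ring)
  show ?thesis by (auto simp: trunc_var_def trunc_ring_def)
qed

lemma tpow_closed [simp]: "tpow j \<in> carrier (trunc_ring k n)"
proof -
  interpret cring "trunc_ring k n" by (rule trunc_cring)
  show ?thesis by simp
qed

lemma tpow_add: "tpow i \<otimes>\<^bsub>trunc_ring k n\<^esub> tpow j = tpow (i + j)"
proof -
  have "monoid (trunc_ring k n)" using trunc_cring by (simp add: cring.axioms(1) ring.is_monoid)
  then show ?thesis by (rule monoid.nat_pow_mult) simp
qed

lemma tpow_smult_smult: "x \<in> ael An p
  \<Longrightarrow> tpow i \<odot>\<^bsub>acomp An p\<^esub> (tpow j \<odot>\<^bsub>acomp An p\<^esub> x) = tpow (i + j) \<odot>\<^bsub>acomp An p\<^esub> x"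
  using AM.smult_assoc1[OF tpow_closed tpow_closed, of x p i j] by (simp add: tpow_add)

lemma tpow_1: "tpow (Suc 0) = t"
proof -
  interpret cring "trunc_ring k n" by (rule trunc_cring)
  show ?thesis by simp
qed

lemma tpow_0_smult: "x \<in> ael An p \<Longrightarrow> tpow 0 \<odot>\<^bsub>acomp An p\<^esub> x = x"
  by simp

lemma t_smult_coeff:
  assumes x: "x \<in> ael An p" and j: "j \<le> n"
  shows "(t \<odot>\<^bsub>acomp An p\<^esub> x) j = (if j = 0 then \<zero>[acomp A p] else x (j - 1))"
proof -
  interpret V: module k "acomp A p" by (rule base_module)
  have xc: "x i \<in> ael A p" if "i \<le> n" for i
    using x that by (auto simp: acomp_An trunc_module_def)
  have e: "(t \<odot>\<^bsub>acomp An p\<^esub> x) j = (\<Oplus>\<^bsub>acomp A p\<^esub>i\<in>{..j}. t i \<odot>\<^bsub>acomp A p\<^esub> x (j - i))"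
    using j by (simp add: acomp_An trunc_module_def)
  have "\<dots> = (\<Oplus>\<^bsub>acomp A p\<^esub>i\<in>{..j}. if 1 = i then x (j - 1) else \<zero>[acomp A p])"
    using j xc by (intro V.M.finsum_cong') (auto simp: trunc_var_def V.smult_l_null)
  also have "\<dots> = (if j = 0 then \<zero>[acomp A p] else x (j - 1))"
  proof (cases "j = 0")
    case False
    then show ?thesis using V.M.add.finprod_singleton[of 1 "{..j}" "\<lambda>i. x (j - 1)"] xc j by simp
  qed simp
  finally show ?thesis using e by simp
qed

lemma tpow_smult_coeff:
  assumes x: "x \<in> ael An p" and j: "j \<le> n"
  shows "(tpow i \<odot>\<^bsub>acomp An p\<^esub> x) j = (if j < i then \<zero>[acomp A p] else x (j - i))"
  using j
proof (induction i arbitrary: j)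
  case 0
  then show ?case unfolding tpow_0_smult[OF x] by simp
next
  case (Suc i)
  have "(tpow (Suc i) \<odot>\<^bsub>acomp An p\<^esub> x) j = (t \<odot>\<^bsub>acomp An p\<^esub> (tpow i \<odot>\<^bsub>acomp An p\<^esub> x)) j"
    using tpow_smult_smult[OF x, of "Suc 0" i] by (simp only: tpow_1) simp
  also have "\<dots> = (if j = 0 then \<zero>[acomp A p] else (tpow i \<odot>\<^bsub>acomp An p\<^esub> x) (j - 1))"
    using x Suc.prems by (intro t_smult_coeff) simp_all
  also have "\<dots> = (if j < Suc i then \<zero>[acomp A p] else x (j - Suc i))"
    using Suc.IH[of "j - 1"] Suc.prems by auto
  finally show ?case .
qed

lemma acomp_ext:
  assumes "x \<in> ael An p" "y \<in> ael An p" "\<And>j. j \<le> n \<Longrightarrow> x j = y j"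
  shows "x = y"
  using assms by (intro PiE_ext[of x "{..n}" "\<lambda>_. ael A p" y]) (auto simp: acomp_An trunc_module_def)

lemma acomp_zero: "j \<le> n \<Longrightarrow> \<zero>[acomp An p] j = \<zero>[acomp A p]"
  by (simp add: acomp_An trunc_module_def)

lemma tpow_nilpotent:
  assumes x: "x \<in> ael An p"
  shows "tpow (Suc n) \<odot>\<^bsub>acomp An p\<^esub> x = \<zero>[acomp An p]"
proof (rule acomp_ext[where p=p])
  show "tpow (Suc n) \<odot>\<^bsub>acomp An p\<^esub> x \<in> ael An p"
    by (rule AM.smult_closed[OF tpow_closed x])
  fix j assume j: "j \<le> n"
  then show "(tpow (Suc n) \<odot>\<^bsub>acomp An p\<^esub> x) j = \<zero>[acomp An p] j"
    unfolding tpow_smult_coeff[OF x j] by (simp add: acomp_zero)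
qed simp

text \<open>Multiplication by t shifts coefficients upwards and loses only the top one, so an
  element of the kernel is concentrated in the coefficient of t^n.\<close>

lemma t_kernel:
  assumes x: "x \<in> ael An p" and tx: "t \<odot>\<^bsub>acomp An p\<^esub> x = \<zero>[acomp An p]"
  shows "\<exists>y\<in>ael An p. x = tpow n \<odot>\<^bsub>acomp An p\<^esub> y"
proof -
  interpret V: module k "acomp A p" by (rule base_module)
  have xc: "x i \<in> ael A p" if "i \<le> n" for i
    using x that by (auto simp: acomp_An trunc_module_def)
  have x0: "x j = \<zero>[acomp A p]" if "j < n" for j
    using t_smult_coeff[OF x, of "Suc j"] tx acomp_zero[of "Suc j"] that by simp
  \<comment> \<open>The surviving top coefficient becomes the constant term.\<close>
  define y where "y = (\<lambda>j\<in>{..n}. if j = 0 then x n else \<zero>[acomp A p])"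
  have y: "y \<in> ael An p" using xc by (auto simp: y_def acomp_An trunc_module_def)
  have "x = tpow n \<odot>\<^bsub>acomp An p\<^esub> y"
  proof (rule acomp_ext[OF x])
    show "tpow n \<odot>\<^bsub>acomp An p\<^esub> y \<in> ael An p" using y by simp
    fix j assume j: "j \<le> n"
    show "x j = (tpow n \<odot>\<^bsub>acomp An p\<^esub> y) j"
      unfolding tpow_smult_coeff[OF y j] using x0[of j] j by (auto simp: y_def)
  qed
  then show ?thesis using y by blast
qed

lemma \<tau>_closed [simp]: "\<tau> j \<in> ael An 0"
  by (simp add: t_pow_def)

lemma \<tau>_mult: "x \<in> ael An p \<Longrightarrow> amult An 0 p (\<tau> j) x = tpow j \<odot>\<^bsub>acomp An p\<^esub> x"
  using mult_smult_l[of "tpow j" "aone An" 0 x p] by (simp add: t_pow_def)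

lemma mult_\<tau>: "x \<in> ael An p \<Longrightarrow> amult An p 0 x (\<tau> j) = tpow j \<odot>\<^bsub>acomp An p\<^esub> x"
  using mult_smult_r[of "tpow j" x p "aone An" 0] by (simp add: t_pow_def)

lemma \<tau>_0: "\<tau> 0 = aone An"
  unfolding t_pow_def by (rule tpow_0_smult[OF one_closed])

lemma \<tau>_\<tau>: "amult An 0 0 (\<tau> i) (\<tau> j) = \<tau> (i + j)"
  unfolding \<tau>_mult[OF \<tau>_closed] using tpow_smult_smult[OF one_closed] by (simp add: t_pow_def)

lemma diff_\<tau>: "adiff An 0 (\<tau> j) = \<zero>[acomp An 1]"
  using diff_smult[of "tpow j" "aone An" 0] diff_one AM.smult_r_null[of "tpow j" 1] by (simp add: t_pow_def)

lemma \<tau>_n: "\<tau> (Suc n) = \<zero>[acomp An 0]"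
  unfolding t_pow_def by (rule tpow_nilpotent[OF one_closed])

lemma \<tau>_ct: "amult An 0 2 (\<tau> (Suc 0)) ct = acurv An"
  using \<tau>_mult[OF ct_closed] t_ct by (simp only: tpow_1)

text \<open>From t d(c/t) = d c = 0 the element d(c/t) lies in the kernel of t, that is in t^n A_n.
  It need not vanish, which is the source of the restricted commutation of b and d.\<close>

lemma diff_ct: "\<exists>z\<in>ael An 3. adiff An 2 ct = tpow n \<odot>\<^bsub>acomp An 3\<^esub> z"
proof (rule t_kernel)
  show "adiff An 2 ct \<in> ael An 3" by simp
  show "t \<odot>\<^bsub>acomp An 3\<^esub> adiff An 2 ct = \<zero>[acomp An 3]"
    using diff_smult[OF t_closed ct_closed] t_ct diff_curv by simp
qed

end

locale deformation_module = deformation k A n An ct + cdg_module An M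
  for k :: "'k ring" and A :: "('k, 'a) cdg_alg" and n :: nat
    and An :: "(nat \<Rightarrow> 'k, nat \<Rightarrow> 'a) cdg_alg" and ct :: "nat \<Rightarrow> 'a" and M :: "(nat \<Rightarrow> 'a, 'm) cdg_mod"
begin

lemma cdg_mod: "cdg_module An M" by unfold_locales

abbreviation T :: "nat \<Rightarrow> int \<Rightarrow> 'm \<Rightarrow> 'm" where
  "T j p \<equiv> mact M 0 p (\<tau> j)"

abbreviation b :: "int \<Rightarrow> 'm \<Rightarrow> 'm" where
  "b p \<equiv> mact M 2 p ct"

lemma T_act:
  assumes "a \<in> ael An p" "m \<in> mel M q" "s = p + q"
  shows "T j s (mact M p q a m) = mact M p q a (T j q m)"
proof -
  have "T j s (mact M p q a m) = mact M p q (amult An 0 p (\<tau> j) a) m"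
    using act_assoc[of "\<tau> j" 0 a p m q] assms by simp
  also have "\<dots> = mact M p q (amult An p 0 a (\<tau> j)) m" using assms by (simp only: \<tau>_mult mult_\<tau>)
  also have "\<dots> = mact M p q a (T j q m)" using act_assoc[of a p "\<tau> j" 0 m q] assms by simp
  finally show ?thesis .
qed

lemma T_T: "m \<in> mel M p \<Longrightarrow> T i p (T j p m) = T (i + j) p m"
  using act_assoc[of "\<tau> i" 0 "\<tau> j" 0 m p] by (simp add: \<tau>_\<tau>)

lemma mdiff_T:
  assumes "m \<in> mel M p"
  shows "mdiff M p (T j p m) = T j (p + 1) (mdiff M p m)"
  using mdiff_act[of "\<tau> j" 0 m p] assms act_zero_l[OF cdg_mod assms, of "p + 1" 1]
  by (simp add: diff_\<tau> sign_of_even add.commute)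

lemma T_nilpotent: "m \<in> mel M p \<Longrightarrow> T (Suc n) p m = \<zero>[M,p]"
  using act_zero_l[OF cdg_mod, of m p p 0] by (simp add: \<tau>_n)

lemma curved_complex: "curved_complex (mcomp M) (mdiff M) T b n"
proof (rule curved_complex.intro)
  show "additive_map (mcomp M p) (mcomp M (p + 1)) (mdiff M p)" for p by (rule mdiff_map) simp
  show "additive_map (mcomp M p) (mcomp M p) (T j p)" for p j by (rule act_map) simp_all
  show "additive_map (mcomp M p) (mcomp M (p + 2)) (b p)" for p by (rule act_map) simp_all
  fix x p assume x: "x \<in> mel M p"
  show "T 0 p x = x" using x by (simp add: \<tau>_0 act_one)
  show "T i p (T j p x) = T (i + j) p x" for i j using x by (rule T_T)
  show "mdiff M p (T j p x) = T j (p + 1) (mdiff M p x)" for j using x by (rule mdiff_T)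
  show "b p (T j p x) = T j (p + 2) (b p x)" for j using T_act[OF ct_closed x, of "p + 2" j] by simp
  show "T (Suc n) p x = \<zero>[M,p]" using x by (rule T_nilpotent)
  show "mdiff M q (mdiff M p x) = T (Suc 0) (p + 2) (b p x)" if "q = p + 1" for q
    using mdiff_mdiff'[OF x that] act_assoc[OF \<tau>_closed ct_closed x, of "Suc 0"] by (simp add: \<tau>_ct add.commute)
  \<comment> \<open>The Leibniz term d(c/t) x equals z t^n x for some z, hence vanishes on Ker t^n;
    the remaining term has no sign because c/t has degree 2.\<close>
  show "mdiff M q (b p x) = b r (mdiff M p x)" if Tn: "T n p x = \<zero>[M,p]" and q: "q = p + 2" "r = p + 1" for q r
  proof -
    obtain z where z: "z \<in> ael An 3" "adiff An 2 ct = tpow n \<odot>\<^bsub>acomp An 3\<^esub> z" using diff_ct by blast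
    have "mact M 3 p (adiff An 2 ct) x = mact M 3 p (amult An 3 0 z (\<tau> n)) x" unfolding z(2) mult_\<tau>[OF z(1)] ..
    also have "\<dots> = mact M 3 p z (T n p x)" using act_assoc[OF z(1) \<tau>_closed x, of n] by simp
    also have "\<dots> = \<zero>[M,p + 3]" unfolding Tn by (rule act_zero[OF z(1)]) simp
    finally have e: "mact M 3 p (adiff An 2 ct) x = \<zero>[M,p + 3]" .
    have c: "b r (mdiff M p x) \<in> mel M (p + 3)" using x q by simp
    show ?thesis
      using mdiff_act'[OF ct_closed x, of q "p + 3" r] q e c by (simp add: sign_of_even)
  qed
qed

sublocale CC: curved_complex "mcomp M" "mdiff M" T b n
  by (rule curved_complex)

definition tsub :: "nat \<Rightarrow> int \<Rightarrow> 'm set" where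
  "tsub j p = t_sub k n An j M p"

lemma tsub_iff: "x \<in> tsub j p \<longleftrightarrow> (\<exists>u\<in>mel M p. x = T j p u)"
  by (auto simp: tsub_def t_sub_def)

lemma tsub_subgroup: "abelian_subgroup (tsub j p) (mcomp M p)"
  using additive_map.image_subgroup[OF CC.T_map] by (simp add: tsub_def t_sub_def)

sublocale TS: abelian_subgroup "tsub j p" "mcomp M p" for j p
  by (rule tsub_subgroup)

lemma tsub_carrier [simp]: "x \<in> tsub j p \<Longrightarrow> x \<in> mel M p"
  using TS.a_subset by blast

lemma tsub_zero [simp]: "\<zero>[M,p] \<in> tsub j p" by (rule TS.zero_closed)
lemma tsub_neg [simp]: "x \<in> tsub j p \<Longrightarrow> \<ominus>[M,p] x \<in> tsub j p" by (rule TS.a_inv_closed)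
lemma tsub_minus [simp]: "\<lbrakk>x \<in> tsub j p; y \<in> tsub j p\<rbrakk> \<Longrightarrow> x \<ominus>[M,p] y \<in> tsub j p" by (simp add: a_minus_def)

lemma tsub_Suc: "x \<in> tsub (Suc j) p \<Longrightarrow> x \<in> tsub j p"
  unfolding tsub_iff using T_T[of _ p j "Suc 0"] act_closed'[OF \<tau>_closed] by (metis add.left_neutral add_Suc_right add.right_neutral)

lemma tsub_mdiff [simp]: "\<lbrakk>x \<in> tsub j p; q = p + 1\<rbrakk> \<Longrightarrow> mdiff M p x \<in> tsub j q"
  unfolding tsub_iff using mdiff_T by auto

text \<open>Cycles of t^j M / t^(j+1) M through representatives in t^j M; with \<open>bdy\<close>
  for the boundaries, this spares cosets in the study of graded pieces.\<close>

definition cyc :: "nat \<Rightarrow> int \<Rightarrow> 'm \<Rightarrow> bool" where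
  "cyc j p x \<longleftrightarrow> x \<in> tsub j p \<and> mdiff M p x \<in> tsub (Suc j) (p + 1)"

definition bdy :: "nat \<Rightarrow> int \<Rightarrow> 'm \<Rightarrow> bool" where
  "bdy j p x \<longleftrightarrow> (\<exists>v\<in>tsub j (p - 1). \<exists>w\<in>tsub (Suc j) p. x = mdiff M (p - 1) v \<oplus>[M,p] w)"

lemma cyc_carrier [simp]: "cyc j p x \<Longrightarrow> x \<in> mel M p"
  by (auto simp: cyc_def)

lemma cyc_add: "\<lbrakk>cyc j p x; cyc j p y\<rbrakk> \<Longrightarrow> cyc j p (x \<oplus>[M,p] y)"
  by (simp add: cyc_def mdiff_add)

lemma cyc_neg: "cyc j p x \<Longrightarrow> cyc j p (\<ominus>[M,p] x)"
  by (simp add: cyc_def mdiff_neg[where s="p + 1"])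

lemma cyc_minus: "\<lbrakk>cyc j p x; cyc j p y\<rbrakk> \<Longrightarrow> cyc j p (x \<ominus>[M,p] y)"
  by (simp add: a_minus_def cyc_add cyc_neg)

lemma bdyI: "\<lbrakk>v \<in> tsub j (p - 1); w \<in> tsub (Suc j) p; x = mdiff M (p - 1) v \<oplus>[M,p] w\<rbrakk> \<Longrightarrow> bdy j p x"
  by (auto simp: bdy_def)

lemma bdyE:
  assumes "bdy j p x"
  obtains v w where "v \<in> tsub j (p - 1)" "w \<in> tsub (Suc j) p" "x = mdiff M (p - 1) v \<oplus>[M,p] w"
  using assms by (auto simp: bdy_def)

lemma bdy_tsub: "w \<in> tsub (Suc j) p \<Longrightarrow> bdy j p w"
  using mdiff_zero[of "p - 1"] by (intro bdyI[of "\<zero>[M,p - 1]" j p w]) simp_all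

lemma bdy_add:
  assumes "bdy j p x" "bdy j p y"
  shows "bdy j p (x \<oplus>[M,p] y)"
proof -
  obtain v w where v: "v \<in> tsub j (p - 1)" "w \<in> tsub (Suc j) p" "x = mdiff M (p - 1) v \<oplus>[M,p] w"
    using assms(1) by (rule bdyE)
  obtain v' w' where v': "v' \<in> tsub j (p - 1)" "w' \<in> tsub (Suc j) p" "y = mdiff M (p - 1) v' \<oplus>[M,p] w'"
    using assms(2) by (rule bdyE)
  have "mdiff M (p - 1) (v \<oplus>[M,p - 1] v') = mdiff M (p - 1) v \<oplus>[M,p] mdiff M (p - 1) v'"
    using mdiff_add[of v "p - 1" v'] v v' by simp
  then have "x \<oplus>[M,p] y = mdiff M (p - 1) (v \<oplus>[M,p - 1] v') \<oplus>[M,p] (w \<oplus>[M,p] w')"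
    using v v' by (simp add: G.a_ac)
  then show ?thesis using v v' by (intro bdyI) simp_all
qed

lemma gr_acyclic_iff: "CC.gr_acyclic j \<longleftrightarrow> (\<forall>p x. cyc j p x \<longrightarrow> bdy j p x)"
proof -
  have 1: "(\<exists>v\<in>tsub j q. P v) \<longleftrightarrow> (\<exists>v\<in>mel M q. P (T j q v))" for P j q
    unfolding tsub_def t_sub_def bex_simps(7) ..
  show ?thesis
  proof
    assume *: "CC.gr_acyclic j"
    show "\<forall>p x. cyc j p x \<longrightarrow> bdy j p x"
    proof (intro allI impI)
      fix p x assume "cyc j p x"
      then obtain u m where u: "u \<in> mel M p" "x = T j p u" "m \<in> mel M (p + 1)"
        "mdiff M p x = T (Suc j) (p + 1) m" unfolding cyc_def tsub_iff by (elim conjE bexE)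
      obtain v w where v: "v \<in> mel M (p - 1)" "w \<in> mel M p"
        "T j p u = mdiff M (p - 1) (T j (p - 1) v) \<oplus>[M,p] T (Suc j) p w"
        by (rule CC.gr_acyclicD[OF * u(1,3) u(4)[unfolded u(2)]])
      then show "bdy j p x" unfolding bdy_def 1 u(2) by (intro bexI)
    qed
  next
    assume *: "\<forall>p x. cyc j p x \<longrightarrow> bdy j p x"
    show "CC.gr_acyclic j"
      unfolding CC.gr_acyclic_def
    proof (intro allI ballI impI)
      fix p u m assume u: "u \<in> mel M p" "m \<in> mel M (p + 1)" "mdiff M p (T j p u) = T (Suc j) (p + 1) m"
      then have "T j p u \<in> tsub j p" "mdiff M p (T j p u) \<in> tsub (Suc j) (p + 1)" unfolding tsub_iff by (rule_tac bexI; simp)+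
      then have "bdy j p (T j p u)" using * by (simp add: cyc_def)
      then show "\<exists>v\<in>mel M (p - 1). \<exists>w\<in>mel M p.
        T j p u = mdiff M (p - 1) (T j (p - 1) v) \<oplus>[M,p] T (Suc j) p w" unfolding bdy_def 1 .
    qed
  qed
qed

text \<open>Unfolds the quotient complexes of \<open>n_acyclic\<close> once and for all: a coset is
  a cycle or a boundary exactly if its representatives satisfy \<open>cyc\<close> or
  \<open>bdy\<close>.\<close>

lemma n_acyclic_iff: "n_acyclic k n An M \<longleftrightarrow> (\<forall>j\<le>n. \<forall>p x. cyc j p x \<longrightarrow> bdy j p x)"
proof -
  have "acyclic_mod (quot_mod (sub_mod M (t_sub k n An j M)) (t_sub k n An (Suc j) M)) \<longleftrightarrow> (\<forall>p x. cyc j p x \<longrightarrow> bdy j p x)" for j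
  proof -
    let ?H = "\<lambda>p. (mcomp M p)\<lparr>carrier := tsub j p\<rparr>"
    let ?N = "tsub (Suc j)"
    have H: "abelian_group (?H p)" for p
    proof (rule abelian_groupI)
      fix x assume "x \<in> carrier (?H p)"
      then show "\<exists>y\<in>carrier (?H p). y \<oplus>[?H p] x = \<zero>[?H p]"
        by (intro bexI[of _ "\<ominus>[M,p] x"]) (simp_all add: G.l_neg)
    qed (simp_all add: G.a_ac)
    interpret H: abelian_group "?H p" for p by (rule H)
    have neg: "\<ominus>[?H p] x = \<ominus>[M,p] x" if "x \<in> tsub j p" for x p
      using that by (intro H.minus_equality) (simp_all add: G.l_neg)
    have N: "abelian_subgroup (?N p) (?H p)" for p
      by (rule additive_subgroupI'[OF H]) (auto simp: neg tsub_Suc)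
    have d: "additive_map (?H p) (?H q) (mdiff M p)" if "q = p + 1" for p q
      using that by (intro additive_map.intro additive_map_axioms.intro H) (simp_all add: mdiff_add)
    have cos: "coset_map (?H q) (?N q) (mdiff M p) (?N p +>\<^bsub>?H p\<^esub> x) = ?N q +>\<^bsub>?H q\<^esub> mdiff M p x"
      if "x \<in> tsub j p" "q = p + 1" for p q x
      using that by (intro abelian_subgroup.coset_map_coset[OF N d N]) auto
    let ?Q = "quot_mod (sub_mod M (t_sub k n An j M)) (t_sub k n An (Suc j) M)"
    have car: "mel ?Q p = (\<lambda>x. ?N p +>\<^bsub>?H p\<^esub> x) ` tsub j p" for p
      using abelian_subgroup.carrier_quot_group[OF N, of p] by (simp add: quot_mod_def sub_mod_def tsub_def)
    have diff: "mdiff ?Q p (?N p +>\<^bsub>?H p\<^esub> x) = ?N (p + 1) +>\<^bsub>?H (p + 1)\<^esub> mdiff M p x" if "x \<in> tsub j p" for p x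
      using cos[OF that, of "p + 1"] by (simp add: quot_mod_def sub_mod_def tsub_def)
    have z: "\<zero>[?Q,p] = ?N p" for p
      by (simp add: quot_mod_def quot_group_def tsub_def)
    have eqz: "?N p +>\<^bsub>?H p\<^esub> x = ?N p \<longleftrightarrow> x \<in> ?N p" if "x \<in> tsub j p" for p x
      using abelian_subgroup.coset_eq_subgroup_iff[OF N, of x p] that by simp
    have eq: "?N p +>\<^bsub>?H p\<^esub> x = ?N p +>\<^bsub>?H p\<^esub> y \<longleftrightarrow> y \<ominus>[M,p] x \<in> ?N p" if "x \<in> tsub j p" "y \<in> tsub j p" for p x y
      using abelian_subgroup.coset_eq_iff[OF N, of y p x] that by (auto simp: a_minus_def neg)
    have bd: "bdy j p x \<longleftrightarrow> (\<exists>y\<in>tsub j (p - 1). x \<ominus>[M,p] mdiff M (p - 1) y \<in> ?N p)" if x: "x \<in> tsub j p" for p x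
    proof
      assume "bdy j p x"
      then obtain v w where v: "v \<in> tsub j (p - 1)" "w \<in> ?N p" "x = mdiff M (p - 1) v \<oplus>[M,p] w" by (rule bdyE)
      have "x \<ominus>[M,p] mdiff M (p - 1) v = w" unfolding v(3)
        by (rule G.group_eqI[where p=p], (rule G.rep_rules | simp add: tsub_carrier[OF v(1)] tsub_carrier[OF v(2)])+)
      then show "\<exists>y\<in>tsub j (p - 1). x \<ominus>[M,p] mdiff M (p - 1) y \<in> ?N p" using v(1,2) by (intro bexI[of _ v]) simp_all
    next
      assume "\<exists>y\<in>tsub j (p - 1). x \<ominus>[M,p] mdiff M (p - 1) y \<in> ?N p"
      then obtain y where y: "y \<in> tsub j (p - 1)" "x \<ominus>[M,p] mdiff M (p - 1) y \<in> ?N p" by blast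
      have "x = mdiff M (p - 1) y \<oplus>[M,p] (x \<ominus>[M,p] mdiff M (p - 1) y)"
        by (rule G.group_eqI[where p=p], (rule G.rep_rules | simp add: tsub_carrier[OF x] tsub_carrier[OF y(1)])+)
      then show "bdy j p x" using y by (intro bdyI)
    qed
    have "acyclic_mod ?Q \<longleftrightarrow> (\<forall>p. \<forall>x\<in>tsub j p. mdiff M p x \<in> ?N (p + 1) \<longrightarrow>
       (\<exists>y\<in>tsub j (p - 1). x \<ominus>[M,p] mdiff M (p - 1) y \<in> ?N p))"
    proof -
      have d2: "mdiff ?Q (p - 1) (?N (p - 1) +>\<^bsub>?H (p - 1)\<^esub> y) = ?N p +>\<^bsub>?H p\<^esub> mdiff M (p - 1) y" if "y \<in> tsub j (p - 1)" for p y
        using diff[OF that] by simp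
      show ?thesis
        unfolding acyclic_mod_def car z by (simp add: diff d2 eqz eq)
    qed
    then show ?thesis using bd by (auto simp: cyc_def)
  qed
  then show ?thesis by (simp add: n_acyclic_def)
qed

end

locale deformation_map = deformation k A n An ct
    + M: deformation_module k A n An ct M + N: deformation_module k A n An ct N + cdg_map An M N f
  for k :: "'k ring" and A :: "('k, 'a) cdg_alg" and n :: nat
    and An :: "(nat \<Rightarrow> 'k, nat \<Rightarrow> 'a) cdg_alg" and ct :: "nat \<Rightarrow> 'a"
    and M :: "(nat \<Rightarrow> 'a, 'm) cdg_mod" and N :: "(nat \<Rightarrow> 'a, 'n) cdg_mod" and f
begin

lemma tsub_map [simp]: "x \<in> M.tsub j p \<Longrightarrow> f p x \<in> N.tsub j p"
  unfolding M.tsub_iff N.tsub_iff using act[OF \<tau>_closed] closed by fastforce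

lemma cyc_map: "M.cyc j p x \<Longrightarrow> N.cyc j p (f p x)"
proof -
  assume x: "M.cyc j p x"
  have "f (p + 1) (mdiff M p x) \<in> N.tsub (Suc j) (p + 1)" using x by (simp add: M.cyc_def)
  then show ?thesis using x diff[OF M.cyc_carrier[OF x] refl] by (simp add: N.cyc_def M.cyc_def)
qed

lemma bdy_map:
  assumes "M.bdy j p x"
  shows "N.bdy j p (f p x)"
proof -
  obtain v w where v: "v \<in> M.tsub j (p - 1)" "w \<in> M.tsub (Suc j) p" "x = mdiff M (p - 1) v \<oplus>[M,p] w"
    using assms by (rule M.bdyE)
  note c = M.tsub_carrier[OF v(1)] M.tsub_carrier[OF v(2)]
  have "f p x = mdiff N (p - 1) (f (p - 1) v) \<oplus>[N,p] f p w"
    unfolding v(3) using c diff[OF c(1), of p] by (simp add: add)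
  then show ?thesis using v by (intro N.bdyI[of "f (p - 1) v" j p "f p w"]) simp_all
qed

end

section \<open>Maps inducing bijections on the cohomology of the graded pieces\<close>

context deformation
begin

lemma deformation_moduleI: "cdg_module An M \<Longrightarrow> deformation_module k A n An ct M"
  by (intro deformation_module.intro deformation_axioms)

lemma deformation_mapI:
  "\<lbrakk>cdg_module An M; cdg_module An N; chain_map An M N f\<rbrakk> \<Longrightarrow> deformation_map k A n An ct M N f"
  by (intro deformation_map.intro deformation_axioms deformation_moduleI cdg_mapI)

abbreviation "gcyc \<equiv> deformation_module.cyc k n An"
abbreviation "gbdy \<equiv> deformation_module.bdy k n An"

text \<open>Injectivity and surjectivity on cohomology, written on representatives. In this form
  composition and cancellation are diagram chases and no octahedral argument about cones is
  required.\<close>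

definition qiso :: "(nat \<Rightarrow> 'a, 'm) cdg_mod \<Rightarrow> (nat \<Rightarrow> 'a, 'n) cdg_mod \<Rightarrow> (int \<Rightarrow> 'm \<Rightarrow> 'n) \<Rightarrow> bool" where
  "qiso M N f \<longleftrightarrow> (\<forall>j\<le>n. \<forall>p.
     (\<forall>x. gcyc M j p x \<longrightarrow> gbdy N j p (f p x) \<longrightarrow> gbdy M j p x) \<and>
     (\<forall>y. gcyc N j p y \<longrightarrow> (\<exists>x. gcyc M j p x \<and> gbdy N j p (y \<ominus>[N,p] f p x))))"

lemma qisoI:
  assumes "\<And>j p x. \<lbrakk>j \<le> n; gcyc M j p x; gbdy N j p (f p x)\<rbrakk> \<Longrightarrow> gbdy M j p x"
    and "\<And>j p y. \<lbrakk>j \<le> n; gcyc N j p y\<rbrakk> \<Longrightarrow> \<exists>x. gcyc M j p x \<and> gbdy N j p (y \<ominus>[N,p] f p x)"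
  shows "qiso M N f"
  using assms unfolding qiso_def by blast

lemma qiso_inj: "\<lbrakk>qiso M N f; j \<le> n; gcyc M j p x; gbdy N j p (f p x)\<rbrakk> \<Longrightarrow> gbdy M j p x"
  unfolding qiso_def by blast

lemma qiso_surj:
  assumes "qiso M N f" "j \<le> n" "gcyc N j p y"
  obtains x where "gcyc M j p x" "gbdy N j p (y \<ominus>[N,p] f p x)"
  using assms unfolding qiso_def by blast

lemma qiso_id:
  assumes "cdg_module An M"
  shows "qiso M M (id_map M)"
proof -
  interpret M: deformation_module k A n An ct M by (rule deformation_moduleI[OF assms])
  have c: "x \<in> mel M p" if "M.cyc j p x" for j p x using that by simp
  show ?thesis
  proof (rule qisoI)
    show "M.bdy j p x" if "M.cyc j p x" "M.bdy j p (id_map M p x)" for j p x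
      using that c[OF that(1)] by simp
    show "\<exists>x. M.cyc j p x \<and> M.bdy j p (y \<ominus>[M,p] id_map M p x)" if "M.cyc j p y" for j p y
      using that c[OF that] M.bdy_tsub[of "\<zero>[M,p]" j p]
      by (intro exI[of _ y]) (simp add: a_minus_def M.G.r_neg)
  qed
qed

lemma qiso_comp:
  assumes MNP: "cdg_module An M" "cdg_module An N" "cdg_module An P"
    and f: "chain_map An M N f" "qiso M N f" and g: "chain_map An N P g" "qiso N P g"
  shows "qiso M P (comp_map M g f)"
proof -
  interpret f: deformation_map k A n An ct M N f by (rule deformation_mapI[OF MNP(1,2) f(1)])
  interpret g: deformation_map k A n An ct N P g by (rule deformation_mapI[OF MNP(2,3) g(1)])
  show ?thesis
  proof (rule qisoI)
    fix j p x assume j: "j \<le> n" and x: "gcyc M j p x" and bx: "gbdy P j p (comp_map M g f p x)"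
    have xc: "x \<in> mel M p" by (rule f.M.cyc_carrier[OF x])
    have "gbdy P j p (g p (f p x))" using bx xc by simp
    then have "gbdy N j p (f p x)" by (rule qiso_inj[OF g(2) j f.cyc_map[OF x]])
    then show "gbdy M j p x" by (rule qiso_inj[OF f(2) j x])
  next
    fix j p z assume j: "j \<le> n" and z: "gcyc P j p z"
    obtain y where y: "gcyc N j p y" "gbdy P j p (z \<ominus>[P,p] g p y)" using qiso_surj[OF g(2) j z] .
    obtain x where x: "gcyc M j p x" "gbdy N j p (y \<ominus>[N,p] f p x)" using qiso_surj[OF f(2) j y(1)] .
    note c = f.M.cyc_carrier[OF x(1)] f.N.cyc_carrier[OF y(1)] g.N.cyc_carrier[OF z]
    have "z \<ominus>[P,p] comp_map M g f p x = (z \<ominus>[P,p] g p y) \<oplus>[P,p] g p (y \<ominus>[N,p] f p x)"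
      unfolding g.minus[OF c(2) f.closed[OF c(1)]] map_simps(5)[OF c(1)]
      by (rule g.N.G.group_eqI[where p=p], (rule g.N.G.rep_rules | simp add: c)+)
    then have "gbdy P j p (z \<ominus>[P,p] comp_map M g f p x)"
      using g.N.bdy_add[OF y(2) g.bdy_map[OF x(2)]] by simp
    then show "\<exists>x. gcyc M j p x \<and> gbdy P j p (z \<ominus>[P,p] comp_map M g f p x)" using x(1) by blast
  qed
qed

text \<open>Two out of three in the direction that \<open>S_cancel\<close> asks for: g is injective
  on cohomology, so f inherits both properties from g f.\<close>

lemma qiso_cancel:
  assumes MNP: "cdg_module An M" "cdg_module An N" "cdg_module An P"
    and f: "chain_map An M N f" and g: "chain_map An N P g" "qiso N P g" and gf: "qiso M P (comp_map M g f)"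
  shows "qiso M N f"
proof -
  interpret f: deformation_map k A n An ct M N f by (rule deformation_mapI[OF MNP(1,2) f(1)])
  interpret g: deformation_map k A n An ct N P g by (rule deformation_mapI[OF MNP(2,3) g(1)])
  show ?thesis
  proof (rule qisoI)
    fix j p x assume j: "j \<le> n" and x: "gcyc M j p x" and bx: "gbdy N j p (f p x)"
    have xc: "x \<in> mel M p" by (rule f.M.cyc_carrier[OF x])
    have "gbdy P j p (comp_map M g f p x)" using g.bdy_map[OF bx] xc by simp
    then show "gbdy M j p x" by (rule qiso_inj[OF gf j x])
  next
    fix j p y assume j: "j \<le> n" and y: "gcyc N j p y"
    obtain x where x: "gcyc M j p x" "gbdy P j p (g p y \<ominus>[P,p] comp_map M g f p x)"
      using qiso_surj[OF gf j g.cyc_map[OF y]] .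
    note c = f.M.cyc_carrier[OF x(1)] f.N.cyc_carrier[OF y(1)]
    have "gbdy P j p (g p (y \<ominus>[N,p] f p x))"
      using x(2) unfolding g.minus[OF c(2) f.closed[OF c(1)]] map_simps(5)[OF c(1)] .
    then have "gbdy N j p (y \<ominus>[N,p] f p x)"
      by (rule qiso_inj[OF g(2) j f.N.cyc_minus[OF y f.cyc_map[OF x(1)]]])
    then show "\<exists>x. gcyc M j p x \<and> gbdy N j p (y \<ominus>[N,p] f p x)" using x(1) by blast
  qed
qed

text \<open>A homotopy commutes with t, hence respects the t-adic filtration. In f x - g x = d h x +
  h d x the first term bounds within t^j N, and the second lies in t^(j+1) N because d x lies in
  t^(j+1) M.\<close>

lemma homotopic_bdy:
  assumes MN: "cdg_module An M" "cdg_module An N" and f: "chain_map An M N f" and g: "chain_map An M N g"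
    and fg: "homotopic An M N f g" and x: "gcyc M j p x"
  shows "gbdy N j p (f p x \<ominus>[N,p] g p x)"
proof -
  interpret f: deformation_map k A n An ct M N f by (rule deformation_mapI[OF MN f])
  interpret g: deformation_map k A n An ct M N g by (rule deformation_mapI[OF MN g])
  obtain h where h: "homotopy An M N h" and h2: "\<forall>q. \<forall>x\<in>mel M q.
     f q x = g q x \<oplus>[N,q] (mdiff N (q - 1) (h q x) \<oplus>[N,q] h (q + 1) (mdiff M q x))"
    using fg unfolding homotopic_def by (elim exE conjE)
  interpret h: cdg_homotopy An M N h by (rule cdg_homotopyI[OF MN h])
  have ht: "h q y \<in> f.N.tsub i s" if y: "y \<in> f.M.tsub i q" and "s = q - 1" for y q i s
  proof -
    obtain u where u: "u \<in> mel M q" "y = mact M 0 q (\<tau> i) u"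
      using f.M.tsub_iff[THEN iffD1, OF y] by blast
    have "h q y = mact N 0 s (\<tau> i) (h q u)"
      unfolding u(2) using h.act[OF \<tau>_closed u(1), of q s s i] \<open>s = q - 1\<close> by (simp add: sign_of_even)
    then show ?thesis unfolding f.N.tsub_iff using h.closed[OF u(1) \<open>s = q - 1\<close>] by (rule bexI)
  qed
  have t: "x \<in> f.M.tsub j p" "mdiff M p x \<in> f.M.tsub (Suc j) (p + 1)" using x by (auto simp: f.M.cyc_def)
  have xc: "x \<in> mel M p" by (rule f.M.cyc_carrier[OF x])
  have "f p x \<ominus>[N,p] g p x = mdiff N (p - 1) (h p x) \<oplus>[N,p] h (p + 1) (mdiff M p x)"
    unfolding h2[rule_format, OF xc]
    by (rule f.N.G.group_eqI[where p=p], (rule f.N.G.rep_rules | simp add: xc)+)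
  then show ?thesis using ht[OF t(1), of "p - 1"] ht[OF t(2), of p] by (intro f.N.bdyI) simp_all
qed

text \<open>\<open>n_quasi_isos\<close> asks for one representative with n-acyclic cone; by this
  invariance the choice of representative is immaterial.\<close>

lemma qiso_homotopic:
  assumes MN: "cdg_module An M" "cdg_module An N" and f: "chain_map An M N f" and g: "chain_map An M N g"
    and fg: "homotopic An M N f g" and q: "qiso M N f"
  shows "qiso M N g"
proof -
  interpret f: deformation_map k A n An ct M N f by (rule deformation_mapI[OF MN f])
  interpret g: deformation_map k A n An ct M N g by (rule deformation_mapI[OF MN g])
  show ?thesis
  proof (rule qisoI)
    fix j p x assume j: "j \<le> n" and x: "gcyc M j p x" and bx: "gbdy N j p (g p x)"
    have xc: "x \<in> mel M p" by (rule f.M.cyc_carrier[OF x])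
    have "f p x = (f p x \<ominus>[N,p] g p x) \<oplus>[N,p] g p x"
      by (rule f.N.G.group_eqI[where p=p], (rule f.N.G.rep_rules | simp add: xc)+)
    then have "gbdy N j p (f p x)" using f.N.bdy_add[OF homotopic_bdy[OF MN f g fg x] bx] by simp
    then show "gbdy M j p x" by (rule qiso_inj[OF q j x])
  next
    fix j p y assume j: "j \<le> n" and y: "gcyc N j p y"
    obtain x where x: "gcyc M j p x" "gbdy N j p (y \<ominus>[N,p] f p x)" using qiso_surj[OF q j y] .
    note c = f.M.cyc_carrier[OF x(1)] f.N.cyc_carrier[OF y(1)]
    have "y \<ominus>[N,p] g p x = (y \<ominus>[N,p] f p x) \<oplus>[N,p] (f p x \<ominus>[N,p] g p x)"
      by (rule f.N.G.group_eqI[where p=p], (rule f.N.G.rep_rules | simp add: c)+)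
    then have "gbdy N j p (y \<ominus>[N,p] g p x)"
      using f.N.bdy_add[OF x(2) homotopic_bdy[OF MN f g fg x(1)]] by simp
    then show "\<exists>x. gcyc M j p x \<and> gbdy N j p (y \<ominus>[N,p] g p x)" using x(1) by blast
  qed
qed

lemma shift_tsub:
  assumes "cdg_module An M"
  shows "deformation_module.tsub k n An (shift l M) j p = deformation_module.tsub k n An M j (p + l)"
proof -
  interpret M: deformation_module k A n An ct M by (rule deformation_moduleI[OF assms])
  interpret S: deformation_module k A n An ct "shift l M"
    by (rule deformation_moduleI[OF shift_cdg_module[OF cdg_algebra_axioms assms]])
  show ?thesis unfolding S.tsub_def M.tsub_def t_sub_def by (simp add: sign_of_even)
qed

lemma shift_n_acyclic:
  assumes M: "cdg_module An M" and ac: "n_acyclic k n An M"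
  shows "n_acyclic k n An (shift l M)"
proof -
  interpret M: deformation_module k A n An ct M by (rule deformation_moduleI[OF M])
  interpret S: deformation_module k A n An ct "shift l M"
    by (rule deformation_moduleI[OF shift_cdg_module[OF cdg_algebra_axioms M]])
  show ?thesis unfolding S.n_acyclic_iff
  proof (intro allI impI)
    fix j p x assume j: "j \<le> n" and x: "S.cyc j p x"
    have E: "p + 1 + l = p + l + 1" "p - 1 + l = p + l - 1" "p - 1 + 1 + l = p + l" by simp_all
    have xt: "x \<in> M.tsub j (p + l)" "sign_of (mcomp M (p + l + 1)) l (mdiff M (p + l) x) \<in> M.tsub (Suc j) (p + l + 1)"
      using x unfolding S.cyc_def shift_tsub[OF M] shift_simps E by auto
    have "mdiff M (p + l) x \<in> M.tsub (Suc j) (p + l + 1)"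
    proof (cases "even l")
      case False
      then have "\<ominus>[M,p + l + 1] (\<ominus>[M,p + l + 1] mdiff M (p + l) x) \<in> M.tsub (Suc j) (p + l + 1)"
        using xt(2) by (rule_tac M.tsub_neg) (simp add: sign_of_odd)
      then show ?thesis using M.tsub_carrier[OF xt(1)] by simp
    qed (use xt(2) in \<open>simp add: sign_of_even\<close>)
    then have "M.cyc j (p + l) x" using xt(1) by (simp add: M.cyc_def)
    then have "M.bdy j (p + l) x" using ac j unfolding M.n_acyclic_iff by blast
    then obtain v w where v: "v \<in> M.tsub j (p + l - 1)" "w \<in> M.tsub (Suc j) (p + l)"
      "x = mdiff M (p + l - 1) v \<oplus>[M,p + l] w" by (rule M.bdyE)
    note c = M.tsub_carrier[OF v(1)]
    have d: "mdiff M (p + l - 1) v \<in> mel M (p + l)" using c by simp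
    show "S.bdy j p x"
    proof (rule S.bdyI)
      show "sign_of (mcomp M (p + l - 1)) l v \<in> S.tsub j (p - 1)" unfolding shift_tsub[OF M] E
        using v(1) by (simp add: sign_of_def)
      show "w \<in> S.tsub (Suc j) p" unfolding shift_tsub[OF M] by (rule v(2))
      show "x = mdiff (shift l M) (p - 1) (sign_of (mcomp M (p + l - 1)) l v) \<oplus>[shift l M,p] w"
        unfolding shift_simps E v(3) using M.mdiff_sign[OF c, of "p + l" l] d by (simp add: sign_of_even)
    qed
  qed
qed

end

context deformation_map
begin

lemma cone_mod: "cdg_module An (cone M N f)"
  by (rule cone_cdg_module[OF cdg_algebra_axioms])

text \<open>The element t^j has degree 0 and acts on the cone without signs, so the graded pieces of
  a cone are the cones of the maps on graded pieces.\<close>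

lemma cone_tsub: "deformation_module.tsub k n An (cone M N f) j p = N.tsub j p \<times> M.tsub j (p + 1)"
proof -
  interpret C: deformation_module k A n An ct "cone M N f" by (rule deformation_moduleI[OF cone_mod])
  have "(\<lambda>(y, x). (mact N 0 p (\<tau> j) y, mact M 0 (p + 1) (\<tau> j) x)) ` (mel N p \<times> mel M (p + 1))
    = N.tsub j p \<times> M.tsub j (p + 1)"
    unfolding N.tsub_def M.tsub_def t_sub_def by (auto simp: image_iff)
  moreover have "mact (cone M N f) 0 p (\<tau> j) z = (case z of (y, x) \<Rightarrow> (mact N 0 p (\<tau> j) y, mact M 0 (p + 1) (\<tau> j) x))" for z
    by (cases z) (simp add: sign_of_even)
  ultimately show ?thesis unfolding C.tsub_def t_sub_def by simp
qed

text \<open>By \<open>cone_tsub\<close> this is the long exact cohomology sequence of a cone,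
  applied to each graded piece and carried out on representatives.\<close>

lemma cone_n_acyclic_iff: "n_acyclic k n An (cone M N f) \<longleftrightarrow> qiso M N f"
proof -
  interpret C: deformation_module k A n An ct "cone M N f" by (rule deformation_moduleI[OF cone_mod])
  have E: "p - 1 + 1 = p" "p - 1 + 2 = p + 1" "p + 1 - 1 = p" "p + 1 + 1 = p + 2" for p :: int by simp_all
  have cyc: "C.cyc j p (y, x) \<longleftrightarrow> y \<in> N.tsub j p \<and> x \<in> M.tsub j (p + 1) \<and>
      mdiff N p y \<oplus>[N,p + 1] f (p + 1) x \<in> N.tsub (Suc j) (p + 1) \<and> mdiff M (p + 1) x \<in> M.tsub (Suc j) (p + 2)" for j p y x
  proof -
    have "\<ominus>[M,p + 2] z \<in> M.tsub (Suc j) (p + 2) \<longleftrightarrow> z \<in> M.tsub (Suc j) (p + 2)" if "z \<in> mel M (p + 2)" for z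
      using M.tsub_neg[of z "Suc j" "p + 2"] M.tsub_neg[of "\<ominus>[M,p + 2] z" "Suc j" "p + 2"] that by auto
    moreover have "mdiff M (p + 1) x \<in> mel M (p + 2)" if "x \<in> M.tsub j (p + 1)" using M.tsub_carrier[OF that] by simp
    ultimately show ?thesis unfolding C.cyc_def cone_tsub cone_simps E by auto
  qed
  have bdy: "C.bdy j p (y, x) \<longleftrightarrow> (\<exists>u\<in>N.tsub j (p - 1). \<exists>x'\<in>M.tsub j p. \<exists>w\<in>N.tsub (Suc j) p. \<exists>w'\<in>M.tsub (Suc j) (p + 1).
      y = mdiff N (p - 1) u \<oplus>[N,p] f p x' \<oplus>[N,p] w \<and> x = \<ominus>[M,p + 1] mdiff M p x' \<oplus>[M,p + 1] w')" for j p y x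
    unfolding C.bdy_def cone_tsub by (simp add: E)
  show ?thesis
  proof
    assume ac: "n_acyclic k n An (cone M N f)"
    show "qiso M N f"
    proof (rule qisoI)
      fix j p x assume j: "j \<le> n" and x: "M.cyc j p x" and bx: "N.bdy j p (f p x)"
      have xt: "x \<in> M.tsub j p" "mdiff M p x \<in> M.tsub (Suc j) (p + 1)" using x by (simp_all add: M.cyc_def)
      obtain v w where v: "v \<in> N.tsub j (p - 1)" "w \<in> N.tsub (Suc j) p" "f p x = mdiff N (p - 1) v \<oplus>[N,p] w"
        using bx by (rule N.bdyE)
      note c = N.tsub_carrier[OF v(1)] N.tsub_carrier[OF v(2)] M.tsub_carrier[OF xt(1)]
      have "mdiff N (p - 1) (\<ominus>[N,p - 1] v) \<oplus>[N,p] f p x = w"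
        unfolding v(3) N.mdiff_neg[OF c(1), of p, simplified] 
        by (rule N.G.group_eqI[where p=p], (rule N.G.rep_rules | simp add: c)+)
      \<comment> \<open>From f x = d v + w the pair (- v, x) is a cycle of the cone; the second
        component of a pair bounding it exhibits x as a boundary.\<close>
      then have "C.cyc j (p - 1) (\<ominus>[N,p - 1] v, x)"
        unfolding cyc E using v xt by simp
      then have "C.bdy j (p - 1) (\<ominus>[N,p - 1] v, x)" using ac j unfolding C.n_acyclic_iff by blast
      then obtain x' w' where x': "x' \<in> M.tsub j (p - 1)" "w' \<in> M.tsub (Suc j) p"
        "x = \<ominus>[M,p] mdiff M (p - 1) x' \<oplus>[M,p] w'" unfolding bdy E by blast
      have "x = mdiff M (p - 1) (\<ominus>[M,p - 1] x') \<oplus>[M,p] w'"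
        unfolding x'(3) using M.mdiff_neg[OF M.tsub_carrier[OF x'(1)], of p] by simp
      then show "M.bdy j p x" using x' by (intro M.bdyI) simp_all
    next
      fix j p y assume j: "j \<le> n" and y: "N.cyc j p y"
      have yt: "y \<in> N.tsub j p" "mdiff N p y \<in> N.tsub (Suc j) (p + 1)" using y by (simp_all add: N.cyc_def)
      have z: "mdiff M (p + 1) \<zero>[M,p + 1] = \<zero>[M,p + 2]" using M.mdiff_zero[of "p + 1"] by (simp only: E)
      have "C.cyc j p (y, \<zero>[M,p + 1])" unfolding cyc z using yt N.tsub_carrier[OF yt(2)] by simp
      then have "C.bdy j p (y, \<zero>[M,p + 1])" using ac j unfolding C.n_acyclic_iff by blast
      then obtain u x' w w' where *: "u \<in> N.tsub j (p - 1)" "x' \<in> M.tsub j p" "w \<in> N.tsub (Suc j) p" "w' \<in> M.tsub (Suc j) (p + 1)"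
        "y = mdiff N (p - 1) u \<oplus>[N,p] f p x' \<oplus>[N,p] w"
        "\<zero>[M,p + 1] = \<ominus>[M,p + 1] mdiff M p x' \<oplus>[M,p + 1] w'" unfolding bdy by blast
      note c = N.tsub_carrier[OF *(1)] M.tsub_carrier[OF *(2)] N.tsub_carrier[OF *(3)] M.tsub_carrier[OF *(4)]
      have "\<ominus>[M,p + 1] (\<ominus>[M,p + 1] mdiff M p x') = w'"
        using *(6)[symmetric] c by (intro M.G.minus_equality) (simp_all add: M.G.a_comm)
      then have "mdiff M p x' = w'" using c by simp
      then have "M.cyc j p x'" using *(2,4) by (simp add: M.cyc_def)
      moreover have "y \<ominus>[N,p] f p x' = mdiff N (p - 1) u \<oplus>[N,p] w"
        unfolding *(5) by (rule N.G.group_eqI[where p=p], (rule N.G.rep_rules | simp add: c)+)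
      then have "N.bdy j p (y \<ominus>[N,p] f p x')" using * by (intro N.bdyI)
      ultimately show "\<exists>x. M.cyc j p x \<and> N.bdy j p (y \<ominus>[N,p] f p x)" by blast
    qed
  next
    assume q: "qiso M N f"
    show "n_acyclic k n An (cone M N f)"
      unfolding C.n_acyclic_iff
    proof (intro allI impI)
      fix j p z assume j: "j \<le> n" and z: "C.cyc j p z"
      obtain y x where zz: "z = (y, x)" by (cases z)
      have yx: "y \<in> N.tsub j p" "x \<in> M.tsub j (p + 1)" "mdiff N p y \<oplus>[N,p + 1] f (p + 1) x \<in> N.tsub (Suc j) (p + 1)"
        "mdiff M (p + 1) x \<in> M.tsub (Suc j) (p + 2)" using z unfolding zz cyc by auto
      note c = N.tsub_carrier[OF yx(1)] M.tsub_carrier[OF yx(2)]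
      have cx: "M.cyc j (p + 1) x" using yx by (simp add: M.cyc_def E)
      have "f (p + 1) x = mdiff N (p + 1 - 1) (\<ominus>[N,p] y) \<oplus>[N,p + 1] (mdiff N p y \<oplus>[N,p + 1] f (p + 1) x)"
        unfolding E N.mdiff_neg[OF c(1) refl]
        by (rule N.G.group_eqI[where p="p + 1"], (rule N.G.rep_rules | simp add: c)+)
      then have "N.bdy j (p + 1) (f (p + 1) x)" using yx by (intro N.bdyI) simp_all
      then have "M.bdy j (p + 1) x" by (rule qiso_inj[OF q j cx])
      then obtain v w where v: "v \<in> M.tsub j p" "w \<in> M.tsub (Suc j) (p + 1)" "x = mdiff M p v \<oplus>[M,p + 1] w"
        unfolding M.bdy_def E by blast
      note c' = M.tsub_carrier[OF v(1)] M.tsub_carrier[OF v(2)]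
      \<comment> \<open>With x = d v + w, adding f v to y removes f x from the cycle condition up to
        t^(j+1), so that y' is a cycle of N.\<close>
      define y' where "y' = y \<oplus>[N,p] f p v"
      have y't: "y' \<in> N.tsub j p" using yx v by (simp add: y'_def)
      have fdv: "f (p + 1) (mdiff M p v) = mdiff N p (f p v)" using diff[OF c'(1) refl] .
      have "mdiff N p y' = (mdiff N p y \<oplus>[N,p + 1] f (p + 1) x) \<ominus>[N,p + 1] f (p + 1) w"
      proof -
        have "f (p + 1) x = mdiff N p (f p v) \<oplus>[N,p + 1] f (p + 1) w"
          unfolding v(3) fdv[symmetric] using c' by (simp add: add)
        moreover have "mdiff N p y' = mdiff N p y \<oplus>[N,p + 1] mdiff N p (f p v)"
          unfolding y'_def by (rule N.mdiff_add[OF c(1) closed[OF c'(1)]])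
        moreover have "mdiff N p y \<oplus>[N,p + 1] mdiff N p (f p v) = mdiff N p y \<oplus>[N,p + 1] (mdiff N p (f p v) \<oplus>[N,p + 1] f (p + 1) w) \<ominus>[N,p + 1] f (p + 1) w"
          by (rule N.G.group_eqI[where p="p + 1"], (rule N.G.rep_rules | simp add: c c')+)
        ultimately show ?thesis by simp
      qed
      then have "N.cyc j p y'" using y't yx(3) v(2) by (simp add: N.cyc_def)
      then obtain x2 where x2: "M.cyc j p x2" "N.bdy j p (y' \<ominus>[N,p] f p x2)" using qiso_surj[OF q j] by blast
      obtain u w' where u: "u \<in> N.tsub j (p - 1)" "w' \<in> N.tsub (Suc j) p" "y' \<ominus>[N,p] f p x2 = mdiff N (p - 1) u \<oplus>[N,p] w'"
        using x2(2) by (rule N.bdyE)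
      have x2t: "x2 \<in> M.tsub j p" "mdiff M p x2 \<in> M.tsub (Suc j) (p + 1)" using x2(1) by (simp_all add: M.cyc_def)
      note c2 = M.tsub_carrier[OF x2t(1)] N.tsub_carrier[OF u(1)] N.tsub_carrier[OF u(2)]
      \<comment> \<open>x2 represents y' in the cohomology of M; taking v off again turns y' = y + f
        v back into y.\<close>
      define x' where "x' = x2 \<ominus>[M,p] v"
      have x't: "x' \<in> M.tsub j p" using x2t v by (simp add: x'_def)
      have "y = mdiff N (p - 1) u \<oplus>[N,p] f p x' \<oplus>[N,p] w'"
      proof -
        have "mdiff N (p - 1) u \<oplus>[N,p] f p x' \<oplus>[N,p] w' = (mdiff N (p - 1) u \<oplus>[N,p] w') \<oplus>[N,p] (f p x2 \<ominus>[N,p] f p v)"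
          unfolding x'_def minus[OF c2(1) c'(1)]
          by (rule N.G.group_eqI[where p=p], (rule N.G.rep_rules | simp add: c2 c')+)
        also have "\<dots> = y" unfolding u(3)[symmetric] y'_def
          by (rule N.G.group_eqI[where p=p], (rule N.G.rep_rules | simp add: c c2 c')+)
        finally show ?thesis by simp
      qed
      moreover have "x = \<ominus>[M,p + 1] mdiff M p x' \<oplus>[M,p + 1] (mdiff M p x2 \<oplus>[M,p + 1] w)"
        unfolding v(3) x'_def M.mdiff_minus[OF c2(1) c'(1) refl]
        by (rule M.G.group_eqI[where p="p + 1"], (rule M.G.rep_rules | simp add: c2 c')+)
      moreover have "mdiff M p x2 \<oplus>[M,p + 1] w \<in> M.tsub (Suc j) (p + 1)" using x2t v by simp
      ultimately show "C.bdy j p z" unfolding zz bdy using u(1,2) x't by blast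
    qed
  qed
qed

text \<open>Cohomology of the fibre of a map into an n-acyclic module agrees with that of the
  source. It is used for the fibre of a map into the cone of a quasi-isomorphism.\<close>

lemma cocone_out_qiso:
  assumes ac: "n_acyclic k n An N"
  shows "qiso cocone M cocone_out"
proof -
  interpret C: deformation_module k A n An ct cocone by (rule deformation_moduleI[OF cocone_cdg_module[OF cdg_algebra_axioms]])
  have E: "p - 1 + 1 = p" "p + - 1 = p - 1" for p :: int by simp_all
  have tsub: "C.tsub j p = N.tsub j (p - 1) \<times> M.tsub j p" for j p
    unfolding shift_tsub[OF cone_mod] cone_tsub by (simp only: E)
  have cyc: "C.cyc j p (y, x) \<longleftrightarrow> y \<in> N.tsub j (p - 1) \<and> x \<in> M.tsub j p \<and>
      mdiff N (p - 1) y \<oplus>[N,p] f p x \<in> N.tsub (Suc j) p \<and> mdiff M p x \<in> M.tsub (Suc j) (p + 1)" for j p y x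
  proof -
    have 1: "\<ominus>[N,p] z \<in> N.tsub (Suc j) p \<longleftrightarrow> z \<in> N.tsub (Suc j) p" if "z \<in> mel N p" for z
      using N.tsub_neg[of z "Suc j" p] N.tsub_neg[of "\<ominus>[N,p] z" "Suc j" p] that by auto
    show ?thesis
    proof (cases "y \<in> N.tsub j (p - 1) \<and> x \<in> M.tsub j p")
      case True
      then have c: "y \<in> mel N (p - 1)" "x \<in> mel M p" using N.tsub_carrier M.tsub_carrier by blast+
      then have "mdiff N (p - 1) y \<oplus>[N,p] f p x \<in> mel N p" by simp
      then show ?thesis using True unfolding C.cyc_def cocone_simps(4)[OF c] tsub by (simp add: 1)
    qed (auto simp: C.cyc_def tsub)
  qed
  have out: "cocone_out p (y, x) = x" if "y \<in> N.tsub j (p - 1)" "x \<in> M.tsub j p" for j p y x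
    using N.tsub_carrier[OF that(1)] M.tsub_carrier[OF that(2)] by (simp add: cocone_out_def)
  show ?thesis
  proof (rule qisoI)
    fix j p z assume j: "j \<le> n" and z: "C.cyc j p z" and bz: "M.bdy j p (cocone_out p z)"
    obtain y x where zz: "z = (y, x)" by (cases z)
    have yx: "y \<in> N.tsub j (p - 1)" "x \<in> M.tsub j p" "mdiff N (p - 1) y \<oplus>[N,p] f p x \<in> N.tsub (Suc j) p"
      "mdiff M p x \<in> M.tsub (Suc j) (p + 1)" using z unfolding zz cyc by auto
    note c = N.tsub_carrier[OF yx(1)] M.tsub_carrier[OF yx(2)]
    obtain v w where v: "v \<in> M.tsub j (p - 1)" "w \<in> M.tsub (Suc j) p" "x = mdiff M (p - 1) v \<oplus>[M,p] w"
      using bz unfolding zz out[OF yx(1,2)] by (rule M.bdyE)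
    note c' = M.tsub_carrier[OF v(1)] M.tsub_carrier[OF v(2)]
    \<comment> \<open>If x = d v + w, then y + f v is a cycle of N, and the acyclicity of N provides
      the first component of the pair bounding (y, x).\<close>
    define y' where "y' = y \<oplus>[N,p - 1] f (p - 1) v"
    have fdv: "f p (mdiff M (p - 1) v) = mdiff N (p - 1) (f (p - 1) v)" using diff[OF c'(1), of p] by simp
    have "mdiff N (p - 1) y' = (mdiff N (p - 1) y \<oplus>[N,p] f p x) \<ominus>[N,p] f p w"
    proof -
      have "f p x = mdiff N (p - 1) (f (p - 1) v) \<oplus>[N,p] f p w"
        unfolding v(3) fdv[symmetric] using c' by (simp add: add)
      moreover have "mdiff N (p - 1) y' = mdiff N (p - 1) y \<oplus>[N,p] mdiff N (p - 1) (f (p - 1) v)"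
        unfolding y'_def using N.mdiff_add[OF c(1) closed[OF c'(1)]] by simp
      moreover have "mdiff N (p - 1) y \<oplus>[N,p] mdiff N (p - 1) (f (p - 1) v) = mdiff N (p - 1) y \<oplus>[N,p] (mdiff N (p - 1) (f (p - 1) v) \<oplus>[N,p] f p w) \<ominus>[N,p] f p w"
        by (rule N.G.group_eqI[where p=p], (rule N.G.rep_rules | simp add: c c')+)
      ultimately show ?thesis by simp
    qed
    then have "N.cyc j (p - 1) y'" using yx v by (simp add: N.cyc_def y'_def)
    then have "N.bdy j (p - 1) y'" using ac j unfolding N.n_acyclic_iff by blast
    then obtain u w' where u: "u \<in> N.tsub j (p - 1 - 1)" "w' \<in> N.tsub (Suc j) (p - 1)" "y' = mdiff N (p - 1 - 1) u \<oplus>[N,p - 1] w'"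
      by (rule N.bdyE)
    note c2 = N.tsub_carrier[OF u(1)] N.tsub_carrier[OF u(2)]
    show "C.bdy j p z" unfolding zz
    proof (rule C.bdyI)
      show "(\<ominus>[N,p - 1 - 1] u, v) \<in> C.tsub j (p - 1)" unfolding tsub using u v by simp
      show "(w', w) \<in> C.tsub (Suc j) p" unfolding tsub using u v by simp
      have uc: "\<ominus>[N,p - 1 - 1] u \<in> mel N (p - 1 - 1)" using c2 by simp
      have du: "mdiff N (p - 1 - 1) u \<in> mel N (p - 1)" using c2(1) by simp
      have n: "mdiff N (p - 1 - 1) (\<ominus>[N,p - 1 - 1] u) = \<ominus>[N,p - 1] mdiff N (p - 1 - 1) u"
        by (rule N.mdiff_neg[OF c2(1)]) simp
      have "y = \<ominus>[N,p - 1] (\<ominus>[N,p - 1] mdiff N (p - 1 - 1) u \<oplus>[N,p - 1] f (p - 1) v) \<oplus>[N,p - 1] w'"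
      proof -
        have "\<ominus>[N,p - 1] (\<ominus>[N,p - 1] mdiff N (p - 1 - 1) u \<oplus>[N,p - 1] f (p - 1) v) \<oplus>[N,p - 1] w'
          = (mdiff N (p - 1 - 1) u \<oplus>[N,p - 1] w') \<ominus>[N,p - 1] f (p - 1) v"
          by (rule N.G.group_eqI[where p="p - 1"], (rule N.G.rep_rules | simp only: du c2(2) closed[OF c'(1)] | simp)+)
        also have "\<dots> = y" unfolding u(3)[symmetric] y'_def
          by (rule N.G.group_eqI[where p="p - 1"], (rule N.G.rep_rules | simp add: c c')+)
        finally show ?thesis by simp
      qed
      then show "(y, x) = mdiff cocone (p - 1) (\<ominus>[N,p - 1 - 1] u, v) \<oplus>[cocone,p] (w', w)"
        unfolding cocone_simps(4)[OF uc c'(1)] cocone_simps(2) n v(3)[symmetric] by simp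
    qed
  next
    fix j p x assume j: "j \<le> n" and x: "M.cyc j p x"
    have xt: "x \<in> M.tsub j p" "mdiff M p x \<in> M.tsub (Suc j) (p + 1)" using x by (simp_all add: M.cyc_def)
    have "N.bdy j p (f p x)" using cyc_map[OF x] ac j unfolding N.n_acyclic_iff by blast
    then obtain u w where u: "u \<in> N.tsub j (p - 1)" "w \<in> N.tsub (Suc j) p" "f p x = mdiff N (p - 1) u \<oplus>[N,p] w"
      by (rule N.bdyE)
    note c = N.tsub_carrier[OF u(1)] N.tsub_carrier[OF u(2)] M.tsub_carrier[OF xt(1)]
    have un: "\<ominus>[N,p - 1] u \<in> N.tsub j (p - 1)" using u(1) by simp
    have n: "mdiff N (p - 1) (\<ominus>[N,p - 1] u) = \<ominus>[N,p] mdiff N (p - 1) u"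
      by (rule N.mdiff_neg[OF c(1)]) simp
    have "mdiff N (p - 1) (\<ominus>[N,p - 1] u) \<oplus>[N,p] f p x = w"
      unfolding n u(3) by (rule N.G.group_eqI[where p=p], (rule N.G.rep_rules | simp add: c)+)
    then have "C.cyc j p (\<ominus>[N,p - 1] u, x)" unfolding cyc using un xt u(2) by simp
    moreover have "x \<ominus>[M,p] cocone_out p (\<ominus>[N,p - 1] u, x) = \<zero>[M,p]"
      unfolding out[OF un xt(1)] using c(3) by (simp add: a_minus_def M.G.r_neg)
    moreover have "M.bdy j p \<zero>[M,p]" by (rule M.bdy_tsub) simp
    ultimately show "\<exists>z. C.cyc j p z \<and> M.bdy j p (x \<ominus>[M,p] cocone_out p z)" by (intro exI[of _ "(\<ominus>[N,p - 1] u, x)"]) simp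
  qed
qed

end

section \<open>Maps out of \<open>\<Gamma>\<^sub>i\<close>\<close>

text \<open>A presentation of \<Gamma>_i: generators \<open>g0\<close> = (1, 0) and
  \<open>g1\<close> = (0, 1) in degrees 0 and -1, annihilated by t^(i+1) and t^i, with d g0 = (c/t)
  g1 and d g1 = t g0. It is stated abstractly so that it also covers the copy of \<Gamma>_i in the
  universe.\<close>

locale gamma_like = deformation k A n An ct + \<Gamma>: deformation_module k A n An ct \<Gamma>
  for k :: "'k ring" and A :: "('k, 'a) cdg_alg" and n :: nat
    and An :: "(nat \<Rightarrow> 'k, nat \<Rightarrow> 'a) cdg_alg" and ct :: "nat \<Rightarrow> 'a" and \<Gamma> :: "(nat \<Rightarrow> 'a, 'm) cdg_mod" +
  fixes i :: nat and g0 g1 :: 'm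
  assumes i_le: "i \<le> n"
    and g0: "g0 \<in> mel \<Gamma> 0" and g1: "g1 \<in> mel \<Gamma> (- 1)"
    and generators: "z \<in> mel \<Gamma> q \<Longrightarrow> \<exists>\<alpha>\<in>ael An q. \<exists>a\<in>ael An (q + 1).
      z = mact \<Gamma> q 0 \<alpha> g0 \<oplus>[\<Gamma>,q] mact \<Gamma> (q + 1) (- 1) a g1"
    and relations: "\<lbrakk>\<alpha> \<in> ael An q; a \<in> ael An (q + 1);
        mact \<Gamma> q 0 \<alpha> g0 \<oplus>[\<Gamma>,q] mact \<Gamma> (q + 1) (- 1) a g1 = \<zero>[\<Gamma>,q]\<rbrakk>
      \<Longrightarrow> (\<exists>\<beta>\<in>ael An q. \<alpha> = amult An q 0 \<beta> (\<tau> (Suc i))) \<and>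
          (\<exists>\<gamma>\<in>ael An (q + 1). a = amult An (q + 1) 0 \<gamma> (\<tau> i))"
    and T_g0: "mact \<Gamma> 0 0 (\<tau> (Suc i)) g0 = \<zero>[\<Gamma>,0]"
    and T_g1: "mact \<Gamma> 0 (- 1) (\<tau> i) g1 = \<zero>[\<Gamma>,- 1]"
    and d_g0: "mdiff \<Gamma> 0 g0 = mact \<Gamma> 2 (- 1) ct g1"
    and d_g1: "mdiff \<Gamma> (- 1) g1 = mact \<Gamma> 0 0 (\<tau> (Suc 0)) g0"
begin

declare g0 [simp] g1 [simp]

abbreviation elt :: "int \<Rightarrow> (nat \<Rightarrow> 'a) \<Rightarrow> (nat \<Rightarrow> 'a) \<Rightarrow> 'm" where
  "elt q \<alpha> a \<equiv> mact \<Gamma> q 0 \<alpha> g0 \<oplus>[\<Gamma>,q] mact \<Gamma> (q + 1) (- 1) a g1"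

lemma generatorsE:
  assumes "z \<in> mel \<Gamma> q"
  obtains \<alpha> a where "\<alpha> \<in> ael An q" "a \<in> ael An (q + 1)" "z = elt q \<alpha> a"
proof -
  from generators[OF assms] obtain \<alpha> where \<alpha>: "\<alpha> \<in> ael An q" "\<exists>a\<in>ael An (q + 1). z = elt q \<alpha> a" by (rule bexE)
  from \<alpha>(2) obtain a where "a \<in> ael An (q + 1)" "z = elt q \<alpha> a" by (rule bexE)
  with \<alpha>(1) show ?thesis by (rule that)
qed

lemma chain_map_eqI:
  assumes M: "cdg_module An M" and f: "chain_map An \<Gamma> M f" and g: "chain_map An \<Gamma> M g"
    and e: "f 0 g0 = g 0 g0" "f (- 1) g1 = g (- 1) g1"
  shows "f = g"
proof -
  interpret f: cdg_map An \<Gamma> M f by (rule cdg_mapI[OF \<Gamma>.cdg_mod M f])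
  interpret g: cdg_map An \<Gamma> M g by (rule cdg_mapI[OF \<Gamma>.cdg_mod M g])
  show ?thesis
  proof (rule graded_map_eqI[where M=\<Gamma>])
    fix q z assume "z \<in> mel \<Gamma> q"
    then obtain \<alpha> a where a: "\<alpha> \<in> ael An q" "a \<in> ael An (q + 1)" "z = elt q \<alpha> a" by (rule generatorsE)
    show "f q z = g q z" unfolding a(3) using a(1,2) by (simp add: f.add g.add f.act g.act e)
  qed (simp_all add: f.extensional g.extensional)
qed

text \<open>Coefficients are determined up to multiples of t^(i+1) and t^i by
  \<open>relations\<close>, and these powers kill x and y. This is the well-definedness of a map
  prescribed on the generators.\<close>

lemma coefficients_unique:
  assumes M: "cdg_module An M" and x: "x \<in> mel M p" "mact M 0 p (\<tau> (Suc i)) x = \<zero>[M,p]"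
    and y: "y \<in> mel M r" "mact M 0 r (\<tau> i) y = \<zero>[M,r]"
    and c: "\<alpha> \<in> ael An q" "\<alpha>' \<in> ael An q"
      "a \<in> ael An (q + 1)" "a' \<in> ael An (q + 1)"
    and eq: "elt q \<alpha> a
      = elt q \<alpha>' a'"
  shows "mact M q p \<alpha> x = mact M q p \<alpha>' x \<and> mact M (q + 1) r a y = mact M (q + 1) r a' y"
proof -
  interpret M: deformation_module k A n An ct M by (rule deformation_moduleI[OF M])
  have l\<Gamma>: "additive_map (acomp An s) (mcomp \<Gamma> (s + u)) (\<lambda>b. mact \<Gamma> s u b z)" if "z \<in> mel \<Gamma> u" for s u z
    using that by (intro additive_map.intro additive_map_axioms.intro alg_group \<Gamma>.comp_group) (simp_all add: \<Gamma>.act_l_distr)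
  have lM: "additive_map (acomp An s) (mcomp M (s + u)) (\<lambda>b. mact M s u b z)" if "z \<in> mel M u" for s u z
    using that by (intro additive_map.intro additive_map_axioms.intro alg_group M.comp_group) (simp_all add: M.act_l_distr)
  have m0: "mact \<Gamma> q 0 (\<alpha> \<ominus>[acomp An q] \<alpha>') g0 = mact \<Gamma> q 0 \<alpha> g0 \<ominus>[\<Gamma>,q] mact \<Gamma> q 0 \<alpha>' g0"
    using additive_map.minus[OF l\<Gamma>[OF g0] c(1,2)] by simp
  have m1: "mact \<Gamma> (q + 1) (- 1) (a \<ominus>[acomp An (q + 1)] a') g1 = mact \<Gamma> (q + 1) (- 1) a g1 \<ominus>[\<Gamma>,q] mact \<Gamma> (q + 1) (- 1) a' g1"
    using additive_map.minus[OF l\<Gamma>[OF g1] c(3,4)] by simp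
  have cc: "mact \<Gamma> q 0 \<alpha> g0 \<in> mel \<Gamma> q" "mact \<Gamma> q 0 \<alpha>' g0 \<in> mel \<Gamma> q"
    "mact \<Gamma> (q + 1) (- 1) a g1 \<in> mel \<Gamma> q" "mact \<Gamma> (q + 1) (- 1) a' g1 \<in> mel \<Gamma> q"
    using c by simp_all
  have "mact \<Gamma> q 0 (\<alpha> \<ominus>[acomp An q] \<alpha>') g0 \<oplus>[\<Gamma>,q] mact \<Gamma> (q + 1) (- 1) (a \<ominus>[acomp An (q + 1)] a') g1
    = (elt q \<alpha> a) \<ominus>[\<Gamma>,q] (elt q \<alpha>' a')"
    unfolding m0 m1 by (rule \<Gamma>.G.group_eqI[where p=q], (rule \<Gamma>.G.rep_rules | simp only: cc | simp)+)
  also have "\<dots> = \<zero>[\<Gamma>,q]" unfolding eq using cc by (simp add: a_minus_def \<Gamma>.G.r_neg)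
  finally have 0: "mact \<Gamma> q 0 (\<alpha> \<ominus>[acomp An q] \<alpha>') g0 \<oplus>[\<Gamma>,q] mact \<Gamma> (q + 1) (- 1) (a \<ominus>[acomp An (q + 1)] a') g1 = \<zero>[\<Gamma>,q]" .
  have d: "\<alpha> \<ominus>[acomp An q] \<alpha>' \<in> ael An q" "a \<ominus>[acomp An (q + 1)] a' \<in> ael An (q + 1)"
    using c AM.minus_closed by simp_all
  obtain \<beta> \<gamma> where b: "\<beta> \<in> ael An q" "\<alpha> \<ominus>[acomp An q] \<alpha>' = amult An q 0 \<beta> (\<tau> (Suc i))"
    "\<gamma> \<in> ael An (q + 1)" "a \<ominus>[acomp An (q + 1)] a' = amult An (q + 1) 0 \<gamma> (\<tau> i)"
    using relations[OF d 0] by blast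
  have "mact M q p \<alpha> x \<ominus>[M,q + p] mact M q p \<alpha>' x = mact M q p (amult An q 0 \<beta> (\<tau> (Suc i))) x"
    using additive_map.minus[OF lM[OF x(1)] c(1,2)] b(2) by simp
  also have "\<dots> = mact M q p \<beta> (mact M 0 p (\<tau> (Suc i)) x)" using M.act_assoc[OF b(1) \<tau>_closed x(1), of "Suc i"] by simp
  also have "\<dots> = \<zero>[M,q + p]" unfolding x(2) by (rule M.act_zero[OF b(1) refl])
  finally have 1: "mact M q p \<alpha> x = mact M q p \<alpha>' x" using M.G.minus_eq_zero_iff[of "mact M q p \<alpha> x" "q + p"] c x by simp
  have "mact M (q + 1) r a y \<ominus>[M,q + 1 + r] mact M (q + 1) r a' y = mact M (q + 1) r (amult An (q + 1) 0 \<gamma> (\<tau> i)) y"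
    using additive_map.minus[OF lM[OF y(1)] c(3,4)] b(4) by simp
  also have "\<dots> = mact M (q + 1) r \<gamma> (mact M 0 r (\<tau> i) y)" using M.act_assoc[OF b(3) \<tau>_closed y(1), of i] by simp
  also have "\<dots> = \<zero>[M,q + 1 + r]" unfolding y(2) by (rule M.act_zero[OF b(3) refl])
  finally have 2: "mact M (q + 1) r a y = mact M (q + 1) r a' y" using M.G.minus_eq_zero_iff[of "mact M (q + 1) r a y" "q + 1 + r"] c y by simp
  show ?thesis using 1 2 by simp
qed

lemma elt_closed: "\<lbrakk>\<alpha> \<in> ael An q; a \<in> ael An (q + 1)\<rbrakk> \<Longrightarrow> elt q \<alpha> a \<in> mel \<Gamma> q"
  by simp

lemma elt_add:
  "\<lbrakk>\<alpha> \<in> ael An q; a \<in> ael An (q + 1); \<beta> \<in> ael An q; b \<in> ael An (q + 1)\<rbrakk>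
    \<Longrightarrow> elt q \<alpha> a \<oplus>[\<Gamma>,q] elt q \<beta> b = elt q (\<alpha> \<oplus>[acomp An q] \<beta>) (a \<oplus>[acomp An (q + 1)] b)"
  by (simp add: \<Gamma>.act_l_distr \<Gamma>.G.a_ac)

lemma elt_act:
  assumes "u \<in> ael An r" "\<alpha> \<in> ael An q" "a \<in> ael An (q + 1)"
  shows "mact \<Gamma> r q u (elt q \<alpha> a) = elt (r + q) (amult An r q u \<alpha>) (amult An r (q + 1) u a)"
proof -
  have "mact \<Gamma> (r + q + 1) (- 1) (amult An r (q + 1) u a) g1 = mact \<Gamma> r q u (mact \<Gamma> (q + 1) (- 1) a g1)"
    using \<Gamma>.act_assoc[OF assms(1,3) g1] by (simp add: add.assoc)
  then show ?thesis using assms \<Gamma>.act_assoc[OF assms(1,2) g0] by (simp add: \<Gamma>.act_r_distr)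
qed

lemma elt_generators: "elt 0 (aone An) \<zero>[acomp An 1] = g0" "elt (- 1) \<zero>[acomp An (- 1)] (aone An) = g1"
  using act_zero_l[OF \<Gamma>.cdg_mod g1, of 0 1] act_zero_l[OF \<Gamma>.cdg_mod g0, of "- 1" "- 1"] by (simp_all add: \<Gamma>.act_one)

text \<open>One construction serves for closed maps (p = 0) and for homotopies (p = -1). A map of
  degree p takes \<open>g0\<close> to degree p and \<open>g1\<close> to degree s = p - 1, and the
  signs are the Koszul signs for moving it past the coefficients.\<close>

lemma generator_linear:
  assumes M: "cdg_module An M" and x: "x \<in> mel M p" "mact M 0 p (\<tau> (Suc i)) x = \<zero>[M,p]"
    and y: "y \<in> mel M s" "mact M 0 s (\<tau> i) y = \<zero>[M,s]" and s: "p = s + 1"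
  shows "\<exists>f\<in>carrier (hom_space An \<Gamma> M p). \<forall>q. \<forall>\<alpha>\<in>ael An q. \<forall>a\<in>ael An (q + 1).
    f q (elt q \<alpha> a) = sign_of (mcomp M (q + p)) (p * q) (mact M q p \<alpha> x)
      \<oplus>[M,q + p] sign_of (mcomp M (q + p)) (p * (q + 1)) (mact M (q + 1) s a y)"
proof -
  interpret M: deformation_module k A n An ct M by (rule deformation_moduleI[OF M])
  let ?x = "\<lambda>q \<alpha>. mact M q p \<alpha> x" and ?y = "\<lambda>q a. mact M (q + 1) s a y"
  let ?e = "\<lambda>q \<alpha> a. sign_of (mcomp M (q + p)) (p * q) (?x q \<alpha>) \<oplus>[M,q + p] sign_of (mcomp M (q + p)) (p * (q + 1)) (?y q a)"
  \<comment> \<open>An arbitrary choice of coefficients; by \<open>coefficients_unique\<close> the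
    value of f does not depend on it.\<close>
  define C where "C q z = (SOME c. fst c \<in> ael An q \<and> snd c \<in> ael An (q + 1) \<and> z = elt q (fst c) (snd c))" for q z
  have C: "fst (C q z) \<in> ael An q \<and> snd (C q z) \<in> ael An (q + 1) \<and> z = elt q (fst (C q z)) (snd (C q z))"
    if z: "z \<in> mel \<Gamma> q" for q z
  proof -
    obtain \<alpha> a where "\<alpha> \<in> ael An q" "a \<in> ael An (q + 1)" "z = elt q \<alpha> a" using generatorsE[OF z] .
    then have "\<exists>c. fst c \<in> ael An q \<and> snd c \<in> ael An (q + 1) \<and> z = elt q (fst c) (snd c)"
      by (intro exI[of _ "(\<alpha>, a)"]) simp
    from someI_ex[OF this] show ?thesis unfolding C_def .
  qed
  define f where "f q = (\<lambda>z\<in>mel \<Gamma> q. ?e q (fst (C q z)) (snd (C q z)))" for q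
  have f: "f q (elt q \<alpha> a) = ?e q \<alpha> a" if b: "\<alpha> \<in> ael An q" "a \<in> ael An (q + 1)" for q \<alpha> a
  proof -
    let ?z = "elt q \<alpha> a"
    have z: "?z \<in> mel \<Gamma> q" using b by (rule elt_closed)
    have c: "fst (C q ?z) \<in> ael An q" "snd (C q ?z) \<in> ael An (q + 1)" "elt q (fst (C q ?z)) (snd (C q ?z)) = ?z"
      using C[OF z] by simp_all
    show ?thesis using coefficients_unique[OF M x y c(1) b(1) c(2) b(2) c(3)] z by (simp add: f_def)
  qed
  have c: "?x q \<alpha> \<in> mel M (q + p)" "?y q a \<in> mel M (q + p)"
    if "\<alpha> \<in> ael An q" "a \<in> ael An (q + 1)" for q \<alpha> a using that x y s by simp_all
  have "f \<in> carrier (hom_space An \<Gamma> M p)"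
    unfolding hom_space_def add_group_def partial_object.simps mem_Collect_eq PiE_iff
  proof (intro conjI allI ballI)
    show "f q \<in> extensional (mel \<Gamma> q)" for q by (simp add: f_def)
    fix q z assume z: "z \<in> mel \<Gamma> q"
    obtain \<alpha> a where b: "\<alpha> \<in> ael An q" "a \<in> ael An (q + 1)" "z = elt q \<alpha> a" using generatorsE[OF z] .
    note cb = c[OF b(1,2)]
    have E: "q + 1 + s = q + p" using s by simp
    show "f q z \<in> mel M (q + p)"
      unfolding b(3) f[OF b(1,2)] by (rule M.G.add.m_closed; rule M.G.sign_of_closed; rule cb)
    show "f q (z \<oplus>[\<Gamma>,q] w) = f q z \<oplus>[M,q + p] f q w" if w: "w \<in> mel \<Gamma> q" for w
    proof -
      obtain \<beta> b' where b': "\<beta> \<in> ael An q" "b' \<in> ael An (q + 1)" "w = elt q \<beta> b'" using generatorsE[OF w] .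
      note cb' = c[OF b'(1,2)]
      have bb: "\<alpha> \<oplus>[acomp An q] \<beta> \<in> ael An q" "a \<oplus>[acomp An (q + 1)] b' \<in> ael An (q + 1)" using b b' by simp_all
      have 1: "?x q (\<alpha> \<oplus>[acomp An q] \<beta>) = ?x q \<alpha> \<oplus>[M,q + p] ?x q \<beta>"
        using M.act_l_distr[OF b(1) b'(1) x(1)] by simp
      have 2: "?y q (a \<oplus>[acomp An (q + 1)] b') = ?y q a \<oplus>[M,q + p] ?y q b'"
        using M.act_l_distr[OF b(2) b'(2) y(1)] E by simp
      show ?thesis
        unfolding b(3) b'(3) elt_add[OF b(1,2) b'(1,2)] f[OF bb] f[OF b(1,2)] f[OF b'(1,2)] 1 2 M.G.sign_of_add[OF cb(1) cb'(1)] M.G.sign_of_add[OF cb(2) cb'(2)]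
        using M.G.sign_of_closed[OF cb(1), of "p * q"] M.G.sign_of_closed[OF cb'(1), of "p * q"]
          M.G.sign_of_closed[OF cb(2), of "p * (q + 1)"] M.G.sign_of_closed[OF cb'(2), of "p * (q + 1)"] by (simp only: M.G.a_ac M.G.a_closed)
    qed
    show "f (r + q) (mact \<Gamma> r q u z) = sign_of (mcomp M (r + q + p)) (p * r) (mact M r (q + p) u (f q z))" if u: "u \<in> ael An r" for r u
    proof -
      have bb: "amult An r q u \<alpha> \<in> ael An (r + q)" "amult An r (q + 1) u a \<in> ael An (r + q + 1)"
        using b u by simp_all
      have E: "r + (q + 1) = r + q + 1" "q + 1 + s = q + p" using s by simp_all
      have 2: "?y (r + q) (amult An r (q + 1) u a) = mact M r (q + p) u (?y q a)"
        using M.act_assoc[OF u b(2) y(1)] by (simp only: E)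
      have 3: "?x (r + q) (amult An r q u \<alpha>) = mact M r (q + p) u (?x q \<alpha>)"
        using M.act_assoc[OF u b(1) x(1)] by simp
      interpret u: additive_map "mcomp M (q + p)" "mcomp M (r + q + p)" "mact M r (q + p) u"
        using u by (intro M.act_map) simp_all
      have cu: "mact M r (q + p) u (?x q \<alpha>) \<in> mel M (r + q + p)" "mact M r (q + p) u (?y q a) \<in> mel M (r + q + p)"
        by (rule u.closed; rule cb)+
      have D: "p * (r + q) = p * r + p * q" "p * (r + q + 1) = p * r + p * (q + 1)" by (simp_all add: distrib_left)
      show ?thesis
        unfolding b(3) elt_act[OF u b(1,2)] f[OF bb] f[OF b(1,2)] 2 3 u.add[OF M.G.sign_of_closed[OF cb(1)] M.G.sign_of_closed[OF cb(2)]] u.sign[OF cb(1)] u.sign[OF cb(2)]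
          M.G.sign_of_add[OF M.G.sign_of_closed[OF cu(1)] M.G.sign_of_closed[OF cu(2)]]
          M.G.sign_of_sign_of[OF cu(1)] M.G.sign_of_sign_of[OF cu(2)] D ..
    qed
  qed
  then show ?thesis using f by blast
qed

text \<open>The map from \<open>generator_linear\<close> commutes with d because d of a combination
  of generators is computed by one formula in \<Gamma> and in M, the equations for d x and d y being
  those for the generators.\<close>

lemma generator_map:
  assumes M: "cdg_module An M" and x: "x \<in> mel M 0" "mact M 0 0 (\<tau> (Suc i)) x = \<zero>[M,0]"
    and y: "y \<in> mel M (- 1)" "mact M 0 (- 1) (\<tau> i) y = \<zero>[M,- 1]"
    and dx: "mdiff M 0 x = mact M 2 (- 1) ct y" and dy: "mdiff M (- 1) y = mact M 0 0 (\<tau> (Suc 0)) x"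
  shows "\<exists>f. chain_map An \<Gamma> M f \<and> f 0 g0 = x \<and> f (- 1) g1 = y"
proof -
  interpret M: deformation_module k A n An ct M by (rule deformation_moduleI[OF M])
  obtain f where fh: "f \<in> carrier (hom_space An \<Gamma> M 0)" and f: "\<forall>q. \<forall>\<beta>\<in>ael An q. \<forall>\<gamma>\<in>ael An (q + 1).
      f q (elt q \<beta> \<gamma>) = mact M q 0 \<beta> x \<oplus>[M,q] mact M (q + 1) (- 1) \<gamma> y"
    using generator_linear[OF M x y] by (auto simp: sign_of_def)
  have diff: "f (q + 1) (mdiff \<Gamma> q z) = mdiff M q (f q z)" if z: "z \<in> mel \<Gamma> q" for q z
  proof -
    obtain \<beta> \<gamma> where b: "\<beta> \<in> ael An q" "\<gamma> \<in> ael An (q + 1)" "z = elt q \<beta> \<gamma>" using generatorsE[OF z] .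
    \<comment> \<open>Coefficients of d z: each generator contributes to the other coefficient
      through d g0 = (c/t) g1 and d g1 = t g0, with the sign for moving d past the
      coefficient.\<close>
    let ?\<beta> = "adiff An q \<beta> \<oplus>[acomp An (q + 1)] sign_of (acomp An (q + 1)) (q + 1) (amult An (q + 1) 0 \<gamma> (\<tau> (Suc 0)))"
    let ?\<gamma> = "adiff An (q + 1) \<gamma> \<oplus>[acomp An (q + 2)] sign_of (acomp An (q + 2)) q (amult An q 2 \<beta> ct)"
    have bb: "?\<beta> \<in> ael An (q + 1)" "?\<gamma> \<in> ael An (q + 1 + 1)"
      using b(1,2) AM.M.sign_of_closed by (simp_all add: add.assoc)
    \<comment> \<open>Stated for any module with such a pair u, v, as it is applied to the
      generators of \<Gamma> and to their prospective images in M.\<close>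
    have key: "mdiff X q (mact X q 0 \<beta> u \<oplus>[X,q] mact X (q + 1) (- 1) \<gamma> v) = mact X (q + 1) 0 ?\<beta> u \<oplus>[X,q + 1] mact X (q + 1 + 1) (- 1) ?\<gamma> v"
        if X: "cdg_module An X" and u: "u \<in> mel X 0" and v: "v \<in> mel X (- 1)"
          and du: "mdiff X 0 u = mact X 2 (- 1) ct v" and dv: "mdiff X (- 1) v = mact X 0 0 (\<tau> (Suc 0)) u"
        for X :: "(nat \<Rightarrow> 'a, 'x) cdg_mod" and u v
      proof -
        interpret X: cdg_module An X by (rule X)
        have lX: "additive_map (acomp An s) (mcomp X w) (\<lambda>b. mact X s t b z)" if "z \<in> mel X t" "w = s + t" for s t z w
          using that by (intro additive_map.intro additive_map_axioms.intro alg_group X.comp_group) (simp_all add: X.act_l_distr)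
        interpret l0: additive_map "acomp An (q + 1)" "mcomp X (q + 1)" "\<lambda>b. mact X (q + 1) 0 b u" using u by (intro lX) simp_all
        interpret l1: additive_map "acomp An (q + 2)" "mcomp X (q + 1)" "\<lambda>b. mact X (q + 2) (- 1) b v" using v by (intro lX) simp_all
        have c: "mact X q 0 \<beta> u \<in> mel X q" "mact X (q + 1) (- 1) \<gamma> v \<in> mel X q"
          "adiff An q \<beta> \<in> ael An (q + 1)" "amult An (q + 1) 0 \<gamma> (\<tau> (Suc 0)) \<in> ael An (q + 1)"
          "adiff An (q + 1) \<gamma> \<in> ael An (q + 2)" "amult An q 2 \<beta> ct \<in> ael An (q + 2)"
          using b(1,2) u v by simp_all
        have d0: "mdiff X q (mact X q 0 \<beta> u) = mact X (q + 1) 0 (adiff An q \<beta>) u \<oplus>[X,q + 1] sign_of (mcomp X (q + 1)) q (mact X (q + 2) (- 1) (amult An q 2 \<beta> ct) v)"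
          using X.mdiff_act[OF b(1) u] X.act_assoc[OF b(1) ct_closed v] by (simp add: du)
        have d1: "mdiff X q (mact X (q + 1) (- 1) \<gamma> v) = mact X (q + 2) (- 1) (adiff An (q + 1) \<gamma>) v \<oplus>[X,q + 1] sign_of (mcomp X (q + 1)) (q + 1) (mact X (q + 1) 0 (amult An (q + 1) 0 \<gamma> (\<tau> (Suc 0))) u)"
          using X.mdiff_act[OF b(2) v] X.act_assoc[OF b(2) \<tau>_closed u, of "Suc 0"] by (simp add: dv add.commute)
        have E: "q + 1 + 1 = q + 2" by simp
        have cc: "mact X (q + 1) 0 (adiff An q \<beta>) u \<in> mel X (q + 1)" "mact X (q + 2) (- 1) (amult An q 2 \<beta> ct) v \<in> mel X (q + 1)"
          "mact X (q + 2) (- 1) (adiff An (q + 1) \<gamma>) v \<in> mel X (q + 1)" "mact X (q + 1) 0 (amult An (q + 1) 0 \<gamma> (\<tau> (Suc 0))) u \<in> mel X (q + 1)"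
          using c u v by simp_all
        show ?thesis
          unfolding X.mdiff_add[OF c(1,2)] d0 d1 E l0.add[OF c(3) AM.M.sign_of_closed[OF c(4)]] l1.add[OF c(5) AM.M.sign_of_closed[OF c(6)]]
            l0.sign[OF c(4)] l1.sign[OF c(6)]
          using cc by (simp add: X.G.a_ac)
      qed
    have "f (q + 1) (mdiff \<Gamma> q z) = mact M (q + 1) 0 ?\<beta> x \<oplus>[M,q + 1] mact M (q + 1 + 1) (- 1) ?\<gamma> y"
      unfolding b(3) key[OF \<Gamma>.cdg_mod g0 g1 d_g0 d_g1] using f bb by blast
    also have "\<dots> = mdiff M q (f q z)" unfolding key[OF M x(1) y(1) dx dy, symmetric] b(3) using f b(1,2) by simp
    finally show ?thesis .
  qed
  have "chain_map An \<Gamma> M f" using fh diff by (simp add: hom_space_def add_group_def chain_map_def sign_of_def)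
  moreover have "f 0 (elt 0 (aone An) \<zero>[acomp An 1]) = mact M 0 0 (aone An) x \<oplus>[M,0] mact M 1 (- 1) \<zero>[acomp An 1] y"
    using f[rule_format, OF one_closed, of "\<zero>[acomp An 1]"] by simp
  moreover have "f (- 1) (elt (- 1) \<zero>[acomp An (- 1)] (aone An)) = mact M (- 1) 0 \<zero>[acomp An (- 1)] x \<oplus>[M,- 1] mact M 0 (- 1) (aone An) y"
    using f[rule_format, of "\<zero>[acomp An (- 1)]" "- 1" "aone An"] by simp
  ultimately show ?thesis
    using act_zero_l[OF M y(1), of 0 1] act_zero_l[OF M x(1), of "- 1" "- 1"] x(1) y(1) unfolding elt_generators by (intro exI[of _ f]) (simp add: M.act_one)
qed

text \<open>The case p = -1 of \<open>generator_linear\<close>. A homotopy obeys no condition on d,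
  so x and y are only required to be killed by the right powers of t.\<close>

lemma generator_homotopy:
  assumes M: "cdg_module An M" and x: "x \<in> mel M (- 1)" "mact M 0 (- 1) (\<tau> (Suc i)) x = \<zero>[M,- 1]"
    and y: "y \<in> mel M (- 2)" "mact M 0 (- 2) (\<tau> i) y = \<zero>[M,- 2]"
  shows "\<exists>h. homotopy An \<Gamma> M h \<and> h 0 g0 = x \<and> h (- 1) g1 = y"
proof -
  interpret M: deformation_module k A n An ct M by (rule deformation_moduleI[OF M])
  interpret \<Gamma>M: cdg_module_pair "trunc_ring k n" An \<Gamma> M by (intro cdg_module_pair.intro cdg_algebra_axioms \<Gamma>.cdg_mod M)
  obtain h where h: "homotopy An \<Gamma> M h" and e: "\<forall>q. \<forall>\<alpha>\<in>ael An q. \<forall>a\<in>ael An (q + 1).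
    h q (elt q \<alpha> a) = sign_of (mcomp M (q + - 1)) (- 1 * q) (mact M q (- 1) \<alpha> x)
      \<oplus>[M,q + - 1] sign_of (mcomp M (q + - 1)) (- 1 * (q + 1)) (mact M (q + 1) (- 2) a y)"
    using generator_linear[OF M x y] unfolding \<Gamma>M.homotopies by auto
  have "h 0 (elt 0 (aone An) \<zero>[acomp An 1]) = x"
    using e[rule_format, OF one_closed, of "\<zero>[acomp An 1]"] act_zero_l[OF M y(1), of "- 1" 1] x(1) by (simp add: M.act_one sign_of_def)
  moreover have "h (- 1) (elt (- 1) \<zero>[acomp An (- 1)] (aone An)) = y"
    using e[rule_format, of "\<zero>[acomp An (- 1)]" "- 1" "aone An"] act_zero_l[OF M x(1), of "- 2" "- 1"] y(1) by (simp add: M.act_one sign_of_def)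
  ultimately show ?thesis unfolding elt_generators using h by blast
qed

end

context gamma_like begin

lemma generators_cocycle:
  assumes M: "cdg_module An M" and f: "chain_map An \<Gamma> M f"
  shows "curved_complex.cone_cocycle (mcomp M) (mdiff M) (\<lambda>j p. mact M 0 p (\<tau> j)) (\<lambda>p. mact M 2 p ct) i 0 (f 0 g0) (f (- 1) g1)"
proof -
  interpret M: deformation_module k A n An ct M by (rule deformation_moduleI[OF M])
  interpret f: cdg_map An \<Gamma> M f by (rule cdg_mapI[OF \<Gamma>.cdg_mod M f])
  have "mact M 0 0 (\<tau> (Suc i)) (f 0 g0) = f 0 (mact \<Gamma> 0 0 (\<tau> (Suc i)) g0)" by (rule f.act[symmetric]) simp_all
  moreover have "mact M 0 (- 1) (\<tau> i) (f (- 1) g1) = f (- 1) (mact \<Gamma> 0 (- 1) (\<tau> i) g1)" by (rule f.act[symmetric]) simp_all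
  moreover have "mdiff M 0 (f 0 g0) = f 1 (mdiff \<Gamma> 0 g0)" by (rule f.diff[symmetric]) simp_all
  moreover have "mdiff M (- 1) (f (- 1) g1) = f 0 (mdiff \<Gamma> (- 1) g1)" by (rule f.diff[symmetric]) simp_all
  moreover have "f 1 (mact \<Gamma> 2 (- 1) ct g1) = mact M 2 (- 1) ct (f (- 1) g1)" by (rule f.act) simp_all
  moreover have "f 0 (mact \<Gamma> 0 0 (\<tau> (Suc 0)) g0) = mact M 0 0 (\<tau> (Suc 0)) (f 0 g0)" by (rule f.act) simp_all
  ultimately show ?thesis unfolding M.CC.cone_cocycle_def using f.closed[OF g0] f.closed[OF g1]
    by (simp add: T_g0 T_g1 d_g0 d_g1 f.zero)
qed

text \<open>A closed map is determined by its values on the generators, and the boundary of h takes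
  the values d h(g0) + (c/t) h(g1) and d h(g1) + t h(g0) there.\<close>

lemma null_homotopic_iff:
  assumes M: "cdg_module An M" and f: "chain_map An \<Gamma> M f"
  shows "null_homotopic An \<Gamma> M f \<longleftrightarrow>
    curved_complex.cone_boundary (mcomp M) (mdiff M) (\<lambda>j p. mact M 0 p (\<tau> j)) (\<lambda>p. mact M 2 p ct) i 0 (f 0 g0) (f (- 1) g1)"
proof -
  interpret M: deformation_module k A n An ct M by (rule deformation_moduleI[OF M])
  interpret MM: cdg_module_pair "trunc_ring k n" An \<Gamma> M by (intro cdg_module_pair.intro cdg_algebra_axioms \<Gamma>.cdg_mod M)
  have bd: "boundary \<Gamma> M h 0 g0 = mdiff M (- 1) (h 0 g0) \<oplus>[M,0] mact M 2 (- 2) ct (h (- 1) g1)"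
    "boundary \<Gamma> M h (- 1) g1 = mdiff M (- 2) (h (- 1) g1) \<oplus>[M,- 1] mact M 0 (- 1) (\<tau> (Suc 0)) (h 0 g0)"
    if h: "homotopy An \<Gamma> M h" for h
  proof -
    interpret h: cdg_homotopy An \<Gamma> M h by (rule cdg_homotopyI[OF \<Gamma>.cdg_mod M h])
    have "h 1 (mact \<Gamma> 2 (- 1) ct g1) = sign_of (mcomp M 0) 2 (mact M 2 (- 2) ct (h (- 1) g1))" by (rule h.act) simp_all
    then show "boundary \<Gamma> M h 0 g0 = mdiff M (- 1) (h 0 g0) \<oplus>[M,0] mact M 2 (- 2) ct (h (- 1) g1)"
      by (simp add: d_g0 sign_of_def)
    have "h 0 (mact \<Gamma> 0 0 (\<tau> (Suc 0)) g0) = sign_of (mcomp M (- 1)) 0 (mact M 0 (- 1) (\<tau> (Suc 0)) (h 0 g0))" by (rule h.act) simp_all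
    then show "boundary \<Gamma> M h (- 1) g1 = mdiff M (- 2) (h (- 1) g1) \<oplus>[M,- 1] mact M 0 (- 1) (\<tau> (Suc 0)) (h 0 g0)"
      by (simp add: d_g1 sign_of_def)
  qed
  show ?thesis
  proof
    assume "null_homotopic An \<Gamma> M f"
    then obtain h where h: "homotopy An \<Gamma> M h" "f = boundary \<Gamma> M h" unfolding null_homotopic_def by blast
    interpret h: cdg_homotopy An \<Gamma> M h by (rule cdg_homotopyI[OF \<Gamma>.cdg_mod M h(1)])
    \<comment> \<open>\<open>cone_boundary\<close> subtracts the terms containing y' while the
      boundary of h adds those with h(g1); hence the sign of the second witness.\<close>
    let ?x = "h 0 g0" and ?y = "\<ominus>[M,- 2] h (- 1) g1"
    have c: "?x \<in> mel M (- 1)" "h (- 1) g1 \<in> mel M (- 2)" by (rule h.closed; simp)+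
    have "h 0 (mact \<Gamma> 0 0 (\<tau> (Suc i)) g0) = sign_of (mcomp M (- 1)) 0 (mact M 0 (- 1) (\<tau> (Suc i)) ?x)" by (rule h.act) simp_all
    then have T0: "mact M 0 (- 1) (\<tau> (Suc i)) ?x = \<zero>[M,- 1]"
      using additive_map.zero[OF h.map, of "- 1" 0] by (simp add: T_g0 sign_of_def)
    have "h (- 1) (mact \<Gamma> 0 (- 1) (\<tau> i) g1) = sign_of (mcomp M (- 2)) 0 (mact M 0 (- 2) (\<tau> i) (h (- 1) g1))" by (rule h.act) simp_all
    then have T1: "mact M 0 (- 2) (\<tau> i) (h (- 1) g1) = \<zero>[M,- 2]"
      using additive_map.zero[OF h.map, of "- 2" "- 1"] by (simp add: T_g1 sign_of_def)
    have n1: "mact M 2 (- 2) ct ?y = \<ominus>[M,0] mact M 2 (- 2) ct (h (- 1) g1)"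
      using additive_map.neg[OF M.act_map[OF ct_closed, where q="- 2" and s=0] c(2)] by simp
    have n2: "mdiff M (- 2) ?y = \<ominus>[M,- 1] mdiff M (- 2) (h (- 1) g1)"
      using additive_map.neg[OF M.mdiff_map[where p="- 2" and s="- 1"] c(2)] by simp
    have n3: "mact M 0 (- 2) (\<tau> i) ?y = \<zero>[M,- 2]"
      using additive_map.neg[OF M.act_map[OF \<tau>_closed, where q="- 2" and s="- 2"] c(2)] T1 by simp
    show "M.CC.cone_boundary i 0 (f 0 g0) (f (- 1) g1)"
      unfolding M.CC.cone_boundary_def h(2) bd[OF h(1)] using c T0 n3
      by (intro bexI[of _ ?x] bexI[of _ ?y]) (simp_all add: n1 n2 a_minus_def M.G.a_comm)
  next
    assume "M.CC.cone_boundary i 0 (f 0 g0) (f (- 1) g1)"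
    then obtain x y where xy: "x \<in> mel M (- 1)" "y \<in> mel M (- 2)"
      "mact M 0 (- 1) (\<tau> (Suc i)) x = \<zero>[M,- 1]" "mact M 0 (- 2) (\<tau> i) y = \<zero>[M,- 2]"
      "f 0 g0 = mdiff M (- 1) x \<ominus>[M,0] mact M 2 (- 2) ct y"
      "f (- 1) g1 = mact M 0 (- 1) (\<tau> (Suc 0)) x \<ominus>[M,- 1] mdiff M (- 2) y"
      unfolding M.CC.cone_boundary_def by auto
    let ?y = "\<ominus>[M,- 2] y"
    have y: "?y \<in> mel M (- 2)" using xy(2) by simp
    have n1: "mact M 2 (- 2) ct ?y = \<ominus>[M,0] mact M 2 (- 2) ct y"
      using additive_map.neg[OF M.act_map[OF ct_closed, where q="- 2" and s=0] xy(2)] by simp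
    have n2: "mdiff M (- 2) ?y = \<ominus>[M,- 1] mdiff M (- 2) y"
      using additive_map.neg[OF M.mdiff_map[where p="- 2" and s="- 1"] xy(2)] by simp
    have n3: "mact M 0 (- 2) (\<tau> i) ?y = \<zero>[M,- 2]"
      using additive_map.neg[OF M.act_map[OF \<tau>_closed, where q="- 2" and s="- 2"] xy(2)] xy(4) by simp
    obtain h where h: "homotopy An \<Gamma> M h" "h 0 g0 = x" "h (- 1) g1 = ?y"
      using generator_homotopy[OF M xy(1,3) y n3] by blast
    have "f = boundary \<Gamma> M h"
    proof (rule chain_map_eqI[OF M f MM.chain_map_boundary[OF h(1)]])
      show "f 0 g0 = boundary \<Gamma> M h 0 g0" unfolding bd[OF h(1)] h(2,3) xy(5) n1 by (simp add: a_minus_def)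
      show "f (- 1) g1 = boundary \<Gamma> M h (- 1) g1" unfolding bd[OF h(1)] h(2,3) xy(6) n2
        using xy(1,2) by (simp add: a_minus_def M.G.a_comm)
    qed
    then show "null_homotopic An \<Gamma> M f" unfolding null_homotopic_def using h(1) by blast
  qed
qed

lemma null_homotopic_n_acyclic:
  assumes M: "cdg_module An M" and ac: "n_acyclic k n An M" and f: "chain_map An \<Gamma> M f"
  shows "null_homotopic An \<Gamma> M f"
proof -
  interpret M: deformation_module k A n An ct M by (rule deformation_moduleI[OF M])
  have "M.CC.gr_acyclic j" if "j \<le> n" for j using ac that unfolding M.n_acyclic_iff M.gr_acyclic_iff by simp
  then show ?thesis unfolding null_homotopic_iff[OF M f]
    using M.CC.cone_acyclic[OF _ i_le generators_cocycle[OF M f]] by simp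
qed

text \<open>Closed maps out of \<Gamma>_i see pairs in degree 0 only. A pair in degree p becomes a
  map into M[p], where d acquires the sign (-1)^p while t and c/t, being of even degree, act as
  before.\<close>

lemma cone_boundary_shift:
  assumes M: "cdg_module An M" and null: "\<And>f. chain_map An \<Gamma> (shift p M) f \<Longrightarrow> null_homotopic An \<Gamma> (shift p M) f"
    and xy: "curved_complex.cone_cocycle (mcomp M) (mdiff M) (\<lambda>j p. mact M 0 p (\<tau> j)) (\<lambda>p. mact M 2 p ct) i p x y"
  shows "curved_complex.cone_boundary (mcomp M) (mdiff M) (\<lambda>j p. mact M 0 p (\<tau> j)) (\<lambda>p. mact M 2 p ct) i p x y"
proof -
  interpret M: deformation_module k A n An ct M by (rule deformation_moduleI[OF M])
  have S: "cdg_module An (shift p M)" by (rule shift_cdg_module[OF cdg_algebra_axioms M])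
  interpret S: deformation_module k A n An ct "shift p M" by (rule deformation_moduleI[OF S])
  let ?s = "\<lambda>q. sign_of (mcomp M q) p"
  have E: "- 1 + p = p - 1" "- 2 + p = p - 2" "1 + p = p + 1" by simp_all
  have Z: "x \<in> mel M p" "y \<in> mel M (p - 1)"
     "M.T (Suc i) p x = \<zero>[M,p]" "M.T i (p - 1) y = \<zero>[M,p - 1]"
     "mdiff M p x = M.b (p - 1) y" "mdiff M (p - 1) y = M.T (Suc 0) p x"
    using xy unfolding M.CC.cone_cocycle_def by blast+
  have sT: "M.T j q (?s q u) = ?s q (M.T j q u)" if "u \<in> mel M q" for j q u
    using additive_map.sign[OF M.act_map[OF \<tau>_closed, where q=q and s=q] that] by simp
  have sb: "M.b q (?s q u) = ?s r (M.b q u)" if "u \<in> mel M q" "r = q + 2" for q r u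
    using additive_map.sign[OF M.act_map[OF ct_closed, where q=q and s=r] that(1)] that(2) by simp
  have sd: "mdiff M q (?s q u) = ?s r (mdiff M q u)" if "u \<in> mel M q" "r = q + 1" for q r u
    using additive_map.sign[OF M.mdiff_map[OF that(2)] that(1)] .
  have ss: "?s q (?s q u) = u" if "u \<in> mel M q" for q u
    using M.G.sign_of_sign_of[OF that, of p p] by (simp add: sign_of_def)
  have s0: "?s q \<zero>[M,q] = \<zero>[M,q]" for q by (simp add: sign_of_def)
  have sm: "?s q (u \<ominus>[M,q] v) = ?s q u \<ominus>[M,q] ?s q v" if "u \<in> mel M q" "v \<in> mel M q" for q u v
    using that by (simp add: sign_of_def a_minus_def M.G.minus_add)
  have shift_simp: "mact (shift p M) 0 q u v = mact M 0 (q + p) u v" "mdiff (shift p M) q v = ?s (q + 1 + p) (mdiff M (q + p) v)"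
    "mcomp (shift p M) q = mcomp M (q + p)" "mact (shift p M) 2 q u v = mact M 2 (q + p) u v" for q u v
    by (simp_all add: shift_def sign_of_def)
  \<comment> \<open>The sign (-1)^p of the shifted differential is put on the component y alone,
    which absorbs it in both cocycle conditions.\<close>
  let ?y = "?s (p - 1) y"
  have cs: "?y \<in> mel M (p - 1)" using Z(2) by (rule M.G.sign_of_closed)
  have "\<exists>f. chain_map An \<Gamma> (shift p M) f \<and> f 0 g0 = x \<and> f (- 1) g1 = ?y"
  proof (rule generator_map[OF S])
    have dy: "mdiff M (p - 1) ?y = ?s p (mdiff M (p - 1) y)" by (rule sd[OF Z(2)]) simp
    have "M.b (p - 1) ?y = ?s (p + 1) (M.b (p - 1) y)" by (rule sb[OF Z(2)]) simp
    then show "mdiff (shift p M) 0 x = mact (shift p M) 2 (- 1) ct ?y" by (simp add: shift_simp E Z(5) sign_of_even)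
    have "M.T (Suc 0) p x \<in> mel M p" using Z(1) by simp
    then show "mdiff (shift p M) (- 1) ?y = mact (shift p M) 0 0 (\<tau> (Suc 0)) x" by (simp add: shift_simp E dy Z(6) ss sign_of_even)
  qed (simp_all add: shift_simp E Z cs sT s0)
  then obtain f where f: "chain_map An \<Gamma> (shift p M) f" "f 0 g0 = x" "f (- 1) g1 = ?y" by blast
  have "S.CC.cone_boundary i 0 x ?y" using null[OF f(1)] null_homotopic_iff[OF S f(1)] f(2,3) by simp
  then obtain x' y' where B: "x' \<in> mel M (p - 1)" "y' \<in> mel M (p - 2)"
      "M.T (Suc i) (p - 1) x' = \<zero>[M,p - 1]" "M.T i (p - 2) y' = \<zero>[M,p - 2]"
      "x = ?s p (mdiff M (p - 1) x') \<ominus>[M,p] M.b (p - 2) y'"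
      "?y = M.T (Suc 0) (p - 1) x' \<ominus>[M,p - 1] ?s (p - 1) (mdiff M (p - 2) y')"
    unfolding S.CC.cone_boundary_def by (auto simp: shift_simp E sign_of_even)
  have cx: "?s (p - 1) x' \<in> mel M (p - 1)" using B(1) by (rule M.G.sign_of_closed)
  have ct: "M.T (Suc 0) (p - 1) x' \<in> mel M (p - 1)" "mdiff M (p - 2) y' \<in> mel M (p - 1)" using B by simp_all
  have "y = ?s (p - 1) ?y" using ss[OF Z(2)] by simp
  also have "\<dots> = M.T (Suc 0) (p - 1) (?s (p - 1) x') \<ominus>[M,p - 1] mdiff M (p - 2) y'"
    unfolding B(6) sm[OF ct(1) M.G.sign_of_closed[OF ct(2)]] sT[OF B(1)] ss[OF ct(2)] ..
  finally have y: "y = M.T (Suc 0) (p - 1) (?s (p - 1) x') \<ominus>[M,p - 1] mdiff M (p - 2) y'" .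
  have x: "x = mdiff M (p - 1) (?s (p - 1) x') \<ominus>[M,p] M.b (p - 2) y'"
    using B(5) sd[OF B(1), of p] by simp
  show ?thesis unfolding M.CC.cone_boundary_def
    using cx B(2,4) x y sT[OF B(1), of "Suc i"] B(3) s0 by (intro bexI[of _ "?s (p - 1) x'"] bexI[of _ y']) simp_all
qed

end

section \<open>The modules \<open>\<Gamma>\<^sub>i\<close>\<close>

text \<open>Quotient groups depend on carrier and addition only, whereas \<open>regular_mod\<close>
  replaces the components of the algebra by records with dummy remaining fields.\<close>

lemma quot_group_same:
  assumes "carrier G' = carrier G" "add G' = add G"
  shows "quot_group G' N = quot_group G N"
  using assms by (simp add: quot_group_def A_RCOSETS_defs set_add_defs r_coset_def)

lemma coset_map_same: "add G' = add G \<Longrightarrow> coset_map G' N f = coset_map G N f"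
  by (intro ext) (simp add: coset_map_def a_r_coset_def r_coset_def)

context deformation begin

definition t_ideal :: "nat \<Rightarrow> int \<Rightarrow> (nat \<Rightarrow> 'a) set" where
  "t_ideal j p = t_sub k n An j (regular_mod An) p"

lemma mem_t_ideal: "x \<in> t_ideal j p \<longleftrightarrow> (\<exists>u\<in>ael An p. x = tpow j \<odot>\<^bsub>acomp An p\<^esub> u)"
  unfolding t_ideal_def t_sub_def by (auto simp: regular_mod_def add_group_def \<tau>_mult image_iff)

lemma t_ideal_subgroup: "abelian_subgroup (t_ideal j p) (acomp An p)"
proof -
  have "t_ideal j p = (\<lambda>x. tpow j \<odot>\<^bsub>acomp An p\<^esub> x) ` ael An p" using mem_t_ideal by (auto simp: image_iff)
  then show ?thesis using additive_map.image_subgroup[OF smult_map[OF tpow_closed, of p j]] by simp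
qed

sublocale TI: abelian_subgroup "t_ideal j p" "acomp An p" for j p by (rule t_ideal_subgroup)

lemma t_idealI: "\<lbrakk>u \<in> ael An p; x = tpow j \<odot>\<^bsub>acomp An p\<^esub> u\<rbrakk> \<Longrightarrow> x \<in> t_ideal j p"
  unfolding mem_t_ideal by (rule bexI)

lemma t_ideal_lmult:
  assumes "a \<in> ael An p" "x \<in> t_ideal j q" "s = p + q"
  shows "amult An p q a x \<in> t_ideal j s"
proof -
  obtain u where u: "u \<in> ael An q" "x = tpow j \<odot>\<^bsub>acomp An q\<^esub> u" using assms(2) unfolding mem_t_ideal by (rule bexE)
  then show ?thesis using mult_smult_r[OF tpow_closed assms(1) u(1), of j] assms by (intro t_idealI[of "amult An p q a u"]) simp_all
qed

lemma t_ideal_rmult: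
  assumes "a \<in> ael An q" "x \<in> t_ideal j p" "s = p + q"
  shows "amult An p q x a \<in> t_ideal j s"
proof -
  obtain u where u: "u \<in> ael An p" "x = tpow j \<odot>\<^bsub>acomp An p\<^esub> u" using assms(2) unfolding mem_t_ideal by (rule bexE)
  then show ?thesis using mult_smult_l[OF tpow_closed u(1) assms(1), of j] assms by (intro t_idealI[of "amult An p q u a"]) simp_all
qed

lemma t_ideal_diff:
  assumes "x \<in> t_ideal j p" "s = p + 1"
  shows "adiff An p x \<in> t_ideal j s"
proof -
  obtain u where u: "u \<in> ael An p" "x = tpow j \<odot>\<^bsub>acomp An p\<^esub> u" using assms(1) unfolding mem_t_ideal by (rule bexE)
  then show ?thesis using diff_smult[OF tpow_closed u(1), of j] assms by (intro t_idealI[of "adiff An p u"]) simp_all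
qed

lemma t_ideal_mono: 
  assumes "x \<in> t_ideal j p" "i \<le> j" shows "x \<in> t_ideal i p"
proof -
  obtain u where u: "u \<in> ael An p" "x = tpow j \<odot>\<^bsub>acomp An p\<^esub> u" using assms(1) unfolding mem_t_ideal by (rule bexE)
  then have "x = tpow i \<odot>\<^bsub>acomp An p\<^esub> (tpow (j - i) \<odot>\<^bsub>acomp An p\<^esub> u)" using tpow_smult_smult[OF u(1), of i "j - i"] assms(2) by simp
  then show ?thesis using u(1) by (intro t_idealI[of "tpow (j - i) \<odot>\<^bsub>acomp An p\<^esub> u"]) simp_all
qed

lemma t_ideal_\<tau>: "x \<in> t_ideal j p \<Longrightarrow> amult An 0 p (\<tau> (Suc 0)) x \<in> t_ideal (Suc j) p"
  unfolding mem_t_ideal[of x]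
proof (elim bexE)
  fix u assume u: "u \<in> ael An p" and x: "x = tpow j \<odot>\<^bsub>acomp An p\<^esub> u"
  have "amult An 0 p (\<tau> (Suc 0)) x = tpow (Suc j) \<odot>\<^bsub>acomp An p\<^esub> u"
    using tpow_smult_smult[OF u, of "Suc 0" j] u by (simp only: x \<tau>_mult AM.smult_closed[OF tpow_closed] add_Suc add_0)
  with u show ?thesis by (rule t_idealI)
qed

lemma \<tau>_t_ideal: "\<tau> j \<in> t_ideal j 0"
  unfolding t_pow_def by (rule t_idealI[OF one_closed refl])

lemma diff_ct_t_ideal: "j \<le> n \<Longrightarrow> adiff An 2 ct \<in> t_ideal j 3"
  using diff_ct t_ideal_mono[of "adiff An 2 ct" n 3 j] by (simp add: mem_t_ideal)

abbreviation cls :: "nat \<Rightarrow> int \<Rightarrow> (nat \<Rightarrow> 'a) \<Rightarrow> (nat \<Rightarrow> 'a) set" where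
  "cls j p x \<equiv> t_ideal j p +>\<^bsub>acomp An p\<^esub> x"

lemma trunc_alg_simps:
  "mcomp (trunc_alg k n An j) p = quot_group (acomp An p) (t_ideal j p)"
  "\<lbrakk>a \<in> ael An p; x \<in> ael An q\<rbrakk>
    \<Longrightarrow> mact (trunc_alg k n An j) p q a (cls j q x) = cls j (p + q) (amult An p q a x)"
  "x \<in> ael An p \<Longrightarrow> mdiff (trunc_alg k n An j) p (cls j p x) = cls j (p + 1) (adiff An p x)"
proof -
  have r: "mel (regular_mod An) p = ael An p" "add (mcomp (regular_mod An) p) = add (acomp An p)"
    "mact (regular_mod An) = amult An" "mdiff (regular_mod An) = adiff An" for p
    by (simp_all add: regular_mod_def add_group_def)
  have 1: "mcomp (trunc_alg k n An j) p = quot_group (acomp An p) (t_ideal j p)" for p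
    unfolding trunc_alg_def quot_mod_def t_ideal_def cdg_mod.simps quot_group_same[OF r(1,2)] ..
  have 2: "mact (trunc_alg k n An j) p q a = coset_map (acomp An (p + q)) (t_ideal j (p + q)) (amult An p q a)" for p q a
    unfolding trunc_alg_def quot_mod_def t_ideal_def cdg_mod.simps coset_map_same[OF r(2)] r(3) ..
  have 3: "mdiff (trunc_alg k n An j) p = coset_map (acomp An (p + 1)) (t_ideal j (p + 1)) (adiff An p)" for p
    unfolding trunc_alg_def quot_mod_def t_ideal_def cdg_mod.simps coset_map_same[OF r(2)] r(4) ..
  show "mcomp (trunc_alg k n An j) p = quot_group (acomp An p) (t_ideal j p)" by (rule 1)
  show "mact (trunc_alg k n An j) p q a (cls j q x) = cls j (p + q) (amult An p q a x)"
    if "a \<in> ael An p" "x \<in> ael An q"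
    unfolding 2 using that t_ideal_lmult[OF that(1)] by (intro TI.coset_map_coset lmult_map t_ideal_subgroup) auto
  show "mdiff (trunc_alg k n An j) p (cls j p x) = cls j (p + 1) (adiff An p x)" if "x \<in> ael An p"
    unfolding 3 using that t_ideal_diff by (intro TI.coset_map_coset diff_map t_ideal_subgroup) auto
qed

lemma Gamma_map_simps:
  "x \<in> ael An p \<Longrightarrow> Gamma_proj k n An i p (cls (Suc i) p x) = cls i p x"
  "x \<in> ael An p \<Longrightarrow> Gamma_t k n An i p (cls i p x) = cls (Suc i) p (amult An 0 p (\<tau> (Suc 0)) x)"
  "x \<in> ael An p \<Longrightarrow> Gamma_rmult k n An i ct p (cls (Suc i) p x) = cls (Suc i) (p + 2) (amult An p 2 x ct)"
proof -
  show "Gamma_proj k n An i p (cls (Suc i) p x) = cls i p x" if x: "x \<in> ael An p"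
  proof -
    have "additive_map (acomp An p) (acomp An p) (\<lambda>x. x)" by (intro additive_map.intro additive_map_axioms.intro alg_group refl)
    then show ?thesis unfolding Gamma_proj_def t_ideal_def[symmetric]
      using x t_ideal_mono[of _ "Suc i" p i] by (intro TI.coset_map_coset t_ideal_subgroup) auto
  qed
  show "Gamma_t k n An i p (cls i p x) = cls (Suc i) p (amult An 0 p (\<tau> (Suc 0)) x)" if x: "x \<in> ael An p"
  proof -
    have e: "amult An 0 p (\<tau> (Suc 0)) x = trunc_var k n \<odot>\<^bsub>acomp An p\<^esub> x" if "x \<in> ael An p" for x
      using \<tau>_mult[OF that] by (simp only: tpow_1)
    have "trunc_var k n \<odot>\<^bsub>acomp An p\<^esub> y \<in> t_ideal (Suc i) p" if "y \<in> t_ideal i p" for y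
      using t_ideal_\<tau>[OF that] e[of y] that TI.a_subset by auto
    then show ?thesis unfolding Gamma_t_def t_ideal_def[symmetric] e[OF x]
      using x by (intro TI.coset_map_coset t_ideal_subgroup smult_map t_closed) auto
  qed
  show "Gamma_rmult k n An i ct p (cls (Suc i) p x) = cls (Suc i) (p + 2) (amult An p 2 x ct)" if x: "x \<in> ael An p"
    unfolding Gamma_rmult_def t_ideal_def[symmetric]
    using x t_ideal_rmult[OF ct_closed] by (intro TI.coset_map_coset t_ideal_subgroup rmult_map) auto
qed

text \<open>\<open>free_Gamma\<close> is \<open>A_n \<oplus> A_n[1]\<close> with the formulas of \<open>\<Gamma>_i\<close>; its predifferential squares to the
  curvature only modulo the submodule divided out in \<open>\<Gamma>_i\<close>.\<close>

definition free_Gamma :: "(nat \<Rightarrow> 'a, (nat \<Rightarrow> 'a) \<times> (nat \<Rightarrow> 'a)) cdg_mod" where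
  "free_Gamma = \<lparr>
     mcomp = (\<lambda>p. add_group (ael An p \<times> ael An (p + 1))
       (\<lambda>(x, y) (x', y'). (x \<oplus>[acomp An p] x', y \<oplus>[acomp An (p + 1)] y')) (\<zero>[acomp An p], \<zero>[acomp An (p + 1)])),
     mact = (\<lambda>p q a (x, y). (amult An p q a x, sign_of (acomp An (p + q + 1)) p (amult An p (q + 1) a y))),
     mdiff = (\<lambda>p (x, y). (adiff An p x \<oplus>[acomp An (p + 1)] amult An 0 (p + 1) (\<tau> (Suc 0)) y,
       (\<ominus>[acomp An (p + 2)] adiff An (p + 1) y) \<oplus>[acomp An (p + 2)] amult An p 2 x ct))\<rparr>"

lemma free_Gamma_simps [simp]:
  "mel free_Gamma p = ael An p \<times> ael An (p + 1)"
  "\<zero>[free_Gamma,p] = (\<zero>[acomp An p], \<zero>[acomp An (p + 1)])"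
  "(x, y) \<oplus>[free_Gamma,p] (x', y') = (x \<oplus>[acomp An p] x', y \<oplus>[acomp An (p + 1)] y')"
  "mact free_Gamma p q a (x, y) = (amult An p q a x, sign_of (acomp An (p + q + 1)) p (amult An p (q + 1) a y))"
  "mdiff free_Gamma p (x, y) = (adiff An p x \<oplus>[acomp An (p + 1)] amult An 0 (p + 1) (\<tau> (Suc 0)) y,
     (\<ominus>[acomp An (p + 2)] adiff An (p + 1) y) \<oplus>[acomp An (p + 2)] amult An p 2 x ct)"
  by (simp_all add: free_Gamma_def add_group_def)

lemma free_Gamma_group: "abelian_group (mcomp free_Gamma p)"
  by (rule abelian_group_pairs[OF alg_group alg_group]) simp_all

lemma free_Gamma_neg: "\<lbrakk>x \<in> ael An p; y \<in> ael An (p + 1)\<rbrakk>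
  \<Longrightarrow> \<ominus>[free_Gamma,p] (x, y) = (\<ominus>[acomp An p] x, \<ominus>[acomp An (p + 1)] y)"
  by (rule abelian_group.minus_equality[OF free_Gamma_group]) (simp_all add: AM.M.l_neg)

lemma free_Gamma_sign: "\<lbrakk>x \<in> ael An p; y \<in> ael An (p + 1)\<rbrakk>
  \<Longrightarrow> sign_of (mcomp free_Gamma p) r (x, y) = (sign_of (acomp An p) r x, sign_of (acomp An (p + 1)) r y)"
  by (simp add: sign_of_def free_Gamma_neg)

lemma \<tau>_central: "x \<in> ael An p \<Longrightarrow> amult An p 0 x (\<tau> j) = amult An 0 p (\<tau> j) x"
  by (simp add: \<tau>_mult mult_\<tau>)

lemma free_Gamma_pre: "pre_cdg_module An free_Gamma"
proof (rule pre_cdg_module.intro)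
  show "abelian_group (mcomp free_Gamma p)" for p by (rule free_Gamma_group)
next
  fix p q a m assume a: "a \<in> ael An p" and "m \<in> mel free_Gamma q"
  then obtain x y where m: "m = (x, y)" "x \<in> ael An q" "y \<in> ael An (q + 1)" by auto
  have ay: "amult An p (q + 1) a y \<in> ael An (p + q + 1)" using a m by simp
  show "mact free_Gamma p q a m \<in> mel free_Gamma (p + q)"
    unfolding m(1) using a m AM.M.sign_of_closed[OF ay] by simp
  show "mdiff free_Gamma (p + q) (mact free_Gamma p q a m) = mact free_Gamma (p + 1) q (adiff An p a) m
            \<oplus>[free_Gamma,p + q + 1] sign_of (mcomp free_Gamma (p + q + 1)) p (mact free_Gamma p (q + 1) a (mdiff free_Gamma q m))"
  proof -
    let ?d1 = "amult An (p + 1) q (adiff An p a) x" and ?d2 = "amult An p (q + 1) a (adiff An q x)"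
      and ?t = "amult An p (q + 1) a (amult An 0 (q + 1) (\<tau> (Suc 0)) y)"
    let ?e1 = "amult An (p + 1) (q + 1) (adiff An p a) y" and ?e2 = "amult An p (q + 2) a (adiff An (q + 1) y)"
      and ?c = "amult An p (q + 2) a (amult An q 2 x ct)"
    have E: "p + q + 1 + 1 = p + q + 2" "p + (q + 1) = p + q + 1" "q + 1 + 1 = q + 2" "p + (q + 2) = p + q + 2" 
      "p + 1 + q = p + q + 1" "p + 1 + q + 1 = p + q + 2" "p + (q + 1) + 1 = p + q + 2" by simp_all
    have c: "?d1 \<in> ael An (p + q + 1)" "?d2 \<in> ael An (p + q + 1)" "?t \<in> ael An (p + q + 1)"
      "?e1 \<in> ael An (p + q + 2)" "?e2 \<in> ael An (p + q + 2)" "?c \<in> ael An (p + q + 2)"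
      using a m by simp_all
    have 1: "adiff An (p + q) (amult An p q a x) = ?d1 \<oplus>[acomp An (p + q + 1)] sign_of (acomp An (p + q + 1)) p ?d2"
      by (rule diff_mult[OF a m(2)])
    have "amult An 0 (p + q + 1) (\<tau> (Suc 0)) (amult An p (q + 1) a y) = amult An (0 + p) (q + 1) (amult An 0 p (\<tau> (Suc 0)) a) y"
      using mult_assoc[OF \<tau>_closed a m(3), of "Suc 0"] by (simp add: E)
    also have "\<dots> = ?t" unfolding \<tau>_central[OF a, symmetric] using mult_assoc[OF a \<tau>_closed m(3), of "Suc 0"] by simp
    finally have 2: "amult An 0 (p + q + 1) (\<tau> (Suc 0)) (sign_of (acomp An (p + q + 1)) p (amult An p (q + 1) a y)) = sign_of (acomp An (p + q + 1)) p ?t"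
      using additive_map.sign[OF lmult_map[OF \<tau>_closed, where q="p + q + 1" and s="p + q + 1"] ay] by simp
    have "adiff An (p + (q + 1)) (amult An p (q + 1) a y) = ?e1 \<oplus>[acomp An (p + q + 2)] sign_of (acomp An (p + q + 2)) p ?e2"
      using diff_mult[OF a m(3)] by (simp only: E)
    then have 3: "adiff An (p + q + 1) (sign_of (acomp An (p + q + 1)) p (amult An p (q + 1) a y))
       = sign_of (acomp An (p + q + 2)) p (?e1 \<oplus>[acomp An (p + q + 2)] sign_of (acomp An (p + q + 2)) p ?e2)"
      using additive_map.sign[OF diff_map[where p="p + q + 1" and s="p + q + 2"] ay] by (simp only: E)
    have 4: "amult An (p + q) 2 (amult An p q a x) ct = ?c" using mult_assoc[OF a m(2) ct_closed] by simp
    have 5: "amult An p (q + 1) a (adiff An q x \<oplus>[acomp An (q + 1)] amult An 0 (q + 1) (\<tau> (Suc 0)) y) = ?d2 \<oplus>[acomp An (p + q + 1)] ?t"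
      using mult_r_distr[OF a, of "adiff An q x" "q + 1" "amult An 0 (q + 1) (\<tau> (Suc 0)) y"] m by (simp add: E)
    have cm: "adiff An (q + 1) y \<in> ael An (q + 2)" "amult An q 2 x ct \<in> ael An (q + 2)" using m by simp_all
    have l: "additive_map (acomp An (q + 2)) (acomp An (p + q + 2)) (amult An p (q + 2) a)" using a by (rule lmult_map) simp
    have 6: "amult An p (q + 2) a ((\<ominus>[acomp An (q + 2)] adiff An (q + 1) y) \<oplus>[acomp An (q + 2)] amult An q 2 x ct) = (\<ominus>[acomp An (p + q + 2)] ?e2) \<oplus>[acomp An (p + q + 2)] ?c"
      using additive_map.add[OF l AM.M.a_inv_closed[OF cm(1)] cm(2)] additive_map.neg[OF l cm(1)] by simp
    have 7: "d \<oplus>[acomp An s] sign_of (acomp An s) p v \<oplus>[acomp An s] sign_of (acomp An s) p w = d \<oplus>[acomp An s] sign_of (acomp An s) p (v \<oplus>[acomp An s] w)"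
      if "d \<in> ael An s" "v \<in> ael An s" "w \<in> ael An s" for d v w s
      using that by (simp add: AM.M.sign_of_add AM.M.a_assoc)
    have 8: "(\<ominus>[acomp An s] sign_of (acomp An s) p (d \<oplus>[acomp An s] sign_of (acomp An s) p v)) \<oplus>[acomp An s] w
       = sign_of (acomp An s) (p + 1) d \<oplus>[acomp An s] sign_of (acomp An s) p (sign_of (acomp An s) p ((\<ominus>[acomp An s] v) \<oplus>[acomp An s] w))"
      if "d \<in> ael An s" "v \<in> ael An s" "w \<in> ael An s" for d v w s
      using that by (cases "even p") (simp_all add: sign_of_even sign_of_odd AM.M.minus_add AM.M.a_assoc)
    have cs: "amult An p (q + 1) a (adiff An q x \<oplus>[acomp An (q + 1)] amult An 0 (q + 1) (\<tau> (Suc 0)) y) \<in> ael An (p + q + 1)"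
       "sign_of (acomp An (p + q + 1 + 1)) p (amult An p (q + 1 + 1) a ((\<ominus>[acomp An (q + 2)] adiff An (q + 1) y) \<oplus>[acomp An (q + 2)] amult An q 2 x ct)) \<in> ael An (p + q + 1 + 1)"
      unfolding E 5 6 using c by simp_all
    show ?thesis
      unfolding m(1) free_Gamma_simps E(2) free_Gamma_sign[OF cs] unfolding E 1 2 3 4 5 6 7[OF c(1-3)] 8[OF c(4-6)] ..
  qed
next
  fix p q a b m assume ab: "a \<in> ael An p" "b \<in> ael An p" and "m \<in> mel free_Gamma q"
  then obtain x y where m: "m = (x, y)" "x \<in> ael An q" "y \<in> ael An (q + 1)" by auto
  have c: "amult An p (q + 1) a y \<in> ael An (p + q + 1)" "amult An p (q + 1) b y \<in> ael An (p + q + 1)" using ab m by simp_all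
  have "amult An p (q + 1) (a \<oplus>[acomp An p] b) y = amult An p (q + 1) a y \<oplus>[acomp An (p + q + 1)] amult An p (q + 1) b y"
    using mult_l_distr[OF ab m(3)] by (simp add: add.assoc)
  then show "mact free_Gamma p q (a \<oplus>[acomp An p] b) m = mact free_Gamma p q a m \<oplus>[free_Gamma,p + q] mact free_Gamma p q b m"
    unfolding m(1) using mult_l_distr[OF ab m(2)] AM.M.sign_of_add[OF c] by simp
next
  fix p q a m m' assume a: "a \<in> ael An p" and "m \<in> mel free_Gamma q" "m' \<in> mel free_Gamma q"
  then obtain x y x' y' where m: "m = (x, y)" "x \<in> ael An q" "y \<in> ael An (q + 1)"
    "m' = (x', y')" "x' \<in> ael An q" "y' \<in> ael An (q + 1)" by auto
  have c: "amult An p (q + 1) a y \<in> ael An (p + q + 1)" "amult An p (q + 1) a y' \<in> ael An (p + q + 1)" using a m by simp_all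
  have "amult An p (q + 1) a (y \<oplus>[acomp An (q + 1)] y') = amult An p (q + 1) a y \<oplus>[acomp An (p + q + 1)] amult An p (q + 1) a y'"
    using mult_r_distr[OF a m(3,6)] by (simp add: add.assoc)
  then show "mact free_Gamma p q a (m \<oplus>[free_Gamma,q] m') = mact free_Gamma p q a m \<oplus>[free_Gamma,p + q] mact free_Gamma p q a m'"
    unfolding m(1,4) using mult_r_distr[OF a m(2,5)] AM.M.sign_of_add[OF c] by simp
next
  fix p q s a b m assume ab: "a \<in> ael An p" "b \<in> ael An q" and "m \<in> mel free_Gamma s"
  then obtain x y where m: "m = (x, y)" "x \<in> ael An s" "y \<in> ael An (s + 1)" by auto
  have by': "amult An q (s + 1) b y \<in> ael An (q + s + 1)" using ab m by simp
  have aby: "amult An p (q + s + 1) a (amult An q (s + 1) b y) \<in> ael An (p + q + s + 1)" using ab(1) by' by simp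
  have 1: "amult An p (q + s + 1) a (sign_of (acomp An (q + s + 1)) q (amult An q (s + 1) b y))
    = sign_of (acomp An (p + q + s + 1)) q (amult An p (q + s + 1) a (amult An q (s + 1) b y))"
    using additive_map.sign[OF lmult_map[OF ab(1), where q="q + s + 1" and s="p + q + s + 1"] by'] by simp
  have 2: "amult An (p + q) (s + 1) (amult An p q a b) y = amult An p (q + s + 1) a (amult An q (s + 1) b y)"
    using mult_assoc[OF ab m(3)] by (simp add: add.assoc)
  have E: "p + (q + s) + 1 = p + q + s + 1" by simp
  show "mact free_Gamma (p + q) s (amult An p q a b) m = mact free_Gamma p (q + s) a (mact free_Gamma q s b m)"
    unfolding m(1) free_Gamma_simps E 1 2 AM.M.sign_of_sign_of[OF aby] using mult_assoc[OF ab m(2)] by simp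
next
  fix p m assume "m \<in> mel free_Gamma p"
  then obtain x y where m: "m = (x, y)" "x \<in> ael An p" "y \<in> ael An (p + 1)" by auto
  show "mact free_Gamma 0 p (aone An) m = m" unfolding m(1) using m by (simp add: sign_of_def)
  show "mdiff free_Gamma p m \<in> mel free_Gamma (p + 1)" unfolding m(1) using m by (simp add: add.assoc)
next
  fix p m m' assume "m \<in> mel free_Gamma p" "m' \<in> mel free_Gamma p"
  then obtain x y x' y' where m: "m = (x, y)" "x \<in> ael An p" "y \<in> ael An (p + 1)"
    "m' = (x', y')" "x' \<in> ael An p" "y' \<in> ael An (p + 1)" by auto
  have E: "p + 1 + 1 = p + 2" by simp
  have 1: "adiff An (p + 1) (y \<oplus>[acomp An (p + 1)] y') = adiff An (p + 1) y \<oplus>[acomp An (p + 2)] adiff An (p + 1) y'"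
    using diff_add[OF m(3,6)] by (simp only: E)
  have 2: "amult An 0 (p + 1) (\<tau> (Suc 0)) (y \<oplus>[acomp An (p + 1)] y') = amult An 0 (p + 1) (\<tau> (Suc 0)) y \<oplus>[acomp An (p + 1)] amult An 0 (p + 1) (\<tau> (Suc 0)) y'"
    using mult_r_distr[OF \<tau>_closed m(3,6)] by simp
  have c: "adiff An p x \<in> ael An (p + 1)" "adiff An p x' \<in> ael An (p + 1)"
    "amult An 0 (p + 1) (\<tau> (Suc 0)) y \<in> ael An (p + 1)" "amult An 0 (p + 1) (\<tau> (Suc 0)) y' \<in> ael An (p + 1)"
    "adiff An (p + 1) y \<in> ael An (p + 2)" "adiff An (p + 1) y' \<in> ael An (p + 2)"
    "amult An p 2 x ct \<in> ael An (p + 2)" "amult An p 2 x' ct \<in> ael An (p + 2)" using m by simp_all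
  show "mdiff free_Gamma p (m \<oplus>[free_Gamma,p] m') = mdiff free_Gamma p m \<oplus>[free_Gamma,p + 1] mdiff free_Gamma p m'"
    unfolding m(1,4) free_Gamma_simps diff_add[OF m(2,5)] 1 2 mult_l_distr[OF m(2,5) ct_closed] E
    using c by (simp add: AM.M.minus_add AM.M.a_ac)
qed

end

context deformation begin

abbreviation "\<Gamma>\<^sub>0 \<equiv> Gamma k n An ct"

text \<open>The projection of \<open>free_Gamma\<close> onto \<Gamma>_i, with kernel t^(i+1) A_n in
  the first and t^i A_n in the second summand.\<close>

definition gcls :: "nat \<Rightarrow> int \<Rightarrow> (nat \<Rightarrow> 'a) \<times> (nat \<Rightarrow> 'a) \<Rightarrow> (nat \<Rightarrow> 'a) set \<times> (nat \<Rightarrow> 'a) set" where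
  "gcls i p z = (cls (Suc i) p (fst z), cls i (p + 1) (snd z))"

lemma cls_add: "\<lbrakk>x \<in> ael An p; y \<in> ael An p\<rbrakk>
  \<Longrightarrow> cls j p x \<oplus>[quot_group (acomp An p) (t_ideal j p)] cls j p y = cls j p (x \<oplus>[acomp An p] y)"
  by (rule TI.quot_group_add)

lemma cls_neg: "x \<in> ael An p
  \<Longrightarrow> \<ominus>[quot_group (acomp An p) (t_ideal j p)] cls j p x = cls j p (\<ominus>[acomp An p] x)"
  by (rule TI.quot_group_neg)

lemma cls_sign: "x \<in> ael An p
  \<Longrightarrow> sign_of (quot_group (acomp An p) (t_ideal j p)) r (cls j p x) = cls j p (sign_of (acomp An p) r x)"
  by (simp add: sign_of_def cls_neg)

lemma Gamma_simps:
  "mel (\<Gamma>\<^sub>0 i) p = gcls i p ` mel free_Gamma p"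
  "\<zero>[\<Gamma>\<^sub>0 i,p] = gcls i p \<zero>[free_Gamma,p]"
  "\<lbrakk>x \<in> mel free_Gamma p; y \<in> mel free_Gamma p\<rbrakk>
    \<Longrightarrow> gcls i p x \<oplus>[\<Gamma>\<^sub>0 i,p] gcls i p y = gcls i p (x \<oplus>[free_Gamma,p] y)"
  "\<lbrakk>a \<in> ael An p; x \<in> mel free_Gamma q\<rbrakk>
    \<Longrightarrow> mact (\<Gamma>\<^sub>0 i) p q a (gcls i q x) = gcls i (p + q) (mact free_Gamma p q a x)"
  "x \<in> mel free_Gamma p \<Longrightarrow> mdiff (\<Gamma>\<^sub>0 i) p (gcls i p x) = gcls i (p + 1) (mdiff free_Gamma p x)"
proof -
  let ?Q = "\<lambda>j p. quot_group (acomp An p) (t_ideal j p)"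
  have S: "mcomp (\<Gamma>\<^sub>0 i) p = add_group (carrier (?Q (Suc i) p) \<times> carrier (?Q i (p + 1)))
       (\<lambda>(x, y) (x', y'). (x \<oplus>[?Q (Suc i) p] x', y \<oplus>[?Q i (p + 1)] y')) (\<zero>[?Q (Suc i) p], \<zero>[?Q i (p + 1)])"
    "mact (\<Gamma>\<^sub>0 i) p q a (X, Y) = (mact (trunc_alg k n An (Suc i)) p q a X,
       sign_of (?Q i (p + q + 1)) (1 * p) (mact (trunc_alg k n An i) p (q + 1) a Y))"
    "mdiff (\<Gamma>\<^sub>0 i) p (X, Y) = (mdiff (trunc_alg k n An (Suc i)) p X \<oplus>[?Q (Suc i) (p + 1)] Gamma_t k n An i (p + 1) Y,
      (\<ominus>[?Q i (p + 2)] mdiff (trunc_alg k n An i) (p + 1) Y) \<oplus>[?Q i (p + 2)]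
        Gamma_proj k n An i (p + 2) (Gamma_rmult k n An i ct p X))" for p q a X Y
    by (simp_all add: Gamma_def Let_def sum_mod_def shift_def trunc_alg_simps(1))
  show "mel (\<Gamma>\<^sub>0 i) p = gcls i p ` mel free_Gamma p"
  proof -
    have "f ` X \<times> g ` Y = (\<lambda>z. (f (fst z), g (snd z))) ` (X \<times> Y)" for f :: "_ \<Rightarrow> (nat \<Rightarrow> 'a) set" and g X Y by force
    then show ?thesis unfolding S(1) add_group_def ring.simps partial_object.simps TI.carrier_quot_group gcls_def by simp
  qed
  show "\<zero>[\<Gamma>\<^sub>0 i,p] = gcls i p \<zero>[free_Gamma,p]"
    by (simp add: S add_group_def TI.quot_group_zero gcls_def TI.coset_zero)
  show "gcls i p x \<oplus>[\<Gamma>\<^sub>0 i,p] gcls i p y = gcls i p (x \<oplus>[free_Gamma,p] y)"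
    if "x \<in> mel free_Gamma p" "y \<in> mel free_Gamma p"
    using that by (cases x; cases y) (simp add: S(1) add_group_def gcls_def cls_add)
  show "mact (\<Gamma>\<^sub>0 i) p q a (gcls i q x) = gcls i (p + q) (mact free_Gamma p q a x)"
    if a: "a \<in> ael An p" and x: "x \<in> mel free_Gamma q"
  proof -
    obtain u v where u: "x = (u, v)" "u \<in> ael An q" "v \<in> ael An (q + 1)" using x by auto
    have E: "p + (q + 1) = p + q + 1" by simp
    have c: "amult An p (q + 1) a v \<in> ael An (p + q + 1)" using a u by simp
    show ?thesis unfolding u(1) gcls_def fst_conv snd_conv S(2) free_Gamma_simps trunc_alg_simps(2)[OF a u(2)] trunc_alg_simps(2)[OF a u(3)]
      E cls_sign[OF c] by simp
  qed
  show "mdiff (\<Gamma>\<^sub>0 i) p (gcls i p x) = gcls i (p + 1) (mdiff free_Gamma p x)" if x: "x \<in> mel free_Gamma p"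
  proof -
    obtain u v where u: "x = (u, v)" "u \<in> ael An p" "v \<in> ael An (p + 1)" using x by auto
    have E: "p + 1 + 1 = p + 2" by simp
    have c: "adiff An p u \<in> ael An (p + 1)" "amult An 0 (p + 1) (\<tau> (Suc 0)) v \<in> ael An (p + 1)"
      "adiff An (p + 1) v \<in> ael An (p + 2)" "amult An p 2 u ct \<in> ael An (p + 2)" using u by simp_all
    show ?thesis unfolding u(1) gcls_def fst_conv snd_conv S(3) free_Gamma_simps trunc_alg_simps(3)[OF u(2)] trunc_alg_simps(3)[OF u(3)]
      Gamma_map_simps(2)[OF u(3)] Gamma_map_simps(3)[OF u(2)] E Gamma_map_simps(1)[OF c(4)] cls_neg[OF c(3)]
      cls_add[OF c(1,2)] cls_add[OF AM.M.a_inv_closed[OF c(3)] c(4)] ..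
  qed
qed

text \<open>In \<open>free_Gamma\<close> the first component of d^2 is the action of c exactly,
  since t (c/t) = c. The second is off by the product of x with d(c/t), up to sign, which lies in
  t^n A_n and therefore in t^i A_n, the part divided out.\<close>

lemma Gamma_cdg_module:
  assumes i: "i \<le> n"
  shows "cdg_module An (\<Gamma>\<^sub>0 i)"
proof (rule cdg_module_image[OF cdg_algebra_axioms free_Gamma_pre, where \<pi>="gcls i"])
  fix p z assume "z \<in> mel free_Gamma p"
  then obtain x y where z: "z = (x, y)" "x \<in> ael An p" "y \<in> ael An (p + 1)" by auto
  let ?c = "acurv An" and ?t = "\<tau> (Suc 0)"
  have E: "p + 1 + 1 = p + 2" "p + 1 + 2 = p + 3" "p + 2 + 1 = p + 3" "2 + p = p + 2" "2 + p + 1 = p + 3" "2 + (p + 1) = p + 3" by simp_all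
  let ?x1 = "adiff An p x" and ?x2 = "amult An 0 (p + 1) ?t y" and ?y1 = "adiff An (p + 1) y" and ?y2 = "amult An p 2 x ct"
  have c: "?x1 \<in> ael An (p + 1)" "?x2 \<in> ael An (p + 1)" "?y1 \<in> ael An (p + 2)" "?y2 \<in> ael An (p + 2)"
    using z by simp_all
  have dx2: "adiff An (p + 1) ?x2 = amult An 0 (p + 2) ?t ?y1"
    unfolding \<tau>_mult[OF z(3)] \<tau>_mult[OF c(3)] using diff_smult[OF tpow_closed z(3), of "Suc 0"] by (simp only: E)
  have ty2: "amult An 0 (p + 2) ?t ?y2 = amult An p 2 x ?c"
    using mult_assoc[OF \<tau>_closed z(2) ct_closed, of "Suc 0"] mult_assoc[OF z(2) \<tau>_closed ct_closed, of "Suc 0"] \<tau>_ct \<tau>_central[OF z(2), of "Suc 0"] by simp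
  have dy2: "adiff An (p + 2) ?y2 = amult An (p + 1) 2 ?x1 ct \<oplus>[acomp An (p + 3)] sign_of (acomp An (p + 3)) p (amult An p 3 x (adiff An 2 ct))"
    using diff_mult[OF z(2) ct_closed] by (simp add: E)
  have x2c: "amult An (p + 1) 2 ?x2 ct = amult An (p + 1) 2 y ?c"
    using mult_assoc[OF z(3) \<tau>_closed ct_closed, of "Suc 0"] \<tau>_ct \<tau>_central[OF z(3), of "Suc 0"] by simp
  have ddx: "adiff An (p + 1) ?x1 = amult An 2 p ?c x \<ominus>[acomp An (p + 2)] amult An p 2 x ?c" by (rule diff_diff[OF z(2)])
  have ddy: "adiff An (p + 2) ?y1 = amult An 2 (p + 1) ?c y \<ominus>[acomp An (p + 3)] amult An (p + 1) 2 y ?c"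
    using diff_diff[OF z(3)] by (simp only: E)
  have k: "amult An 2 p ?c x \<in> ael An (p + 2)" "amult An p 2 x ?c \<in> ael An (p + 2)"
    "amult An 0 (p + 2) ?t ?y1 \<in> ael An (p + 2)"
    "amult An 2 (p + 1) ?c y \<in> ael An (p + 3)" "amult An (p + 1) 2 y ?c \<in> ael An (p + 3)"
    "amult An (p + 1) 2 ?x1 ct \<in> ael An (p + 3)" "amult An p 3 x (adiff An 2 ct) \<in> ael An (p + 3)"
    using z c by simp_all
  \<comment> \<open>The only obstruction to d^2 = c on \<open>free_Gamma\<close>; i \<le> n puts it
    into t^i A_n.\<close>
  let ?w = "sign_of (acomp An (p + 3)) p (amult An p 3 x (adiff An 2 ct))"
  have w: "?w \<in> ael An (p + 3)" by (rule AM.M.sign_of_closed[OF k(7)])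
  have "amult An p 3 x (adiff An 2 ct) \<in> t_ideal i (p + 3)" by (rule t_ideal_lmult[OF z(2) diff_ct_t_ideal[OF i] refl])
  then have wi: "?w \<in> t_ideal i (p + 3)" by (simp add: sign_of_def TI.a_inv_closed)
  let ?X = "?x1 \<oplus>[acomp An (p + 1)] ?x2" and ?Y = "(\<ominus>[acomp An (p + 2)] ?y1) \<oplus>[acomp An (p + 2)] ?y2"
  have dX: "adiff An (p + 1) ?X = (amult An 2 p ?c x \<ominus>[acomp An (p + 2)] amult An p 2 x ?c) \<oplus>[acomp An (p + 2)] amult An 0 (p + 2) ?t ?y1"
    using diff_add[OF c(1,2)] by (simp only: E ddx dx2)
  have ltm: "additive_map (acomp An (p + 2)) (acomp An (p + 2)) (amult An 0 (p + 2) ?t)" by (rule lmult_map[OF \<tau>_closed]) simp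
  have tY: "amult An 0 (p + 2) ?t ?Y = (\<ominus>[acomp An (p + 2)] amult An 0 (p + 2) ?t ?y1) \<oplus>[acomp An (p + 2)] amult An p 2 x ?c"
    unfolding additive_map.add[OF ltm AM.M.a_inv_closed[OF c(3)] c(4)] additive_map.neg[OF ltm c(3)] ty2 ..
  have dm: "additive_map (acomp An (p + 2)) (acomp An (p + 3)) (adiff An (p + 2))" by (rule diff_map) simp
  have dY: "adiff An (p + 2) ?Y = (\<ominus>[acomp An (p + 3)] (amult An 2 (p + 1) ?c y \<ominus>[acomp An (p + 3)] amult An (p + 1) 2 y ?c))
      \<oplus>[acomp An (p + 3)] (amult An (p + 1) 2 ?x1 ct \<oplus>[acomp An (p + 3)] ?w)"
    unfolding additive_map.add[OF dm AM.M.a_inv_closed[OF c(3)] c(4)] additive_map.neg[OF dm c(3)] ddy dy2 ..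
  have Xc: "amult An (p + 1) 2 ?X ct = amult An (p + 1) 2 ?x1 ct \<oplus>[acomp An (p + 3)] amult An (p + 1) 2 y ?c"
    using mult_l_distr[OF c(1,2) ct_closed] by (simp only: E x2c)
  have 1: "adiff An (p + 1) ?X \<oplus>[acomp An (p + 2)] amult An 0 (p + 2) ?t ?Y = amult An 2 p ?c x"
    unfolding dX tY by (rule AM.M.group_eqI[where p="p + 2"], (rule AM.M.rep_rules | rule k)+) simp
  have 2: "(\<ominus>[acomp An (p + 3)] adiff An (p + 2) ?Y) \<oplus>[acomp An (p + 3)] amult An (p + 1) 2 ?X ct = amult An 2 (p + 1) ?c y \<ominus>[acomp An (p + 3)] ?w"
    unfolding dY Xc by (rule AM.M.group_eqI[where p="p + 3"], (rule AM.M.rep_rules | rule k w)+) simp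
  have dd: "mdiff free_Gamma (p + 1) (mdiff free_Gamma p z) = (amult An 2 p ?c x, amult An 2 (p + 1) ?c y \<ominus>[acomp An (p + 3)] ?w)"
    unfolding z(1) free_Gamma_simps E 1 2 ..
  have m: "mact free_Gamma 2 p ?c z = (amult An 2 p ?c x, amult An 2 (p + 1) ?c y)"
    unfolding z(1) free_Gamma_simps by (simp add: sign_of_def)
  have "cls i (p + 3) (amult An 2 (p + 1) ?c y \<ominus>[acomp An (p + 3)] ?w) = cls i (p + 3) (amult An 2 (p + 1) ?c y)"
  proof (subst TI.coset_eq_iff)
    have "(amult An 2 (p + 1) ?c y \<ominus>[acomp An (p + 3)] ?w) \<ominus>[acomp An (p + 3)] amult An 2 (p + 1) ?c y = \<ominus>[acomp An (p + 3)] ?w"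
      by (rule AM.M.group_eqI[where p="p + 3"], (rule AM.M.rep_rules | rule k w)+) simp
    then show "(amult An 2 (p + 1) ?c y \<ominus>[acomp An (p + 3)] ?w) \<ominus>[acomp An (p + 3)] amult An 2 (p + 1) ?c y \<in> t_ideal i (p + 3)"
      using TI.a_inv_closed[OF wi] by simp
  qed (rule AM.M.minus_closed k w; rule k w)+
  then show "gcls i (p + 2) (mdiff free_Gamma (p + 1) (mdiff free_Gamma p z)) = gcls i (p + 2) (mact free_Gamma 2 p ?c z)"
    unfolding dd m gcls_def fst_conv snd_conv E by simp
qed (simp_all only: Gamma_simps)

text \<open>Because the second summand is shifted, a coefficient a acts on (0, 1) as (0, (-1)^|a|
  a). The sign is an involution, so it affects neither generation nor the ideals in which the
  relations lie.\<close>

lemma Gamma_gamma_like: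
  assumes i: "i \<le> n"
  shows "gamma_like k A n An ct (\<Gamma>\<^sub>0 i) i (gcls i 0 (aone An, \<zero>[acomp An 1])) (gcls i (- 1) (\<zero>[acomp An (- 1)], aone An))"
proof -
  let ?g0 = "(aone An, \<zero>[acomp An 1])" and ?g1 = "(\<zero>[acomp An (- 1)], aone An)"
  have g: "?g0 \<in> mel free_Gamma 0" "?g1 \<in> mel free_Gamma (- 1)" by simp_all
  have z0: "amult An q r a \<zero>[acomp An r] = \<zero>[acomp An s]" if "a \<in> ael An q" "s = q + r" for q r s a
    using additive_map.zero[OF lmult_map[OF that]] .
  have z1: "amult An r q \<zero>[acomp An r] a = \<zero>[acomp An s]" if "a \<in> ael An q" "s = r + q" for q r s a
    using additive_map.zero[OF rmult_map[OF that]] .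
  have a0: "mact free_Gamma q 0 a ?g0 = (a, \<zero>[acomp An (q + 1)])" if "a \<in> ael An q" for q a
    using that by (simp add: z0)
  have a1: "mact free_Gamma (q + 1) (- 1) a ?g1 = (\<zero>[acomp An q], sign_of (acomp An (q + 1)) (q + 1) a)" if "a \<in> ael An (q + 1)" for q a
    using that by (simp add: z0[of _ _ q])
  have b0: "mact (\<Gamma>\<^sub>0 i) q 0 a (gcls i 0 ?g0) = gcls i q (a, \<zero>[acomp An (q + 1)])" if a: "a \<in> ael An q" for q a
    unfolding Gamma_simps(4)[OF a g(1)] a0[OF a] by simp
  have b1: "mact (\<Gamma>\<^sub>0 i) (q + 1) (- 1) a (gcls i (- 1) ?g1) = gcls i q (\<zero>[acomp An q], sign_of (acomp An (q + 1)) (q + 1) a)"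
    if a: "a \<in> ael An (q + 1)" for q a
    unfolding Gamma_simps(4)[OF a g(2)] a1[OF a] by simp
  have b: "mact (\<Gamma>\<^sub>0 i) q 0 \<alpha> (gcls i 0 ?g0) \<oplus>[\<Gamma>\<^sub>0 i,q] mact (\<Gamma>\<^sub>0 i) (q + 1) (- 1) a (gcls i (- 1) ?g1)
    = gcls i q (\<alpha>, sign_of (acomp An (q + 1)) (q + 1) a)" if a: "\<alpha> \<in> ael An q" "a \<in> ael An (q + 1)" for q a \<alpha>
    unfolding b0[OF a(1)] b1[OF a(2)] using a AM.M.sign_of_closed[OF a(2), of "q + 1"] by (subst Gamma_simps(3)) simp_all
  have zero: "gcls i q (x, y) = \<zero>[\<Gamma>\<^sub>0 i,q] \<longleftrightarrow> x \<in> t_ideal (Suc i) q \<and> y \<in> t_ideal i (q + 1)"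
    if "x \<in> ael An q" "y \<in> ael An (q + 1)" for q x y
    unfolding Gamma_simps(2) using that by (simp add: gcls_def TI.coset_zero TI.coset_eq_subgroup_iff)
  show ?thesis
  proof (intro gamma_like.intro gamma_like_axioms.intro deformation_axioms deformation_moduleI Gamma_cdg_module[OF i] i)
    show "gcls i 0 ?g0 \<in> mel (\<Gamma>\<^sub>0 i) 0" "gcls i (- 1) ?g1 \<in> mel (\<Gamma>\<^sub>0 i) (- 1)"
      unfolding Gamma_simps(1) using g by blast+
  next
    fix z q assume "z \<in> mel (\<Gamma>\<^sub>0 i) q"
    then obtain x y where z: "z = gcls i q (x, y)" "x \<in> ael An q" "y \<in> ael An (q + 1)"
      unfolding Gamma_simps(1) by auto
    have s: "sign_of (acomp An (q + 1)) (q + 1) y \<in> ael An (q + 1)" by (rule AM.M.sign_of_closed[OF z(3)])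
    have "sign_of (acomp An (q + 1)) (q + 1) (sign_of (acomp An (q + 1)) (q + 1) y) = y"
      using AM.M.sign_of_sign_of[OF z(3), of "q + 1" "q + 1"] by (simp add: sign_of_even)
    then show "\<exists>\<alpha>\<in>ael An q. \<exists>a\<in>ael An (q + 1).
      z = mact (\<Gamma>\<^sub>0 i) q 0 \<alpha> (gcls i 0 ?g0) \<oplus>[\<Gamma>\<^sub>0 i,q] mact (\<Gamma>\<^sub>0 i) (q + 1) (- 1) a (gcls i (- 1) ?g1)"
      by (intro bexI[OF _ z(2)] bexI[OF _ s]) (simp only: b[OF z(2) s] z(1))
  next
    fix \<alpha> q a assume a: "\<alpha> \<in> ael An q" "a \<in> ael An (q + 1)"
      and e: "mact (\<Gamma>\<^sub>0 i) q 0 \<alpha> (gcls i 0 ?g0) \<oplus>[\<Gamma>\<^sub>0 i,q] mact (\<Gamma>\<^sub>0 i) (q + 1) (- 1) a (gcls i (- 1) ?g1) = \<zero>[\<Gamma>\<^sub>0 i,q]"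
    have 1: "\<alpha> \<in> t_ideal (Suc i) q" "sign_of (acomp An (q + 1)) (q + 1) a \<in> t_ideal i (q + 1)"
      using e unfolding b[OF a] zero[OF a(1) AM.M.sign_of_closed[OF a(2)]] by simp_all
    have "a \<in> t_ideal i (q + 1)"
      using 1(2) TI.a_inv_closed[of "\<ominus>[acomp An (q + 1)] a" i "q + 1"] a(2) by (auto simp: sign_of_def split: if_splits)
    then show "(\<exists>\<beta>\<in>ael An q. \<alpha> = amult An q 0 \<beta> (\<tau> (Suc i))) \<and> (\<exists>\<gamma>\<in>ael An (q + 1). a = amult An (q + 1) 0 \<gamma> (\<tau> i))"
      using 1(1) unfolding mem_t_ideal by (intro conjI) (erule bexE, rule bexI, rule trans[OF _ mult_\<tau>[symmetric]], assumption+)+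
  next
    show "mact (\<Gamma>\<^sub>0 i) 0 0 (\<tau> (Suc i)) (gcls i 0 ?g0) = \<zero>[\<Gamma>\<^sub>0 i,0]"
      unfolding b0[OF \<tau>_closed] by (subst zero) (simp_all add: \<tau>_t_ideal TI.zero_closed)
    show "mact (\<Gamma>\<^sub>0 i) 0 (- 1) (\<tau> i) (gcls i (- 1) ?g1) = \<zero>[\<Gamma>\<^sub>0 i,- 1]"
      using b1[of "\<tau> i" "- 1"] zero[of "\<zero>[acomp An (- 1)]" "- 1" "\<tau> i"] by (simp add: \<tau>_t_ideal TI.zero_closed sign_of_def)
    show "mdiff (\<Gamma>\<^sub>0 i) 0 (gcls i 0 ?g0) = mact (\<Gamma>\<^sub>0 i) 2 (- 1) ct (gcls i (- 1) ?g1)"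
    proof -
      have "mdiff free_Gamma 0 ?g0 = (\<zero>[acomp An 1], ct)"
        using additive_map.zero[OF diff_map, of 2 1] by (simp add: diff_one z0[of _ 0 1 1])
      then show ?thesis unfolding Gamma_simps(5)[OF g(1)] using b1[of ct 1] by (simp add: sign_of_def)
    qed
    show "mdiff (\<Gamma>\<^sub>0 i) (- 1) (gcls i (- 1) ?g1) = mact (\<Gamma>\<^sub>0 i) 0 0 (\<tau> (Suc 0)) (gcls i 0 ?g0)"
    proof -
      have "mdiff free_Gamma (- 1) ?g1 = (\<tau> (Suc 0), \<zero>[acomp An 1])"
        using additive_map.zero[OF diff_map, of 0 "- 1"] by (simp add: diff_one z1[of _ 2 1 "- 1"])
      then show ?thesis unfolding Gamma_simps(5)[OF g(2)] using b0[OF \<tau>_closed, of "Suc 0"] by simp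
    qed
  qed
qed

end

text \<open>A presentation by generators and relations is insensitive to renaming the elements, so
  everything proved about maps out of \<Gamma>_i holds for its copy in the universe.\<close>

lemma (in gamma_like) transport_gamma_like:
  assumes inj: "\<And>p. inj_on (e p) (mel \<Gamma> p)"
  shows "gamma_like k A n An ct (transport e \<Gamma>) i (e 0 g0) (e (- 1) g1)"
proof -
  interpret t: transported "trunc_ring k n" An \<Gamma> e by unfold_locales (rule inj)
  have act0: "mact (transport e \<Gamma>) q 0 \<alpha> (e 0 g0) = e q (mact \<Gamma> q 0 \<alpha> g0)" for q \<alpha>
    by (simp add: t.transport_simps)
  have act1: "mact (transport e \<Gamma>) q (- 1) a (e (- 1) g1) = e (q - 1) (mact \<Gamma> q (- 1) a g1)" for q a
    by (simp add: t.transport_simps)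
  have sum: "mact (transport e \<Gamma>) q 0 \<alpha> (e 0 g0) \<oplus>[transport e \<Gamma>,q] mact (transport e \<Gamma>) (q + 1) (- 1) a (e (- 1) g1)
     = e q (mact \<Gamma> q 0 \<alpha> g0 \<oplus>[\<Gamma>,q] mact \<Gamma> (q + 1) (- 1) a g1)"
    if "\<alpha> \<in> ael An q" "a \<in> ael An (q + 1)" for q \<alpha> a
    unfolding act0 act1 using that by (simp add: t.transport_simps)
  show ?thesis
  proof (intro gamma_like.intro gamma_like_axioms.intro deformation_axioms deformation_moduleI t.transport_cdg_module i_le)
    show "e 0 g0 \<in> mel (transport e \<Gamma>) 0" "e (- 1) g1 \<in> mel (transport e \<Gamma>) (- 1)"
      by (simp_all add: t.transport_simps)
  next
    fix z q assume "z \<in> mel (transport e \<Gamma>) q"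
    then obtain x where x: "z = e q x" "x \<in> mel \<Gamma> q" by (auto simp: t.transport_simps)
    from generators[OF x(2)] obtain \<alpha> where \<alpha>: "\<alpha> \<in> ael An q"
      "\<exists>a\<in>ael An (q + 1). x = mact \<Gamma> q 0 \<alpha> g0 \<oplus>[\<Gamma>,q] mact \<Gamma> (q + 1) (- 1) a g1" by (rule bexE)
    from \<alpha>(2) obtain a where a: "a \<in> ael An (q + 1)"
      "x = mact \<Gamma> q 0 \<alpha> g0 \<oplus>[\<Gamma>,q] mact \<Gamma> (q + 1) (- 1) a g1" by (rule bexE)
    show "\<exists>\<alpha>\<in>ael An q. \<exists>a\<in>ael An (q + 1).
      z = mact (transport e \<Gamma>) q 0 \<alpha> (e 0 g0) \<oplus>[transport e \<Gamma>,q] mact (transport e \<Gamma>) (q + 1) (- 1) a (e (- 1) g1)"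
      by (intro bexI[OF _ \<alpha>(1)] bexI[OF _ a(1)]) (simp only: sum[OF \<alpha>(1) a(1)] x(1) a(2))
  next
    fix \<alpha> q a assume a: "\<alpha> \<in> ael An q" "a \<in> ael An (q + 1)"
      and "mact (transport e \<Gamma>) q 0 \<alpha> (e 0 g0) \<oplus>[transport e \<Gamma>,q] mact (transport e \<Gamma>) (q + 1) (- 1) a (e (- 1) g1) = \<zero>[transport e \<Gamma>,q]"
    then have "e q (mact \<Gamma> q 0 \<alpha> g0 \<oplus>[\<Gamma>,q] mact \<Gamma> (q + 1) (- 1) a g1) = e q \<zero>[\<Gamma>,q]"
      unfolding sum[OF a] by (simp add: t.transport_simps)
    then have "mact \<Gamma> q 0 \<alpha> g0 \<oplus>[\<Gamma>,q] mact \<Gamma> (q + 1) (- 1) a g1 = \<zero>[\<Gamma>,q]"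
      by (rule inj_onD[OF inj]) (use a in simp_all)
    then show "(\<exists>\<beta>\<in>ael An q. \<alpha> = amult An q 0 \<beta> (\<tau> (Suc i))) \<and> (\<exists>\<gamma>\<in>ael An (q + 1). a = amult An (q + 1) 0 \<gamma> (\<tau> i))"
      by (rule relations[OF a])
  qed (simp_all add: act0 act1 t.transport_simps T_g0 T_g1 d_g0 d_g1)
qed

section \<open>The \<open>n\<close>-derived category\<close>

lemma comp_map_assoc:
  assumes "cdg_module A M" "cdg_module A N" "chain_map A M N f"
  shows "comp_map M (comp_map N h g) f = comp_map M h (comp_map M g f)"
proof -
  interpret f: cdg_map A M N f by (rule cdg_mapI[OF assms])
  show ?thesis by (rule graded_map_eqI[where M=M]) simp_all
qed

lemma comp_map_id:
  assumes "cdg_module A M" "cdg_module A N" "chain_map A M N f"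
  shows "comp_map M f (id_map M) = f" "comp_map M (id_map N) f = f"
proof -
  interpret f: cdg_map A M N f by (rule cdg_mapI[OF assms])
  show "comp_map M f (id_map M) = f" "comp_map M (id_map N) f = f"
    by (rule graded_map_eqI[where M=M]; simp add: f.extensional)+
qed

context cdg_module_pair
begin

lemma null_homotopic_iff_homotopic_zero:
  "chain_map A M N f \<Longrightarrow> null_homotopic A M N f \<longleftrightarrow> homotopic A M N f (zero_map M N)"
proof -
  assume f: "chain_map A M N f"
  have "f \<in> carrier (hom_cocycles A M N)" using f by (simp add: hom_cocycles_carrier)
  then have "f \<ominus>[hom_cocycles A M N] \<zero>[hom_cocycles A M N] = f" by (simp add: a_minus_def)
  then show ?thesis unfolding homotopic_iff[OF f chain_map_zero] hom_boundaries_eq by (simp add: hom_cocycles_simps)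
qed

lemma homotopic_iff_null_homotopic:
  assumes "chain_map A M N f" "chain_map A M N g"
  shows "homotopic A M N f g \<longleftrightarrow> null_homotopic A M N (add_map M N f (neg_map M N g))"
  unfolding homotopic_iff[OF assms] hom_boundaries_eq a_minus_def hom_cocycles_neg[OF assms(2)] by (simp add: hom_cocycles_simps)

end

lemma null_homotopic_comp:
  assumes A: "cdg_algebra R A" and MNP: "cdg_module A M" "cdg_module A N" "cdg_module A P"
    and f: "chain_map A M N f" and g: "chain_map A N P g"
    and nul: "null_homotopic A M N f \<or> null_homotopic A N P g"
  shows "null_homotopic A M P (comp_map M g f)"
proof -
  interpret f: cdg_map A M N f by (rule cdg_mapI[OF MNP(1,2) f])
  interpret g: cdg_map A N P g by (rule cdg_mapI[OF MNP(2,3) g])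
  interpret MN: cdg_module_pair R A M N by (intro cdg_module_pair.intro A MNP)
  interpret NP: cdg_module_pair R A N P by (intro cdg_module_pair.intro A MNP)
  interpret MP: cdg_module_pair R A M P by (intro cdg_module_pair.intro A MNP)
  have "homotopic A M P (comp_map M g f) (zero_map M P)"
    using nul
  proof
    assume "null_homotopic A M N f"
    then have "homotopic A M P (comp_map M g f) (comp_map M g (zero_map M N))"
      using homotopic_comp[OF MNP f MN.chain_map_zero _ g g homotopic_refl[OF A MNP(2,3) g]]
      unfolding MN.null_homotopic_iff_homotopic_zero[OF f] by blast
    also have "comp_map M g (zero_map M N) = zero_map M P" by (rule graded_map_eqI[where M=M]) (simp_all add: g.zero)
    finally show ?thesis .
  next
    assume "null_homotopic A N P g"
    then have "homotopic A M P (comp_map M g f) (comp_map M (zero_map N P) f)"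
      using homotopic_comp[OF MNP f f homotopic_refl[OF A MNP(1,2) f] g NP.chain_map_zero]
      unfolding NP.null_homotopic_iff_homotopic_zero[OF g] by blast
    also have "comp_map M (zero_map N P) f = zero_map M P" by (rule graded_map_eqI[where M=M]) simp_all
    finally show ?thesis .
  qed
  then show ?thesis unfolding MP.null_homotopic_iff_homotopic_zero[OF chain_map_comp[OF MNP f g]] .
qed

definition module_iso :: "('r, 'a) cdg_alg \<Rightarrow> ('a, 'm) cdg_mod \<Rightarrow> ('a, 'n) cdg_mod \<Rightarrow> (int \<Rightarrow> 'm \<Rightarrow> 'n) \<Rightarrow> (int \<Rightarrow> 'n \<Rightarrow> 'm) \<Rightarrow> bool" where
  "module_iso A M N f g \<longleftrightarrow> chain_map A M N f \<and> chain_map A N M g \<and> comp_map M g f = id_map M \<and> comp_map N f g = id_map N"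

lemma universe_copy:
  assumes A: "cdg_algebra R A" and M: "cdg_module A M" and e: "\<And>p. inj_on (e p :: 'm \<Rightarrow> 'u) (mel M p)"
  shows "\<exists>(N :: ('a, 'u) cdg_mod) f g. cdg_module A N \<and> module_iso A M N f g"
proof -
  interpret transported R A M e by (intro transported.intro transported_axioms.intro A M e)
  show ?thesis unfolding module_iso_def
    using transport_cdg_module transport_map transport_inv transport_inv_map transport_map_inv by blast
qed

lemma (in deformation) module_iso_qiso:
  assumes MN: "cdg_module An M" "cdg_module An N" and iso: "module_iso An M N f g"
  shows "qiso N M g"
proof -
  note i = iso[unfolded module_iso_def]
  interpret f: deformation_map k A n An ct M N f using i by (intro deformation_mapI MN) simp
  interpret g: deformation_map k A n An ct N M g using i by (intro deformation_mapI MN) simp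
  have gf: "g p (f p x) = x" if "x \<in> mel M p" for p x
  proof -
    have "comp_map M g f p x = id_map M p x" using i by simp
    then show ?thesis using that by simp
  qed
  have fg: "f p (g p x) = x" if "x \<in> mel N p" for p x
  proof -
    have "comp_map N f g p x = id_map N p x" using i by simp
    then show ?thesis using that by simp
  qed
  show ?thesis
  proof (rule qisoI)
    fix j p x assume "j \<le> n" "gcyc N j p x" "gbdy M j p (g p x)"
    then show "gbdy N j p x" using f.bdy_map[of j p "g p x"] fg[of x p] f.N.cyc_carrier by simp
  next
    fix j p y assume y: "j \<le> n" "gcyc M j p y"
    have c: "y \<in> mel M p" by (rule f.M.cyc_carrier[OF y(2)])
    have "y \<ominus>[M,p] g p (f p y) = \<zero>[M,p]" unfolding gf[OF c] using c by (simp add: a_minus_def f.M.G.r_neg)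
    then have "gbdy M j p (y \<ominus>[M,p] g p (f p y))" using f.M.bdy_tsub[OF f.M.tsub_zero] by simp
    then show "\<exists>x. gcyc N j p x \<and> gbdy M j p (y \<ominus>[M,p] g p x)" using f.cyc_map[OF y(2)] by blast
  qed
qed

text \<open>The type argument fixes the universe in which objects live; its being infinite makes
  room for cones, fibres and direct sums.\<close>

locale derived = deformation k A n An ct
  for k :: "'k ring" and A :: "('k, 'a) cdg_alg" and n :: nat
    and An :: "(nat \<Rightarrow> 'k, nat \<Rightarrow> 'a) cdg_alg" and ct :: "nat \<Rightarrow> 'a" +
  fixes universe :: "'u itself"
  assumes infinite_universe: "infinite (UNIV :: 'u set)"
begin

abbreviation H :: "((nat \<Rightarrow> 'a, 'u) cdg_mod, (int \<Rightarrow> 'u \<Rightarrow> 'u) set) precat" where "H \<equiv> Hot An"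
abbreviation S :: "(nat \<Rightarrow> 'a, 'u) cdg_mod \<Rightarrow> (nat \<Rightarrow> 'a, 'u) cdg_mod \<Rightarrow> (int \<Rightarrow> 'u \<Rightarrow> 'u) set set" where
  "S \<equiv> n_quasi_isos k n An"

sublocale H: preadditive_category H by (rule Hot_preadditive[OF cdg_algebra_axioms])

lemma pair: "\<lbrakk>cdg_module An X; cdg_module An Y\<rbrakk> \<Longrightarrow> cdg_module_pair (trunc_ring k n) An X Y"
  by (intro cdg_module_pair.intro cdg_algebra_axioms)

lemma Hpair: "\<lbrakk>cdg_module An X; cdg_module An Y\<rbrakk> \<Longrightarrow> hot_pair (trunc_ring k n) An X Y"
  by (intro hot_pair.intro pair)

lemma arrI: "\<lbrakk>cdg_module An X; cdg_module An Y; chain_map An X Y f\<rbrakk> \<Longrightarrow> H.arr X Y (hot_class An X Y f)"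
  using hot_pair.Hom_Hot_carrier[OF Hpair, of X Y] by (simp add: H.arr_def Ob_Hot)

lemma arrE:
  assumes "H.arr X Y \<phi>"
  obtains f where "cdg_module An X" "cdg_module An Y" "chain_map An X Y f" "\<phi> = hot_class An X Y f"
proof -
  have XY: "cdg_module An X" "cdg_module An Y" and "\<phi> \<in> carrier (Hom H X Y)" using assms by (auto simp: H.arr_def Ob_Hot)
  then obtain f where "chain_map An X Y f" "\<phi> = hot_class An X Y f" unfolding hot_pair.Hom_Hot_carrier[OF Hpair[OF XY]] by blast
  then show ?thesis using that XY by blast
qed

lemmas Comp_H = Comp_Hot[OF cdg_algebra_axioms]

text \<open>Combines the description of n-acyclic cones with invariance under homotopy, so that from
  here on denominators are handled as \<open>qiso\<close> on any representative.\<close>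

lemma mem_S:
  assumes XY: "cdg_module An X" "cdg_module An Y" and f: "chain_map An X Y f"
  shows "hot_class An X Y f \<in> S X Y \<longleftrightarrow> qiso X Y f"
proof -
  interpret P: hot_pair "trunc_ring k n" An X Y by (rule Hpair[OF XY])
  have c: "n_acyclic k n An (cone X Y g) \<longleftrightarrow> qiso X Y g" if "chain_map An X Y g" for g
    by (rule deformation_map.cone_n_acyclic_iff[OF deformation_mapI[OF XY that]])
  show ?thesis
  proof
    assume "hot_class An X Y f \<in> S X Y"
    then obtain g where "g \<in> hot_class An X Y f" "n_acyclic k n An (cone X Y g)" unfolding n_quasi_isos_def by blast
    then have g: "chain_map An X Y g" "homotopic An X Y g f" "qiso X Y g" unfolding P.mem_hot_class[OF f] using c by blast+
    show "qiso X Y f" by (rule qiso_homotopic[OF XY g(1) f g(2,3)])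
  next
    assume "qiso X Y f"
    moreover have "f \<in> hot_class An X Y f"
      unfolding P.mem_hot_class[OF f] using f homotopic_refl[OF cdg_algebra_axioms XY f] by blast
    ultimately show "hot_class An X Y f \<in> S X Y" unfolding n_quasi_isos_def P.Hom_Hot_carrier using f c by blast
  qed
qed

lemma inj_universe_prod: "\<exists>e :: 'u \<times> 'u \<Rightarrow> 'u. inj e"
  by (rule inj_prod_universe[OF infinite_universe])

lemma universe_cone:
  fixes C :: "(nat \<Rightarrow> 'a, 'u \<times> 'u) cdg_mod"
  assumes C: "cdg_module An C"
  obtains Z :: "(nat \<Rightarrow> 'a, 'u) cdg_mod" and \<iota> \<rho> where "cdg_module An Z" "module_iso An C Z \<iota> \<rho>"
proof -
  obtain e :: "'u \<times> 'u \<Rightarrow> 'u" where e: "inj e" using inj_universe_prod by blast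
  have "\<And>p. inj_on e (mel C p)" using e inj_on_subset by blast
  from universe_copy[OF cdg_algebra_axioms C this] obtain Z :: "(nat \<Rightarrow> 'a, 'u) cdg_mod" and \<iota> \<rho>
    where "cdg_module An Z" "module_iso An C Z \<iota> \<rho>" by (elim exE conjE)
  then show ?thesis by (rule that)
qed

text \<open>W is the fibre of the composite of f with Z \<rightarrow> cone(s). The cone is
  n-acyclic, so the projection t of the fibre to X is a denominator; f t becomes null-homotopic in
  cone(s), hence lifts along s up to homotopy by \<open>cone_lift\<close>.\<close>

lemma Ore:
  assumes f: "H.arr X Z \<phi>" and s: "H.arr Y Z \<sigma>" "\<sigma> \<in> S Y Z"
  shows "\<exists>W t g. H.arr W X t \<and> t \<in> S W X \<and> H.arr W Y g \<and> Comp H W X Z \<phi> t = Comp H W Y Z \<sigma> g"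
proof -
  obtain f where f: "cdg_module An X" "cdg_module An Z" "chain_map An X Z f" "\<phi> = hot_class An X Z f" using f by (rule arrE)
  obtain s where s': "cdg_module An Y" "chain_map An Y Z s" "\<sigma> = hot_class An Y Z s" using s(1) by (rule arrE)
  have qs: "qiso Y Z s" using s(2) mem_S[OF s'(1) f(2) s'(2)] s'(3) by simp
  interpret s: deformation_map k A n An ct Y Z s by (rule deformation_mapI[OF s'(1) f(2) s'(2)])
  let ?C = "cone Y Z s"
  have C: "cdg_module An ?C" by (rule s.cone_mod)
  have ci: "chain_map An Z ?C s.cone_in" by (rule s.cone_in_chain_map)
  have g: "chain_map An X ?C (comp_map X s.cone_in f)" by (rule chain_map_comp[OF f(1,2) C f(3) ci])
  interpret g: deformation_map k A n An ct X ?C "comp_map X s.cone_in f" by (rule deformation_mapI[OF f(1) C g])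
  have W0: "cdg_module An g.cocone" by (rule g.cocone_cdg_module[OF cdg_algebra_axioms])
  have t0: "chain_map An g.cocone X g.cocone_out" "qiso g.cocone X g.cocone_out"
    using g.cocone_out_chain_map g.cocone_out_qiso s.cone_n_acyclic_iff qs by simp_all
  have ft0: "chain_map An g.cocone Z (comp_map g.cocone f g.cocone_out)" by (rule chain_map_comp[OF W0 f(1,2) t0(1) f(3)])
  have "null_homotopic An g.cocone ?C (comp_map g.cocone s.cone_in (comp_map g.cocone f g.cocone_out))"
    using g.cocone_out_null unfolding comp_map_assoc[OF W0 f(1) t0(1)] .
  from s.cone_lift[OF W0 ft0 this] obtain f' where f': "chain_map An g.cocone Y f'"
    "homotopic An g.cocone Z (comp_map g.cocone f g.cocone_out) (comp_map g.cocone s f')" by blast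
  obtain e :: "'u \<times> 'u \<Rightarrow> 'u" where e: "inj e" using inj_universe_prod by blast
  \<comment> \<open>Elements of the fibre are pairs whose first entry is itself a pair, which calls
    for two rounds of the injection of pairs.\<close>
  have inj: "inj_on (\<lambda>z. e (e (fst z), snd z)) V" for V :: "(('u \<times> 'u) \<times> 'u) set"
  proof (rule inj_onI)
    fix z w :: "('u \<times> 'u) \<times> 'u" assume "e (e (fst z), snd z) = e (e (fst w), snd w)"
    then have zw: "(e (fst z), snd z) = (e (fst w), snd w)" by (rule injD[OF e])
    then have "e (fst z) = e (fst w)" by simp
    then have "fst z = fst w" by (rule injD[OF e])
    then show "z = w" using zw by (intro prod_eqI) simp_all
  qed
  from universe_copy[OF cdg_algebra_axioms W0 inj] obtain W :: "(nat \<Rightarrow> 'a, 'u) cdg_mod" and \<iota> \<rho>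
    where W: "cdg_module An W" "module_iso An g.cocone W \<iota> \<rho>" by (elim exE conjE)
  have \<rho>: "chain_map An W g.cocone \<rho>" "qiso W g.cocone \<rho>" using W module_iso_qiso[OF W0 W] by (simp_all add: module_iso_def)
  let ?t = "comp_map W g.cocone_out \<rho>" and ?g = "comp_map W f' \<rho>"
  have t: "chain_map An W X ?t" by (rule chain_map_comp[OF W(1) W0 f(1) \<rho>(1) t0(1)])
  have tS: "qiso W X ?t" by (rule qiso_comp[OF W(1) W0 f(1) \<rho> t0])
  have gg: "chain_map An W Y ?g" by (rule chain_map_comp[OF W(1) W0 s'(1) \<rho>(1) f'(1)])
  have sf': "chain_map An g.cocone Z (comp_map g.cocone s f')" by (rule chain_map_comp[OF W0 s'(1) f(2) f'(1) s'(2)])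
  have hom: "homotopic An W Z (comp_map W f ?t) (comp_map W s ?g)"
    unfolding comp_map_assoc[OF W(1) W0 \<rho>(1), symmetric]
    by (rule homotopic_comp[OF W(1) W0 f(2) \<rho>(1) \<rho>(1) homotopic_refl[OF cdg_algebra_axioms W(1) W0 \<rho>(1)] ft0 sf' f'(2)])
  have "Comp H W X Z \<phi> (hot_class An W X ?t) = Comp H W Y Z \<sigma> (hot_class An W Y ?g)"
    unfolding f(4) s'(3) Comp_H[OF W(1) f(1,2) t f(3)] Comp_H[OF W(1) s'(1) f(2) gg s'(2)]
    using cdg_module_pair.hot_class_eq_iff[OF pair[OF W(1) f(2)] chain_map_comp[OF W(1) f(1,2) t f(3)] chain_map_comp[OF W(1) s'(1) f(2) gg s'(2)]] hom by simp
  then show ?thesis using arrI[OF W(1) f(1) t] arrI[OF W(1) s'(1) gg] mem_S[OF W(1) f(1) t] tS by blast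
qed

sublocale F: fraction_category H S
proof (intro fraction_category.intro fraction_category_axioms.intro H.preadditive_category_axioms)
  fix X assume "X \<in> Ob H"
  then have X: "cdg_module An X" by (simp add: Ob_Hot)
  show "Ident H X \<in> S X X" unfolding Ident_Hot using mem_S[OF X X chain_map_id[OF X]] qiso_id[OF X] by simp
next
  fix X Y Z s s' assume a: "H.arr X Y s" "s \<in> S X Y" "H.arr Y Z s'" "s' \<in> S Y Z"
  obtain f where f: "cdg_module An X" "cdg_module An Y" "chain_map An X Y f" "s = hot_class An X Y f" using a(1) by (rule arrE)
  obtain g where g: "cdg_module An Z" "chain_map An Y Z g" "s' = hot_class An Y Z g" using a(3) by (rule arrE)
  have q: "qiso X Y f" "qiso Y Z g" using a(2,4) mem_S[OF f(1-3)] mem_S[OF f(2) g(1,2)] f(4) g(3) by simp_all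
  show "Comp H X Y Z s' s \<in> S X Z"
    unfolding f(4) g(3) Comp_H[OF f(1,2) g(1) f(3) g(2)] mem_S[OF f(1) g(1) chain_map_comp[OF f(1,2) g(1) f(3) g(2)]]
    by (rule qiso_comp[OF f(1,2) g(1) f(3) q(1) g(2) q(2)])
next
  fix X Y Z u s assume a: "H.arr X Y u" "H.arr Y Z s" "s \<in> S Y Z" "Comp H X Y Z s u \<in> S X Z"
  obtain f where f: "cdg_module An X" "cdg_module An Y" "chain_map An X Y f" "u = hot_class An X Y f" using a(1) by (rule arrE)
  obtain g where g: "cdg_module An Z" "chain_map An Y Z g" "s = hot_class An Y Z g" using a(2) by (rule arrE)
  have q: "qiso X Z (comp_map X g f)" "qiso Y Z g"
    using a(3,4) mem_S[OF f(2) g(1,2)] mem_S[OF f(1) g(1) chain_map_comp[OF f(1,2) g(1) f(3) g(2)]]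
    unfolding f(4) g(3) Comp_H[OF f(1,2) g(1) f(3) g(2)] by simp_all
  show "u \<in> S X Y" unfolding f(4) mem_S[OF f(1-3)] by (rule qiso_cancel[OF f(1,2) g(1) f(3) g(2) q(2,1)])
next
  show "\<exists>W t g. H.arr W X t \<and> t \<in> S W X \<and> H.arr W Y g \<and> Comp H W X Z f t = Comp H W Y Z s g"
    if "H.arr X Z f" "H.arr Y Z s" "s \<in> S Y Z" for X Y Z f s using that by (rule Ore)
qed

end

text \<open>A zero module is wanted on the universe type itself; \<open>undefined\<close> is an
  element that every type provides.\<close>

definition trivial_mod :: "('a, 'm) cdg_mod" where
  "trivial_mod = \<lparr>mcomp = (\<lambda>_. add_group {undefined} (\<lambda>_ _. undefined) undefined),
     mact = (\<lambda>_ _ _ _. undefined), mdiff = (\<lambda>_ _. undefined)\<rparr>"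

lemma trivial_mod_simps:
  "mel trivial_mod p = {undefined}" "\<zero>[trivial_mod,p] = undefined"
  "x \<oplus>[trivial_mod,p] y = undefined" "mact trivial_mod p q a x = undefined" "mdiff trivial_mod p x = undefined"
  by (simp_all add: trivial_mod_def add_group_def)

lemma trivial_mod_cdg_module: "cdg_module A trivial_mod"
proof -
  have g: "abelian_group (mcomp trivial_mod p)" for p
    by (rule abelian_groupI) (auto simp: trivial_mod_simps)
  show ?thesis
    by (rule cdg_module.intro) (simp_all add: trivial_mod_simps g)
qed

lemma trivial_mod_maps:
  assumes "cdg_module A M"
  shows "chain_map A trivial_mod M f \<Longrightarrow> f = zero_map trivial_mod M"
    and "chain_map A M trivial_mod f \<Longrightarrow> f = zero_map M trivial_mod"
proof -
  show "f = zero_map trivial_mod M" if f: "chain_map A trivial_mod M f"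
  proof -
    interpret f: cdg_map A trivial_mod M f by (rule cdg_mapI[OF trivial_mod_cdg_module assms f])
    show ?thesis
    proof (rule graded_map_eqI[OF f.extensional map_extensional(4)])
      show "f q x = zero_map trivial_mod M q x" if "x \<in> mel trivial_mod q" for q x
        using that f.zero[of q] by (simp add: trivial_mod_simps)
    qed
  qed
  show "f = zero_map M trivial_mod" if f: "chain_map A M trivial_mod f"
  proof -
    interpret f: cdg_map A M trivial_mod f by (rule cdg_mapI[OF assms trivial_mod_cdg_module f])
    show ?thesis
    proof (rule graded_map_eqI[OF f.extensional map_extensional(4)])
      show "f q x = zero_map M trivial_mod q x" if "x \<in> mel M q" for q x
        using that f.closed[of x q] by (simp add: trivial_mod_simps)
    qed
  qed
qed

section \<open>Weak cokernels and zero objects\<close>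

context derived
begin

text \<open>Z is a copy of the cone in the universe. \<open>cone_in_null\<close> and
  \<open>cone_lift\<close>, moved along the isomorphism, say that it is a weak cokernel and that
  maps out of V are exact at Y.\<close>

lemma cone_axiom:
  assumes "H.arr X Y \<phi>"
  shows "\<exists>Z q. H.arr Y Z q \<and> Comp H X Y Z q \<phi> = \<zero>[Hom H X Z] \<and>
      (\<forall>\<gamma>. H.arr V Y \<gamma> \<and> Comp H V Y Z q \<gamma> = \<zero>[Hom H V Z] \<longrightarrow> (\<exists>\<psi>. H.arr V X \<psi> \<and> Comp H V X Y \<phi> \<psi> = \<gamma>))"
proof -
  obtain f where f: "cdg_module An X" "cdg_module An Y" "chain_map An X Y f" "\<phi> = hot_class An X Y f" using assms by (rule arrE)
  interpret f: deformation_map k A n An ct X Y f by (rule deformation_mapI[OF f(1-3)])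
  let ?C = "cone X Y f"
  have C: "cdg_module An ?C" by (rule f.cone_mod)
  have ci: "chain_map An Y ?C f.cone_in" by (rule f.cone_in_chain_map)
  obtain Z :: "(nat \<Rightarrow> 'a, 'u) cdg_mod" and \<iota> \<rho> where Z: "cdg_module An Z" "module_iso An ?C Z \<iota> \<rho>" using universe_cone[OF C] .
  have \<iota>: "chain_map An ?C Z \<iota>" and \<rho>: "chain_map An Z ?C \<rho>" and \<rho>\<iota>: "comp_map ?C \<rho> \<iota> = id_map ?C" using Z(2) by (simp_all add: module_iso_def)
  let ?q = "comp_map Y \<iota> f.cone_in"
  have q: "chain_map An Y Z ?q" by (rule chain_map_comp[OF f(2) C Z(1) ci \<iota>])
  have \<rho>q: "comp_map Y \<rho> ?q = f.cone_in"
    unfolding comp_map_assoc[OF f(2) C ci, symmetric] \<rho>\<iota> comp_map_id(2)[OF f(2) C ci] ..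
  have qf: "chain_map An X Z (comp_map X ?q f)" by (rule chain_map_comp[OF f(1,2) Z(1) f(3) q])
  have "null_homotopic An X Z (comp_map X \<iota> (comp_map X f.cone_in f))"
    by (rule null_homotopic_comp[OF cdg_algebra_axioms f(1) C Z(1) chain_map_comp[OF f(1,2) C f(3) ci] \<iota> disjI1[OF f.cone_in_null]])
  then have "null_homotopic An X Z (comp_map X ?q f)" unfolding comp_map_assoc[OF f(1,2,3)] .
  then have 1: "Comp H X Y Z (hot_class An Y Z ?q) \<phi> = \<zero>[Hom H X Z]"
    unfolding f(4) Comp_H[OF f(1,2) Z(1) f(3) q] using hot_pair.hot_class_eq_zero_iff[OF Hpair[OF f(1) Z(1)] qf] by simp
  have 2: "\<exists>\<psi>. H.arr V X \<psi> \<and> Comp H V X Y \<phi> \<psi> = \<gamma>"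
    if \<gamma>: "H.arr V Y \<gamma>" "Comp H V Y Z (hot_class An Y Z ?q) \<gamma> = \<zero>[Hom H V Z]" for \<gamma>
  proof -
    obtain g where g: "cdg_module An V" "chain_map An V Y g" "\<gamma> = hot_class An V Y g" using \<gamma>(1) by (rule arrE)
    have qg: "chain_map An V Z (comp_map V ?q g)" by (rule chain_map_comp[OF g(1) f(2) Z(1) g(2) q])
    have "null_homotopic An V Z (comp_map V ?q g)"
      using \<gamma>(2) hot_pair.hot_class_eq_zero_iff[OF Hpair[OF g(1) Z(1)] qg] unfolding g(3) Comp_H[OF g(1) f(2) Z(1) g(2) q] by simp
    then have "null_homotopic An V ?C (comp_map V \<rho> (comp_map V ?q g))"
      by (intro null_homotopic_comp[OF cdg_algebra_axioms g(1) Z(1) C qg \<rho>] disjI1)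
    then have "null_homotopic An V ?C (comp_map V f.cone_in g)" unfolding comp_map_assoc[OF g(1) f(2) g(2), symmetric] \<rho>q .
    from f.cone_lift[OF g(1,2) this] obtain h where h: "chain_map An V X h" "homotopic An V Y g (comp_map V f h)" by blast
    have fh: "chain_map An V Y (comp_map V f h)" by (rule chain_map_comp[OF g(1) f(1,2) h(1) f(3)])
    have "Comp H V X Y \<phi> (hot_class An V X h) = \<gamma>"
      unfolding f(4) g(3) Comp_H[OF g(1) f(1,2) h(1) f(3)] using cdg_module_pair.hot_class_eq_iff[OF pair[OF g(1) f(2)] g(2) fh] h(2) by simp
    then show ?thesis using arrI[OF g(1) f(1) h(1)] by blast
  qed
  show ?thesis using arrI[OF f(2) Z(1) q] 1 2 by blast
qed

lemma zero_map_qiso_iff: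
  assumes V: "cdg_module An V" and M: "cdg_module An M"
  shows "qiso V M (zero_map V M) \<Longrightarrow> n_acyclic k n An M"
    and "\<lbrakk>n_acyclic k n An V; n_acyclic k n An M\<rbrakk> \<Longrightarrow> qiso V M (zero_map V M)"
proof -
  interpret V: deformation_module k A n An ct V by (rule deformation_moduleI[OF V])
  interpret M: deformation_module k A n An ct M by (rule deformation_moduleI[OF M])
  have m0: "y \<ominus>[M,p] zero_map V M p x = y" if "y \<in> mel M p" "x \<in> mel V p" for x y p
    using that by (simp add: a_minus_def)
  show "n_acyclic k n An M" if q: "qiso V M (zero_map V M)"
    unfolding M.n_acyclic_iff
  proof (intro allI impI)
    fix j p y assume j: "j \<le> n" and y: "M.cyc j p y"
    obtain x where x: "V.cyc j p x" "M.bdy j p (y \<ominus>[M,p] zero_map V M p x)" by (rule qiso_surj[OF q j y])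
    then show "M.bdy j p y" using m0[OF M.cyc_carrier[OF y] V.cyc_carrier[OF x(1)]] by simp
  qed
  show "qiso V M (zero_map V M)" if "n_acyclic k n An V" "n_acyclic k n An M"
  proof (rule qisoI)
    show "V.bdy j p x" if "j \<le> n" "V.cyc j p x" for j p x using \<open>n_acyclic k n An V\<close> that unfolding V.n_acyclic_iff by simp
    fix j p y assume y: "j \<le> n" "M.cyc j p y"
    have z: "V.cyc j p \<zero>[V,p]" unfolding V.cyc_def by simp
    have "M.bdy j p y" using \<open>n_acyclic k n An M\<close> y unfolding M.n_acyclic_iff by simp
    then have "M.bdy j p (y \<ominus>[M,p] zero_map V M p \<zero>[V,p])" using m0[OF M.cyc_carrier[OF y(2)] V.G.zero_closed] by simp
    with z show "\<exists>x. V.cyc j p x \<and> M.bdy j p (y \<ominus>[M,p] zero_map V M p x)" by blast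
  qed
qed

lemma trivial_n_acyclic: "n_acyclic k n An (trivial_mod :: (nat \<Rightarrow> 'a, 'm) cdg_mod)"
proof -
  let ?Z = "trivial_mod :: (nat \<Rightarrow> 'a, 'm) cdg_mod"
  interpret Z: deformation_module k A n An ct ?Z by (rule deformation_moduleI[OF trivial_mod_cdg_module])
  show ?thesis unfolding Z.n_acyclic_iff
  proof (intro allI impI)
    fix j p x assume "Z.cyc j p x"
    then have x: "x = \<zero>[?Z,p]" using Z.cyc_carrier[of j p x] by (simp add: trivial_mod_simps)
    show "Z.bdy j p x" unfolding x by (rule Z.bdy_tsub[OF Z.tsub_zero])
  qed
qed

text \<open>If M is zero, some zero map V \<rightarrow> M is a denominator; being onto on
  cohomology, it forces the cohomology of the graded pieces of M to vanish. Conversely the map from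
  the trivial module to an n-acyclic M is a denominator.\<close>

lemma zero_object_iff:
  assumes M: "cdg_module An M"
  shows "zero_object (localisation H S) M \<longleftrightarrow> n_acyclic k n An M"
proof
  assume "zero_object (localisation H S) M"
  then obtain V where V: "cdg_module An V" "\<zero>[Hom H V M] \<in> S V M" using F.zero_objectD by (auto simp: Ob_Hot)
  have "chain_map An V M (zero_map V M)" by (rule cdg_module_pair.chain_map_zero[OF pair[OF V(1) M]])
  then have "qiso V M (zero_map V M)" using V(2) mem_S[OF V(1) M] unfolding hot_pair.hot_class_zero[OF Hpair[OF V(1) M]] by simp
  then show "n_acyclic k n An M" by (rule zero_map_qiso_iff(1)[OF V(1) M])
next
  assume ac: "n_acyclic k n An M"
  let ?Z = "trivial_mod :: (nat \<Rightarrow> 'a, 'u) cdg_mod"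
  have Z: "cdg_module An ?Z" by (rule trivial_mod_cdg_module)
  have z: "chain_map An ?Z M (zero_map ?Z M)" by (rule cdg_module_pair.chain_map_zero[OF pair[OF Z M]])
  show "zero_object (localisation H S) M"
  proof (rule F.zero_objectI)
    show "M \<in> Ob H" "?Z \<in> Ob H" using M Z by (simp_all add: Ob_Hot)
    show "H.arr ?Z M (hot_class An ?Z M (zero_map ?Z M))" by (rule arrI[OF Z M z])
    show "hot_class An ?Z M (zero_map ?Z M) \<in> S ?Z M"
      unfolding mem_S[OF Z M z] by (rule zero_map_qiso_iff(2)[OF Z M trivial_n_acyclic ac])
  next
    fix Y f g assume "H.arr ?Z Y f" "H.arr ?Z Y g"
    then obtain f' g' where "cdg_module An Y" "chain_map An ?Z Y f'" "f = hot_class An ?Z Y f'" "chain_map An ?Z Y g'" "g = hot_class An ?Z Y g'"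
      by (elim arrE)
    then show "f = g" using trivial_mod_maps(1) by metis
  next
    fix Y f g assume "H.arr Y ?Z f" "H.arr Y ?Z g"
    then obtain f' g' where "cdg_module An Y" "chain_map An Y ?Z f'" "f = hot_class An Y ?Z f'" "chain_map An Y ?Z g'" "g = hot_class An Y ?Z g'"
      by (elim arrE)
    then show "f = g" using trivial_mod_maps(2) by metis
  qed
qed

end

section \<open>The objects \<Gamma>_i in the derived category\<close>

locale gamma_object = derived k A n An ct universe + gamma_like k A n An ct \<Gamma> i g0 g1
  for k :: "'k ring" and A :: "('k, 'a) cdg_alg" and n :: nat
    and An :: "(nat \<Rightarrow> 'k, nat \<Rightarrow> 'a) cdg_alg" and ct :: "nat \<Rightarrow> 'a" and universe :: "'u itself"
    and \<Gamma> :: "(nat \<Rightarrow> 'a, 'u) cdg_mod" and i :: nat and g0 g1 :: 'u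
begin

text \<open>The cone of s is n-acyclic, so the composite of f with Y \<rightarrow> cone(s) is
  null-homotopic and f lifts along s up to homotopy.\<close>

lemma lift_surj:
  assumes s: "cdg_module An X" "cdg_module An Y" "chain_map An X Y s" "qiso X Y s" and f: "chain_map An \<Gamma> Y f"
  shows "\<exists>g. chain_map An \<Gamma> X g \<and> homotopic An \<Gamma> Y f (comp_map \<Gamma> s g)"
proof -
  interpret s: deformation_map k A n An ct X Y s by (rule deformation_mapI[OF s(1-3)])
  have "chain_map An \<Gamma> (cone X Y s) (comp_map \<Gamma> s.cone_in f)"
    by (rule chain_map_comp[OF \<Gamma>.cdg_mod s(2) s.cone_mod f s.cone_in_chain_map])
  then have "null_homotopic An \<Gamma> (cone X Y s) (comp_map \<Gamma> s.cone_in f)"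
    using s.cone_n_acyclic_iff s(4) by (intro null_homotopic_n_acyclic s.cone_mod) simp_all
  then show ?thesis by (rule s.cone_lift[OF \<Gamma>.cdg_mod f])
qed

text \<open>If s f is null-homotopic, f factors through the fibre of s, which is n-acyclic; every
  map from \<Gamma> to it is null-homotopic.\<close>

lemma lift_inj:
  assumes s: "cdg_module An X" "cdg_module An Y" "chain_map An X Y s" "qiso X Y s"
    and f: "chain_map An \<Gamma> X f" and nul: "null_homotopic An \<Gamma> Y (comp_map \<Gamma> s f)"
  shows "null_homotopic An \<Gamma> X f"
proof -
  interpret s: deformation_map k A n An ct X Y s by (rule deformation_mapI[OF s(1-3)])
  have C: "cdg_module An s.cocone" by (rule s.cocone_cdg_module[OF cdg_algebra_axioms])
  obtain g where g: "chain_map An \<Gamma> s.cocone g" "comp_map \<Gamma> s.cocone_out g = f"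
    using s.cocone_lift[OF \<Gamma>.cdg_mod f nul] by blast
  have "n_acyclic k n An s.cocone" using s.cone_n_acyclic_iff s(4) by (intro shift_n_acyclic s.cone_mod) simp
  then have "null_homotopic An \<Gamma> s.cocone g" using g(1) by (intro null_homotopic_n_acyclic C)
  then show ?thesis using null_homotopic_comp[OF cdg_algebra_axioms \<Gamma>.cdg_mod C s(1) g(1) s.cocone_out_chain_map] g(2) by simp
qed

sublocale P: fraction_projective H S \<Gamma>
proof (intro fraction_projective.intro fraction_projective_axioms.intro F.fraction_category_axioms)
  show "\<Gamma> \<in> Ob H" using \<Gamma>.cdg_mod by (simp add: Ob_Hot)
  fix X Y \<sigma> \<phi> assume \<sigma>: "F.sarr X Y \<sigma>" and \<phi>: "H.arr \<Gamma> Y \<phi>"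
  have "H.arr X Y \<sigma>" and \<sigma>S: "\<sigma> \<in> S X Y" using \<sigma> by (simp_all add: F.sarr_def)
  then obtain s where s: "cdg_module An X" "cdg_module An Y" "chain_map An X Y s" "\<sigma> = hot_class An X Y s" by (elim arrE)
  have q: "qiso X Y s" using \<sigma>S mem_S[OF s(1-3)] s(4) by simp
  obtain f where f: "chain_map An \<Gamma> Y f" "\<phi> = hot_class An \<Gamma> Y f" using \<phi> by (rule arrE)
  interpret s: cdg_map An X Y s by (rule cdg_mapI[OF s(1-3)])
  interpret GX: cdg_module_pair "trunc_ring k n" An \<Gamma> X by (rule pair[OF \<Gamma>.cdg_mod s(1)])
  interpret GY: cdg_module_pair "trunc_ring k n" An \<Gamma> Y by (rule pair[OF \<Gamma>.cdg_mod s(2)])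
  note comp = Comp_H[OF \<Gamma>.cdg_mod s(1,2) _ s(3)] and cm = chain_map_comp[OF \<Gamma>.cdg_mod s(1,2) _ s(3)]
  show "\<exists>!\<psi>. H.arr \<Gamma> X \<psi> \<and> Comp H \<Gamma> X Y \<sigma> \<psi> = \<phi>"
  proof (rule ex_ex1I; (elim conjE)?)
    obtain g where g: "chain_map An \<Gamma> X g" "homotopic An \<Gamma> Y f (comp_map \<Gamma> s g)" using lift_surj[OF s(1-3) q f(1)] by blast
    have "Comp H \<Gamma> X Y \<sigma> (hot_class An \<Gamma> X g) = \<phi>"
      unfolding s(4) f(2) comp[OF g(1)] using GY.hot_class_eq_iff[OF f(1) cm[OF g(1)]] g(2) by simp
    then show "\<exists>\<psi>. H.arr \<Gamma> X \<psi> \<and> Comp H \<Gamma> X Y \<sigma> \<psi> = \<phi>" using arrI[OF \<Gamma>.cdg_mod s(1) g(1)] by blast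
  next
    fix \<psi> \<psi>' assume a: "H.arr \<Gamma> X \<psi>" "Comp H \<Gamma> X Y \<sigma> \<psi> = \<phi>" "H.arr \<Gamma> X \<psi>'" "Comp H \<Gamma> X Y \<sigma> \<psi>' = \<phi>"
    obtain g where g: "chain_map An \<Gamma> X g" "\<psi> = hot_class An \<Gamma> X g" using a(1) by (rule arrE)
    obtain g' where g': "chain_map An \<Gamma> X g'" "\<psi>' = hot_class An \<Gamma> X g'" using a(3) by (rule arrE)
    interpret g: cdg_map An \<Gamma> X g by (rule cdg_mapI[OF \<Gamma>.cdg_mod s(1) g(1)])
    interpret g': cdg_map An \<Gamma> X g' by (rule cdg_mapI[OF \<Gamma>.cdg_mod s(1) g'(1)])
    \<comment> \<open>By additivity the uniqueness of lifts amounts to null-homotopy of the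
      difference of two lifts, which \<open>lift_inj\<close> provides.\<close>
    let ?d = "add_map \<Gamma> X g (neg_map \<Gamma> X g')"
    have d: "chain_map An \<Gamma> X ?d" by (rule GX.chain_map_add[OF g(1) GX.chain_map_neg[OF g'(1)]])
    have "homotopic An \<Gamma> Y (comp_map \<Gamma> s g) (comp_map \<Gamma> s g')"
      using a(2,4) GY.hot_class_eq_iff[OF cm[OF g(1)] cm[OF g'(1)]] unfolding s(4) g(2) g'(2) comp[OF g(1)] comp[OF g'(1)] by simp
    moreover have "add_map \<Gamma> Y (comp_map \<Gamma> s g) (neg_map \<Gamma> Y (comp_map \<Gamma> s g')) = comp_map \<Gamma> s ?d"
      by (rule graded_map_eqI[where M=\<Gamma>]) (simp_all add: s.add s.neg)
    ultimately have "null_homotopic An \<Gamma> Y (comp_map \<Gamma> s ?d)"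
      unfolding GY.homotopic_iff_null_homotopic[OF cm[OF g(1)] cm[OF g'(1)]] by simp
    then have "null_homotopic An \<Gamma> X ?d" by (rule lift_inj[OF s(1-3) q d])
    then show "\<psi> = \<psi>'" unfolding g(2) g'(2) GX.hot_class_eq_iff[OF g(1) g'(1)] GX.homotopic_iff_null_homotopic[OF g(1) g'(1)] .
  qed
qed

text \<open>Q is a copy in the universe of the direct sum of modules. The extension property is
  solved on chosen representatives, and the finiteness statement holds for each closed map out of
  \<Gamma> before passing to homotopy classes.\<close>

lemma dsum_axiom:
  fixes I :: "'u set"
  assumes W: "\<And>j. j \<in> I \<Longrightarrow> W j \<in> Ob H"
  shows "\<exists>Q \<kappa>. Q \<in> Ob H \<and> (\<forall>j\<in>I. H.arr (W j) Q (\<kappa> j)) \<and>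
      (\<forall>Y f. Y \<in> Ob H \<and> (\<forall>j\<in>I. H.arr (W j) Y (f j)) \<longrightarrow>
        (\<exists>g. H.arr Q Y g \<and> (\<forall>j\<in>I. Comp H (W j) Q Y g (\<kappa> j) = f j))) \<and>
      (\<forall>\<phi>. H.arr \<Gamma> Q \<phi> \<longrightarrow> (\<exists>J \<psi>. finite J \<and> J \<subseteq> I \<and> (\<forall>j\<in>J. H.arr \<Gamma> (W j) (\<psi> j)) \<and>
        \<phi> = (\<Oplus>\<^bsub>Hom H \<Gamma> Q\<^esub>j\<in>J. Comp H \<Gamma> (W j) Q (\<kappa> j) (\<psi> j))))"
proof -
  interpret d: dsum "trunc_ring k n" An I W using W by (intro dsum.intro dsum_axioms.intro cdg_algebra_axioms) (simp add: Ob_Hot)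
  have DS: "cdg_module An d.DS" by (rule d.dsum_cdg_module)
  \<comment> \<open>Each degree of the direct sum consists of finitely supported families over a
    subset of the universe.\<close>
  have "\<forall>p. \<exists>e :: ('u \<Rightarrow> 'u) \<Rightarrow> 'u. inj_on e (mel d.DS p)"
  proof
    show "\<exists>e :: ('u \<Rightarrow> 'u) \<Rightarrow> 'u. inj_on e (mel d.DS p)" for p
      using inj_finite_support[OF infinite_universe, where I=I and C="\<lambda>j. mel (W j) p" and z="\<lambda>j. \<zero>[W j,p]"]
      by (simp add: dsum_mod_def add_group_def)
  qed
  from choice[OF this] obtain e :: "int \<Rightarrow> ('u \<Rightarrow> 'u) \<Rightarrow> 'u" where e: "\<forall>p. inj_on (e p) (mel d.DS p)" by (rule exE)
  from universe_copy[OF cdg_algebra_axioms DS spec[OF e]] obtain Q :: "(nat \<Rightarrow> 'a, 'u) cdg_mod" and \<iota> \<rho>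
    where Q: "cdg_module An Q" "module_iso An d.DS Q \<iota> \<rho>" by (elim exE conjE)
  have \<iota>: "chain_map An d.DS Q \<iota>" and \<rho>: "chain_map An Q d.DS \<rho>" and \<rho>\<iota>: "comp_map d.DS \<rho> \<iota> = id_map d.DS"
    and \<iota>\<rho>: "comp_map Q \<iota> \<rho> = id_map Q" using Q(2) by (simp_all add: module_iso_def)
  let ?\<kappa> = "\<lambda>j. comp_map (W j) \<iota> (d.inclusion j)"
  have \<kappa>: "chain_map An (W j) Q (?\<kappa> j)" if "j \<in> I" for j
    by (rule chain_map_comp[OF d.mod[OF that] DS Q(1) d.inclusion_chain_map[OF that] \<iota>])
  show ?thesis
  proof (intro exI[of _ Q] exI[of _ "\<lambda>j. hot_class An (W j) Q (?\<kappa> j)"] conjI allI impI ballI; (elim conjE)?)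
    show "Q \<in> Ob H" using Q(1) by (simp add: Ob_Hot)
    show "H.arr (W j) Q (hot_class An (W j) Q (?\<kappa> j))" if "j \<in> I" for j by (rule arrI[OF d.mod[OF that] Q(1) \<kappa>[OF that]])
  next
    fix Y f assume "Y \<in> Ob H" and f: "\<forall>j\<in>I. H.arr (W j) Y (f j)"
    then have Y: "cdg_module An Y" by (simp add: Ob_Hot)
    have "\<forall>j\<in>I. \<exists>g. chain_map An (W j) Y g \<and> f j = hot_class An (W j) Y g"
    proof
      fix j assume "j \<in> I"
      then have "H.arr (W j) Y (f j)" using f by blast
      then obtain g where "chain_map An (W j) Y g" "f j = hot_class An (W j) Y g" by (rule arrE)
      then show "\<exists>g. chain_map An (W j) Y g \<and> f j = hot_class An (W j) Y g" by blast
    qed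
    from bchoice[OF this] obtain g where g: "\<And>j. j \<in> I \<Longrightarrow> chain_map An (W j) Y (g j)" "\<And>j. j \<in> I \<Longrightarrow> f j = hot_class An (W j) Y (g j)" by blast
    obtain h where h: "chain_map An d.DS Y h" "\<And>j. j \<in> I \<Longrightarrow> comp_map (W j) h (d.inclusion j) = g j" using d.dsum_lift[OF Y g(1)] by blast
    have h\<rho>: "chain_map An Q Y (comp_map Q h \<rho>)" by (rule chain_map_comp[OF Q(1) DS Y \<rho> h(1)])
    have "Comp H (W j) Q Y (hot_class An Q Y (comp_map Q h \<rho>)) (hot_class An (W j) Q (?\<kappa> j)) = f j" if j: "j \<in> I" for j
    proof -
      have "comp_map (W j) (comp_map Q h \<rho>) (?\<kappa> j) = comp_map (W j) h (comp_map (W j) (comp_map d.DS \<rho> \<iota>) (d.inclusion j))"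
        unfolding comp_map_assoc[OF d.mod[OF j] Q(1) \<kappa>[OF j]] comp_map_assoc[OF d.mod[OF j] DS d.inclusion_chain_map[OF j]] ..
      also have "\<dots> = g j" unfolding \<rho>\<iota> comp_map_id(2)[OF d.mod[OF j] DS d.inclusion_chain_map[OF j]] h(2)[OF j] ..
      finally show ?thesis unfolding Comp_H[OF d.mod[OF j] Q(1) Y \<kappa>[OF j] h\<rho>] g(2)[OF j] by simp
    qed
    then show "\<exists>g. H.arr Q Y g \<and> (\<forall>j\<in>I. Comp H (W j) Q Y g (hot_class An (W j) Q (?\<kappa> j)) = f j)"
      using arrI[OF Q(1) Y h\<rho>] by blast
  next
    fix \<phi> assume "H.arr \<Gamma> Q \<phi>"
    then obtain f where f: "chain_map An \<Gamma> Q f" "\<phi> = hot_class An \<Gamma> Q f" by (rule arrE)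
    let ?f = "comp_map \<Gamma> \<rho> f"
    have f0: "chain_map An \<Gamma> d.DS ?f" by (rule chain_map_comp[OF \<Gamma>.cdg_mod Q(1) DS f(1) \<rho>])
    interpret f0: cdg_map An \<Gamma> d.DS ?f by (rule cdg_mapI[OF \<Gamma>.cdg_mod DS f0])
    have f0g: "?f 0 g0 \<in> mel d.DS 0" "?f (- 1) g1 \<in> mel d.DS (- 1)" by (rule f0.closed[OF g0] f0.closed[OF g1])+
    \<comment> \<open>The supports of the images of the two generators. A component outside J
      vanishes on both generators and is therefore the zero map.\<close>
    define J where "J = d.supp 0 (?f 0 g0) \<union> d.supp (- 1) (?f (- 1) g1)"
    have J: "finite J" "J \<subseteq> I" unfolding J_def using d.finite_supp[OF f0g(1)] d.finite_supp[OF f0g(2)] by (auto simp: d.supp_def)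
    let ?p = "\<lambda>j. comp_map \<Gamma> (d.projection j) ?f"
    have p: "chain_map An \<Gamma> (W j) (?p j)" if "j \<in> I" for j
      by (rule chain_map_comp[OF \<Gamma>.cdg_mod DS d.mod[OF that] f0 d.projection_chain_map[OF that]])
    have pe: "?p j q x = ?f q x j" if "x \<in> mel \<Gamma> q" for j q x
      using that f0.closed[OF that] by (simp add: d.projection_def)
    have nul: "?f q x j = \<zero>[W j,q]" if x: "x \<in> mel \<Gamma> q" and j: "j \<in> I - J" for q x j
    proof -
      have jI: "j \<in> I" using j by simp
      have "?p j = zero_map \<Gamma> (W j)"
      proof (rule chain_map_eqI[OF d.mod[OF jI] p[OF jI] cdg_module_pair.chain_map_zero[OF pair[OF \<Gamma>.cdg_mod d.mod[OF jI]]]])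
        show "?p j 0 g0 = zero_map \<Gamma> (W j) 0 g0" unfolding pe[OF g0] using j d.not_supp[OF jI, of 0 "?f 0 g0"] by (simp add: J_def)
        show "?p j (- 1) g1 = zero_map \<Gamma> (W j) (- 1) g1" unfolding pe[OF g1] using j d.not_supp[OF jI, of "- 1" "?f (- 1) g1"] by (simp add: J_def)
      qed
      then show ?thesis using pe[OF x, of j] x by simp
    qed
    have dec: "?f = (\<Oplus>\<^bsub>hom_cocycles An \<Gamma> d.DS\<^esub>j\<in>J. comp_map \<Gamma> (d.inclusion j) (?p j))"
      by (rule d.dsum_decompose[OF \<Gamma>.cdg_mod f0 J nul])
    interpret GD: cdg_module_pair "trunc_ring k n" An \<Gamma> d.DS by (rule pair[OF \<Gamma>.cdg_mod DS])
    interpret GQ: hot_pair "trunc_ring k n" An \<Gamma> Q by (rule Hpair[OF \<Gamma>.cdg_mod Q(1)])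
    interpret \<iota>: cdg_map An d.DS Q \<iota> by (rule cdg_mapI[OF DS Q(1) \<iota>])
    let ?F = "\<lambda>u. hot_class An \<Gamma> Q (comp_map \<Gamma> \<iota> u)"
    have cu: "chain_map An \<Gamma> Q (comp_map \<Gamma> \<iota> u)" if "chain_map An \<Gamma> d.DS u" for u
      by (rule chain_map_comp[OF \<Gamma>.cdg_mod DS Q(1) that \<iota>])
    have F: "additive_map (hom_cocycles An \<Gamma> d.DS) (Hom H \<Gamma> Q) ?F"
    proof (intro additive_map.intro additive_map_axioms.intro GD.hom_cocycles_group GQ.Hom_Hot_group; unfold GD.hom_cocycles_carrier mem_Collect_eq)
      show "?F u \<in> carrier (Hom H \<Gamma> Q)" if "chain_map An \<Gamma> d.DS u" for u unfolding GQ.Hom_Hot_carrier using cu[OF that] by blast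
      fix u v assume uv: "chain_map An \<Gamma> d.DS u" "chain_map An \<Gamma> d.DS v"
      interpret u: cdg_map An \<Gamma> d.DS u by (rule cdg_mapI[OF \<Gamma>.cdg_mod DS uv(1)])
      interpret v: cdg_map An \<Gamma> d.DS v by (rule cdg_mapI[OF \<Gamma>.cdg_mod DS uv(2)])
      have "comp_map \<Gamma> \<iota> (add_map \<Gamma> d.DS u v) = add_map \<Gamma> Q (comp_map \<Gamma> \<iota> u) (comp_map \<Gamma> \<iota> v)"
        by (rule graded_map_eqI[where M=\<Gamma>]) (simp_all add: \<iota>.add)
      then show "?F (u \<oplus>[hom_cocycles An \<Gamma> d.DS] v) = ?F u \<oplus>[Hom H \<Gamma> Q] ?F v"
        unfolding GD.hom_cocycles_simps GQ.hot_class_add[OF cu[OF uv(1)] cu[OF uv(2)]] by simp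
    qed
    have G: "comp_map \<Gamma> (d.inclusion j) (?p j) \<in> carrier (hom_cocycles An \<Gamma> d.DS)" if "j \<in> J" for j
    proof -
      have j: "j \<in> I" using that J(2) by blast
      show ?thesis unfolding GD.hom_cocycles_carrier mem_Collect_eq
        by (rule chain_map_comp[OF \<Gamma>.cdg_mod d.mod[OF j] DS p[OF j] d.inclusion_chain_map[OF j]])
    qed
    have "comp_map \<Gamma> \<iota> ?f = f"
      unfolding comp_map_assoc[OF \<Gamma>.cdg_mod Q(1) f(1), symmetric] \<iota>\<rho> by (rule comp_map_id(2)[OF \<Gamma>.cdg_mod Q(1) f(1)])
    then have "\<phi> = ?F ?f" unfolding f(2) by simp
    also have "\<dots> = ?F (\<Oplus>\<^bsub>hom_cocycles An \<Gamma> d.DS\<^esub>j\<in>J. comp_map \<Gamma> (d.inclusion j) (?p j))" by (rule arg_cong[where f="?F", OF dec])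
    also have "\<dots> = (\<Oplus>\<^bsub>Hom H \<Gamma> Q\<^esub>j\<in>J. ?F (comp_map \<Gamma> (d.inclusion j) (?p j)))" by (rule additive_map.map_finsum[OF F J(1) G])
    also have "\<dots> = (\<Oplus>\<^bsub>Hom H \<Gamma> Q\<^esub>j\<in>J. Comp H \<Gamma> (W j) Q (hot_class An (W j) Q (?\<kappa> j)) (hot_class An \<Gamma> (W j) (?p j)))"
    proof (rule abelian_monoid.finsum_cong'[OF abelian_group.axioms(1)[OF GQ.Hom_Hot_group] refl])
      have e: "Comp H \<Gamma> (W j) Q (hot_class An (W j) Q (?\<kappa> j)) (hot_class An \<Gamma> (W j) (?p j)) = ?F (comp_map \<Gamma> (d.inclusion j) (?p j))" if "j \<in> J" for j
      proof -
        have j: "j \<in> I" using that J(2) by blast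
        show ?thesis unfolding Comp_H[OF \<Gamma>.cdg_mod d.mod[OF j] Q(1) p[OF j] \<kappa>[OF j]] comp_map_assoc[OF \<Gamma>.cdg_mod d.mod[OF j] p[OF j]] ..
      qed
      show "(\<lambda>j. Comp H \<Gamma> (W j) Q (hot_class An (W j) Q (?\<kappa> j)) (hot_class An \<Gamma> (W j) (?p j))) \<in> J \<rightarrow> carrier (Hom H \<Gamma> Q)"
        using e additive_map.closed[OF F G] by simp
      show "?F (comp_map \<Gamma> (d.inclusion j) (?p j)) = Comp H \<Gamma> (W j) Q (hot_class An (W j) Q (?\<kappa> j)) (hot_class An \<Gamma> (W j) (?p j))" if "j \<in> J" for j
        using e[OF that] by simp
    qed
    finally have "\<phi> = (\<Oplus>\<^bsub>Hom H \<Gamma> Q\<^esub>j\<in>J. Comp H \<Gamma> (W j) Q (hot_class An (W j) Q (?\<kappa> j)) (hot_class An \<Gamma> (W j) (?p j)))" .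
    moreover have "\<forall>j\<in>J. H.arr \<Gamma> (W j) (hot_class An \<Gamma> (W j) (?p j))" using J(2) arrI[OF \<Gamma>.cdg_mod d.mod p] by blast
    ultimately show "\<exists>J \<psi>. finite J \<and> J \<subseteq> I \<and> (\<forall>j\<in>J. H.arr \<Gamma> (W j) (\<psi> j)) \<and>
        \<phi> = (\<Oplus>\<^bsub>Hom H \<Gamma> Q\<^esub>j\<in>J. Comp H \<Gamma> (W j) Q (hot_class An (W j) Q (?\<kappa> j)) (\<psi> j))"
      using J by (intro exI[of _ J] exI[of _ "\<lambda>j. hot_class An \<Gamma> (W j) (?p j)"]) simp
  qed
qed

lemma compact: "compact_object (UNIV :: 'u set) (localisation H S) \<Gamma>"
  by (rule P.compact_objectI[OF cone_axiom dsum_axiom])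

lemma trivial_Hom_iff:
  assumes M: "cdg_module An M"
  shows "carrier (Hom (localisation H S) \<Gamma> M) = {\<zero>[Hom (localisation H S) \<Gamma> M]}
    \<longleftrightarrow> (\<forall>f. chain_map An \<Gamma> M f \<longrightarrow> null_homotopic An \<Gamma> M f)"
proof -
  interpret GM: hot_pair "trunc_ring k n" An \<Gamma> M by (rule Hpair[OF \<Gamma>.cdg_mod M])
  have "carrier (Hom H \<Gamma> M) = {\<zero>[Hom H \<Gamma> M]} \<longleftrightarrow> (\<forall>f. chain_map An \<Gamma> M f \<longrightarrow> hot_class An \<Gamma> M f = \<zero>[Hom H \<Gamma> M])"
    unfolding GM.Hom_Hot_carrier using GM.hot_class_zero GM.chain_map_zero by blast
  also have "\<dots> \<longleftrightarrow> (\<forall>f. chain_map An \<Gamma> M f \<longrightarrow> null_homotopic An \<Gamma> M f)" using GM.hot_class_eq_zero_iff by blast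
  finally show ?thesis using P.trivial_Hom_D_iff M by (simp add: Ob_Hot)
qed

end

text \<open>The elements of \<open>Gamma\<close> are pairs of cosets, so it enters D through the
  injections \<open>e\<close>. Vanishing in D, n-acyclicity and exactness of all pair complexes are
  equivalent; the shift by l supplies the degree in which a pair lives.\<close>

theorem theorem4p5:
  fixes k :: "'k ring" and A :: "('k, 'a) cdg_alg" and n :: nat
    and An :: "(nat \<Rightarrow> 'k, nat \<Rightarrow> 'a) cdg_alg" and ct :: "nat \<Rightarrow> 'a"
    and e :: "nat \<Rightarrow> int \<Rightarrow> (nat \<Rightarrow> 'a) set \<times> (nat \<Rightarrow> 'a) set \<Rightarrow> 'u"
    and D :: "(nat \<Rightarrow> 'a, 'u) n_derived"
    and \<Gamma> :: "nat \<Rightarrow> (nat \<Rightarrow> 'a, 'u) cdg_mod"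
  assumes "cring k" and "dg_algebra k A" and "cdg_deformation k A n An"
    and "ct \<in> carrier (acomp An 2)"
    and "trunc_var k n \<odot>\<^bsub>acomp An 2\<^esub> ct = acurv An"
    and "infinite (UNIV :: 'u set)"
    and "\<And>i p. i \<le> n \<Longrightarrow> inj_on (e i p) (carrier (mcomp (Gamma k n An ct i) p))"
    and "D = n_derived_category k n An"
    and "\<Gamma> = (\<lambda>i. transport (e i) (Gamma k n An ct i))"
  shows "(\<forall>i\<le>n. compact_object (UNIV :: 'u set) D (\<Gamma> i)) \<and>
    (\<forall>M \<in> Ob D. zero_object D M \<longleftrightarrow>
      (\<forall>i\<le>n. \<forall>l::int. carrier (Hom D (\<Gamma> i) (shift l M)) = {\<zero>\<^bsub>Hom D (\<Gamma> i) (shift l M)\<^esub>}))"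
proof -
  interpret derived k A n An ct "TYPE('u)"
    using assms by (intro derived.intro derived_axioms.intro deformation.intro)
  have D: "D = localisation H S" using assms(8) by (simp add: n_derived_category_def)
  have g: "gamma_object k A n An ct (\<Gamma> i) i
      (e i 0 (gcls i 0 (aone An, \<zero>[acomp An 1]))) (e i (- 1) (gcls i (- 1) (\<zero>[acomp An (- 1)], aone An)))" if "i \<le> n" for i
    unfolding assms(9) using that
    by (intro gamma_object.intro derived_axioms gamma_like.transport_gamma_like[OF Gamma_gamma_like] assms(7))
  show ?thesis
  proof (intro conjI allI impI ballI)
    show "compact_object (UNIV :: 'u set) D (\<Gamma> i)" if "i \<le> n" for i
      unfolding D by (rule gamma_object.compact[OF g[OF that]])
  next
    fix M assume "M \<in> Ob D"
    then have M: "cdg_module An M" by (simp add: D F.Ob_D Ob_Hot)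
    interpret M: deformation_module k A n An ct M by (rule deformation_moduleI[OF M])
    have S: "cdg_module An (shift l M)" for l by (rule shift_cdg_module[OF cdg_algebra_axioms M])
    have "n_acyclic k n An M \<longleftrightarrow> (\<forall>i\<le>n. \<forall>l. \<forall>f. chain_map An (\<Gamma> i) (shift l M) f \<longrightarrow> null_homotopic An (\<Gamma> i) (shift l M) f)"
    proof (intro iffI allI impI)
      fix i l f assume "n_acyclic k n An M" "i \<le> n" "chain_map An (\<Gamma> i) (shift l M) f"
      then show "null_homotopic An (\<Gamma> i) (shift l M) f"
        by (intro gamma_like.null_homotopic_n_acyclic[OF gamma_object.axioms(2)[OF g]] S shift_n_acyclic M)
    next
      assume nul: "\<forall>i\<le>n. \<forall>l. \<forall>f. chain_map An (\<Gamma> i) (shift l M) f \<longrightarrow> null_homotopic An (\<Gamma> i) (shift l M) f"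
      have "M.CC.cone_boundary i p x y" if i: "i \<le> n" and c: "M.CC.cone_cocycle i p x y" for i p x y
        using nul i by (intro gamma_like.cone_boundary_shift[OF gamma_object.axioms(2)[OF g[OF i]] M _ c]) blast
      then have "M.CC.gr_acyclic j" if "j \<le> n" for j using that by (rule M.CC.exact_gr_acyclic)
      then show "n_acyclic k n An M" unfolding M.n_acyclic_iff M.gr_acyclic_iff by blast
    qed
    then show "zero_object D M \<longleftrightarrow> (\<forall>i\<le>n. \<forall>l::int. carrier (Hom D (\<Gamma> i) (shift l M)) = {\<zero>[Hom D (\<Gamma> i) (shift l M)]})"
      unfolding D zero_object_iff[OF M] by (simp add: gamma_object.trivial_Hom_iff[OF g S] cong: imp_cong)
  qed
qed

end
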